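(* Let $\mathcal{S}$ be a pseudoreal-plane Riemann surface with non-singular plane model of degree $d\geq 4$, and suppose that $\operatorname{Aut}_+(\mathcal{S})$, viewed as a subgroup of $\operatorname{PGL}_3(\mathbb{C})$ via this model, is $\operatorname{PGL}_3(\mathbb{C})$-conjugate to a finite non-trivial group $G\leq\operatorname{PGL}_3(\mathbb{C})$ that leaves invariant infinitely many points of $\mathbb{P}^2_{\mathbb{C}}$ (i.e. infinitely many points of $\mathbb{P}^2_{\mathbb{C}}$ are fixed by every element of $G$). Then $\operatorname{Aut}_+(\mathcal{S})$ is cyclic of even order $n$, and $n$ divides $d$.
   Context: A plane Riemann surface of degree $d\geq4$ is a compact Riemann surface $\mathcal{S}$ isomorphic to a non-singular plane curve $F_{\mathcal{S}}(X,Y,Z)=0$ in $\mathbb{P}^2_{\mathbb{C}}$ with $F_{\mathcal{S}}$ homogeneous of degree $d$ (so of genus $g=(d-1)(d-2)/2$). $\operatorname{Aut}_+(\mathcal{S})$ denotes its group of conformal automorphisms; each of them is induced by a unique element of $\operatorname{PGL}_3(\mathbb{C})$ preserving the plane model, so $\operatorname{Aut}_+(\mathcal{S})$ is a subgroup of $\operatorname{PGL}_3(\mathbb{C})$, well defined up to conjugation. $\mathcal{S}$ (viewed as a complex projective curve) has field of moduli $\mathbb{R}$ relative to $\mathbb{C}/\mathbb{R}$ if it is isomorphic over $\mathbb{C}$ to its complex conjugate curve; $\mathbb{R}$ is a field of definition if $\mathcal{S}$ is isomorphic over $\mathbb{C}$ to (the base change of) a curve defined over $\mathbb{R}$. $\mathcal{S}$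 is pseudoreal if $\mathbb{R}$ is its field of moduli but not a field of definition; equivalently, $\mathcal{S}$ has anticonformal automorphisms, but none of them is an involution. Pseudoreal-plane means pseudoreal and plane. *)

theory Defs
  imports "HOL-Analysis.Analysis" "HOL-Algebra.Bij" "HOL-Algebra.Elementary_Groups"
begin

section \<open>Riemann surfaces\<close>

text \<open>The atlas need not be maximal. A chart is a pair of a domain and a map; the values
  of the map outside the domain play no role.\<close>

record 'a surface =
  top_of :: "'a topology"
  atlas :: "('a set \<times> ('a \<Rightarrow> complex)) set"

abbreviation points :: "'a surface \<Rightarrow> 'a set" where
  "points S \<equiv> topspace (top_of S)"

definition complex_chart :: "'a topology \<Rightarrow> 'a set \<Rightarrow> ('a \<Rightarrow> complex) \<Rightarrow> bool" where
  "complex_chart X U x \<longleftrightarrow>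
     openin X U \<and> open (x ` U) \<and>
     homeomorphic_map (subtopology X U) (top_of_set (x ` U)) x"

definition riemann_surface :: "'a surface \<Rightarrow> bool" where
  "riemann_surface S \<longleftrightarrow>
     points S \<noteq> {} \<and> connected_space (top_of S) \<and> Hausdorff_space (top_of S) \<and>
     (\<forall>(U, x) \<in> atlas S. complex_chart (top_of S) U x) \<and>
     points S = (\<Union>(U, x) \<in> atlas S. U) \<and>
     (\<forall>(U, x) \<in> atlas S. \<forall>(V, y) \<in> atlas S. (y \<circ> inv_into U x) holomorphic_on x ` (U \<inter> V))"

text \<open>Second countability is automatic for compact surfaces.\<close>

definition compact_riemann_surface :: "'a surface \<Rightarrow> bool" where
  "compact_riemann_surface S \<longleftrightarrow> riemann_surface S \<and> compact_space (top_of S)"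

definition holomorphic_map :: "'a surface \<Rightarrow> 'b surface \<Rightarrow> ('a \<Rightarrow> 'b) \<Rightarrow> bool" where
  "holomorphic_map S T f \<longleftrightarrow>
     continuous_map (top_of S) (top_of T) f \<and>
     (\<forall>(U, x) \<in> atlas S. \<forall>(V, y) \<in> atlas T.
        (y \<circ> f \<circ> inv_into U x) holomorphic_on x ` {p \<in> U. f p \<in> V})"

definition antiholomorphic_map :: "'a surface \<Rightarrow> 'b surface \<Rightarrow> ('a \<Rightarrow> 'b) \<Rightarrow> bool" where
  "antiholomorphic_map S T f \<longleftrightarrow>
     continuous_map (top_of S) (top_of T) f \<and>
     (\<forall>(U, x) \<in> atlas S. \<forall>(V, y) \<in> atlas T.
        (cnj \<circ> y \<circ> f \<circ> inv_into U x) holomorphic_on x ` {p \<in> U. f p \<in> V})"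

definition biholomorphic_map :: "'a surface \<Rightarrow> 'b surface \<Rightarrow> ('a \<Rightarrow> 'b) \<Rightarrow> bool" where
  "biholomorphic_map S T f \<longleftrightarrow>
     bij_betw f (points S) (points T) \<and>
     holomorphic_map S T f \<and> holomorphic_map T S (inv_into (points S) f)"

definition conformal_automorphisms :: "'a surface \<Rightarrow> ('a \<Rightarrow> 'a) set" where
  "conformal_automorphisms S = {f \<in> Bij (points S). biholomorphic_map S S f}"

definition anticonformal_automorphisms :: "'a surface \<Rightarrow> ('a \<Rightarrow> 'a) set" where
  "anticonformal_automorphisms S =
     {f \<in> Bij (points S). antiholomorphic_map S S f \<and>
        antiholomorphic_map S S (inv_into (points S) f)}"

definition Aut_plus :: "'a surface \<Rightarrow> ('a \<Rightarrow> 'a) monoid" where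
  "Aut_plus S = (BijGroup (points S))\<lparr>carrier := conformal_automorphisms S\<rparr>"

text \<open>An anticonformal automorphism is never the identity, so it is an involution as soon as
  its square is the identity.\<close>

definition pseudoreal :: "'a surface \<Rightarrow> bool" where
  "pseudoreal S \<longleftrightarrow>
     anticonformal_automorphisms S \<noteq> {} \<and>
     \<not> (\<exists>f \<in> anticonformal_automorphisms S. \<forall>p \<in> points S. f (f p) = p)"


section \<open>The complex projective plane\<close>

definition proportional :: "complex^3 \<Rightarrow> complex^3 \<Rightarrow> bool" where
  "proportional v w \<longleftrightarrow> v \<noteq> 0 \<and> w \<noteq> 0 \<and> (\<exists>c. c \<noteq> 0 \<and> w = c *s v)"

lemma part_equivp_proportional: "part_equivp proportional"
proof (rule part_equivpI)
  have "proportional (axis 1 1) (axis 1 1)"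
    by (auto simp: proportional_def axis_eq_0_iff intro: exI[of _ 1])
  then show "\<exists>v. proportional v v" by blast
  show "symp proportional"
  proof (rule sympI)
    fix v w assume "proportional v w"
    then obtain c where "v \<noteq> 0" "w \<noteq> 0" "c \<noteq> 0" "w = c *s v"
      by (auto simp: proportional_def)
    then have "v = inverse c *s w" by (simp add: vector_smult_assoc)
    with \<open>v \<noteq> 0\<close> \<open>w \<noteq> 0\<close> \<open>c \<noteq> 0\<close> show "proportional w v"
      unfolding proportional_def by (metis nonzero_imp_inverse_nonzero)
  qed
  show "transp proportional"
  proof (rule transpI)
    fix u v w assume "proportional u v" "proportional v w"
    then show "proportional u w"
      unfolding proportional_def by (metis mult_eq_0_iff vector_smult_assoc)
  qed
qed

text \<open>For nonzero \<open>v\<close>, the point with homogeneous coordinates \<open>v\<close> is \<open>abs_proj2 v\<close>; the value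
  \<open>abs_proj2 0\<close> is meaningless.\<close>

quotient_type proj2 = "complex^3" / partial: proportional
  by (rule part_equivp_proportional)

lemma abs_proj2_eq_iff:
  assumes "v \<noteq> 0" "w \<noteq> 0"
  shows "abs_proj2 v = abs_proj2 w \<longleftrightarrow> (\<exists>c. c \<noteq> 0 \<and> w = c *s v)"
proof -
  have refl: "proportional u u" if "u \<noteq> 0" for u
    using that by (auto simp: proportional_def intro: exI[of _ 1])
  show ?thesis
    using Quotient3_rel[OF Quotient3_proj2, of v w] refl[OF assms(1)] refl[OF assms(2)] assms
    by (simp add: proportional_def)
qed

lemma rep_proj2_nonzero: "rep_proj2 p \<noteq> 0"
  using Quotient3_rep_reflp[OF Quotient3_proj2, of p] by (simp add: proportional_def)

lemma abs_rep_proj2: "abs_proj2 (rep_proj2 p) = p"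
  by (rule Quotient3_abs_rep[OF Quotient3_proj2])

text \<open>The quotient topology of the nonzero vectors.\<close>

instantiation proj2 :: topological_space
begin

definition open_proj2 :: "proj2 set \<Rightarrow> bool" where
  "open_proj2 U \<longleftrightarrow> open {v. v \<noteq> 0 \<and> abs_proj2 v \<in> U}"

instance
proof
  have "{v::complex^3. v \<noteq> 0 \<and> abs_proj2 v \<in> UNIV} = - {0}" by auto
  then show "open (UNIV :: proj2 set)" by (simp add: open_proj2_def open_Compl)
next
  fix S T :: "proj2 set" assume "open S" "open T"
  moreover have "{v. v \<noteq> 0 \<and> abs_proj2 v \<in> S \<inter> T} =
      {v. v \<noteq> 0 \<and> abs_proj2 v \<in> S} \<inter> {v. v \<noteq> 0 \<and> abs_proj2 v \<in> T}" by auto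
  ultimately show "open (S \<inter> T)" by (simp add: open_proj2_def open_Int)
next
  fix K :: "proj2 set set" assume "\<forall>S\<in>K. open S"
  moreover have "{v. v \<noteq> 0 \<and> abs_proj2 v \<in> \<Union>K} =
      (\<Union>S\<in>K. {v. v \<noteq> 0 \<and> abs_proj2 v \<in> S})" by auto
  ultimately show "open (\<Union>K)" unfolding open_proj2_def by (simp only:) auto
qed

end


section \<open>The projective linear group and its action\<close>

definition GL3 :: "(complex^3^3) monoid" where
  "GL3 = \<lparr>carrier = {A. invertible A}, mult = (**), one = mat 1\<rparr>"

definition scalars3 :: "(complex^3^3) set" where
  "scalars3 = {mat c | c. c \<noteq> 0}"

definition PGL3 :: "(complex^3^3) set monoid" where
  "PGL3 = GL3 Mod scalars3"

lemma mat_mult_vec: "(mat c :: complex^3^3) *v v = c *s v"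
  by (simp add: vec_eq_iff matrix_vector_mult_def mat_def if_distrib if_distribR cong: if_cong)

lemma mat_mult_nth: "((mat c :: complex^3^3) ** A) $ i $ j = c * A $ i $ j"
  by (simp add: matrix_matrix_mult_def mat_def if_distrib if_distribR cong: if_cong)

lemma mat_mult_commute: "(mat c :: complex^3^3) ** A = A ** mat c"
proof -
  have "(A ** mat c) $ i $ j = A $ i $ j * c" for i j
    by (simp add: matrix_matrix_mult_def mat_def if_distrib if_distribR cong: if_cong)
  then show ?thesis by (simp add: vec_eq_iff mat_mult_nth)
qed

lemma mat_mult_mat: "(mat a :: complex^3^3) ** mat b = mat (a * b)"
  by (simp only: vec_eq_iff mat_mult_nth) (simp add: mat_def)

lemma invertible_mat: "c \<noteq> 0 \<Longrightarrow> invertible (mat c :: complex^3^3)"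
  unfolding invertible_def by (rule exI[of _ "mat (inverse c)"]) (simp add: mat_mult_mat)

lemma group_GL3: "Group.group GL3"
proof (rule groupI)
  fix A assume "A \<in> carrier GL3"
  then obtain B where B: "A ** B = mat 1" "B ** A = mat 1"
    by (auto simp: GL3_def invertible_def)
  then have "B \<in> carrier GL3" by (auto simp: GL3_def invertible_def)
  with B show "\<exists>B \<in> carrier GL3. B \<otimes>\<^bsub>GL3\<^esub> A = \<one>\<^bsub>GL3\<^esub>" by (auto simp: GL3_def)
qed (auto simp: GL3_def invertible_mult matrix_mul_assoc invertible_mat)

lemma normal_scalars3: "scalars3 \<lhd> GL3"
proof -
  interpret Group.group GL3 by (rule group_GL3)
  have sub: "subgroup scalars3 GL3"
  proof (rule subgroupI)
    show "scalars3 \<subseteq> carrier GL3" by (auto simp: scalars3_def GL3_def invertible_mat)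
    show "scalars3 \<noteq> {}" by (auto simp: scalars3_def intro: exI[of _ 1])
    fix A assume "A \<in> scalars3"
    then obtain a where a: "a \<noteq> 0" "A = mat a" by (auto simp: scalars3_def)
    have "inv\<^bsub>GL3\<^esub> A = mat (inverse a)"
      using a by (intro inv_equality) (auto simp: GL3_def mat_mult_mat invertible_mat)
    with a show "inv\<^bsub>GL3\<^esub> A \<in> scalars3" by (auto simp: scalars3_def)
    fix B assume "B \<in> scalars3"
    with a show "A \<otimes>\<^bsub>GL3\<^esub> B \<in> scalars3" by (auto simp: scalars3_def GL3_def mat_mult_mat)
  qed
  show ?thesis
  proof (rule normalI[OF sub], intro ballI)
    fix A assume "A \<in> carrier GL3"
    show "scalars3 #>\<^bsub>GL3\<^esub> A = A <#\<^bsub>GL3\<^esub> scalars3"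
      by (auto simp: r_coset_def l_coset_def scalars3_def GL3_def mat_mult_commute)
  qed
qed

lemma group_PGL3: "Group.group PGL3"
  unfolding PGL3_def by (rule normal.factorgroup_is_group[OF normal_scalars3])

definition pgl_act :: "(complex^3^3) set \<Rightarrow> proj2 \<Rightarrow> proj2" where
  "pgl_act T p = abs_proj2 ((SOME A. A \<in> T) *v rep_proj2 p)"

lemma invertible_mult_vec_nonzero:
  assumes "invertible (A :: complex^3^3)" "v \<noteq> 0"
  shows "A *v v \<noteq> 0"
proof
  assume "A *v v = 0"
  obtain B where "B ** A = mat 1" using assms(1) by (auto simp: invertible_def)
  then have "v = B *v (A *v v)" by (simp add: matrix_vector_mul_assoc)
  with \<open>A *v v = 0\<close> \<open>v \<noteq> 0\<close> show False by simp
qed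

text \<open>The action does not depend on the choice of representatives.\<close>

lemma pgl_act_eq:
  assumes T: "T \<in> carrier PGL3" and A: "A \<in> T" and v: "v \<noteq> 0"
  shows "pgl_act T (abs_proj2 v) = abs_proj2 (A *v v)"
proof -
  define B where "B = (SOME B. B \<in> T)"
  have "B \<in> T" unfolding B_def using A by (rule someI)
  obtain M where M: "invertible M" "T = scalars3 #>\<^bsub>GL3\<^esub> M"
    using T by (auto simp: PGL3_def carrier_FactGroup GL3_def)
  from A M(2) obtain a where a: "a \<noteq> 0" "A = mat a ** M"
    by (auto simp: r_coset_def scalars3_def GL3_def)
  from \<open>B \<in> T\<close> M(2) obtain b where b: "b \<noteq> 0" "B = mat b ** M"
    by (auto simp: r_coset_def scalars3_def GL3_def)
  have "abs_proj2 v = abs_proj2 (rep_proj2 (abs_proj2 v))" by (simp add: abs_rep_proj2)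
  then obtain c where c: "c \<noteq> 0" "rep_proj2 (abs_proj2 v) = c *s v"
    using abs_proj2_eq_iff[OF v rep_proj2_nonzero] by blast
  have w: "A *v v = a *s (M *v v)" "B *v rep_proj2 (abs_proj2 v) = (b * c) *s (M *v v)"
    by (simp_all add: a b c flip: matrix_vector_mul_assoc)
      (simp_all add: mat_mult_vec vector_scalar_commute vector_smult_assoc)
  have Mv: "M *v v \<noteq> 0" using invertible_mult_vec_nonzero[OF M(1) v] .
  have "abs_proj2 (A *v v) = abs_proj2 (B *v rep_proj2 (abs_proj2 v))"
  proof (subst abs_proj2_eq_iff)
    show "A *v v \<noteq> 0" "B *v rep_proj2 (abs_proj2 v) \<noteq> 0"
      unfolding w using a(1) b(1) c(1) Mv by (simp_all add: vector_mul_eq_0)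
    show "\<exists>k. k \<noteq> 0 \<and> B *v rep_proj2 (abs_proj2 v) = k *s (A *v v)"
      unfolding w using a(1) b(1) c(1)
      by (intro exI[of _ "b * c / a"]) (simp add: vector_smult_assoc)
  qed
  then show ?thesis by (simp add: pgl_act_def B_def)
qed


section \<open>Non-singular plane curves\<close>

text \<open>A form is represented by its polynomial function on \<open>\<complex>\<^sup>3\<close>; a multi-index is a function
  on the three variables.\<close>

definition form_of_degree :: "nat \<Rightarrow> (complex^3 \<Rightarrow> complex) \<Rightarrow> bool" where
  "form_of_degree d F \<longleftrightarrow>
     (\<exists>a :: (3 \<Rightarrow> nat) \<Rightarrow> complex. \<forall>v.
        F v = (\<Sum>\<alpha> | sum \<alpha> UNIV = d. a \<alpha> * (\<Prod>i\<in>UNIV. (v $ i) ^ \<alpha> i)))"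

lemma finite_multi_indices: "finite {\<alpha> :: 3 \<Rightarrow> nat. sum \<alpha> UNIV = d}"
proof (rule finite_subset)
  show "{\<alpha> :: 3 \<Rightarrow> nat. sum \<alpha> UNIV = d} \<subseteq> PiE UNIV (\<lambda>_. {..d})"
    by (auto intro: member_le_sum)
qed (auto intro: finite_PiE)

definition partial_deriv :: "3 \<Rightarrow> (complex^3 \<Rightarrow> complex) \<Rightarrow> complex^3 \<Rightarrow> complex" where
  "partial_deriv k F v = deriv (\<lambda>t. F (v + t *s axis k 1)) 0"

definition nonsingular_form :: "(complex^3 \<Rightarrow> complex) \<Rightarrow> bool" where
  "nonsingular_form F \<longleftrightarrow> (\<forall>v. v \<noteq> 0 \<and> F v = 0 \<longrightarrow> (\<exists>k. partial_deriv k F v \<noteq> 0))"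

definition plane_curve :: "(complex^3 \<Rightarrow> complex) \<Rightarrow> proj2 set" where
  "plane_curve F = {abs_proj2 v | v. v \<noteq> 0 \<and> F v = 0}"

text \<open>The charts of a non-singular plane curve are the affine coordinates \<open>x\<^sub>j / x\<^sub>i\<close> wherever
  \<open>x\<^sub>i\<close> and the partial derivative with respect to the remaining variable \<open>x\<^sub>k\<close> do not vanish,
  restricted to open sets on which they are injective.\<close>

definition curve_surface :: "(complex^3 \<Rightarrow> complex) \<Rightarrow> proj2 surface" where
  "curve_surface F =
     \<lparr>top_of = top_of_set (plane_curve F),
      atlas = {(U, x). complex_chart (top_of_set (plane_curve F)) U x \<and>
        (\<exists>i j k. i \<noteq> j \<and> j \<noteq> k \<and> i \<noteq> k \<and>
          (\<forall>v. v \<noteq> 0 \<and> abs_proj2 v \<in> U \<longrightarrow>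
             v $ i \<noteq> 0 \<and> partial_deriv k F v \<noteq> 0 \<and> x (abs_proj2 v) = v $ j / v $ i))}\<rparr>"

definition plane_model ::
    "'a surface \<Rightarrow> nat \<Rightarrow> (complex^3 \<Rightarrow> complex) \<Rightarrow> ('a \<Rightarrow> proj2) \<Rightarrow> bool" where
  "plane_model S d F \<phi> \<longleftrightarrow>
     form_of_degree d F \<and> nonsingular_form F \<and> biholomorphic_map S (curve_surface F) \<phi>"

text \<open>The conformal automorphism group viewed in the projective linear group via the embedding
  \<open>\<phi>\<close>: the projectivities that induce a conformal automorphism.\<close>

definition Aut_plus_in_PGL3 :: "'a surface \<Rightarrow> ('a \<Rightarrow> proj2) \<Rightarrow> (complex^3^3) set set" where
  "Aut_plus_in_PGL3 S \<phi> =
     {T \<in> carrier PGL3. \<exists>f \<in> carrier (Aut_plus S). \<forall>p \<in> points S. \<phi> (f p) = pgl_act T (\<phi> p)}"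

end

theory Submission
  imports Defs "HOL-Computational_Algebra.Fundamental_Theorem_Algebra"
    "HOL-Complex_Analysis.Conformal_Mappings"
begin

text \<open>The main step is that a holomorphic bijection \<open>f\<close> between non-singular plane curves of the same
  degree \<open>d \<ge> 4\<close> is induced by a linear map; composing with complex conjugation, anticonformal
  automorphisms are then induced by antilinear maps. Let \<open>l\<close> be a line that meets the target curve in
  \<open>d\<close> points, and let \<open>l'\<close> be another line through one of them. By the residue theorem for the
  differentials \<open>(l' \<circ> f / l \<circ> f) P dx / F\<^sub>y\<close> with \<open>P\<close> of degree \<open>d - 3\<close>, proved by taking
  traces to the projective line, the preimages of the other \<open>d - 1\<close> points satisfy a linear relation
  without zero coefficients on all forms of degree \<open>d - 3\<close>, which forces them to be collinear. So the
  preimage of the line section is the section by a line \<open>m\<close>, and comparing two such lines gives a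
  function \<open>(l\<^sub>1 \<circ> f / l\<^sub>2 \<circ> f) (m\<^sub>2 / m\<^sub>1)\<close> without zeros and poles, hence a constant.

  A group with infinitely many fixed points consists of homologies with a common axis, and is therefore a
  finite group of roots of unity. If \<open>B\<close> is an antilinear map inducing an anticonformal automorphism,
  then \<open>B\<^sup>2\<close> is such a homology, not a scalar. This forces \<open>B\<close> to have no fixed point on the axis, the
  eigenvalue ratio of \<open>B\<^sup>2\<close> to be \<open>-1\<close>, and the centre to lie off the curve. Lines through the centre
  then meet the curve in \<open>d\<close> points that are permuted freely by the group.\<close>

section \<open>Linear algebra in three complex dimensions\<close>

text \<open>The degree \<open>d - 3\<close> is fixed from two sides: it makes the integrand
  homogeneous of degree \<open>-2\<close>, so that the trace has no residue at infinity, and for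
  \<open>d \<ge> 4\<close> it leaves a linear factor that can vanish at two points at once. The
  common point drops out of the relation because \<open>l'\<close> cancels the simple pole there;
  this saves the one factor that a count of degrees would otherwise lack. General position is
  obtained by cardinality: branch values have no limit point, so the bad sets are countable, and a
  pencil has uncountably many lines. Pseudoreality enters through one anticonformal map whose square
  is not the identity. That square lies in a finite group of homologies, so its eigenvalue ratio is
  a root of unity, and the value \<open>-1\<close> of a faithful character makes the order even.
  Divisibility comes from the product of the \<open>d\<close> nonzero coordinates in one fibre,
  which multiplication by the ratio leaves unchanged.\<close>

definition cdot :: "complex^3 \<Rightarrow> complex^3 \<Rightarrow> complex" where
  "cdot l v = l$1 * v$1 + l$2 * v$2 + l$3 * v$3"

definition cdet :: "complex^3 \<Rightarrow> complex^3 \<Rightarrow> complex^3 \<Rightarrow> complex" where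
  "cdet a b c = a$1 * (b$2 * c$3 - b$3 * c$2) - a$2 * (b$1 * c$3 - b$3 * c$1)
     + a$3 * (b$1 * c$2 - b$2 * c$1)"

text \<open>By \<open>cdot_ccross\<close> this is the line through the points \<open>a\<close> and
  \<open>b\<close>, and it vanishes exactly when they do not span a line.\<close>

definition ccross :: "complex^3 \<Rightarrow> complex^3 \<Rightarrow> complex^3" where
  "ccross a b = vector [a$2 * b$3 - a$3 * b$2, a$3 * b$1 - a$1 * b$3, a$1 * b$2 - a$2 * b$1]"

lemma cdot_add [simp]: "cdot l (v + w) = cdot l v + cdot l w"
  and cdot_diff [simp]: "cdot l (v - w) = cdot l v - cdot l w"
  and cdot_smult [simp]: "cdot l (c *s v) = c * cdot l v"
  and cdot_zero [simp]: "cdot l 0 = 0"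
  and cdot_add_left: "cdot (l + m) v = cdot l v + cdot m v"
  and cdot_diff_left: "cdot (l - m) v = cdot l v - cdot m v"
  and cdot_smult_left: "cdot (c *s l) v = c * cdot l v"
  and cdot_zero_left [simp]: "cdot 0 v = 0"
  by (simp_all add: cdot_def algebra_simps)

lemma cdot_ccross: "cdot (ccross a b) c = cdet a b c"
  by (simp add: cdot_def ccross_def cdet_def) algebra

lemma cdet_same [simp]: "cdet a a c = 0" "cdet a b a = 0" "cdet a b b = 0"
  by (simp_all add: cdet_def) algebra+

lemma cdet_cycle: "cdet a b c = cdet b c a"
  and cdet_swap: "cdet a b c = - cdet b a c"
  and cdet_swap': "cdet a b c = - cdet a c b"
  by (simp_all add: cdet_def) algebra+

lemma cdet_linear3 [simp]: "cdet a b (c + d) = cdet a b c + cdet a b d"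
    "cdet a b (k *s c) = k * cdet a b c" "cdet a b 0 = 0"
  by (simp_all add: cdet_def algebra_simps)

lemma cdet_linear1 [simp]: "cdet (c + d) a b = cdet c a b + cdet d a b"
    "cdet (k *s c) a b = k * cdet c a b" "cdet 0 a b = 0"
  by (simp_all add: cdet_def algebra_simps)

lemma cdet_linear2 [simp]: "cdet a (c + d) b = cdet a c b + cdet a d b"
    "cdet a (k *s c) b = k * cdet a c b" "cdet a 0 b = 0"
  by (simp_all add: cdet_def algebra_simps)

text \<open>Cramer's rule with the denominator cleared: a polynomial identity, valid for dependent
  vectors as well.\<close>

lemma cramer: "cdet a b c *s v = cdet v b c *s a + cdet a v c *s b + cdet a b v *s c"
  by (simp add: vec_eq_iff forall_3 cdet_def) algebra

lemma basis_expand: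
  assumes "cdet a b c \<noteq> 0"
  shows "v = (cdet v b c / cdet a b c) *s a + (cdet a v c / cdet a b c) *s b
           + (cdet a b v / cdet a b c) *s c"
proof -
  have "v = inverse (cdet a b c) *s (cdet a b c *s v)"
    using assms by (simp add: vector_smult_assoc)
  also have "\<dots> = (cdet v b c / cdet a b c) *s a + (cdet a v c / cdet a b c) *s b
           + (cdet a b v / cdet a b c) *s c"
    by (subst cramer) (simp add: vector_add_ldistrib vector_smult_assoc field_simps)
  finally show ?thesis .
qed

lemma basis_nonzero:
  assumes "cdet a b c \<noteq> 0"
  shows "a \<noteq> 0" "b \<noteq> 0" "c \<noteq> 0"
  using assms by auto

lemma basis_coords_zero:
  assumes "cdet a b c \<noteq> 0" "x *s a + y *s b + z *s c = 0"
  shows "x = 0" "y = 0" "z = 0"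
proof -
  have "cdet (x *s a + y *s b + z *s c) b c = 0" "cdet a (x *s a + y *s b + z *s c) c = 0"
    "cdet a b (x *s a + y *s b + z *s c) = 0"
    using assms(2) by simp_all
  then show "x = 0" "y = 0" "z = 0" using assms(1) by simp_all
qed

lemma cdot_basis_zero:
  assumes "cdet a b c \<noteq> 0" "cdot l a = 0" "cdot l b = 0" "cdot l c = 0"
  shows "l = 0"
proof -
  have z: "cdot l v = 0" for v
    by (subst basis_expand[OF assms(1), of v]) (simp add: assms)
  have "l $ i = 0" for i
    using z[of "axis i 1"] exhaust_3[of i] by (auto simp: cdot_def axis_def)
  then show ?thesis by (simp add: vec_eq_iff)
qed

lemma cdot_nonzero: "l \<noteq> 0 \<Longrightarrow> \<exists>v. cdot l v \<noteq> 0"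
  using cdot_basis_zero[of "axis 1 1" "axis 2 1" "axis 3 1" l]
  by (force simp: cdet_def axis_def)

lemma ccross_nonzero: "ccross a b \<noteq> 0 \<longleftrightarrow> (\<exists>c. cdet a b c \<noteq> 0)"
  by (metis cdot_ccross cdot_nonzero cdot_zero_left)

lemma ccross_zero:
  assumes "ccross a b = 0" "a \<noteq> 0"
  shows "\<exists>k. b = k *s a"
proof -
  have e: "a$2 * b$3 = a$3 * b$2" "a$3 * b$1 = a$1 * b$3" "a$1 * b$2 = a$2 * b$1"
    using assms(1) by (auto simp: ccross_def vec_eq_iff forall_3)
  obtain i where i: "a $ i \<noteq> 0" using assms(2) by (auto simp: vec_eq_iff)
  have "b = (b $ i / a $ i) *s a"
    using i exhaust_3[of i] e by (auto simp: vec_eq_iff forall_3 field_simps)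
  then show ?thesis by blast
qed

lemma not_multiple_basis:
  assumes "a \<noteq> 0" "\<nexists>k. b = k *s a"
  obtains c where "cdet a b c \<noteq> 0"
  using assms ccross_zero ccross_nonzero by blast

lemma extend_basis:
  assumes "a \<noteq> 0"
  obtains b c where "cdet a b c \<noteq> 0"
proof -
  have "\<exists>b. \<nexists>k. b = k *s a"
  proof (rule ccontr)
    assume "\<not> ?thesis"
    then obtain k l where k: "axis 1 1 = k *s a" "axis 2 1 = l *s a" by metis
    have "l *s (axis 1 1 :: complex^3) = k *s axis 2 1" unfolding k
      by (simp add: vector_smult_assoc mult.commute)
    then have "k = 0" "l = 0" by (simp_all add: vec_eq_iff forall_3 axis_def)
    with k show False by (simp add: vec_eq_iff axis_def forall_3)
  qed
  then show ?thesis using not_multiple_basis[OF assms] that by metis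
qed

text \<open>A nonzero form cannot vanish on a basis, so \<open>a\<close>, \<open>b\<close>,
  \<open>v\<close> are dependent and the third coordinate of \<open>v\<close> is zero.\<close>

lemma line_span:
  assumes "cdot l a = 0" "cdot l b = 0" "cdot l v = 0" "l \<noteq> 0" "ccross a b \<noteq> 0"
  obtains x y where "v = x *s a + y *s b"
proof -
  obtain c where c: "cdet a b c \<noteq> 0" using assms(5) ccross_nonzero by blast
  have "cdet a b v = 0" using cdot_basis_zero assms by blast
  with basis_expand[OF c, of v] that show ?thesis by simp
qed

lemma line_direction:
  assumes "l \<noteq> 0" "cdot l a = 0" "a \<noteq> 0"
  obtains b where "cdot l b = 0" "ccross a b \<noteq> 0"
proof -
  obtain b c where bc: "cdet a b c \<noteq> 0" using extend_basis[OF assms(3)] .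
  show ?thesis
  proof (cases "cdot l b = 0")
    case True then show ?thesis using that bc ccross_nonzero by blast
  next
    case False
    let ?b = "c - (cdot l c / cdot l b) *s b"
    have "cdet a ?b b \<noteq> 0"
      using bc cdet_swap'[of a b c] by (simp add: cdet_def algebra_simps)
    moreover have "cdot l ?b = 0" using False by simp
    ultimately show ?thesis using that ccross_nonzero by blast
  qed
qed


section \<open>Homogeneous polynomial functions\<close>

text \<open>An inductive closure in place of the coefficient sum of \<open>form_of_degree\<close>:
  gradients, holomorphy along curves, restriction to lines and conjugation of coefficients then all
  become inductions over four rules.\<close>

inductive homog :: "nat \<Rightarrow> (complex^3 \<Rightarrow> complex) \<Rightarrow> bool" where
  const: "homog 0 (\<lambda>v. c)"
| coord: "homog 1 (\<lambda>v. v $ i)"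
| add: "homog k f \<Longrightarrow> homog k g \<Longrightarrow> homog k (\<lambda>v. f v + g v)"
| mult: "homog j f \<Longrightarrow> homog k g \<Longrightarrow> homog (j + k) (\<lambda>v. f v * g v)"

lemma homog_cmult: "homog k f \<Longrightarrow> homog k (\<lambda>v. c * f v)"
  using homog.mult[OF homog.const[of c]] by fastforce

lemma homog_zero: "homog k (\<lambda>v. 0)"
proof (induction k)
  case 0 show ?case by (rule homog.const)
next
  case (Suc k)
  from homog.mult[OF homog.coord[of 1] this] show ?case by simp
qed

lemma homog_sum: "(\<And>a. a \<in> A \<Longrightarrow> homog k (f a)) \<Longrightarrow> homog k (\<lambda>v. \<Sum>a\<in>A. f a v)"
  by (induction A rule: infinite_finite_induct) (auto intro: homog_zero homog.add)

lemma homog_power: "homog k f \<Longrightarrow> homog (n * k) (\<lambda>v. f v ^ n)"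
proof (induction n)
  case 0 show ?case using homog.const[of 1] by simp
next
  case (Suc n)
  then show ?case using homog.mult[of k f "n * k" "\<lambda>v. f v ^ n"] by simp
qed

lemma homog_prod:
  "finite A \<Longrightarrow> (\<And>a. a \<in> A \<Longrightarrow> homog (k a) (f a)) \<Longrightarrow> homog (sum k A) (\<lambda>v. \<Prod>a\<in>A. f a v)"
proof (induction A rule: finite_induct)
  case empty show ?case using homog.const[of 1] by simp
qed (simp add: homog.mult)

lemma homog_cdot: "homog 1 (\<lambda>v. cdot l v)"
  unfolding cdot_def by (intro homog.add homog_cmult homog.coord)

lemma form_imp_homog:
  assumes "form_of_degree d F"
  shows "homog d F"
proof -
  obtain a :: "(3 \<Rightarrow> nat) \<Rightarrow> complex" where
    a: "\<And>v. F v = (\<Sum>\<alpha> | sum \<alpha> UNIV = d. a \<alpha> * (\<Prod>i\<in>UNIV. (v $ i) ^ \<alpha> i))"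
    using assms unfolding form_of_degree_def by blast
  have "homog (sum \<alpha> UNIV) (\<lambda>v. \<Prod>i\<in>UNIV. (v $ i) ^ \<alpha> i)" for \<alpha> :: "3 \<Rightarrow> nat"
    using homog_power[OF homog.coord] by (intro homog_prod) auto
  then have "homog d (\<lambda>v. \<Sum>\<alpha> | sum \<alpha> UNIV = d. a \<alpha> * (\<Prod>i\<in>UNIV. (v $ i) ^ \<alpha> i))"
    by (intro homog_sum homog_cmult) auto
  moreover have "F = (\<lambda>v. \<Sum>\<alpha> | sum \<alpha> UNIV = d. a \<alpha> * (\<Prod>i\<in>UNIV. (v $ i) ^ \<alpha> i))"
    using a by blast
  ultimately show ?thesis by simp
qed

lemma homog_smult: "homog k f \<Longrightarrow> f (c *s v) = c ^ k * f v"
  by (induction arbitrary: v rule: homog.induct) (auto simp: algebra_simps power_add)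

text \<open>Two forms of the chain rule with the same coefficients: the real total derivative, which
  the inverse function theorem takes as input, and the complex derivative along a curve, which real
  differentiability alone would not give. Degree zero is split off because \<open>k - 1\<close> is
  truncated there.\<close>

lemma homog_gradient:
  assumes "homog k f"
  shows "\<exists>g. (\<forall>i. if k = 0 then g i = (\<lambda>v. 0) else homog (k - 1) (g i)) \<and>
    (\<forall>v. (f has_derivative (\<lambda>w. \<Sum>i\<in>UNIV. g i v * w $ i)) (at v)) \<and>
    (\<forall>\<gamma> \<gamma>' t. (\<forall>i. ((\<lambda>t. \<gamma> t $ i) has_field_derivative \<gamma>' $ i) (at t)) \<longrightarrow>
       ((\<lambda>t. f (\<gamma> t)) has_field_derivative (\<Sum>i\<in>UNIV. g i (\<gamma> t) * \<gamma>' $ i)) (at t))"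
  using assms
proof (induction rule: homog.induct)
  case (const c)
  show ?case by (intro exI[of _ "\<lambda>i v. 0"]) (auto intro: DERIV_const)
next
  case (coord i)
  have e: "(\<Sum>j\<in>UNIV. (if j = i then 1 else 0) * w $ j) = w $ i" for w :: "complex^3"
    by (simp add: if_distrib if_distribR cong: if_cong)
  show ?case
    by (intro exI[of _ "\<lambda>j v. if j = i then 1 else 0"])
      (simp only: e, auto intro!: homog.const bounded_linear_imp_has_derivative bounded_linear_vec_nth)
next
  case (add k f g)
  then obtain f' g' where
    f': "\<forall>i. if k = 0 then f' i = (\<lambda>v. 0) else homog (k - 1) (f' i)"
       "\<And>v. (f has_derivative (\<lambda>w. \<Sum>i\<in>UNIV. f' i v * w $ i)) (at v)"
       "\<And>\<gamma> \<gamma>' t. (\<forall>i. ((\<lambda>t. \<gamma> t $ i) has_field_derivative \<gamma>' $ i) (at t)) \<Longrightarrow>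
       ((\<lambda>t. f (\<gamma> t)) has_field_derivative (\<Sum>i\<in>UNIV. f' i (\<gamma> t) * \<gamma>' $ i)) (at t)" and
    g': "\<forall>i. if k = 0 then g' i = (\<lambda>v. 0) else homog (k - 1) (g' i)"
       "\<And>v. (g has_derivative (\<lambda>w. \<Sum>i\<in>UNIV. g' i v * w $ i)) (at v)"
       "\<And>\<gamma> \<gamma>' t. (\<forall>i. ((\<lambda>t. \<gamma> t $ i) has_field_derivative \<gamma>' $ i) (at t)) \<Longrightarrow>
       ((\<lambda>t. g (\<gamma> t)) has_field_derivative (\<Sum>i\<in>UNIV. g' i (\<gamma> t) * \<gamma>' $ i)) (at t)"
    by blast
  have s: "(\<Sum>i\<in>UNIV. (f' i v + g' i v) * w $ i)
      = (\<Sum>i\<in>UNIV. f' i v * w $ i) + (\<Sum>i\<in>UNIV. g' i v * w $ i)" for v w :: "complex^3"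
    by (simp add: sum.distrib algebra_simps)
  show ?case
    apply (intro exI[of _ "\<lambda>i v. f' i v + g' i v"])
    apply (simp only: s)
    using f'(1) g'(1)
    apply (auto intro!: has_derivative_add f' g' DERIV_add homog.add split: if_splits)
    done
next
  case (mult j f k g)
  then obtain f' g' where
    f': "\<forall>i. if j = 0 then f' i = (\<lambda>v. 0) else homog (j - 1) (f' i)"
       "\<And>v. (f has_derivative (\<lambda>w. \<Sum>i\<in>UNIV. f' i v * w $ i)) (at v)"
       "\<And>\<gamma> \<gamma>' t. (\<forall>i. ((\<lambda>t. \<gamma> t $ i) has_field_derivative \<gamma>' $ i) (at t)) \<Longrightarrow>
       ((\<lambda>t. f (\<gamma> t)) has_field_derivative (\<Sum>i\<in>UNIV. f' i (\<gamma> t) * \<gamma>' $ i)) (at t)" and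
    g': "\<forall>i. if k = 0 then g' i = (\<lambda>v. 0) else homog (k - 1) (g' i)"
       "\<And>v. (g has_derivative (\<lambda>w. \<Sum>i\<in>UNIV. g' i v * w $ i)) (at v)"
       "\<And>\<gamma> \<gamma>' t. (\<forall>i. ((\<lambda>t. \<gamma> t $ i) has_field_derivative \<gamma>' $ i) (at t)) \<Longrightarrow>
       ((\<lambda>t. g (\<gamma> t)) has_field_derivative (\<Sum>i\<in>UNIV. g' i (\<gamma> t) * \<gamma>' $ i)) (at t)"
    by blast
  have s: "(\<Sum>i\<in>UNIV. (f v * g' i v + f' i v * g v) * w $ i)
      = f v * (\<Sum>i\<in>UNIV. g' i v * w $ i) + (\<Sum>i\<in>UNIV. f' i v * w $ i) * g v" for v w :: "complex^3"
    by (simp add: sum.distrib sum_distrib_left sum_distrib_right algebra_simps)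
  \<comment> \<open>The degree \<open>j + k - 1\<close> splits as \<open>(j - 1) + k\<close> or
    \<open>j + (k - 1)\<close> only when the factor that is differentiated has positive degree;
    otherwise its gradient vanishes and the term disappears.\<close>
  have h1: "if j + k = 0 then (\<lambda>v. f v * g' i v + f' i v * g v) = (\<lambda>v. 0)
      else homog (j + k - 1) (\<lambda>v. f v * g' i v + f' i v * g v)" for i
  proof (cases "j = 0")
    case True
    then have "f' i = (\<lambda>v. 0)" using f'(1) by (simp add: if_distrib)
    then show ?thesis using True g'(1)[rule_format, of i] mult.hyps
      by (auto split: if_splits dest: homog.mult[of 0 f "k - 1" "g' i"])
  next
    case False
    then have a: "homog (j + k - 1) (\<lambda>v. f' i v * g v)"
      using f'(1)[rule_format, of i] homog.mult[OF _ mult.hyps(2), of "j - 1" "f' i"] by simp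
    have "homog (j + k - 1) (\<lambda>v. f v * g' i v)"
    proof (cases "k = 0")
      case True
      then have "g' i = (\<lambda>v. 0)" using g'(1) by (simp add: if_distrib)
      then show ?thesis by (simp add: homog_zero)
    next
      case False
      then show ?thesis
        using g'(1)[rule_format, of i] homog.mult[OF mult.hyps(1), of "k - 1" "g' i"] by simp
    qed
    with a False show ?thesis by (simp add: homog.add)
  qed
  show ?case
    apply (intro exI[of _ "\<lambda>i v. f v * g' i v + f' i v * g v"] conjI allI impI)
    subgoal for i by (rule h1)
    subgoal for v by (simp only: s) (rule has_derivative_mult[OF f'(2) g'(2)])
    subgoal for \<gamma> \<gamma>' t
      by (simp only: s) (use DERIV_mult'[OF f'(3)[of \<gamma> \<gamma>' t] g'(3)[of \<gamma> \<gamma>' t]] in simp)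
    done
qed

definition grad :: "(complex^3 \<Rightarrow> complex) \<Rightarrow> complex^3 \<Rightarrow> complex^3 \<Rightarrow> complex" where
  "grad F v w = (\<Sum>i\<in>UNIV. partial_deriv i F v * w $ i)"

lemma grad_linear [simp]: "grad F v (w + w') = grad F v w + grad F v w'"
    "grad F v (c *s w) = c * grad F v w" "grad F v 0 = 0"
  by (simp_all add: grad_def sum.distrib sum_distrib_left algebra_simps)

lemma grad_axis: "grad F v (axis k 1) = partial_deriv k F v"
  by (simp add: grad_def axis_def if_distrib cong: if_cong)

lemma homog_grad_exists:
  assumes "homog k f"
  obtains g where "\<And>i. if k = 0 then g i = (\<lambda>v. 0) else homog (k - 1) (g i)"
    "\<And>i v. partial_deriv i f v = g i v"
    "\<And>v. (f has_derivative grad f v) (at v)"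
    "\<And>\<gamma> \<gamma>' t. (\<And>i. ((\<lambda>t. \<gamma> t $ i) has_field_derivative \<gamma>' $ i) (at t)) \<Longrightarrow>
       ((\<lambda>t. f (\<gamma> t)) has_field_derivative grad f (\<gamma> t) \<gamma>') (at t)"
proof -
  obtain g where g: "\<And>i. if k = 0 then g i = (\<lambda>v. 0) else homog (k - 1) (g i)"
    "\<And>v. (f has_derivative (\<lambda>w. \<Sum>i\<in>UNIV. g i v * w $ i)) (at v)"
    "\<And>\<gamma> \<gamma>' t. (\<And>i. ((\<lambda>t. \<gamma> t $ i) has_field_derivative \<gamma>' $ i) (at t)) \<Longrightarrow>
       ((\<lambda>t. f (\<gamma> t)) has_field_derivative (\<Sum>i\<in>UNIV. g i (\<gamma> t) * \<gamma>' $ i)) (at t)"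
    using homog_gradient[OF assms] by blast
  have p: "partial_deriv i f v = g i v" for i v
  proof -
    have "((\<lambda>t. f (v + t *s axis i 1)) has_field_derivative
        (\<Sum>j\<in>UNIV. g j (v + 0 *s axis i 1) * (axis i 1 :: complex^3) $ j)) (at 0)"
      by (rule g(3)) (auto intro!: derivative_eq_intros)
    then show ?thesis unfolding partial_deriv_def
      by (auto dest!: DERIV_imp_deriv simp: axis_def if_distrib cong: if_cong)
  qed
  have e: "grad f v = (\<lambda>w. \<Sum>i\<in>UNIV. g i v * w $ i)" for v
    by (simp add: grad_def p fun_eq_iff)
  show ?thesis
    by (rule that[of g]) (use g p e in auto)
qed

lemma homog_has_derivative: "homog k f \<Longrightarrow> (f has_derivative grad f v) (at v)"
  using homog_grad_exists by blast

lemma homog_curve_derivative: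
  assumes "homog k f" "\<And>i. ((\<lambda>t. \<gamma> t $ i) has_field_derivative \<gamma>' $ i) (at t)"
  shows "((\<lambda>t. f (\<gamma> t)) has_field_derivative grad f (\<gamma> t) \<gamma>') (at t)"
  using homog_grad_exists[OF assms(1)] assms(2) by metis

lemma homog_partial:
  assumes "homog (Suc k) f"
  shows "homog k (\<lambda>v. partial_deriv i f v)"
proof -
  obtain g where "\<And>i. if Suc k = 0 then g i = (\<lambda>v. 0) else homog (Suc k - 1) (g i)"
    "\<And>i v. partial_deriv i f v = g i v" using homog_grad_exists[OF assms] by metis
  then show ?thesis by simp
qed

lemma homog_grad: "homog (Suc k) f \<Longrightarrow> homog k (\<lambda>v. grad f v w)"
  unfolding grad_def using homog_cmult[OF homog_partial]
  by (intro homog_sum) (auto simp: mult.commute)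

lemma homog_continuous: "homog k f \<Longrightarrow> continuous_on A f"
  by (induction rule: homog.induct) (auto intro!: continuous_intros)

lemma homog_isCont: "homog k f \<Longrightarrow> isCont f v"
  using homog_continuous[of k f UNIV] by (simp add: continuous_on_eq_continuous_at)

lemma homog_holomorphic:
  assumes "homog k f" "\<And>i. (\<lambda>t. \<gamma> t $ i) holomorphic_on T"
  shows "(\<lambda>t. f (\<gamma> t)) holomorphic_on T"
  using assms(1) by (induction rule: homog.induct) (auto intro!: holomorphic_intros assms(2))

text \<open>Euler's relation, from differentiating \<open>f (t *s v)\<close> at \<open>t = 1\<close>
  in two ways. On the curve it says that the gradient kills the point itself.\<close>

lemma homog_euler:
  assumes "homog k f"
  shows "grad f v v = of_nat k * f v"
proof -
  have "((\<lambda>t. f (t *s v)) has_field_derivative grad f (1 *s v) v) (at 1)"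
    by (rule homog_curve_derivative[OF assms]) (auto intro!: derivative_eq_intros)
  moreover have "((\<lambda>t. f (t *s v)) has_field_derivative of_nat k * f v) (at 1)"
    unfolding homog_smult[OF assms] by (auto intro!: derivative_eq_intros)
  ultimately show ?thesis using DERIV_unique by force
qed

text \<open>The coefficient in degree \<open>k\<close> is the value at \<open>w\<close>, the point
  at infinity of the line. If it is nonzero, the restriction has degree exactly
  \<open>k\<close>.\<close>

lemma homog_poly:
  assumes "homog k f"
  shows "\<exists>p. degree p \<le> k \<and> coeff p k = f w \<and> (\<forall>t. poly p t = f (v + t *s w))"
  using assms
proof (induction rule: homog.induct)
  case (const c)
  show ?case by (intro exI[of _ "[:c:]"]) auto
next
  case (coord i)
  show ?case by (intro exI[of _ "[:v $ i, w $ i:]"]) auto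
next
  case (add k f g)
  then obtain p q where "degree p \<le> k \<and> coeff p k = f w \<and> (\<forall>t. poly p t = f (v + t *s w))"
    "degree q \<le> k \<and> coeff q k = g w \<and> (\<forall>t. poly q t = g (v + t *s w))" by blast
  then show ?case by (intro exI[of _ "p + q"]) (auto intro: degree_add_le)
next
  case (mult j f k g)
  then obtain p q where p: "degree p \<le> j" "coeff p j = f w" "\<forall>t. poly p t = f (v + t *s w)"
    and q: "degree q \<le> k" "coeff q k = g w" "\<forall>t. poly q t = g (v + t *s w)" by blast
  have "coeff (p * q) (j + k) = coeff p j * coeff q k"
  proof (cases "degree p = j \<and> degree q = k")
    case True
    then show ?thesis using coeff_mult_degree_sum[of p q] by simp
  next
    case False
    then have "degree p < j \<or> degree q < k" using p q by linarith
    moreover from this have "degree (p * q) < j + k"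
      using p q degree_mult_le[of p q] by linarith
    ultimately show ?thesis using p(1) q(1) by (auto simp: coeff_eq_0)
  qed
  moreover have "degree (p * q) \<le> j + k" using p q degree_mult_le[of p q] by linarith
  ultimately show ?case using p q by (intro exI[of _ "p * q"]) auto
qed

lemma nonsingular_grad:
  assumes "nonsingular_form F" "v \<noteq> 0" "F v = 0"
  shows "\<exists>w. grad F v w \<noteq> 0"
  using assms unfolding nonsingular_form_def by (metis grad_axis)

lemma grad_basis_nonzero:
  assumes "nonsingular_form F" "v \<noteq> 0" "F v = 0" "cdet a b c \<noteq> 0" "grad F v a = 0" "grad F v b = 0"
  shows "grad F v c \<noteq> 0"
proof
  assume c: "grad F v c = 0"
  obtain w where w: "grad F v w \<noteq> 0" using nonsingular_grad[OF assms(1-3)] by blast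
  have "grad F v w = 0"
    by (subst basis_expand[OF assms(4), of w]) (simp add: assms c)
  with w show False by simp
qed

text \<open>A line contained in the curve carries the zeros of the normal derivative, a form of positive
  degree; they are singular points.\<close>

lemma line_not_in_curve:
  assumes F: "homog d F" "nonsingular_form F" "d \<ge> 2" and ab: "ccross a b \<noteq> 0"
  shows "\<exists>x y. F (x *s a + y *s b) \<noteq> 0"
proof (rule ccontr)
  assume "\<not> ?thesis"
  then have z: "F (x *s a + y *s b) = 0" for x y by blast
  obtain c where c: "cdet a b c \<noteq> 0" using ab ccross_nonzero by blast
  have nz: "x *s a + y *s b \<noteq> 0" if "x \<noteq> 0 \<or> y \<noteq> 0" for x y
    using basis_coords_zero[OF c, of x y 0] that by auto
  have ga: "grad F (x *s a + y *s b) a = 0" for x y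
  proof -
    have "((\<lambda>t. F ((x + t) *s a + y *s b)) has_field_derivative grad F ((x + 0) *s a + y *s b) a) (at 0)"
      by (rule homog_curve_derivative[OF F(1)]) (auto intro!: derivative_eq_intros)
    then have "((\<lambda>t. 0) has_field_derivative grad F (x *s a + y *s b) a) (at (0::complex))"
      by (simp only: z add_0_right)
    then show ?thesis using DERIV_unique DERIV_const by blast
  qed
  have gb: "grad F (x *s a + y *s b) b = 0" for x y
  proof -
    have "((\<lambda>t. F (x *s a + (y + t) *s b)) has_field_derivative grad F (x *s a + (y + 0) *s b) b) (at 0)"
      by (rule homog_curve_derivative[OF F(1)]) (auto intro!: derivative_eq_intros)
    then have "((\<lambda>t. 0) has_field_derivative grad F (x *s a + y *s b) b) (at (0::complex))"
      by (simp only: z add_0_right)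
    then show ?thesis using DERIV_unique DERIV_const by blast
  qed
  have gc: "grad F (x *s a + y *s b) c \<noteq> 0" if "x \<noteq> 0 \<or> y \<noteq> 0" for x y
    using grad_basis_nonzero[OF F(2) nz[OF that] z c ga gb] .
  obtain e where e: "d = Suc (Suc e)" using F(3) by (metis Suc_le_D numeral_2_eq_2 Suc_le_mono)
  have "homog (Suc e) (\<lambda>v. grad F v c)" using homog_grad F(1) e by blast
  then obtain p where p: "coeff p (Suc e) = grad F b c" "\<forall>t. poly p t = grad F (a + t *s b) c"
    using homog_poly by metis
  \<comment> \<open>The top coefficient is the normal derivative at the point \<open>b\<close> of
    the line, already known to be nonzero; thus the polynomial is not constant and has a
    root.\<close>
  have "coeff p (Suc e) \<noteq> 0" using gc[of 0 1] p(1) by simp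
  then have "degree p \<noteq> 0" using le_degree[of p "Suc e"] by linarith
  then obtain t where "poly p t = 0"
    using Fundamental_Theorem_Algebra.fundamental_theorem_of_algebra[of p] by (auto simp: constant_degree)
  then show False using p(2) gc[of 1 t] by simp
qed

section \<open>The implicit function theorem for complex plane sections\<close>

lemma homog_grad_continuous: "homog k F \<Longrightarrow> continuous_on A (\<lambda>v. grad F v w)"
proof (cases k)
  case 0
  assume "homog k F"
  then obtain g where "\<And>i. if k = 0 then g i = (\<lambda>v. 0) else homog (k - 1) (g i)"
    "\<And>i v. partial_deriv i F v = g i v" using homog_grad_exists by metis
  then have "grad F v w = 0" for v by (simp add: grad_def 0)
  then show ?thesis by simp
next
  case (Suc j)
  then show "homog k F \<Longrightarrow> ?thesis" using homog_grad homog_continuous by blast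
qed

lemma bounded_linear_smult: "bounded_linear (\<lambda>x::complex. x *s (v::complex^3))"
  by (intro linear_conv_bounded_linear[THEN iffD1] linearI)
    (simp_all add: vec_eq_iff algebra_simps)

lemma continuous_smult [continuous_intros]:
  "continuous_on A f \<Longrightarrow> continuous_on A (\<lambda>x. f x *s (v::complex^3))"
  using bounded_linear.continuous_on[OF bounded_linear_smult] .

lemma has_derivative_smult [derivative_intros]:
  "(f has_derivative f') F \<Longrightarrow> ((\<lambda>x. f x *s (v::complex^3)) has_derivative (\<lambda>h. f' h *s v)) F"
  using bounded_linear.has_derivative[OF bounded_linear_smult] .

text \<open>The inverse function theorem for
  \<open>(x, y) \<mapsto> (x, F (v0 + x *s e + y *s n))\<close>. It gives \<open>g\<close> only as a
  real differentiable function; that its derivative is multiplication by a complex number is read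
  off from the equation \<open>F = 0\<close>.\<close>

lemma implicit_function:
  assumes F: "homog k F" and z: "F v0 = 0" and n: "grad F v0 n \<noteq> 0"
  obtains r g where "r > 0" "g holomorphic_on ball 0 r" "g 0 = 0"
    "\<And>x. x \<in> ball 0 r \<Longrightarrow> F (v0 + x *s e + g x *s n) = 0"
    "\<forall>\<^sub>F z in nhds (0, 0). F (v0 + fst z *s e + snd z *s n) = 0 \<longrightarrow> snd z = g (fst z)"
proof -
  let ?p = "\<lambda>z. v0 + fst z *s e + snd z *s n"
  define \<Psi> where "\<Psi> z = (fst z, F (?p z))" for z
  define a b where "a z = grad F (?p z) e" and "b z = grad F (?p z) n" for z
  define f' where "f' z = Blinfun (\<lambda>h. (fst h, fst h * a z + snd h * b z))" for z
  have contp: "continuous_on UNIV ?p" by (intro continuous_intros)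
  have conta: "continuous_on UNIV a" and contb: "continuous_on UNIV b"
    unfolding a_def b_def
    by (rule continuous_on_compose2[OF homog_grad_continuous[OF F, of UNIV] contp]; simp)+
  have bl: "bounded_linear (\<lambda>h. (fst h, fst h * p + snd h * q))" for p q :: complex
    by (intro bounded_linear_intros)
  have f'_apply: "blinfun_apply (f' z) = (\<lambda>h. (fst h, fst h * a z + snd h * b z))" for z
    unfolding f'_def by (rule bounded_linear_Blinfun_apply[OF bl])
  have der: "(\<Psi> has_derivative blinfun_apply (f' z)) (at z)" for z
  proof -
    have "((\<lambda>z. F (?p z)) has_derivative (\<lambda>h. grad F (?p z) (fst h *s e + snd h *s n))) (at z)"
      by (rule has_derivative_compose[OF _ homog_has_derivative[OF F]])
        (auto intro!: derivative_eq_intros)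
    then have "(\<Psi> has_derivative (\<lambda>h. (fst h, grad F (?p z) (fst h *s e + snd h *s n)))) (at z)"
      unfolding \<Psi>_def by (intro has_derivative_Pair) (auto intro!: derivative_eq_intros)
    then show ?thesis by (simp add: f'_apply a_def b_def)
  qed
  have cont: "continuous_on UNIV f'"
    by (rule continuous_on_blinfun_componentwise)
      (auto simp: f'_apply intro!: continuous_intros conta contb)
  have b0: "b (0, 0) \<noteq> 0" using n by (simp add: b_def)
  \<comment> \<open>The inverse of the triangular derivative at the origin, available because the
    derivative in direction \<open>n\<close> is nonzero.\<close>
  have bl2: "bounded_linear (\<lambda>h. (fst h, (snd h - fst h * a (0,0)) * inverse (b (0,0))))"
    by (intro bounded_linear_intros)
  have inv: "Blinfun (\<lambda>h. (fst h, (snd h - fst h * a (0,0)) * inverse (b (0,0)))) o\<^sub>L f' (0,0)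
      = id_blinfun"
    using b0 by (intro blinfun_eqI)
      (simp add: f'_apply bounded_linear_Blinfun_apply[OF bl2] prod_eq_iff)
  obtain U' V G G' where U': "open U'" "(0,0) \<in> U'" and V: "open V" "\<Psi> (0,0) \<in> V"
    and hom: "homeomorphism U' V \<Psi> G" and G': "\<And>y. y \<in> V \<Longrightarrow> (G has_derivative G' y) (at y)"
    and bij: "\<And>y. y \<in> V \<Longrightarrow> bij (blinfun_apply (f' (G y)))"
    using inverse_function_theorem[OF open_UNIV der cont UNIV_I inv] by metis
  have P0: "\<Psi> (0,0) = (0,0)" by (simp add: \<Psi>_def z)
  define g where "g x = snd (G (x, 0))" for x
  have "open ((\<lambda>x::complex. (x, 0::complex)) -` V)"
    by (rule open_vimage[OF V(1)]) (intro continuous_intros)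
  then obtain r where r: "r > 0" "ball 0 r \<subseteq> (\<lambda>x. (x, 0)) -` V"
    using V(2) P0 by (force simp: open_contains_ball)
  then have inV: "(x, 0) \<in> V" if "x \<in> ball 0 r" for x using that by auto
  have PG: "\<Psi> (G y) = y" if "y \<in> V" for y using hom that by (auto simp: homeomorphism_def)
  have GP: "G (\<Psi> y) = y" if "y \<in> U'" for y using hom that by (auto simp: homeomorphism_def)
  have Gx: "G (x, 0) = (x, g x)" "F (v0 + x *s e + g x *s n) = 0" if "x \<in> ball 0 r" for x
    using PG[OF inV[OF that]] by (auto simp: \<Psi>_def g_def prod_eq_iff)
  have "g field_differentiable at x" if x: "x \<in> ball 0 r" for x
  proof -
    let ?L = "\<lambda>h. snd (G' (x, 0) (h, 0))"
    have "((\<lambda>x. G (x, 0)) has_derivative (\<lambda>h. G' (x, 0) (h, 0))) (at x)"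
      by (rule has_derivative_compose[of "\<lambda>x. (x, 0)" "\<lambda>h. (h, 0)" x UNIV G, OF _ G'[OF inV[OF x]]])
        (auto intro!: derivative_eq_intros)
    then have gd: "(g has_derivative ?L) (at x)"
      unfolding g_def by (rule has_derivative_snd)
    \<comment> \<open>Differentiating the identity \<open>F = 0\<close> along the graph shows that
      the derivative of \<open>g\<close> is multiplication by \<open>- a / b\<close>, hence complex
      linear.\<close>
    have "((\<lambda>x. F (v0 + x *s e + g x *s n)) has_derivative
        (\<lambda>h. grad F (v0 + x *s e + g x *s n) (h *s e + ?L h *s n))) (at x)"
      by (rule has_derivative_compose[OF _ homog_has_derivative[OF F]])
        (auto intro!: derivative_eq_intros gd)
    then have "((\<lambda>x. 0) has_derivative
        (\<lambda>h. grad F (v0 + x *s e + g x *s n) (h *s e + ?L h *s n))) (at x)"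
      by (rule has_derivative_transform_within_open[OF _ open_ball x]) (use Gx in auto)
    from has_derivative_unique[OF this has_derivative_const]
    have e: "h * a (x, g x) + ?L h * b (x, g x) = 0" for h
      by (simp add: a_def b_def fun_eq_iff)
    \<comment> \<open>Otherwise the derivative of \<open>\<Psi>\<close> would send
      \<open>(0, 1)\<close> and \<open>(0, 0)\<close> to the same vector, although it is bijective
      on the image of \<open>G\<close>.\<close>
    have "b (x, g x) \<noteq> 0"
    proof
      assume "b (x, g x) = 0"
      then have "f' (G (x,0)) (0, 1) = f' (G (x,0)) (0, 0)" by (simp add: f'_apply Gx[OF x])
      with bij[OF inV[OF x]] show False
        by (metis bij_is_inj injD prod.inject zero_neq_one)
    qed
    with e have "?L h = (- a (x, g x) / b (x, g x)) * h" for h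
      using e[of h] by (simp add: field_simps add_eq_0_iff2)
    then have "?L = (*) (- a (x, g x) / b (x, g x))" by (simp add: fun_eq_iff)
    with gd show ?thesis
      unfolding field_differentiable_def has_field_derivative_def by (intro exI) simp
  qed
  then have hol: "g holomorphic_on ball 0 r"
    by (simp add: holomorphic_on_def field_differentiable_at_within)
  have g0: "g 0 = 0" using GP[OF U'(2)] by (simp add: g_def P0)
  have "\<forall>\<^sub>F z in nhds (0, 0). z \<in> U'" using U' eventually_nhds_in_open by blast
  then have "\<forall>\<^sub>F z in nhds (0, 0). F (?p z) = 0 \<longrightarrow> snd z = g (fst z)"
  proof eventually_elim
    case (elim z)
    then show ?case using GP[OF elim] by (auto simp: \<Psi>_def g_def)
  qed
  with that r(1) hol g0 Gx(2) show ?thesis by blast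
qed

text \<open>Write \<open>h w - h c = (w - c) ^ n * g w\<close> with \<open>g c \<noteq> 0\<close>.
  Then \<open>deriv h w = (w - c) ^ (n - 1) * k w\<close> with \<open>k c = n * g c\<close>, and the
  quotient is \<open>(w - c) * g w / k w\<close>.\<close>

lemma zero_over_derivative:
  assumes h: "h holomorphic_on ball c r" "r > 0" and nc: "\<not> h constant_on ball c r"
  shows "((\<lambda>y. (h y - h c) / deriv h y) \<longlongrightarrow> 0) (at c)" "\<forall>\<^sub>F y in at c. deriv h y \<noteq> 0"
proof -
  have 1: "(\<lambda>y. h y - h c) holomorphic_on ball c r" by (intro holomorphic_intros h)
  have 2: "\<not> (\<lambda>y. h y - h c) constant_on ball c r"
  proof
    assume "(\<lambda>y. h y - h c) constant_on ball c r"
    then obtain k where "\<And>y. y \<in> ball c r \<Longrightarrow> h y - h c = k" by (auto simp: constant_on_def)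
    then have "\<And>y. y \<in> ball c r \<Longrightarrow> h y = k + h c" by (simp add: diff_eq_eq)
    with nc show False unfolding constant_on_def by blast
  qed
  have 3: "c \<in> ball c r" "(\<lambda>y. h y - h c) c = 0" using h(2) by auto
  obtain g s n where n: "0 < n" "0 < s" "ball c s \<subseteq> ball c r" "g holomorphic_on ball c s"
    and g: "\<And>w. w \<in> ball c s \<Longrightarrow> h w - h c = (w - c) ^ n * g w" "\<And>w. w \<in> ball c s \<Longrightarrow> g w \<noteq> 0"
    by (rule holomorphic_factor_zero_nonconstant[OF 1 open_ball connected_ball 3 2]) (rule that)
  define k where "k w = of_nat n * g w + (w - c) * deriv g w" for w
  have d: "deriv h w = (w - c) ^ (n - 1) * k w" if w: "w \<in> ball c s" for w
  proof -
    have gd: "(g has_field_derivative deriv g w) (at w)"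
      using holomorphic_derivI[OF n(4) open_ball w] .
    have pw: "(w - c) ^ n = (w - c) ^ (n - 1) * (w - c)"
      using n(1) by (simp add: power_eq_if)
    have "((\<lambda>w. h c + (w - c) ^ n * g w) has_field_derivative (w - c) ^ (n - 1) * k w) (at w)"
      by (auto intro!: derivative_eq_intros gd simp: k_def algebra_simps pw)
    then have "(h has_field_derivative (w - c) ^ (n - 1) * k w) (at w)"
      by (rule has_field_derivative_transform_within_open[OF _ open_ball w])
        (use g(1) in \<open>metis add.commute diff_add_cancel\<close>)
    then show ?thesis by (rule DERIV_imp_deriv)
  qed
  have cg: "continuous_on (ball c s) g" by (intro holomorphic_on_imp_continuous_on n)
  have ck: "continuous_on (ball c s) k" unfolding k_def
    by (intro continuous_intros cg holomorphic_on_imp_continuous_on holomorphic_deriv n open_ball)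
  have gl: "(g \<longlongrightarrow> g c) (at c)" and kl: "(k \<longlongrightarrow> k c) (at c)"
    using cg ck n(2) by (auto simp: continuous_on_eq_continuous_at isCont_def)
  have k0: "k c \<noteq> 0" using g(2)[of c] n by (simp add: k_def)
  have ek: "\<forall>\<^sub>F w in at c. k w \<noteq> 0" using tendsto_imp_eventually_ne[OF kl k0] .
  have es: "\<forall>\<^sub>F w in at c. w \<in> ball c s \<and> w \<noteq> c"
    using n(2) by (auto simp: eventually_at intro!: exI[of _ s] simp: dist_commute)
  show "\<forall>\<^sub>F y in at c. deriv h y \<noteq> 0"
    using ek es by eventually_elim (auto simp: d)
  have "((\<lambda>w. (w - c) * g w / k w) \<longlongrightarrow> (c - c) * g c / k c) (at c)"
    by (intro tendsto_intros gl kl k0)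
  then have "((\<lambda>w. (w - c) * g w / k w) \<longlongrightarrow> 0) (at c)" by simp
  then show "((\<lambda>y. (h y - h c) / deriv h y) \<longlongrightarrow> 0) (at c)"
  proof (rule Lim_transform_eventually)
    show "\<forall>\<^sub>F w in at c. (w - c) * g w / k w = (h w - h c) / deriv h w"
      using ek es
    proof eventually_elim
      case (elim w)
      have "(w - c) ^ n = (w - c) ^ (n - 1) * (w - c)" using n(1) by (simp add: power_eq_if)
      then show ?case using elim by (simp add: d g(1))
    qed
  qed
qed


section \<open>Pencils of lines\<close>

text \<open>Projection from the point \<open>e2\<close>. The parameter \<open>x\<close> runs through
  the lines through \<open>e2\<close>, except the one spanned by \<open>e1\<close> and
  \<open>e2\<close>, and \<open>y\<close> is the coordinate on such a line. As the centre is off the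
  curve, every fibre polynomial has degree exactly \<open>d\<close> and no branch escapes to
  infinity.\<close>

locale pencil =
  fixes F :: "complex^3 \<Rightarrow> complex" and d :: nat and e0 e1 e2 :: "complex^3"
  assumes F: "homog d F" and nons: "nonsingular_form F" and d2: "d \<ge> 2"
    and basis: "cdet e0 e1 e2 \<noteq> 0" and center: "F e2 \<noteq> 0"
begin

definition pt :: "complex \<Rightarrow> complex \<Rightarrow> complex^3" where
  "pt x y = e0 + x *s e1 + y *s e2"

definition rts :: "complex \<Rightarrow> complex set" where
  "rts x = {y. F (pt x y) = 0}"

definition unram :: "complex \<Rightarrow> bool" where
  "unram x \<longleftrightarrow> (\<forall>y \<in> rts x. grad F (pt x y) e2 \<noteq> 0)"

lemma pt_nonzero: "pt x y \<noteq> 0"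
  using basis_coords_zero(1)[OF basis, of 1 x y] by (auto simp: pt_def)

lemma pt_shift: "pt x y = pt b c + (x - b) *s e1 + (y - c) *s e2"
  by (simp add: pt_def vector_sub_rdistrib)

lemma pt_proportional:
  assumes "pt x y = c *s pt x' y'"
  shows "x = x'" "y = y'" "c = 1"
proof -
  have "(1 - c) *s e0 + (x - c * x') *s e1 + (y - c * y') *s e2 = 0"
    using assms by (simp add: pt_def vec_eq_iff algebra_simps)
  from basis_coords_zero[OF basis this] show "x = x'" "y = y'" "c = 1" by auto
qed

lemma continuous_pt [continuous_intros]:
  "continuous_on A f \<Longrightarrow> continuous_on A g \<Longrightarrow> continuous_on A (\<lambda>z. pt (f z) (g z))"
  unfolding pt_def by (intro continuous_intros)

lemma isCont_grad_pt: "isCont (\<lambda>z. grad F (pt (fst z) (snd z)) w) z"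
proof -
  have "continuous_on UNIV (\<lambda>z. grad F (pt (fst z) (snd z)) w)"
    by (rule continuous_on_compose2[OF homog_grad_continuous[OF F, of UNIV]])
      (auto intro!: continuous_intros)
  then show ?thesis by (simp add: continuous_on_eq_continuous_at del: split_paired_All)
qed

lemma isCont_F_pt: "isCont (\<lambda>z. F (pt (fst z) (snd z))) z"
proof -
  have "continuous_on UNIV (\<lambda>z. F (pt (fst z) (snd z)))"
    by (rule continuous_on_compose2[OF homog_continuous[OF F, of UNIV]])
      (auto intro!: continuous_intros)
  then show ?thesis by (simp add: continuous_on_eq_continuous_at del: split_paired_All)
qed

lemma fiber_poly:
  obtains p where "degree p = d" "lead_coeff p = F e2" "\<And>y. poly p y = F (pt x y)"
    "\<And>y. poly (pderiv p) y = grad F (pt x y) e2"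
proof -
  obtain p where p: "degree p \<le> d" "coeff p d = F e2" "\<forall>t. poly p t = F (e0 + x *s e1 + t *s e2)"
    using homog_poly[OF F] by blast
  then have dp: "degree p = d" using center le_degree[of p d] by force
  have "((\<lambda>y. F (pt x y)) has_field_derivative grad F (pt x y) e2) (at y)" for y
    by (rule homog_curve_derivative[OF F]) (auto simp: pt_def intro!: derivative_eq_intros)
  moreover have "(\<lambda>y. F (pt x y)) = poly p" using p by (auto simp: pt_def)
  ultimately have "poly (pderiv p) y = grad F (pt x y) e2" for y
    using DERIV_unique poly_DERIV by metis
  with that dp p show ?thesis by (simp add: pt_def)
qed

text \<open>The derivative of the fibre polynomial is the derivative of \<open>F\<close> in
  direction \<open>e2\<close>, so \<open>unram\<close> says that the polynomial is square-free, that
  is, that it has \<open>d\<close> different roots.\<close>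

lemma finite_rts: "finite (rts x)" and card_rts: "card (rts x) \<le> d"
  and rts_nonempty: "rts x \<noteq> {}" and card_rts_unram: "unram x \<Longrightarrow> card (rts x) = d"
  and unramI: "card (rts x) = d \<Longrightarrow> unram x"
proof -
  obtain p where p: "degree p = d" "lead_coeff p = F e2" "\<And>y. poly p y = F (pt x y)"
    "\<And>y. poly (pderiv p) y = grad F (pt x y) e2" using fiber_poly by blast
  have p0: "p \<noteq> 0" using p(1) d2 by auto
  have r: "rts x = {y. poly p y = 0}" by (simp add: rts_def p)
  show "finite (rts x)" "card (rts x) \<le> d"
    using poly_roots_finite[OF p0] card_poly_roots_bound[OF p0] p(1) by (auto simp: r)
  show "rts x \<noteq> {}"
    using Fundamental_Theorem_Algebra.fundamental_theorem_of_algebra[of p] p(1) d2 by (auto simp: r constant_degree)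
  show "card (rts x) = d" if "unram x"
  proof -
    have "rsquarefree p" using that by (auto simp: rsquarefree_roots unram_def r p)
    from complex_poly_decompose_rsquarefree[OF this]
    have "degree (smult (lead_coeff p) (\<Prod>z|poly p z = 0. [:-z, 1:])) = d"
      by (simp only: p(1))
    then show ?thesis using p0 by (simp add: r degree_prod_sum_eq)
  qed
  show "unram x" if c: "card (rts x) = d"
    unfolding unram_def
  proof
    fix y assume y: "y \<in> rts x"
    then have "poly p y = 0" by (simp add: r)
    \<comment> \<open>The derivative of \<open>p\<close> at \<open>y\<close> is \<open>q\<close> at
      \<open>y\<close>. Were it zero, all roots of \<open>p\<close> would be roots of
      \<open>q\<close>, which has only degree \<open>d - 1\<close>.\<close>
    then obtain q where q: "p = [:-y, 1:] * q" by (metis poly_eq_0_iff_dvd dvdE)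
    have q0: "q \<noteq> 0" using p0 q by auto
    have dq: "d = Suc (degree q)" using p(1) q0 by (simp add: q degree_mult_eq del: mult_pCons_left)
    show "grad F (pt x y) e2 \<noteq> 0"
    proof
      assume "grad F (pt x y) e2 = 0"
      then have "poly q y = 0" using p(4)[of y]
        by (simp add: q pderiv_mult pderiv_pCons del: mult_pCons_left)
      then have "rts x = {z. poly q z = 0}" by (auto simp: r q)
      then show False using card_poly_roots_bound[OF q0] c dq by simp
    qed
  qed
qed

text \<open>For a large root \<open>y\<close> the vector \<open>inverse y *s pt x y\<close> is close
  to \<open>e2\<close>, where \<open>F\<close> does not vanish.\<close>

lemma rts_bounded:
  obtains K where "\<And>x y. cmod x \<le> R \<Longrightarrow> y \<in> rts x \<Longrightarrow> cmod y \<le> K"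
proof -
  have "\<forall>\<^sub>F v in nhds e2. F v \<noteq> 0"
    using homog_isCont[OF F, of e2] center
    by (simp add: isCont_def tendsto_imp_eventually_ne eventually_nhds_conv_at)
  then obtain \<eta> where \<eta>: "\<eta> > 0" "\<And>v. dist v e2 < \<eta> \<Longrightarrow> F v \<noteq> 0"
    by (auto simp: eventually_nhds_metric)
  obtain B where B: "\<And>x. norm (x *s e1) \<le> norm x * B"
    using bounded_linear.bounded[OF bounded_linear_smult, of e1] by blast
  have sn: "norm (c *s v) = cmod c * norm v" for c and v :: "complex^3"
    by (simp add: norm_vec_def norm_mult L2_set_right_distrib)
  define M where "M = norm e0 + \<bar>R\<bar> * \<bar>B\<bar> + 1"
  have M: "M > 0" by (simp add: M_def add_nonneg_pos)
  have "cmod y \<le> M / \<eta>" if x: "cmod x \<le> R" and y: "y \<in> rts x" for x y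
  proof (rule ccontr)
    assume "\<not> ?thesis"
    then have yM: "cmod y * \<eta> > M" using \<eta>(1) by (simp add: field_simps)
    then have y0: "y \<noteq> 0" using M by auto
    have "norm (e0 + x *s e1) \<le> norm e0 + norm x * B"
      by (rule order_trans[OF norm_triangle_ineq add_left_mono[OF B]])
    also have "\<dots> \<le> norm e0 + \<bar>R\<bar> * \<bar>B\<bar>"
      using x by (intro add_left_mono order_trans[OF mult_left_mono[OF abs_ge_self] mult_right_mono]) auto
    finally have n: "norm (e0 + x *s e1) < M" by (simp add: M_def)
    define w where "w = e0 + x *s e1"
    have "pt x y = y *s (e2 + inverse y *s w)"
      using y0 by (simp add: pt_def w_def[symmetric] vector_add_ldistrib vector_smult_assoc)
    then have "F (e2 + inverse y *s w) = 0"
      using y y0 homog_smult[OF F] by (simp only: rts_def mem_Collect_eq) simp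
    moreover have "dist (e2 + inverse y *s w) e2 < \<eta>"
    proof -
      have "dist (e2 + inverse y *s w) e2 = inverse (cmod y) * norm w"
        by (simp add: dist_norm sn norm_inverse)
      also have "\<dots> < \<eta>" using n yM y0 by (simp add: w_def[symmetric] field_simps)
      finally show ?thesis .
    qed
    ultimately show False using \<eta>(2) by blast
  qed
  with that show ?thesis by blast
qed

text \<open>Tube lemma over a closed disc that contains all roots over nearby \<open>x\<close>: a
  condition that holds on the curve near each point over \<open>b\<close> holds at all points over
  values near \<open>b\<close>. Points of the disc that are not roots satisfy it vacuously in a
  neighbourhood.\<close>

lemma rts_eventually:
  assumes "\<And>y. y \<in> rts b \<Longrightarrow> \<forall>\<^sub>F z in nhds (b, y). F (pt (fst z) (snd z)) = 0 \<longrightarrow> P z"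
  shows "\<forall>\<^sub>F x in nhds b. \<forall>y \<in> rts x. P (x, y)"
proof -
  obtain K where K: "\<And>x y. cmod x \<le> cmod b + 1 \<Longrightarrow> y \<in> rts x \<Longrightarrow> cmod y \<le> K"
    using rts_bounded by blast
  define W where "W = interior {z. F (pt (fst z) (snd z)) = 0 \<longrightarrow> P z}"
  have "{b} \<times> cball 0 K \<subseteq> W"
  proof clarify
    fix y :: complex
    have "\<forall>\<^sub>F z in nhds (b, y). F (pt (fst z) (snd z)) = 0 \<longrightarrow> P z"
    proof (cases "y \<in> rts b")
      case False
      then have "\<forall>\<^sub>F z in at (b, y). F (pt (fst z) (snd z)) \<noteq> 0"
        using isCont_F_pt[of "(b, y)"] unfolding isCont_def
        by (intro tendsto_imp_eventually_ne) (auto simp: rts_def)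
      then have "\<forall>\<^sub>F z in nhds (b, y). F (pt (fst z) (snd z)) \<noteq> 0"
        using False by (simp add: eventually_nhds_conv_at rts_def)
      then show ?thesis by (auto elim: eventually_mono)
    qed (use assms in auto)
    then show "(b, y) \<in> W" unfolding W_def eventually_nhds
      by (auto intro: interiorI)
  qed
  then obtain X0 where X0: "b \<in> X0" "open X0" "X0 \<times> cball 0 K \<subseteq> W"
    using Elementary_Topology.tube_lemma[of "cball 0 K" W b] by (auto simp: W_def)
  have "\<forall>\<^sub>F x in nhds b. x \<in> X0" using X0 eventually_nhds_in_open by blast
  moreover have "\<forall>\<^sub>F x in nhds b. x \<in> ball b 1" by (intro eventually_nhds_in_open) auto
  ultimately show ?thesis
  proof eventually_elim
    case (elim x)
    have "cmod x \<le> cmod b + cmod (x - b)" using norm_triangle_ineq[of b "x - b"] by simp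
    then have x: "cmod x \<le> cmod b + 1" using elim(2) by (simp add: dist_norm norm_minus_commute)
    show ?case
    proof
      fix y assume y: "y \<in> rts x"
      then have "(x, y) \<in> W" using K[OF x y] X0(3) elim(1) by auto
      then show "P (x, y)" using y interior_subset unfolding W_def rts_def by fastforce
    qed
  qed
qed

end

section \<open>Ramification, branches and traces of the projection\<close>

context pencil
begin

lemma eventually_fst_nhds: "eventually P (nhds b) \<Longrightarrow> eventually (\<lambda>z. P (fst z)) (nhds (b, c))"
  and eventually_snd_nhds: "eventually Q (nhds c) \<Longrightarrow> eventually (\<lambda>z. Q (snd z)) (nhds (b, c))"
  unfolding nhds_prod by (auto simp: eventually_prod_filter intro: eventually_True)

text \<open>Near a ramification point the curve is a graph \<open>x = X y\<close> with \<open>grad F e1 * X' + grad F e2 = 0\<close>,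
  and \<open>(X y - b) / X' y\<close> tends to zero.\<close>

lemma ram_bound:
  assumes c: "c \<in> rts b" and \<epsilon>: "\<epsilon> > 0"
  shows "\<forall>\<^sub>F z in nhds (b, c). F (pt (fst z) (snd z)) = 0 \<longrightarrow> fst z \<noteq> b \<longrightarrow>
    grad F (pt (fst z) (snd z)) e2 \<noteq> 0 \<and>
    cmod (fst z - b) \<le> \<epsilon> * cmod (grad F (pt (fst z) (snd z)) e2)"
proof (cases "grad F (pt b c) e2 = 0")
  case False
  define m where "m = cmod (grad F (pt b c) e2) / 2"
  have m: "m > 0" using False by (simp add: m_def)
  have "((\<lambda>z. cmod (grad F (pt (fst z) (snd z)) e2)) \<longlongrightarrow> cmod (grad F (pt b c) e2)) (nhds (b, c))"
    using isCont_grad_pt[of "(b, c)" e2]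
    by (intro tendsto_norm) (simp add: isCont_def tendsto_nhds_iff)
  then have "\<forall>\<^sub>F z in nhds (b, c). cmod (grad F (pt (fst z) (snd z)) e2) > m"
    by (rule order_tendstoD) (use m in \<open>simp add: m_def\<close>)
  moreover have "\<forall>\<^sub>F z in nhds (b, c). fst z \<in> ball b (\<epsilon> * m)"
    by (rule eventually_fst_nhds, rule eventually_nhds_in_open) (use m \<epsilon> in auto)
  ultimately show ?thesis
  proof eventually_elim
    case (elim z)
    have "cmod (fst z - b) \<le> \<epsilon> * m" using elim(2) by (simp add: dist_norm norm_minus_commute)
    also have "\<dots> \<le> \<epsilon> * cmod (grad F (pt (fst z) (snd z)) e2)"
      using elim(1) \<epsilon> by simp
    finally show ?case using elim(1) m by auto
  qed
next
  case True
  have z0: "F (pt b c) = 0" using c by (simp add: rts_def)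
  \<comment> \<open>The gradient kills \<open>pt b c\<close> by Euler's relation and
    \<open>e2\<close> by the case assumption, so on a non-singular curve it cannot also kill
    \<open>e1\<close>.\<close>
  have e1: "grad F (pt b c) e1 \<noteq> 0"
  proof (rule grad_basis_nonzero[OF nons pt_nonzero z0])
    have "cdet (pt b c) e2 e1 = - cdet e0 e1 e2"
      by (simp add: pt_def cdet_swap'[of _ e2 e1] cdet_swap[of e2 e1])
    then show "cdet (pt b c) e2 e1 \<noteq> 0" using basis by simp
    show "grad F (pt b c) (pt b c) = 0" by (simp add: homog_euler[OF F] z0)
  qed (rule True)
  obtain r g where r: "r > 0" "g holomorphic_on ball 0 r" "g 0 = 0"
    and gz: "\<And>x. x \<in> ball 0 r \<Longrightarrow> F (pt b c + x *s e2 + g x *s e1) = 0"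
    and gu: "\<forall>\<^sub>F z in nhds (0, 0). F (pt b c + fst z *s e2 + snd z *s e1) = 0 \<longrightarrow> snd z = g (fst z)"
    using implicit_function[OF F z0 e1] by blast
  define X where "X y = b + g (y - c)" for y
  have Xc: "X c = b" by (simp add: X_def r)
  have Xhol: "X holomorphic_on ball c r"
    unfolding X_def using r(2)
    by (auto intro!: holomorphic_intros holomorphic_on_compose_gen[of "\<lambda>y. y - c", unfolded o_def]
        simp: dist_norm norm_minus_commute)
  have Xz: "F (pt (X y) y) = 0" if "y \<in> ball c r" for y
  proof -
    have "y - c \<in> ball 0 r" using that by (simp add: dist_norm norm_minus_commute)
    from gz[OF this] show ?thesis
      by (subst pt_shift[of _ _ b c]) (simp add: X_def add_ac)
  qed
  have Xu: "\<forall>\<^sub>F z in nhds (b, c). F (pt (fst z) (snd z)) = 0 \<longrightarrow> fst z = X (snd z)"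
  proof -
    have "filterlim (\<lambda>z. (snd z - c, fst z - b)) (nhds (0, 0)) (nhds (b, c))"
    proof -
      have "isCont (\<lambda>z. (snd z - c, fst z - b)) (b, c)" by (intro continuous_intros)
      then have "((\<lambda>z. (snd z - c, fst z - b)) \<longlongrightarrow> (snd (b, c) - c, fst (b, c) - b)) (nhds (b, c))"
        by (simp only: isCont_def tendsto_nhds_iff)
      then show ?thesis by simp
    qed
    from eventually_compose_filterlim[OF gu this] show ?thesis
    proof (rule eventually_mono, intro impI)
      fix z :: "complex \<times> complex"
      assume i: "F (pt b c + fst (snd z - c, fst z - b) *s e2 + snd (snd z - c, fst z - b) *s e1) = 0 \<longrightarrow>
          snd (snd z - c, fst z - b) = g (fst (snd z - c, fst z - b))"
        and f: "F (pt (fst z) (snd z)) = 0"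
      have "pt (fst z) (snd z) = pt b c + (snd z - c) *s e2 + (fst z - b) *s e1"
        by (subst pt_shift[of _ _ b c]) (simp add: add_ac)
      with i f have "fst z - b = g (snd z - c)" by simp
      then show "fst z = X (snd z)" by (simp add: X_def diff_eq_eq add.commute)
    qed
  qed
  have Xd: "grad F (pt (X y) y) e1 * deriv X y + grad F (pt (X y) y) e2 = 0" if y: "y \<in> ball c r" for y
  proof -
    have Xy: "(X has_field_derivative deriv X y) (at y)" using holomorphic_derivI[OF Xhol open_ball y] .
    have "((\<lambda>y. F (pt (X y) y)) has_field_derivative grad F (pt (X y) y) (deriv X y *s e1 + e2)) (at y)"
      by (rule homog_curve_derivative[OF F]) (auto simp: pt_def intro!: derivative_eq_intros Xy)
    then have "((\<lambda>y. 0) has_field_derivative grad F (pt (X y) y) (deriv X y *s e1 + e2)) (at y)"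
      by (rule has_field_derivative_transform_within_open[OF _ open_ball y]) (use Xz in auto)
    then have "grad F (pt (X y) y) (deriv X y *s e1 + e2) = 0"
      using DERIV_unique[OF _ DERIV_const] by blast
    then show ?thesis by (simp add: mult.commute)
  qed
  \<comment> \<open>A constant \<open>X\<close> would place a whole disc in the finite fibre over
    \<open>b\<close>.\<close>
  have nc: "\<not> X constant_on ball c r"
  proof
    assume "X constant_on ball c r"
    then have "X y = b" if "y \<in> ball c r" for y
      using Xc r(1) that unfolding constant_on_def by (metis centre_in_ball)
    then have "ball c r \<subseteq> rts b" using Xz by (auto simp: rts_def)
    then have "countable (ball c r)" using finite_rts[of b] finite_subset countable_finite by blast
    then show False using uncountable_ball[OF r(1), of c] by blast
  qed
  note zd = zero_over_derivative[OF Xhol r(1) nc]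
  define m where "m = cmod (grad F (pt b c) e1) / 2"
  have m: "m > 0" using e1 by (simp add: m_def)
  have "((\<lambda>z. cmod (grad F (pt (fst z) (snd z)) e1)) \<longlongrightarrow> cmod (grad F (pt b c) e1)) (nhds (b, c))"
    using isCont_grad_pt[of "(b, c)" e1]
    by (intro tendsto_norm) (simp add: isCont_def tendsto_nhds_iff)
  then have em: "\<forall>\<^sub>F z in nhds (b, c). cmod (grad F (pt (fst z) (snd z)) e1) > m"
    by (rule order_tendstoD) (use m in \<open>simp add: m_def\<close>)
  have "((\<lambda>y. cmod ((X y - X c) / deriv X y)) \<longlongrightarrow> 0) (at c)"
    using zd(1) by (rule tendsto_norm_zero)
  then have "\<forall>\<^sub>F y in at c. cmod ((X y - X c) / deriv X y) < \<epsilon> * m"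
    by (rule order_tendstoD) (use m \<epsilon> in simp)
  then have "\<forall>\<^sub>F y in at c. cmod (X y - b) \<le> \<epsilon> * m * cmod (deriv X y) \<and> deriv X y \<noteq> 0"
    using zd(2) by eventually_elim (auto simp: Xc norm_divide field_simps)
  then have e1: "\<forall>\<^sub>F y in nhds c. y \<noteq> c \<longrightarrow>
      cmod (X y - b) \<le> \<epsilon> * m * cmod (deriv X y) \<and> deriv X y \<noteq> 0"
    by (simp add: eventually_at_filter)
  have e2: "\<forall>\<^sub>F y in nhds c. y \<in> ball c r" using r(1) by (intro eventually_nhds_in_open) auto
  show ?thesis
    using Xu em eventually_snd_nhds[OF e1] eventually_snd_nhds[OF e2]
  proof eventually_elim
    case (elim z)
    show ?case
    proof (intro impI)
      assume z: "F (pt (fst z) (snd z)) = 0" "fst z \<noteq> b"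
      then have x: "fst z = X (snd z)" using elim(1) by blast
      then have "snd z \<noteq> c" using z(2) Xc by auto
      then have l: "cmod (fst z - b) \<le> \<epsilon> * m * cmod (deriv X (snd z))" "deriv X (snd z) \<noteq> 0"
        using elim(3) x by auto
      have g: "grad F (pt (fst z) (snd z)) e2 = - (grad F (pt (fst z) (snd z)) e1 * deriv X (snd z))"
        using Xd[OF elim(4)] x by (simp add: eq_neg_iff_add_eq_0 add.commute)
      have n: "m * cmod (deriv X (snd z)) \<le> cmod (grad F (pt (fst z) (snd z)) e2)"
        unfolding g norm_minus_cancel norm_mult using elim(2) by (intro mult_right_mono) auto
      have "cmod (fst z - b) \<le> \<epsilon> * cmod (grad F (pt (fst z) (snd z)) e2)"
        using order_trans[OF l(1)[unfolded mult.assoc] mult_left_mono[OF n]] \<epsilon> by simp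
      moreover have "grad F (pt (fst z) (snd z)) e1 \<noteq> 0" using elim(2) m by auto
      ultimately show "grad F (pt (fst z) (snd z)) e2 \<noteq> 0 \<and>
          cmod (fst z - b) \<le> \<epsilon> * cmod (grad F (pt (fst z) (snd z)) e2)"
        using g l(2) by simp
    qed
  qed
qed

text \<open>By \<open>ram_bound\<close> the vertical derivative is nonzero on the curve near a point
  over \<open>b\<close>, away from the fibre over \<open>b\<close> itself. Hence branch values are
  isolated.\<close>

lemma eventually_unram: "\<forall>\<^sub>F x in at b. unram x"
proof -
  have "\<forall>\<^sub>F x in nhds b. \<forall>y \<in> rts x. fst (x, y) \<noteq> b \<longrightarrow>
      grad F (pt (fst (x, y)) (snd (x, y))) e2 \<noteq> 0"
  proof (rule rts_eventually)
    fix c assume "c \<in> rts b"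
    from ram_bound[OF this zero_less_one]
    show "\<forall>\<^sub>F z in nhds (b, c). F (pt (fst z) (snd z)) = 0 \<longrightarrow> fst z \<noteq> b \<longrightarrow>
        grad F (pt (fst z) (snd z)) e2 \<noteq> 0"
      by (rule eventually_mono) blast
  qed
  then show ?thesis
    unfolding eventually_at_filter by (rule eventually_mono) (auto simp: unram_def)
qed

text \<open>A set of complex numbers without limit points is countable, which is all that the later
  choices in general position require.\<close>

lemma countable_ram: "countable {x. \<not> unram x}"
proof (rule no_limpt_imp_countable)
  fix b
  show "\<not> b islimpt {x. \<not> unram x}"
    using eventually_unram[of b]
    by (auto simp: islimpt_iff_eventually elim: eventually_mono)
qed

definition branches :: "complex \<Rightarrow> real \<Rightarrow> (complex \<Rightarrow> complex \<Rightarrow> complex) \<Rightarrow> bool" where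
  "branches b r G \<longleftrightarrow> r > 0 \<and>
     (\<forall>c \<in> rts b. G c holomorphic_on ball b r \<and> G c b = c) \<and>
     (\<forall>x \<in> ball b r. inj_on (\<lambda>c. G c x) (rts b) \<and> rts x = (\<lambda>c. G c x) ` rts b \<and> unram x)"

text \<open>The implicit function theorem gives one branch through each of the \<open>d\<close>
  roots, and a smaller disc keeps them apart. Their \<open>d\<close> different values exhaust a
  fibre that has at most \<open>d\<close> elements, so every root lies on a branch and every nearby
  fibre is unramified.\<close>

lemma fiber_branches:
  assumes b: "unram b"
  shows "\<exists>r G. branches b r G"
proof -
  have "\<exists>s g. s > 0 \<and> g holomorphic_on ball b s \<and> g b = c \<and> (\<forall>x \<in> ball b s. F (pt x (g x)) = 0)"
    if c: "c \<in> rts b" for c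
  proof -
    have z: "F (pt b c) = 0" "grad F (pt b c) e2 \<noteq> 0" using b c by (auto simp: unram_def rts_def)
    obtain r g where r: "r > 0" "g holomorphic_on ball 0 r" "g 0 = 0"
      and gz: "\<And>x. x \<in> ball 0 r \<Longrightarrow> F (pt b c + x *s e1 + g x *s e2) = 0"
      using implicit_function[OF F z, of e1] by metis
    show ?thesis
    proof (intro exI conjI ballI)
      show "(\<lambda>x. c + g (x - b)) holomorphic_on ball b r"
        using r(2) by (auto intro!: holomorphic_intros
          holomorphic_on_compose_gen[of "\<lambda>y. y - b", unfolded o_def] simp: dist_norm norm_minus_commute)
      fix x assume "x \<in> ball b r"
      then have "x - b \<in> ball 0 r" by (simp add: dist_norm norm_minus_commute)
      from gz[OF this] show "F (pt x (c + g (x - b))) = 0"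
        by (subst pt_shift[of _ _ b c]) simp
    qed (use r in auto)
  qed
  then obtain s G where sG: "\<And>c. c \<in> rts b \<Longrightarrow> s c > 0 \<and> G c holomorphic_on ball b (s c) \<and> G c b = c
      \<and> (\<forall>x \<in> ball b (s c). F (pt x (G c x)) = 0)" by metis
  define s0 where "s0 = Min (s ` rts b)"
  have s0: "s0 > 0" "\<And>c. c \<in> rts b \<Longrightarrow> s0 \<le> s c"
    using sG finite_rts rts_nonempty by (auto simp: s0_def)
  have cont: "isCont (G c) b" if "c \<in> rts b" for c
    using sG[OF that] holomorphic_on_imp_continuous_on
    by (metis centre_in_ball continuous_on_eq_continuous_at open_ball)
  have "\<forall>\<^sub>F x in nhds b. G c x \<noteq> G c' x" if cc: "c \<in> rts b" "c' \<in> rts b" "c \<noteq> c'" for c c'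
  proof -
    have "((\<lambda>x. G c x - G c' x) \<longlongrightarrow> c - c') (at b)"
      using cont[OF cc(1)] cont[OF cc(2)] sG cc by (auto simp: isCont_def intro!: tendsto_diff)
    then have "\<forall>\<^sub>F x in at b. G c x - G c' x \<noteq> 0" using cc by (intro tendsto_imp_eventually_ne) auto
    then show ?thesis using sG cc by (simp add: eventually_nhds_conv_at)
  qed
  then have "\<forall>\<^sub>F x in nhds b. \<forall>c\<in>rts b. \<forall>c'\<in>rts b. c \<noteq> c' \<longrightarrow> G c x \<noteq> G c' x"
    by (intro eventually_ball_finite finite_rts ballI) (auto intro: always_eventually)
  then obtain s1 where s1: "s1 > 0"
      "\<And>x. dist x b < s1 \<Longrightarrow> \<forall>c\<in>rts b. \<forall>c'\<in>rts b. c \<noteq> c' \<longrightarrow> G c x \<noteq> G c' x"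
    by (auto simp: eventually_nhds_metric)
  define r where "r = min s0 s1"
  have sub: "ball b r \<subseteq> ball b (s c)" if "c \<in> rts b" for c using s0(2)[OF that] by (auto simp: r_def)
  have inj: "inj_on (\<lambda>c. G c x) (rts b)" if "x \<in> ball b r" for x
    using s1(2)[of x] that by (auto simp: inj_on_def r_def dist_commute)
  have im: "(\<lambda>c. G c x) ` rts b \<subseteq> rts x" if "x \<in> ball b r" for x
    using sG sub that by (force simp: rts_def)
  have cd: "card ((\<lambda>c. G c x) ` rts b) = d" if "x \<in> ball b r" for x
    using card_image[OF inj[OF that]] card_rts_unram[OF b] by simp
  have eq: "rts x = (\<lambda>c. G c x) ` rts b" if "x \<in> ball b r" for x
    using card_seteq[OF finite_rts im[OF that]] cd[OF that] card_rts by simp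
  have "r > 0" using s0 s1 by (simp add: r_def)
  moreover have "unram x" if "x \<in> ball b r" for x
    using unramI eq[OF that] cd[OF that] by simp
  moreover have "G c holomorphic_on ball b r" if "c \<in> rts b" for c
    using holomorphic_on_subset[OF _ sub[OF that]] sG that by blast
  ultimately have "branches b r G" unfolding branches_def using sG inj eq by blast
  then show ?thesis by blast
qed

lemma branchesD:
  assumes "branches b r G"
  shows "r > 0" "\<And>c. c \<in> rts b \<Longrightarrow> G c holomorphic_on ball b r"
    "\<And>c. c \<in> rts b \<Longrightarrow> G c b = c"
    "\<And>x. x \<in> ball b r \<Longrightarrow> inj_on (\<lambda>c. G c x) (rts b)"
    "\<And>x. x \<in> ball b r \<Longrightarrow> rts x = (\<lambda>c. G c x) ` rts b"
    "\<And>x. x \<in> ball b r \<Longrightarrow> unram x"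
  using assms unfolding branches_def by blast+

text \<open>If \<open>\<tau>\<close> is the coefficient of a differential with respect to
  \<open>dx\<close>, this is the coefficient of its direct image on the \<open>x\<close>-line. Being
  symmetric in the roots, it is single-valued around branch values.\<close>

definition trace :: "(complex^3 \<Rightarrow> complex) \<Rightarrow> complex \<Rightarrow> complex" where
  "trace \<tau> x = (\<Sum>y \<in> rts x. \<tau> (pt x y))"

lemma trace_holomorphic:
  assumes b: "unram b"
    and hol: "\<And>r g. r > 0 \<Longrightarrow> g holomorphic_on ball b r \<Longrightarrow>
       (\<And>x. x \<in> ball b r \<Longrightarrow> g x \<in> rts x \<and> unram x) \<Longrightarrow>
       \<exists>s>0. (\<lambda>x. \<tau> (pt x (g x))) holomorphic_on ball b s"
  shows "trace \<tau> field_differentiable at b"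
proof -
  obtain r G where G: "branches b r G" using fiber_branches[OF b] by blast
  note r = branchesD[OF G]
  have t: "(\<Sum>c\<in>rts b. \<tau> (pt x (G c x))) = trace \<tau> x" if "x \<in> ball b r" for x
    unfolding trace_def r(5)[OF that] by (rule sum.reindex_cong[OF r(4)[OF that], symmetric]) auto
  have "(\<lambda>x. \<tau> (pt x (G c x))) field_differentiable at b" if c: "c \<in> rts b" for c
  proof -
    have "\<exists>s>0. (\<lambda>x. \<tau> (pt x (G c x))) holomorphic_on ball b s"
      using hol[OF r(1) r(2)[OF c]] c r(5,6) by blast
    then show ?thesis
      by (metis centre_in_ball holomorphic_on_imp_differentiable_at open_ball)
  qed
  then have "(\<lambda>x. \<Sum>c\<in>rts b. \<tau> (pt x (G c x))) field_differentiable at b"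
    by (intro field_differentiable_sum) auto
  then show ?thesis
    by (rule field_differentiable_transform_within[OF r(1) UNIV_I, rotated])
      (use t in \<open>auto simp: dist_commute\<close>)
qed

lemma trace_residue:
  assumes G: "branches b r G"
    and lim: "\<And>c. c \<in> rts b \<Longrightarrow> ((\<lambda>x. (x - b) * \<tau> (pt x (G c x))) \<longlongrightarrow> \<rho> c) (at b)"
  shows "((\<lambda>x. (x - b) * trace \<tau> x) \<longlongrightarrow> (\<Sum>c \<in> rts b. \<rho> c)) (at b)"
proof -
  note r = branchesD[OF G]
  have t: "(\<Sum>c\<in>rts b. \<tau> (pt x (G c x))) = trace \<tau> x" if "x \<in> ball b r" for x
    unfolding trace_def r(5)[OF that] by (rule sum.reindex_cong[OF r(4)[OF that], symmetric]) auto
  have "((\<lambda>x. \<Sum>c\<in>rts b. (x - b) * \<tau> (pt x (G c x))) \<longlongrightarrow> (\<Sum>c \<in> rts b. \<rho> c)) (at b)"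
    by (intro tendsto_sum lim)
  then show ?thesis
    by (rule Lim_transform_within_open[OF _ open_ball centre_in_ball[THEN iffD2, OF r(1)]])
      (simp add: t flip: sum_distrib_left)
qed

text \<open>The hypothesis says that the differential is a bounded multiple of
  \<open>dx / F\<^sub>y\<close>. By \<open>ram_bound\<close>, \<open>x - b\<close> is small compared
  with \<open>F\<^sub>y\<close> even at a ramification point, so each of the at most
  \<open>d\<close> terms tends to zero.\<close>

lemma trace_tendsto_0:
  assumes bd: "\<And>c. c \<in> rts b \<Longrightarrow> \<exists>M. \<forall>\<^sub>F z in nhds (b, c). F (pt (fst z) (snd z)) = 0 \<longrightarrow>
     cmod (\<tau> (pt (fst z) (snd z)) * grad F (pt (fst z) (snd z)) e2) \<le> M"
  shows "((\<lambda>x. (x - b) * trace \<tau> x) \<longlongrightarrow> 0) (at b)"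
proof (rule tendstoI)
  fix e :: real assume e: "e > 0"
  \<comment> \<open>Half of \<open>e / d\<close>, so that at most \<open>d\<close> non-strict bounds
    add up to a strict one.\<close>
  define e' where "e' = e / (2 * real d)"
  have e': "e' > 0" using e d2 by (simp add: e'_def)
  have "\<forall>\<^sub>F x in nhds b. \<forall>y \<in> rts x. fst (x, y) \<noteq> b \<longrightarrow>
      cmod ((fst (x, y) - b) * \<tau> (pt (fst (x, y)) (snd (x, y)))) \<le> e'"
  proof (rule rts_eventually[where P = "\<lambda>z. fst z \<noteq> b \<longrightarrow>
      cmod ((fst z - b) * \<tau> (pt (fst z) (snd z))) \<le> e'"])
    fix c assume c: "c \<in> rts b"
    obtain M where M: "\<forall>\<^sub>F z in nhds (b, c). F (pt (fst z) (snd z)) = 0 \<longrightarrow>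
        cmod (\<tau> (pt (fst z) (snd z)) * grad F (pt (fst z) (snd z)) e2) \<le> M"
      using bd[OF c] by blast
    define M' where "M' = max M 1"
    have M': "M' > 0" "M \<le> M'" by (auto simp: M'_def)
    have "e' / M' > 0" using e' M' by simp
    from ram_bound[OF c this] M
    show "\<forall>\<^sub>F z in nhds (b, c). F (pt (fst z) (snd z)) = 0 \<longrightarrow> fst z \<noteq> b \<longrightarrow>
      cmod ((fst z - b) * \<tau> (pt (fst z) (snd z))) \<le> e'"
    proof eventually_elim
      case (elim z)
      show ?case
      proof (intro impI)
        let ?g = "grad F (pt (fst z) (snd z)) e2" and ?t = "\<tau> (pt (fst z) (snd z))"
        assume z: "F (pt (fst z) (snd z)) = 0" "fst z \<noteq> b"
        have "cmod (fst z - b) \<le> e' / M' * cmod ?g" using elim(1) z by blast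
        from mult_right_mono[OF this, of "cmod ?t"]
        have "cmod ((fst z - b) * ?t) \<le> (e' / M' * cmod ?g) * cmod ?t"
          by (simp only: norm_mult norm_ge_zero simp_thms)
        also have "\<dots> = e' / M' * cmod (?t * ?g)" by (simp add: norm_mult)
        also have "\<dots> \<le> e' / M' * M'" using elim(2) z M' e' by (intro mult_left_mono) auto
        finally show "cmod ((fst z - b) * ?t) \<le> e'" using M' by simp
      qed
    qed
  qed
  then show "\<forall>\<^sub>F x in at b. dist ((x - b) * trace \<tau> x) 0 < e"
    unfolding eventually_at_filter
  proof eventually_elim
    case (elim x)
    show ?case
    proof (intro impI)
      assume x: "x \<noteq> b"
      have "cmod ((x - b) * trace \<tau> x) \<le> (\<Sum>y \<in> rts x. cmod ((x - b) * \<tau> (pt x y)))"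
        unfolding trace_def sum_distrib_left by (rule norm_sum)
      also have "\<dots> \<le> real (card (rts x)) * e'" using elim x by (intro sum_bounded_above) auto
      also have "\<dots> \<le> real d * e'" using card_rts[of x] e' by (intro mult_right_mono) auto
      also have "\<dots> < e" using e d2 by (simp add: e'_def)
      finally show "dist ((x - b) * trace \<tau> x) 0 < e" by simp
    qed
  qed
qed

end

text \<open>After subtraction of the principal parts the function has removable singularities
  everywhere and tends to zero at infinity, so it vanishes by Liouville's theorem. Then
  \<open>x * t x\<close> tends both to zero and to the sum of the residues.\<close>

lemma residue_sum_zero:
  fixes t :: "complex \<Rightarrow> complex"
  assumes hol: "\<And>b. \<forall>\<^sub>F x in at b. t field_differentiable at x"
    and X: "finite X" and pole: "\<And>b. b \<in> X \<Longrightarrow> ((\<lambda>x. (x - b) * t x) \<longlongrightarrow> \<rho> b) (at b)"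
    and reg: "\<And>b. b \<notin> X \<Longrightarrow> ((\<lambda>x. (x - b) * t x) \<longlongrightarrow> 0) (at b)"
    and inf: "((\<lambda>x. x * t x) \<longlongrightarrow> 0) at_infinity"
  shows "(\<Sum>b\<in>X. \<rho> b) = 0"
proof -
  define t0 where "t0 x = t x - (\<Sum>b\<in>X. \<rho> b / (x - b))" for x
  have lim: "((\<lambda>x. (x - b) * t0 x) \<longlongrightarrow> 0) (at b)" for b
  proof -
    have q: "((\<lambda>x. (x - b) * (\<rho> a / (x - a))) \<longlongrightarrow> (if a = b then \<rho> b else 0)) (at b)" for a
    proof (cases "a = b")
      case True
      have "\<forall>\<^sub>F x in at b. \<rho> b = (x - b) * (\<rho> a / (x - a))"
        unfolding eventually_at_filter True by (auto intro: always_eventually)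
      then show ?thesis using True by (auto intro: Lim_transform_eventually[OF tendsto_const])
    next
      case False
      have "((\<lambda>x. (x - b) * (\<rho> a / (x - a))) \<longlongrightarrow> (b - b) * (\<rho> a / (b - a))) (at b)"
        using False by (intro tendsto_intros) auto
      then show ?thesis using False by simp
    qed
    have "((\<lambda>x. \<Sum>a\<in>X. (x - b) * (\<rho> a / (x - a))) \<longlongrightarrow> (\<Sum>a\<in>X. if a = b then \<rho> b else 0)) (at b)"
      by (intro tendsto_sum q)
    then have 1: "((\<lambda>x. (x - b) * (\<Sum>a\<in>X. \<rho> a / (x - a))) \<longlongrightarrow> (if b \<in> X then \<rho> b else 0)) (at b)"
      using X by (simp add: sum_distrib_left)
    have 2: "((\<lambda>x. (x - b) * t x) \<longlongrightarrow> (if b \<in> X then \<rho> b else 0)) (at b)"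
      using pole reg by auto
    show ?thesis using tendsto_diff[OF 2 1] by (simp add: t0_def right_diff_distrib)
  qed
  have hol0: "\<forall>\<^sub>F x in at b. t0 field_differentiable at x" for b
  proof -
    have "\<forall>\<^sub>F x in at b. x \<notin> X"
      using islimpt_finite[OF X, of b] by (simp add: islimpt_iff_eventually)
    with hol show ?thesis
    proof eventually_elim
      case (elim x)
      then show ?case unfolding t0_def
        by (intro field_differentiable_diff field_differentiable_sum field_differentiable_divide
            field_differentiable_const field_differentiable_ident) auto
    qed
  qed
  have ext: "\<exists>r>0. \<exists>g. g holomorphic_on ball b r \<and> (\<forall>x \<in> ball b r - {b}. g x = t0 x)" for b
  proof -
    obtain r where r: "r > 0" "\<And>x. x \<noteq> b \<Longrightarrow> dist x b < r \<Longrightarrow> t0 field_differentiable at x"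
      using hol0[of b] by (auto simp: eventually_at)
    have "t0 holomorphic_on ball b r - {b}"
      using r by (auto simp: holomorphic_on_def dist_commute intro: field_differentiable_at_within)
    moreover have "b \<in> interior (ball b r)" using r(1) by simp
    ultimately have "\<exists>g. g holomorphic_on ball b r \<and> (\<forall>z \<in> ball b r - {b}. g z = t0 z)"
      using holomorphic_on_extend_lim[of t0 "ball b r" b] lim[of b] by simp
    with r(1) show ?thesis by blast
  qed
  \<comment> \<open>The values of \<open>t0\<close> at isolated points are arbitrary; the limit
    replaces them by those of the holomorphic extension.\<close>
  define t1 where "t1 b = Lim (at b) t0" for b
  have t1: "\<exists>r>0. t1 holomorphic_on ball b r \<and> (\<forall>x \<in> ball b r - {b}. t1 x = t0 x)" for b
  proof -
    obtain r g where r: "r > 0" "g holomorphic_on ball b r" "\<And>x. x \<in> ball b r - {b} \<Longrightarrow> g x = t0 x"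
      using ext by blast
    have "t1 x = g x" if x: "x \<in> ball b r" for x
    proof -
      have "(g \<longlongrightarrow> g x) (at x)"
        using holomorphic_on_imp_continuous_on[OF r(2)] x
        by (simp add: continuous_on_eq_continuous_at isCont_def)
      moreover have "\<forall>\<^sub>F y in at x. g y = t0 y"
      proof -
        have "\<forall>\<^sub>F y in at x. y \<in> ball b r - {b}"
        proof (cases "x = b")
          case True
          then show ?thesis using r(1) by (auto simp: eventually_at dist_commute intro!: exI[of _ r])
        next
          case False
          then have "\<forall>\<^sub>F y in nhds x. y \<in> ball b r - {b}"
            using x by (intro eventually_nhds_in_open) auto
          then show ?thesis by (simp add: eventually_nhds_conv_at)
        qed
        then show ?thesis by (rule eventually_mono) (use r(3) in auto)
      qed
      ultimately have "(t0 \<longlongrightarrow> g x) (at x)" by (rule Lim_transform_eventually)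
      then show ?thesis unfolding t1_def by (intro tendsto_Lim) auto
    qed
    with r show ?thesis by (metis DiffD1 holomorphic_transform)
  qed
  have hol1: "t1 holomorphic_on UNIV"
    unfolding holomorphic_on_def using t1
    by (metis centre_in_ball field_differentiable_at_within holomorphic_on_imp_differentiable_at open_ball)
  have one: "((\<lambda>x. x / (x - b)) \<longlongrightarrow> 1) at_infinity" for b :: complex
  proof -
    have "filterlim (\<lambda>x. x + - b) at_infinity at_infinity"
      by (rule tendsto_add_filterlim_at_infinity'[OF filterlim_ident tendsto_const])
    then have H: "filterlim (\<lambda>x. x - b) at_infinity at_infinity" by simp
    have "((\<lambda>x. 1 + b / (x - b)) \<longlongrightarrow> 1 + 0) at_infinity"
      by (intro tendsto_add tendsto_const tendsto_divide_0[OF tendsto_const H])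
    then have "((\<lambda>x. 1 + b / (x - b)) \<longlongrightarrow> 1) at_infinity" by simp
    moreover have "\<forall>\<^sub>F x in at_infinity. 1 + b / (x - b) = x / (x - b)"
    proof -
      have "\<forall>\<^sub>F x in at_infinity. cmod b + 1 \<le> cmod x"
        unfolding eventually_at_infinity by blast
      then show ?thesis
      proof eventually_elim
        case (elim x)
        then have "x \<noteq> b" by auto
        then show ?case by (simp add: field_simps)
      qed
    qed
    ultimately show ?thesis by (rule Lim_transform_eventually)
  qed
  \<comment> \<open>Each \<open>x / (x - b)\<close> tends to 1, so the principal parts contribute
    minus the sum of the residues.\<close>
  have inf0: "((\<lambda>x. x * t0 x) \<longlongrightarrow> 0 - (\<Sum>b\<in>X. \<rho> b * 1)) at_infinity"
  proof -
    have "((\<lambda>x. x * t x - (\<Sum>b\<in>X. \<rho> b * (x / (x - b)))) \<longlongrightarrow> 0 - (\<Sum>b\<in>X. \<rho> b * 1)) at_infinity"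
      by (intro tendsto_diff inf tendsto_sum tendsto_mult tendsto_const one)
    moreover have "x * t x - (\<Sum>b\<in>X. \<rho> b * (x / (x - b))) = x * t0 x" for x
      by (simp add: t0_def right_diff_distrib sum_distrib_left mult.commute)
    ultimately show ?thesis by simp
  qed
  have t10: "\<forall>\<^sub>F x in at b. t0 x = t1 x" for b
  proof -
    obtain r where "r > 0" "\<forall>x \<in> ball b r - {b}. t1 x = t0 x" using t1 by blast
    then show ?thesis by (auto simp: eventually_at dist_commute intro!: exI[of _ r])
  qed
  have t1lim: "(t0 \<longlongrightarrow> t1 b) (at b)" for b
  proof -
    have "(t1 \<longlongrightarrow> t1 b) (at b)"
      using holomorphic_on_imp_continuous_on[OF hol1]
      by (simp add: continuous_on_eq_continuous_at isCont_def)
    then show ?thesis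
      by (rule Lim_transform_eventually) (use t10[of b] in \<open>auto elim: eventually_mono\<close>)
  qed
  have t0inf: "(t0 \<longlongrightarrow> 0) at_infinity"
  proof -
    have "((\<lambda>x. inverse x * (x * t0 x)) \<longlongrightarrow> 0 * (0 - (\<Sum>b\<in>X. \<rho> b * 1))) at_infinity"
      by (intro tendsto_mult inf0 tendsto_inverse_0)
    moreover have "\<forall>\<^sub>F x::complex in at_infinity. inverse x * (x * t0 x) = t0 x"
      unfolding eventually_at_infinity
    proof (intro exI[of _ 1] allI impI)
      fix x :: complex assume "1 \<le> cmod x"
      then have "x \<noteq> 0" by auto
      then show "inverse x * (x * t0 x) = t0 x" by simp
    qed
    ultimately show ?thesis using Lim_transform_eventually by fastforce
  qed
  have "(t1 \<longlongrightarrow> 0) at_infinity"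
  proof (rule tendstoI)
    fix e :: real assume e: "e > 0"
    have "\<forall>\<^sub>F x in at_infinity. dist (t0 x) 0 < e / 2" using tendstoD[OF t0inf, of "e/2"] e by simp
    then obtain R where R: "\<And>x. R \<le> cmod x \<Longrightarrow> cmod (t0 x) < e / 2"
      by (auto simp: eventually_at_infinity)
    have "cmod (t1 b) \<le> e / 2" if b: "R + 1 \<le> cmod b" for b
    proof (rule tendsto_upperbound[OF tendsto_norm[OF t1lim[of b]]])
      show "\<forall>\<^sub>F x in at b. cmod (t0 x) \<le> e / 2"
        unfolding eventually_at
      proof (intro exI[of _ 1] conjI ballI impI)
        fix x assume "x \<noteq> b \<and> dist x b < 1"
        then have "R \<le> cmod x" using b norm_triangle_ineq[of x "b - x"]
          by (simp add: dist_norm norm_minus_commute)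
        then show "cmod (t0 x) \<le> e / 2" using R by (meson less_imp_le)
      qed simp
    qed simp
    then show "\<forall>\<^sub>F x in at_infinity. dist (t1 x) 0 < e"
      unfolding eventually_at_infinity using e by (intro exI[of _ "R + 1"]) fastforce
  qed
  then have t1z: "t1 x = 0" for x using Liouville_weak_0[OF hol1] by blast
  show ?thesis
  proof (rule ccontr)
    assume c: "(\<Sum>b\<in>X. \<rho> b) \<noteq> 0"
    have "\<forall>\<^sub>F x in at_infinity. x * t0 x \<noteq> 0"
      by (rule tendsto_imp_eventually_ne[OF inf0]) (use c in simp)
    then obtain R where R: "\<And>x. R \<le> cmod x \<Longrightarrow> x * t0 x \<noteq> 0"
      by (auto simp: eventually_at_infinity)
    \<comment> \<open>\<open>t0\<close> agrees with \<open>t1 = 0\<close> only in punctured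
      neighbourhoods, so the contradiction is taken at points close to one that lies beyond the
      radius \<open>R\<close>.\<close>
    define b where "b = complex_of_real (\<bar>R\<bar> + 1)"
    have "\<forall>\<^sub>F x in at b. cmod x > R"
      by (rule order_tendstoD(1)[OF tendsto_norm[OF tendsto_ident_at]]) (simp add: b_def)
    with t10[of b] have "\<forall>\<^sub>F x in at b. False"
      by eventually_elim (use R t1z in \<open>metis less_imp_le mult_zero_right\<close>)
    then show False by simp
  qed
qed

section \<open>Points, lines and curves in the projective plane\<close>

definition on_line :: "complex^3 \<Rightarrow> proj2 \<Rightarrow> bool" where
  "on_line m p \<longleftrightarrow> cdot m (rep_proj2 p) = 0"

lemma rep_abs_proj2:
  assumes "v \<noteq> 0"
  obtains c where "c \<noteq> 0" "rep_proj2 (abs_proj2 v) = c *s v"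
  using abs_proj2_eq_iff[OF assms rep_proj2_nonzero, of "abs_proj2 v"] by (auto simp: abs_rep_proj2)

lemma on_line_abs: "v \<noteq> 0 \<Longrightarrow> on_line m (abs_proj2 v) \<longleftrightarrow> cdot m v = 0"
  by (metis rep_abs_proj2 on_line_def cdot_smult mult_eq_0_iff)

lemma abs_proj2_smult: "v \<noteq> 0 \<Longrightarrow> c \<noteq> 0 \<Longrightarrow> abs_proj2 (c *s v) = abs_proj2 v"
  by (subst eq_commute, subst abs_proj2_eq_iff) (auto simp: vector_mul_eq_0)

lemma abs_in_plane_curve:
  assumes "homog d F" "v \<noteq> 0"
  shows "abs_proj2 v \<in> plane_curve F \<longleftrightarrow> F v = 0"
proof
  assume "abs_proj2 v \<in> plane_curve F"
  then obtain w where w: "abs_proj2 v = abs_proj2 w" "w \<noteq> 0" "F w = 0" by (auto simp: plane_curve_def)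
  then obtain c where c: "c \<noteq> 0" "w = c *s v" using abs_proj2_eq_iff[OF assms(2) w(2)] by blast
  then have "c ^ d * F v = 0" using homog_smult[OF assms(1), of c v] w(3) by simp
  then show "F v = 0" using c by simp
qed (use assms in \<open>auto simp: plane_curve_def\<close>)

lemma rep_plane_curve: "homog d F \<Longrightarrow> p \<in> plane_curve F \<longleftrightarrow> F (rep_proj2 p) = 0"
  using abs_in_plane_curve[OF _ rep_proj2_nonzero, of d F p] by (simp add: abs_rep_proj2)

lemma continuous_abs_proj2: "continuous_on (- {0}) abs_proj2"
proof (subst continuous_on_open_vimage[OF open_Compl[OF closed_singleton]], intro allI impI)
  fix B :: "proj2 set" assume "open B"
  then have "open {v. v \<noteq> 0 \<and> abs_proj2 v \<in> B}" by (simp add: open_proj2_def)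
  moreover have "{v. v \<noteq> 0 \<and> abs_proj2 v \<in> B} = abs_proj2 -` B \<inter> - {0}" by auto
  ultimately show "open (abs_proj2 -` B \<inter> - {0})" by simp
qed

lemma open_proj2I:
  assumes "open {v. v \<noteq> 0 \<and> P v}" "\<And>v c. v \<noteq> 0 \<Longrightarrow> c \<noteq> 0 \<Longrightarrow> P (c *s v) \<longleftrightarrow> P v"
  shows "open {p. P (rep_proj2 p)}"
proof -
  have "{v. v \<noteq> 0 \<and> abs_proj2 v \<in> {p. P (rep_proj2 p)}} = {v. v \<noteq> 0 \<and> P v}"
    using rep_abs_proj2 assms(2) by (auto; metis)
  then show ?thesis unfolding open_proj2_def using assms(1) by simp
qed

lemma eventually_abs_proj2:
  assumes "open W" "abs_proj2 v0 \<in> W" "v0 \<noteq> 0"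
  shows "\<forall>\<^sub>F v in nhds v0. v \<noteq> 0 \<and> abs_proj2 v \<in> W"
  using eventually_nhds_in_open[of "{v. v \<noteq> 0 \<and> abs_proj2 v \<in> W}" v0] assms
  by (simp add: open_proj2_def)

context pencil
begin

lemma abs_pt_inj: "abs_proj2 (pt x y) = abs_proj2 (pt x' y') \<Longrightarrow> x = x' \<and> y = y'"
  by (metis abs_proj2_eq_iff[OF pt_nonzero pt_nonzero] pt_proportional(1,2))

lemma abs_pt_in_curve: "abs_proj2 (pt x y) \<in> plane_curve F \<longleftrightarrow> y \<in> rts x"
  by (simp add: abs_in_plane_curve[OF F pt_nonzero] rts_def)

text \<open>The only point of the line without a coordinate \<open>y\<close> is the centre
  \<open>e2\<close>, and it is not on the curve.\<close>

lemma line_points: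
  assumes m: "m \<noteq> 0" "cdot m (e0 + x *s e1) = 0" "cdot m e2 = 0"
  shows "bij_betw (\<lambda>y. abs_proj2 (pt x y)) (rts x) {p \<in> plane_curve F. on_line m p}"
  unfolding bij_betw_def
proof
  show "inj_on (\<lambda>y. abs_proj2 (pt x y)) (rts x)" using abs_pt_inj by (auto simp: inj_on_def)
  have c: "cdet (e0 + x *s e1) e2 e1 \<noteq> 0"
    using basis by (simp add: cdet_swap'[of _ e2 e1] cdet_swap[of e2 e1])
  show "(\<lambda>y. abs_proj2 (pt x y)) ` rts x = {p \<in> plane_curve F. on_line m p}"
  proof (intro equalityI subsetI)
    fix p assume "p \<in> (\<lambda>y. abs_proj2 (pt x y)) ` rts x"
    then show "p \<in> {p \<in> plane_curve F. on_line m p}"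
      using m by (auto simp: abs_pt_in_curve on_line_abs[OF pt_nonzero]) (simp add: pt_def)
  next
    fix p assume p: "p \<in> {p \<in> plane_curve F. on_line m p}"
    define v where "v = rep_proj2 p"
    have v: "v \<noteq> 0" "F v = 0" "cdot m v = 0" "p = abs_proj2 v"
      using p rep_plane_curve[OF F] by (auto simp: v_def rep_proj2_nonzero on_line_def abs_rep_proj2)
    have "ccross (e0 + x *s e1) e2 \<noteq> 0" using c ccross_nonzero by blast
    from line_span[OF m(2,3) v(3) m(1) this] obtain a b where ab: "v = a *s (e0 + x *s e1) + b *s e2" .
    have a0: "a \<noteq> 0"
    proof
      assume "a = 0"
      then have "v = b *s e2" using ab by simp
      then show False using v(1,2) center homog_smult[OF F, of b e2] by auto
    qed
    have "v = a *s pt x (b / a)"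
      using a0 ab by (simp add: pt_def vector_add_ldistrib vector_smult_assoc)
    then have pe: "p = abs_proj2 (pt x (b / a))" using v(4) abs_proj2_smult[OF pt_nonzero a0] by simp
    moreover have "b / a \<in> rts x" using p pe abs_pt_in_curve by blast
    ultimately show "p \<in> (\<lambda>y. abs_proj2 (pt x y)) ` rts x" by blast
  qed
qed

lemma infinite_curve: "infinite (plane_curve F)"
proof -
  have "\<forall>x. \<exists>y. y \<in> rts x" using rts_nonempty by blast
  then obtain Y where Y: "\<And>x. Y x \<in> rts x" by metis
  have "range (\<lambda>x. abs_proj2 (pt x (Y x))) \<subseteq> plane_curve F" using Y abs_pt_in_curve by auto
  moreover have "infinite (range (\<lambda>x. abs_proj2 (pt x (Y x))))"
    using finite_imageD[of "\<lambda>x. abs_proj2 (pt x (Y x))" UNIV] abs_pt_inj infinite_UNIV_char_0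
    by (auto simp: inj_on_def)
  ultimately show ?thesis using finite_subset by blast
qed

end

text \<open>Expressed by the number of points and not by tangency, because a number of points is
  what the bijection \<open>f\<close> carries over. The infinitesimal meaning is recovered in
  \<open>transversal_direction\<close>.\<close>

definition transversal :: "(complex^3 \<Rightarrow> complex) \<Rightarrow> nat \<Rightarrow> complex^3 \<Rightarrow> bool" where
  "transversal F d m \<longleftrightarrow> m \<noteq> 0 \<and> card {p \<in> plane_curve F. on_line m p} = d"

lemma (in pencil) transversal_unram:
  assumes "unram x"
  shows "transversal F d (ccross (e0 + x *s e1) e2)"
proof -
  have c: "cdet (e0 + x *s e1) e2 e1 \<noteq> 0"
    using basis by (simp add: cdet_swap'[of _ e2 e1] cdet_swap[of e2 e1])
  then have m: "ccross (e0 + x *s e1) e2 \<noteq> 0" using ccross_nonzero by blast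
  have "cdot (ccross (e0 + x *s e1) e2) (e0 + x *s e1) = 0" "cdot (ccross (e0 + x *s e1) e2) e2 = 0"
    by (simp_all only: cdot_ccross cdet_same)
  from bij_betw_same_card[OF line_points[OF m this]] card_rts_unram[OF assms] m
  show ?thesis by (simp add: transversal_def)
qed

text \<open>The line is not contained in the curve, so it has a point off the curve. Projection from
  that point makes the section by the line the fibre over \<open>x = 0\<close>.\<close>

lemma line_pencil:
  assumes F: "homog d F" "nonsingular_form F" "d \<ge> 2"
    and m: "m \<noteq> 0" "cdot m w = 0" "w \<noteq> 0" "F w = 0"
  obtains e1 e2 where "pencil F d w e1 e2" "cdot m e2 = 0"
proof -
  obtain n where n: "cdot m n = 0" "ccross w n \<noteq> 0" using line_direction[OF m(1-3)] .
  obtain x y where xy: "F (x *s w + y *s n) \<noteq> 0" using line_not_in_curve[OF F n(2)] by blast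
  obtain c where c: "cdet w n c \<noteq> 0" using n(2) ccross_nonzero by blast
  \<comment> \<open>The chosen point is off the curve and so is no multiple of \<open>w\<close>;
    this keeps the new basis independent.\<close>
  have y0: "y \<noteq> 0"
  proof
    assume "y = 0"
    then show False using xy homog_smult[OF F(1), of x w] m(4) by simp
  qed
  have "pencil F d w c (x *s w + y *s n)"
  proof
    show "cdet w c (x *s w + y *s n) \<noteq> 0" using y0 c cdet_swap'[of w n c] by simp
  qed (use F xy in auto)
  moreover have "cdot m (x *s w + y *s n) = 0" using m n by simp
  ultimately show ?thesis using that by blast
qed

lemma card_line:
  assumes F: "homog d F" "nonsingular_form F" "d \<ge> 2" and m: "m \<noteq> 0"
  shows "finite {p \<in> plane_curve F. on_line m p}" "card {p \<in> plane_curve F. on_line m p} \<le> d"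
proof -
  have "finite {p \<in> plane_curve F. on_line m p} \<and> card {p \<in> plane_curve F. on_line m p} \<le> d"
  proof (cases "{p \<in> plane_curve F. on_line m p} = {}")
    case False
    then obtain p where p: "p \<in> plane_curve F" "on_line m p" by blast
    have w: "cdot m (rep_proj2 p) = 0" "rep_proj2 p \<noteq> 0" "F (rep_proj2 p) = 0"
      using p rep_plane_curve[OF F(1)] by (auto simp: on_line_def rep_proj2_nonzero)
    obtain e1 e2 where e: "pencil F d (rep_proj2 p) e1 e2" "cdot m e2 = 0"
      using line_pencil[OF F m w] .
    interpret pencil F d "rep_proj2 p" e1 e2 by (rule e)
    have "bij_betw (\<lambda>y. abs_proj2 (pt 0 y)) (rts 0) {p \<in> plane_curve F. on_line m p}"
      by (rule line_points[OF m]) (use w e in simp_all)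
    then show ?thesis using card_rts finite_rts bij_betw_same_card bij_betw_finite by metis
  next
    case True
    show ?thesis unfolding True by simp
  qed
  then show "finite {p \<in> plane_curve F. on_line m p}" "card {p \<in> plane_curve F. on_line m p} \<le> d"
    by auto
qed

text \<open>In the pencil centred on the line, \<open>d\<close> points in the fibre mean that it is
  unramified, and the direction towards the centre serves as \<open>n\<close>.\<close>

lemma transversal_direction:
  assumes F: "homog d F" "nonsingular_form F" "d \<ge> 2"
    and m: "transversal F d m" "cdot m w = 0" "w \<noteq> 0" "F w = 0"
  obtains n where "cdot m n = 0" "grad F w n \<noteq> 0"
proof -
  have m0: "m \<noteq> 0" using m(1) by (simp add: transversal_def)
  obtain e1 e2 where e: "pencil F d w e1 e2" "cdot m e2 = 0" using line_pencil[OF F m0 m(2-4)] .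
  interpret pencil F d w e1 e2 by (rule e)
  have "bij_betw (\<lambda>y. abs_proj2 (pt 0 y)) (rts 0) {p \<in> plane_curve F. on_line m p}"
    by (rule line_points[OF m0]) (use m e in simp_all)
  then have "card (rts 0) = d" using m(1) bij_betw_same_card by (auto simp: transversal_def)
  then have "unram 0" by (rule unramI)
  moreover have "0 \<in> rts 0" using m(4) by (simp add: rts_def pt_def)
  ultimately have "grad F (pt 0 0) e2 \<noteq> 0" by (simp add: unram_def)
  then show ?thesis using that e by (simp add: pt_def)
qed

text \<open>The condition on \<open>e1\<close> makes it a second admissible centre, so that
  \<open>three_lines\<close> can project from both \<open>e2\<close> and \<open>e1\<close>.\<close>

lemma exists_pencil:
  assumes F: "homog d F" "nonsingular_form F" "d \<ge> 2"
  shows "\<exists>e0 e1 e2. pencil F d e0 e1 e2 \<and> F e1 \<noteq> 0"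
proof -
  have "ccross (axis 1 1) (axis 2 1) \<noteq> 0" by (simp add: ccross_def axis_def vec_eq_iff forall_3)
  from line_not_in_curve[OF F this] obtain v where v: "F v \<noteq> 0" by blast
  have "F 0 = 0" using homog_smult[OF F(1), of 0 0] F(3) by (simp add: zero_power)
  then have "v \<noteq> 0" using v by auto
  then obtain b c where bc: "cdet v b c \<noteq> 0" using extend_basis by blast
  have "\<forall>\<^sub>F t in at 0. F (v + t *s b) \<noteq> 0"
  proof (rule tendsto_imp_eventually_ne)
    have "continuous_on UNIV (\<lambda>t. F (v + t *s b))"
      by (rule continuous_on_compose2[OF homog_continuous[OF F(1), of UNIV]])
        (auto intro!: continuous_intros)
    then have "isCont (\<lambda>t. F (v + t *s b)) 0" by (simp add: continuous_on_eq_continuous_at)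
    then show "((\<lambda>t. F (v + t *s b)) \<longlongrightarrow> F v) (at 0)" by (simp add: isCont_def)
  qed (rule v)
  then have "\<forall>\<^sub>F t in at 0. F (v + t *s b) \<noteq> 0 \<and> t \<noteq> 0"
    by (simp add: eventually_at_filter)
  then obtain t where t: "F (v + t *s b) \<noteq> 0" "t \<noteq> 0"
    using eventually_happens' at_neq_bot by blast
  have "cdet c (v + t *s b) v = - (t * cdet v b c)"
    by (simp add: cdet_cycle[of c] cdet_swap[of b v])
  then have "pencil F d c (v + t *s b) v" using F v bc t(2) by unfold_locales auto
  with t show ?thesis by blast
qed


section \<open>Holomorphic curves and simple zeros\<close>

definition hol_vec :: "(complex \<Rightarrow> complex^3) \<Rightarrow> complex set \<Rightarrow> bool" where
  "hol_vec \<gamma> T \<longleftrightarrow> (\<forall>i. (\<lambda>t. \<gamma> t $ i) holomorphic_on T)"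

lemma hol_vec_add: "hol_vec f T \<Longrightarrow> hol_vec g T \<Longrightarrow> hol_vec (\<lambda>t. f t + g t) T"
  and hol_vec_const: "hol_vec (\<lambda>t. v) T"
  and hol_vec_smult: "h holomorphic_on T \<Longrightarrow> hol_vec (\<lambda>t. h t *s v) T"
  by (auto simp: hol_vec_def intro!: holomorphic_intros)

lemma hol_vec_subset: "hol_vec f T \<Longrightarrow> S \<subseteq> T \<Longrightarrow> hol_vec f S"
  by (auto simp: hol_vec_def intro: holomorphic_on_subset)

lemma hol_vec_cdot: "hol_vec f T \<Longrightarrow> (\<lambda>t. cdot l (f t)) holomorphic_on T"
  by (auto simp: hol_vec_def cdot_def intro!: holomorphic_intros)

lemma hol_vec_homog: "homog k F \<Longrightarrow> hol_vec f T \<Longrightarrow> (\<lambda>t. F (f t)) holomorphic_on T"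
  by (auto simp: hol_vec_def intro: homog_holomorphic)

lemma hol_vec_continuous:
  assumes "hol_vec f T"
  shows "continuous_on T f"
proof -
  have "continuous_on T (\<lambda>t. \<chi> i. f t $ i)"
    using assms unfolding hol_vec_def
    by (intro continuous_on_vec_lambda holomorphic_on_imp_continuous_on) blast
  then show ?thesis by simp
qed

lemma hol_vec_cdet: "hol_vec f T \<Longrightarrow> (\<lambda>t. cdet (f t) b c) holomorphic_on T"
  "hol_vec f T \<Longrightarrow> (\<lambda>t. cdet a (f t) c) holomorphic_on T"
  "hol_vec f T \<Longrightarrow> (\<lambda>t. cdet a b (f t)) holomorphic_on T"
  by (auto simp: hol_vec_def cdet_def intro!: holomorphic_intros)

text \<open>A curve germ that embeds into the plane curve meets a transversal line with multiplicity one,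
  since the abscissa is an injective function on it.\<close>

lemma simple_zero:
  assumes F: "homog k F" and \<delta>: "hol_vec \<delta> (ball b r)" "r > 0"
    and on: "\<And>t. t \<in> ball b r \<Longrightarrow> \<delta> t \<noteq> 0 \<and> F (\<delta> t) = 0"
    and inj: "\<And>t t' c. t \<in> ball b r \<Longrightarrow> t' \<in> ball b r \<Longrightarrow> c \<noteq> 0 \<Longrightarrow> \<delta> t = c *s \<delta> t' \<Longrightarrow> t = t'"
    and l: "l \<noteq> 0" "cdot l (\<delta> b) = 0" and n: "cdot l n = 0" "grad F (\<delta> b) n \<noteq> 0"
  shows "deriv (\<lambda>t. cdot l (\<delta> t)) b \<noteq> 0"
proof -
  define w where "w = \<delta> b"
  have bb: "b \<in> ball b r" using \<delta>(2) by simp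
  have w: "w \<noteq> 0" "F w = 0" using on[OF bb] by (auto simp: w_def)
  \<comment> \<open>By Euler's relation the gradient kills multiples of \<open>w\<close>, but it
    does not kill \<open>n\<close>.\<close>
  have "\<nexists>c. n = c *s w"
    using n(2) homog_euler[OF F, of w] w(2) by (auto simp: w_def)
  then obtain c where c0: "cdet w n c \<noteq> 0" using not_multiple_basis[OF w(1)] by blast
  have lc: "cdot l c \<noteq> 0" using cdot_basis_zero[OF c0] l n by (auto simp: w_def)
  define D where "D = cdet w c n"
  have D: "D \<noteq> 0" using c0 cdet_swap'[of w n c] by (simp add: D_def)
  define \<alpha> \<beta> \<nu> where "\<alpha> t = cdet (\<delta> t) c n / D" and "\<beta> t = cdet w (\<delta> t) n / D"
    and "\<nu> t = cdet w c (\<delta> t) / D" for t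
  have exp: "\<delta> t = \<alpha> t *s w + \<beta> t *s c + \<nu> t *s n" for t
    unfolding \<alpha>_def \<beta>_def \<nu>_def D_def by (rule basis_expand) (use D in \<open>simp add: D_def\<close>)
  have hol: "\<alpha> holomorphic_on ball b r" "\<beta> holomorphic_on ball b r" "\<nu> holomorphic_on ball b r"
    unfolding \<alpha>_def \<beta>_def \<nu>_def using D by (auto intro!: holomorphic_intros hol_vec_cdet \<delta>)
  have ini: "\<alpha> b = 1" "\<beta> b = 0" "\<nu> b = 0"
    using D by (simp_all add: \<alpha>_def \<beta>_def \<nu>_def w_def[symmetric] D_def)
  obtain r' g where g: "\<forall>\<^sub>F z in nhds (0, 0). F (w + fst z *s c + snd z *s n) = 0 \<longrightarrow> snd z = g (fst z)"
    using implicit_function[OF F w(2), of n c] n(2) by (metis w_def)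
  have cont: "isCont \<alpha> b" "isCont \<beta> b" "isCont \<nu> b"
    using hol bb by (auto simp: continuous_on_eq_continuous_at dest!: holomorphic_on_imp_continuous_on)
  have "((\<lambda>t. (\<beta> t / \<alpha> t, \<nu> t / \<alpha> t)) \<longlongrightarrow> (\<beta> b / \<alpha> b, \<nu> b / \<alpha> b)) (nhds b)"
    using cont ini by (intro tendsto_Pair tendsto_divide) (auto simp: isCont_def tendsto_nhds_iff)
  then have "filterlim (\<lambda>t. (\<beta> t / \<alpha> t, \<nu> t / \<alpha> t)) (nhds (0, 0)) (nhds b)" by (simp add: ini)
  from eventually_compose_filterlim[OF g this]
  have e1: "\<forall>\<^sub>F t in nhds b. F (w + (\<beta> t / \<alpha> t) *s c + (\<nu> t / \<alpha> t) *s n) = 0 \<longrightarrow>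
      \<nu> t / \<alpha> t = g (\<beta> t / \<alpha> t)" by simp
  have e2: "\<forall>\<^sub>F t in nhds b. \<alpha> t \<noteq> 0"
    using cont(1) ini(1) by (simp add: isCont_def tendsto_imp_eventually_ne eventually_nhds_conv_at)
  have e3: "\<forall>\<^sub>F t in nhds b. t \<in> ball b r" by (rule eventually_nhds_in_open) (use bb in auto)
  have "\<forall>\<^sub>F t in nhds b. t \<in> ball b r \<and> \<alpha> t \<noteq> 0 \<and> \<nu> t / \<alpha> t = g (\<beta> t / \<alpha> t) \<and>
      \<delta> t = \<alpha> t *s (w + (\<beta> t / \<alpha> t) *s c + (\<nu> t / \<alpha> t) *s n)"
    using e1 e2 e3
  proof eventually_elim
    case (elim t)
    have d: "\<delta> t = \<alpha> t *s (w + (\<beta> t / \<alpha> t) *s c + (\<nu> t / \<alpha> t) *s n)"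
      using exp[of t] elim(2) by (simp add: vector_add_ldistrib vector_smult_assoc)
    have "F (w + (\<beta> t / \<alpha> t) *s c + (\<nu> t / \<alpha> t) *s n) = 0"
    proof -
      have "F (\<delta> t) = \<alpha> t ^ k * F (w + (\<beta> t / \<alpha> t) *s c + (\<nu> t / \<alpha> t) *s n)"
        by (subst d) (rule homog_smult[OF F])
      then show ?thesis using on[OF elim(3)] elim(2) by simp
    qed
    then show ?case using elim d by blast
  qed
  then obtain s where s: "s > 0" and S: "\<And>t. t \<in> ball b s \<Longrightarrow> t \<in> ball b r \<and> \<alpha> t \<noteq> 0 \<and>
      \<nu> t / \<alpha> t = g (\<beta> t / \<alpha> t) \<and> \<delta> t = \<alpha> t *s (w + (\<beta> t / \<alpha> t) *s c + (\<nu> t / \<alpha> t) *s n)"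
    by (auto simp: eventually_nhds_metric dist_commute)
  \<comment> \<open>The abscissa of the curve in the affine coordinates centred at \<open>w\<close>.
    The ordinate is \<open>g (q t)\<close>, so \<open>q t\<close> determines
    \<open>\<delta> t\<close> up to a factor; therefore \<open>q\<close> is injective and its
    derivative has no zero.\<close>
  define q where "q t = \<beta> t / \<alpha> t" for t
  have "inj_on q (ball b s)"
  proof (rule inj_onI)
    fix t t' assume t: "t \<in> ball b s" "t' \<in> ball b s" and q: "q t = q t'"
    have "\<delta> t = \<alpha> t *s (w + q t *s c + g (q t) *s n)" "\<delta> t' = \<alpha> t' *s (w + q t *s c + g (q t) *s n)"
      using S[OF t(1)] S[OF t(2)] q by (metis q_def)+
    then have "\<delta> t = (\<alpha> t / \<alpha> t') *s \<delta> t'" using S[OF t(2)] by (simp only: vector_smult_assoc) simp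
    then show "t = t'" using inj S[OF t(1)] S[OF t(2)] by (metis divide_eq_0_iff)
  qed
  moreover have "q holomorphic_on ball b s"
    unfolding q_def using S hol by (intro holomorphic_intros) (auto intro: holomorphic_on_subset)
  ultimately have dq: "deriv q b \<noteq> 0"
    using holomorphic_injective_imp_regular[of q "ball b s" b] s by simp
  have d\<alpha>: "(\<alpha> has_field_derivative deriv \<alpha> b) (at b)" and d\<beta>: "(\<beta> has_field_derivative deriv \<beta> b) (at b)"
    using hol bb holomorphic_derivI open_ball by blast+
  have "(q has_field_derivative deriv \<beta> b) (at b)"
    using DERIV_divide[OF d\<beta> d\<alpha>] ini by (simp add: q_def[abs_def])
  then have "deriv \<beta> b \<noteq> 0" using dq DERIV_imp_deriv by metis
  \<comment> \<open>\<open>l\<close> vanishes on \<open>w\<close> and on \<open>n\<close>, so it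
    only sees the component along \<open>c\<close>.\<close>
  moreover have "cdot l (\<delta> t) = \<beta> t * cdot l c" for t
    by (subst exp) (use l n in \<open>simp add: w_def\<close>)
  moreover have "deriv (\<lambda>t. \<beta> t * cdot l c) b = deriv \<beta> b * cdot l c"
    by (rule DERIV_imp_deriv) (auto intro!: derivative_eq_intros d\<beta>)
  ultimately show ?thesis using lc by simp
qed

section \<open>The residue relation\<close>

text \<open>Holomorphy of \<open>f\<close> without charts: the image of every holomorphic germ in
  the cone over the curve again has holomorphic homogeneous coordinates. In this form it can be used
  directly in the trace computations.\<close>

definition hol_lift :: "(complex^3 \<Rightarrow> complex) \<Rightarrow> (proj2 \<Rightarrow> proj2) \<Rightarrow> bool" where
  "hol_lift F f \<longleftrightarrow> (\<forall>\<gamma> b r. r > 0 \<longrightarrow> hol_vec \<gamma> (ball b r) \<longrightarrow> (\<forall>t \<in> ball b r. \<gamma> t \<noteq> 0 \<and> F (\<gamma> t) = 0) \<longrightarrow>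
     (\<exists>s \<delta>. 0 < s \<and> s \<le> r \<and> hol_vec \<delta> (ball b s) \<and>
        (\<forall>t \<in> ball b s. \<delta> t \<noteq> 0 \<and> f (abs_proj2 (\<gamma> t)) = abs_proj2 (\<delta> t))))"

text \<open>Source and target are separate curves of the same degree, because an anticonformal
  automorphism becomes a holomorphic bijection onto the conjugate curve.\<close>

locale curve_iso =
  fixes F F' :: "complex^3 \<Rightarrow> complex" and d :: nat and f :: "proj2 \<Rightarrow> proj2"
  assumes FF: "homog d F" "nonsingular_form F" and F': "homog d F'" "nonsingular_form F'"
    and d4: "d \<ge> 4" and bij: "bij_betw f (plane_curve F) (plane_curve F')"
    and cont: "continuous_on (plane_curve F) f" and lift: "hol_lift F f"
begin

text \<open>The function \<open>l / l0\<close> of the target, pulled back by \<open>f\<close>. At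
  its poles the division yields the value 0; only limits at such points enter the residues.\<close>

definition ratio :: "complex^3 \<Rightarrow> complex^3 \<Rightarrow> proj2 \<Rightarrow> complex" where
  "ratio l l0 p = cdot l (rep_proj2 (f p)) / cdot l0 (rep_proj2 (f p))"

lemma ratio_lift:
  assumes "f p = abs_proj2 w" "w \<noteq> 0"
  shows "ratio l l0 p = cdot l w / cdot l0 w"
proof -
  obtain c where "c \<noteq> 0" "rep_proj2 (abs_proj2 w) = c *s w" using rep_abs_proj2[OF assms(2)] .
  then show ?thesis by (simp add: ratio_def assms(1))
qed

lemma f_in: "p \<in> plane_curve F \<Longrightarrow> f p \<in> plane_curve F'"
  using bij by (auto simp: bij_betw_def)

lemma f_inj: "p \<in> plane_curve F \<Longrightarrow> q \<in> plane_curve F \<Longrightarrow> f p = f q \<Longrightarrow> p = q"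
  using bij by (auto simp: bij_betw_def inj_on_def)

lemma obtain_lift:
  assumes "r > 0" "hol_vec \<gamma> (ball b r)" "\<And>t. t \<in> ball b r \<Longrightarrow> \<gamma> t \<noteq> 0 \<and> F (\<gamma> t) = 0"
  obtains s \<delta> where "0 < s" "s \<le> r" "hol_vec \<delta> (ball b s)"
    "\<And>t. t \<in> ball b s \<Longrightarrow> \<delta> t \<noteq> 0 \<and> F' (\<delta> t) = 0 \<and> f (abs_proj2 (\<gamma> t)) = abs_proj2 (\<delta> t)"
proof -
  obtain s \<delta> where s: "0 < s" "s \<le> r" "hol_vec \<delta> (ball b s)"
    and \<delta>: "\<forall>t \<in> ball b s. \<delta> t \<noteq> 0 \<and> f (abs_proj2 (\<gamma> t)) = abs_proj2 (\<delta> t)"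
    using lift assms unfolding hol_lift_def by blast
  have "F' (\<delta> t) = 0" if t: "t \<in> ball b s" for t
  proof -
    have "t \<in> ball b r" using t s(2) by auto
    then have "abs_proj2 (\<gamma> t) \<in> plane_curve F" using assms(3) abs_in_plane_curve[OF FF(1)] by blast
    then have "abs_proj2 (\<delta> t) \<in> plane_curve F'" using f_in \<delta> t by metis
    then show ?thesis using abs_in_plane_curve[OF F'(1)] \<delta> t by blast
  qed
  with that s \<delta> show ?thesis by blast
qed

text \<open>The lift \<open>\<delta>\<close> inherits from \<open>\<gamma>\<close> and from the
  injectivity of \<open>f\<close> that different parameters give different points, which is what
  \<open>simple_zero\<close> needs on the target.\<close>

lemma simple_zero_image:
  assumes \<gamma>: "\<And>t. t \<in> ball b r \<Longrightarrow> \<gamma> t \<noteq> 0 \<and> F (\<gamma> t) = 0"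
    and inj: "\<And>t t' c. t \<in> ball b r \<Longrightarrow> t' \<in> ball b r \<Longrightarrow> \<gamma> t = c *s \<gamma> t' \<Longrightarrow> t = t'"
    and \<delta>: "0 < s" "s \<le> r" "hol_vec \<delta> (ball b s)"
    "\<And>t. t \<in> ball b s \<Longrightarrow> \<delta> t \<noteq> 0 \<and> F' (\<delta> t) = 0 \<and> f (abs_proj2 (\<gamma> t)) = abs_proj2 (\<delta> t)"
    and l: "transversal F' d l" "cdot l (\<delta> b) = 0"
  shows "deriv (\<lambda>t. cdot l (\<delta> t)) b \<noteq> 0"
proof -
  have bs: "b \<in> ball b s" using \<delta>(1) by simp
  obtain n where n: "cdot l n = 0" "grad F' (\<delta> b) n \<noteq> 0"
    using transversal_direction[OF F' _ l] \<delta>(4)[OF bs] d4 by auto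
  show ?thesis
  proof (rule simple_zero[OF F'(1) \<delta>(3,1) _ _ _ l(2) n])
    show "l \<noteq> 0" using l(1) by (simp add: transversal_def)
    show "\<delta> t \<noteq> 0 \<and> F' (\<delta> t) = 0" if "t \<in> ball b s" for t using \<delta>(4)[OF that] by blast
    fix t t' c assume t: "t \<in> ball b s" "t' \<in> ball b s" and c: "c \<noteq> 0" "\<delta> t = c *s \<delta> t'"
    have tr: "t \<in> ball b r" "t' \<in> ball b r" using t \<delta>(2) by auto
    have "abs_proj2 (\<delta> t) = abs_proj2 (\<delta> t')"
      using c abs_proj2_smult \<delta>(4)[OF t(2)] by metis
    then have "f (abs_proj2 (\<gamma> t)) = f (abs_proj2 (\<gamma> t'))" using \<delta>(4) t by metis
    then have "abs_proj2 (\<gamma> t) = abs_proj2 (\<gamma> t')"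
      by (rule f_inj[rotated 2]) (use \<gamma> tr abs_in_plane_curve[OF FF(1)] in blast)+
    then show "t = t'" using abs_proj2_eq_iff \<gamma> tr inj by metis
  qed
qed

text \<open>The inequality \<open>\<bar>l\<bar> < M * \<bar>l0\<bar>\<close> is invariant under
  scaling and so defines an open set of the plane. It contains the image of the given point, thanks
  to the summand 1 in \<open>M\<close>, and \<open>f\<close> is continuous.\<close>

lemma ratio_bounded:
  assumes v0: "v0 \<noteq> 0" "F v0 = 0" and nl: "\<not> on_line l0 (f (abs_proj2 v0))"
  shows "\<exists>M. \<forall>\<^sub>F v in nhds v0. F v = 0 \<longrightarrow> cmod (ratio l l0 (abs_proj2 v)) \<le> M"
proof -
  let ?w = "rep_proj2 (f (abs_proj2 v0))"
  have w: "cdot l0 ?w \<noteq> 0" using nl by (simp add: on_line_def)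
  define M where "M = cmod (cdot l ?w) / cmod (cdot l0 ?w) + 1"
  define O' where "O' = {p. cmod (cdot l (rep_proj2 p)) < M * cmod (cdot l0 (rep_proj2 p))}"
  have "open O'" unfolding O'_def
  proof (rule open_proj2I)
    have c: "continuous_on UNIV (\<lambda>v. cmod (cdot m v))" for m
      using homog_continuous[OF homog_cdot] by (intro continuous_intros) auto
    have "open ({v. cmod (cdot l v) < M * cmod (cdot l0 v)} \<inter> - {0})"
      by (intro open_Int open_Collect_less c continuous_intros)
    moreover have "{v. v \<noteq> 0 \<and> cmod (cdot l v) < M * cmod (cdot l0 v)} =
        {v. cmod (cdot l v) < M * cmod (cdot l0 v)} \<inter> - {0}" by auto
    ultimately show "open {v. v \<noteq> 0 \<and> cmod (cdot l v) < M * cmod (cdot l0 v)}" by simp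
  qed (simp add: norm_mult)
  moreover have "f (abs_proj2 v0) \<in> O'" using w by (simp add: O'_def M_def field_simps)
  ultimately obtain W where W: "open W" "abs_proj2 v0 \<in> W"
      "\<And>p. p \<in> plane_curve F \<Longrightarrow> p \<in> W \<Longrightarrow> f p \<in> O'"
    using cont v0 abs_in_plane_curve[OF FF(1)] unfolding continuous_on_topological by metis
  have "\<forall>\<^sub>F v in nhds v0. F v = 0 \<longrightarrow> cmod (ratio l l0 (abs_proj2 v)) \<le> M"
    using eventually_abs_proj2[OF W(1,2) v0(1)]
  proof eventually_elim
    case (elim v)
    show ?case
    proof
      assume "F v = 0"
      then have "f (abs_proj2 v) \<in> O'" using W(3) elim abs_in_plane_curve[OF FF(1)] by blast
      then have lt: "cmod (cdot l (rep_proj2 (f (abs_proj2 v)))) < M * cmod (cdot l0 (rep_proj2 (f (abs_proj2 v))))"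
        by (simp add: O'_def)
      then have "cmod (cdot l0 (rep_proj2 (f (abs_proj2 v)))) \<noteq> 0" by (metis mult_zero_right norm_not_less_zero)
      then show "cmod (ratio l l0 (abs_proj2 v)) \<le> M"
        using lt by (simp add: ratio_def norm_divide divide_le_eq)
    qed
  qed
  then show ?thesis by blast
qed

lemma finite_preimage_line:
  assumes "l \<noteq> 0"
  shows "finite {p \<in> plane_curve F. on_line l (f p)}"
    "card {p \<in> plane_curve F. on_line l (f p)} = card {p \<in> plane_curve F'. on_line l p}"
proof -
  have "bij_betw f {p \<in> plane_curve F. on_line l (f p)} {p \<in> plane_curve F'. on_line l p}"
    using bij unfolding bij_betw_def by (auto intro: inj_on_subset)
  moreover have "finite {p \<in> plane_curve F'. on_line l p}"
    using card_line(1)[OF F' _ assms] d4 by simp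
  ultimately show "finite {p \<in> plane_curve F. on_line l (f p)}"
    "card {p \<in> plane_curve F. on_line l (f p)} = card {p \<in> plane_curve F'. on_line l p}"
    using bij_betw_finite bij_betw_same_card by blast+
qed

end

section \<open>Poles and residues of the pulled-back differential\<close>

locale curve_pencil = curve_iso F F' d f + pencil F d e0 e1 e2 for F F' d f e0 e1 e2
begin

lemma hol_vec_pt: "g holomorphic_on T \<Longrightarrow> hol_vec (\<lambda>x. pt x (g x)) T"
  unfolding pt_def by (intro hol_vec_add hol_vec_const hol_vec_smult holomorphic_on_ident)

definition integrand :: "complex^3 \<Rightarrow> complex^3 \<Rightarrow> (complex^3 \<Rightarrow> complex) \<Rightarrow> complex^3 \<Rightarrow> complex" where
  "integrand l l0 P v = ratio l l0 (abs_proj2 v) * P v / grad F v e2"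

text \<open>Along a branch the denominator has at most a simple zero, because \<open>l0\<close> is
  transversal. At such a zero the limit is \<open>N b / deriv D b / g b\<close>, which is nonzero
  exactly if the numerator is; elsewhere the limit is zero.\<close>

lemma local_limit:
  assumes l0: "transversal F' d l0" and G: "branches b r G" and c: "c \<in> rts b"
  shows "\<exists>k. ((\<lambda>x. (x - b) * integrand l l0 (\<lambda>v. 1) (pt x (G c x))) \<longlongrightarrow> k) (at b) \<and>
    (k \<noteq> 0 \<longleftrightarrow> on_line l0 (f (abs_proj2 (pt b c))) \<and> \<not> on_line l (f (abs_proj2 (pt b c))))"
proof -
  note br = branchesD[OF G]
  define \<gamma> where "\<gamma> x = pt x (G c x)" for x
  have \<gamma>b: "\<gamma> b = pt b c" using br(3)[OF c] by (simp add: \<gamma>_def)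
  have \<gamma>z: "\<gamma> x \<noteq> 0 \<and> F (\<gamma> x) = 0" if "x \<in> ball b r" for x
    using br(5)[OF that] c pt_nonzero by (auto simp: \<gamma>_def rts_def)
  have h\<gamma>: "hol_vec \<gamma> (ball b r)" unfolding \<gamma>_def using br(2)[OF c] by (rule hol_vec_pt)
  obtain s \<delta> where s: "0 < s" "s \<le> r" and h\<delta>: "hol_vec \<delta> (ball b s)"
    and \<delta>: "\<And>t. t \<in> ball b s \<Longrightarrow> \<delta> t \<noteq> 0 \<and> F' (\<delta> t) = 0 \<and> f (abs_proj2 (\<gamma> t)) = abs_proj2 (\<delta> t)"
    using obtain_lift[OF br(1) h\<gamma> \<gamma>z] by blast
  have bs: "b \<in> ball b s" using s(1) by simp
  define N D g where "N x = cdot l (\<delta> x)" and "D x = cdot l0 (\<delta> x)" and "g x = grad F (\<gamma> x) e2" for x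
  have hN: "N holomorphic_on ball b s" and hD: "D holomorphic_on ball b s"
    unfolding N_def D_def by (intro hol_vec_cdot h\<delta>)+
  have "continuous_on (ball b r) g" unfolding g_def
    by (rule continuous_on_compose2[OF homog_grad_continuous[OF F, of UNIV] hol_vec_continuous[OF h\<gamma>]]) auto
  then have gl: "(g \<longlongrightarrow> g b) (at b)" using br(1) by (simp add: continuous_on_eq_continuous_at isCont_def)
  have Nl: "(N \<longlongrightarrow> N b) (at b)" and Dl: "(D \<longlongrightarrow> D b) (at b)"
    using holomorphic_on_imp_continuous_on[OF hN] holomorphic_on_imp_continuous_on[OF hD] bs
    by (auto simp: continuous_on_eq_continuous_at isCont_def)
  have g0: "g b \<noteq> 0" using br(6)[of b] br(1) c by (auto simp: g_def \<gamma>b unram_def)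
  have i: "integrand l l0 (\<lambda>v. 1) (pt x (G c x)) = N x / D x / g x" if "x \<in> ball b s" for x
    using ratio_lift[of "abs_proj2 (\<gamma> x)" "\<delta> x" l l0] \<delta>[OF that]
    by (simp add: integrand_def \<gamma>_def N_def D_def g_def)
  have fb: "f (abs_proj2 (pt b c)) = abs_proj2 (\<delta> b)" "\<delta> b \<noteq> 0" using \<delta>[OF bs] \<gamma>b by auto
  have on: "on_line m (f (abs_proj2 (pt b c))) \<longleftrightarrow> cdot m (\<delta> b) = 0" for m
    using on_line_abs[OF fb(2)] fb(1) by simp
  have ev: "\<forall>\<^sub>F x in at b. x \<in> ball b s \<and> x \<noteq> b"
    using s(1) by (auto simp: eventually_at dist_commute intro!: exI[of _ s])
  show ?thesis
  proof (cases "D b = 0")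
    case False
    have "((\<lambda>x. (x - b) * (N x / D x / g x)) \<longlongrightarrow> (b - b) * (N b / D b / g b)) (at b)"
      by (intro tendsto_intros Nl Dl gl False g0)
    then have "((\<lambda>x. (x - b) * (N x / D x / g x)) \<longlongrightarrow> 0) (at b)" by simp
    then have "((\<lambda>x. (x - b) * integrand l l0 (\<lambda>v. 1) (pt x (G c x))) \<longlongrightarrow> 0) (at b)"
      by (rule Lim_transform_eventually) (use ev i in \<open>auto elim: eventually_mono\<close>)
    then show ?thesis using False on by (intro exI[of _ 0]) (auto simp: D_def)
  next
    case True
    have dz: "deriv D b \<noteq> 0" unfolding D_def
    proof (rule simple_zero_image[OF \<gamma>z _ s h\<delta> \<delta> l0])
      show "cdot l0 (\<delta> b) = 0" using True by (simp add: D_def)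
      show "t = t'" if "\<gamma> t = c' *s \<gamma> t'" for t t' c'
        using pt_proportional(1) that unfolding \<gamma>_def by blast
    qed
    have "(D has_field_derivative deriv D b) (at b)" using holomorphic_derivI[OF hD open_ball bs] .
    then have dl: "((\<lambda>x. (D x - D b) / (x - b)) \<longlongrightarrow> deriv D b) (at b)"
      by (simp add: has_field_derivative_iff)
    have "((\<lambda>x. N x / ((D x - D b) / (x - b)) / g x) \<longlongrightarrow> N b / deriv D b / g b) (at b)"
      by (intro tendsto_intros Nl dl gl dz g0)
    then have "((\<lambda>x. (x - b) * integrand l l0 (\<lambda>v. 1) (pt x (G c x))) \<longlongrightarrow> N b / deriv D b / g b) (at b)"
      by (rule Lim_transform_eventually) (use ev i True in \<open>auto elim!: eventually_mono simp: mult.commute\<close>)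
    then show ?thesis using True on dz g0 by (intro exI[of _ "N b / deriv D b / g b"]) (auto simp: D_def N_def)
  qed
qed

lemma integrand_holomorphic:
  assumes P: "homog k P" and r: "r > 0" and g: "g holomorphic_on ball b r"
    and gr: "\<And>x. x \<in> ball b r \<Longrightarrow> g x \<in> rts x \<and> unram x"
    and nl: "\<not> on_line l0 (f (abs_proj2 (pt b (g b))))"
  shows "\<exists>s>0. (\<lambda>x. integrand l l0 P (pt x (g x))) holomorphic_on ball b s"
proof -
  define \<gamma> where "\<gamma> x = pt x (g x)" for x
  have \<gamma>z: "\<gamma> x \<noteq> 0 \<and> F (\<gamma> x) = 0" if "x \<in> ball b r" for x
    using gr[OF that] pt_nonzero by (auto simp: \<gamma>_def rts_def)
  have h\<gamma>: "hol_vec \<gamma> (ball b r)" unfolding \<gamma>_def using g by (rule hol_vec_pt)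
  obtain s \<delta> where s: "0 < s" "s \<le> r" and h\<delta>: "hol_vec \<delta> (ball b s)"
    and \<delta>: "\<And>t. t \<in> ball b s \<Longrightarrow> \<delta> t \<noteq> 0 \<and> F' (\<delta> t) = 0 \<and> f (abs_proj2 (\<gamma> t)) = abs_proj2 (\<delta> t)"
    using obtain_lift[OF r h\<gamma> \<gamma>z] by blast
  have bs: "b \<in> ball b s" using s(1) by simp
  have hD: "(\<lambda>x. cdot l0 (\<delta> x)) holomorphic_on ball b s" by (intro hol_vec_cdot h\<delta>)
  have "cdot l0 (\<delta> b) \<noteq> 0"
    using nl \<delta>[OF bs] on_line_abs by (metis \<gamma>_def)
  moreover have "isCont (\<lambda>x. cdot l0 (\<delta> x)) b"
    using holomorphic_on_imp_continuous_on[OF hD] bs by (simp add: continuous_on_eq_continuous_at)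
  ultimately have "\<forall>\<^sub>F x in nhds b. cdot l0 (\<delta> x) \<noteq> 0"
    by (simp add: isCont_def tendsto_imp_eventually_ne eventually_nhds_conv_at)
  then obtain s' where s': "s' > 0" "\<And>x. x \<in> ball b s' \<Longrightarrow> cdot l0 (\<delta> x) \<noteq> 0"
    by (auto simp: eventually_nhds_metric dist_commute)
  have sub: "ball b (min s s') \<subseteq> ball b s" "ball b (min s s') \<subseteq> ball b r"
    "ball b (min s s') \<subseteq> ball b s'" using s by auto
  obtain k' where k': "d = Suc k'" using d2 by (cases d) auto
  have "(\<lambda>x. cdot l (\<delta> x) / cdot l0 (\<delta> x) * P (\<gamma> x) / grad F (\<gamma> x) e2) holomorphic_on ball b (min s s')"
  proof (intro holomorphic_intros)
    show "(\<lambda>x. cdot l (\<delta> x)) holomorphic_on ball b (min s s')"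
      "(\<lambda>x. cdot l0 (\<delta> x)) holomorphic_on ball b (min s s')"
      by (rule hol_vec_cdot[OF hol_vec_subset[OF h\<delta> sub(1)]])+
    show "(\<lambda>x. P (\<gamma> x)) holomorphic_on ball b (min s s')"
      by (rule hol_vec_homog[OF P hol_vec_subset[OF h\<gamma> sub(2)]])
    show "(\<lambda>x. grad F (\<gamma> x) e2) holomorphic_on ball b (min s s')"
      by (rule hol_vec_homog[OF homog_grad hol_vec_subset[OF h\<gamma> sub(2)]]) (use F k' in auto)
    show "grad F (\<gamma> x) e2 \<noteq> 0" if "x \<in> ball b (min s s')" for x
      using gr[of x] that sub(2) by (auto simp: unram_def \<gamma>_def)
    show "cdot l0 (\<delta> x) \<noteq> 0" if "x \<in> ball b (min s s')" for x
      using s'(2) that sub(3) by blast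
  qed
  then have "(\<lambda>x. integrand l l0 P (pt x (g x))) holomorphic_on ball b (min s s')"
  proof (rule holomorphic_transform)
    fix x assume "x \<in> ball b (min s s')"
    then have "x \<in> ball b s" using sub(1) by blast
    then show "cdot l (\<delta> x) / cdot l0 (\<delta> x) * P (\<gamma> x) / grad F (\<gamma> x) e2 = integrand l l0 P (pt x (g x))"
      using ratio_lift[of "abs_proj2 (\<gamma> x)" "\<delta> x" l l0] \<delta> by (simp add: integrand_def \<gamma>_def)
  qed
  then show ?thesis using s s' by (intro exI[of _ "min s s'"]) auto
qed

text \<open>After multiplication by \<open>F\<^sub>y\<close> only \<open>ratio * P\<close> remains,
  which is bounded even where the fibre is ramified. Where \<open>F\<^sub>y\<close> vanishes the
  product is zero by the convention for division.\<close>

lemma integrand_bounded: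
  assumes P: "homog k P" and c: "c \<in> rts b" and nl: "\<not> on_line l0 (f (abs_proj2 (pt b c)))"
  shows "\<exists>M. \<forall>\<^sub>F z in nhds (b, c). F (pt (fst z) (snd z)) = 0 \<longrightarrow>
     cmod (integrand l l0 P (pt (fst z) (snd z)) * grad F (pt (fst z) (snd z)) e2) \<le> M"
proof -
  have "F (pt b c) = 0" using c by (simp add: rts_def)
  then obtain M where M: "\<forall>\<^sub>F v in nhds (pt b c). F v = 0 \<longrightarrow> cmod (ratio l l0 (abs_proj2 v)) \<le> M"
    using ratio_bounded[OF pt_nonzero _ nl] by blast
  have ptl: "filterlim (\<lambda>z. pt (fst z) (snd z)) (nhds (pt b c)) (nhds (b, c))"
  proof -
    have "continuous_on UNIV (\<lambda>z. pt (fst z) (snd z))" by (intro continuous_intros)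
    then have "isCont (\<lambda>z. pt (fst z) (snd z)) (b, c)"
      by (simp add: continuous_on_eq_continuous_at del: split_paired_All)
    then have "((\<lambda>z. pt (fst z) (snd z)) \<longlongrightarrow> pt (fst (b, c)) (snd (b, c))) (nhds (b, c))"
      by (simp only: isCont_def tendsto_nhds_iff)
    then show ?thesis by simp
  qed
  have "isCont P (pt b c)" using homog_isCont[OF P] .
  then have "(P \<longlongrightarrow> P (pt b c)) (nhds (pt b c))" by (simp add: isCont_def tendsto_nhds_iff)
  then have "((\<lambda>v. cmod (P v)) \<longlongrightarrow> cmod (P (pt b c))) (nhds (pt b c))" by (rule tendsto_norm)
  then have "\<forall>\<^sub>F v in nhds (pt b c). cmod (P v) < cmod (P (pt b c)) + 1"
    by (rule order_tendstoD) simp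
  with M have "\<forall>\<^sub>F v in nhds (pt b c). F v = 0 \<longrightarrow>
      cmod (integrand l l0 P v * grad F v e2) \<le> \<bar>M\<bar> * (cmod (P (pt b c)) + 1)"
  proof eventually_elim
    case (elim v)
    show ?case
    proof
      assume "F v = 0"
      then have "cmod (ratio l l0 (abs_proj2 v)) \<le> \<bar>M\<bar>" using elim(1) by linarith
      then have "cmod (ratio l l0 (abs_proj2 v) * P v) \<le> \<bar>M\<bar> * (cmod (P (pt b c)) + 1)"
        unfolding norm_mult using elim(2) by (intro mult_mono) auto
      moreover have "0 \<le> \<bar>M\<bar> * (cmod (P (pt b c)) + 1)" by (intro mult_nonneg_nonneg) auto
      ultimately show "cmod (integrand l l0 P v * grad F v e2) \<le> \<bar>M\<bar> * (cmod (P (pt b c)) + 1)"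
        by (cases "grad F v e2 = 0") (auto simp: integrand_def)
    qed
  qed
  from eventually_compose_filterlim[OF this ptl] show ?thesis by blast
qed

definition pole_set :: "complex^3 \<Rightarrow> (complex \<times> complex) set" where
  "pole_set l0 = {z. snd z \<in> rts (fst z) \<and> on_line l0 (f (abs_proj2 (pt (fst z) (snd z))))}"

lemma pole_set_bij:
  assumes "\<And>p. p \<in> plane_curve F \<Longrightarrow> on_line l0 (f p) \<Longrightarrow> \<exists>x y. p = abs_proj2 (pt x y) \<and> unram x"
  shows "bij_betw (\<lambda>z. abs_proj2 (pt (fst z) (snd z))) (pole_set l0) {p \<in> plane_curve F. on_line l0 (f p)}"
  unfolding bij_betw_def
proof
  show "inj_on (\<lambda>z. abs_proj2 (pt (fst z) (snd z))) (pole_set l0)"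
    using abs_pt_inj by (auto simp: inj_on_def prod_eq_iff)
  show "(\<lambda>z. abs_proj2 (pt (fst z) (snd z))) ` pole_set l0 = {p \<in> plane_curve F. on_line l0 (f p)}"
  proof (intro equalityI subsetI)
    fix p assume p: "p \<in> {p \<in> plane_curve F. on_line l0 (f p)}"
    then obtain x y where xy: "p = abs_proj2 (pt x y)" using assms by blast
    then have "(x, y) \<in> pole_set l0" using p abs_pt_in_curve by (auto simp: pole_set_def)
    with xy show "p \<in> (\<lambda>z. abs_proj2 (pt (fst z) (snd z))) ` pole_set l0" by force
  qed (auto simp: pole_set_def abs_pt_in_curve)
qed

text \<open>The trace of \<open>ratio * P dx / F\<^sub>y\<close> is a rational differential on the projective line without poles
  except below the poles of the ratio; at infinity it is the same expression in the coordinates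
  with \<open>e0\<close> and \<open>e1\<close> exchanged, because the integrand is homogeneous of degree \<open>-2\<close>.\<close>

lemma residue_relation:
  assumes l0: "transversal F' d l0"
    and aff: "\<And>p. p \<in> plane_curve F \<Longrightarrow> on_line l0 (f p) \<Longrightarrow> \<exists>x y. p = abs_proj2 (pt x y) \<and> unram x"
  shows "\<exists>\<kappa>. (\<forall>z \<in> pole_set l0. \<kappa> z \<noteq> 0 \<longleftrightarrow> \<not> on_line l (f (abs_proj2 (pt (fst z) (snd z))))) \<and>
    (\<forall>P. homog (d - 3) P \<longrightarrow> (\<Sum>z \<in> pole_set l0. \<kappa> z * P (pt (fst z) (snd z))) = 0)"
proof -
  let ?I = "pole_set l0"
  have l00: "l0 \<noteq> 0" using l0 by (simp add: transversal_def)
  have finI: "finite ?I" using pole_set_bij[OF aff] finite_preimage_line(1)[OF l00] bij_betw_finite by blast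
  have unr: "unram (fst z)" if z: "z \<in> ?I" for z
  proof -
    have "abs_proj2 (pt (fst z) (snd z)) \<in> plane_curve F" using z abs_pt_in_curve by (auto simp: pole_set_def)
    moreover have "on_line l0 (f (abs_proj2 (pt (fst z) (snd z))))" using z by (simp add: pole_set_def)
    ultimately obtain x y where "abs_proj2 (pt (fst z) (snd z)) = abs_proj2 (pt x y)" "unram x"
      using aff by blast
    then show ?thesis using abs_pt_inj by metis
  qed
  obtain r G where G: "\<And>b. unram b \<Longrightarrow> branches b (r b) (G b)" using fiber_branches by metis
  \<comment> \<open>The limits are taken with \<open>P = 1\<close>, so that one choice of
    coefficients serves all forms \<open>P\<close>; on a branch, \<open>P\<close> contributes only
    the factor \<open>P (pt b c)\<close>.\<close>
  define Q where "Q z k \<longleftrightarrow>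
      ((\<lambda>x. (x - fst z) * integrand l l0 (\<lambda>v. 1) (pt x (G (fst z) (snd z) x))) \<longlongrightarrow> k) (at (fst z)) \<and>
      (k \<noteq> 0 \<longleftrightarrow> on_line l0 (f (abs_proj2 (pt (fst z) (snd z)))) \<and>
        \<not> on_line l (f (abs_proj2 (pt (fst z) (snd z)))))" for z k
  define \<kappa> where "\<kappa> z = (SOME k. Q z k)" for z
  have Q: "Q z (\<kappa> z)" if "unram (fst z)" "snd z \<in> rts (fst z)" for z
    unfolding \<kappa>_def by (rule someI_ex, unfold Q_def) (rule local_limit[OF l0 G[OF that(1)] that(2)])
  note \<kappa> = Q[unfolded Q_def]
  have "(\<Sum>z \<in> ?I. \<kappa> z * P (pt (fst z) (snd z))) = 0" if P: "homog (d - 3) P" for P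
  proof -
    define X where "X = fst ` ?I"
    define t where "t = trace (integrand l l0 P)"
    have finX: "finite X" using finI by (simp add: X_def)
    have nopole: "\<not> on_line l0 (f (abs_proj2 (pt b c)))" if "b \<notin> X" "c \<in> rts b" for b c
    proof
      assume "on_line l0 (f (abs_proj2 (pt b c)))"
      then have "(b, c) \<in> ?I" using that(2) by (simp add: pole_set_def)
      then have "fst (b, c) \<in> X" unfolding X_def by (rule imageI)
      then show False using that(1) by simp
    qed
    have hol: "\<forall>\<^sub>F x in at b. t field_differentiable at x" for b
    proof -
      have "\<forall>\<^sub>F x in at b. x \<notin> X"
        using islimpt_finite[OF finX, of b] by (simp add: islimpt_iff_eventually)
      with eventually_unram[of b] show ?thesis
      proof eventually_elim
        case (elim x)
        show ?case unfolding t_def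
        proof (rule trace_holomorphic[OF elim(1)])
          fix r g assume r: "0 < r" and g: "g holomorphic_on ball x r"
            and gr: "\<And>y. y \<in> ball x r \<Longrightarrow> g y \<in> rts y \<and> unram y"
          show "\<exists>s>0. (\<lambda>y. integrand l l0 P (pt y (g y))) holomorphic_on ball x s"
            by (rule integrand_holomorphic[OF P r g gr nopole[OF elim(2)]]) (use gr[of x] r in auto)
        qed
      qed
    qed
    have pole: "((\<lambda>x. (x - b) * t x) \<longlongrightarrow> (\<Sum>c \<in> rts b. \<kappa> (b, c) * P (pt b c))) (at b)" if b: "b \<in> X" for b
    proof -
      have ub: "unram b" using b unr by (auto simp: X_def)
      note br = branchesD[OF G[OF ub]]
      show ?thesis unfolding t_def
      proof (rule trace_residue[OF G[OF ub]])
        fix c assume c: "c \<in> rts b"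
        have "hol_vec (\<lambda>x. pt x (G b c x)) (ball b (r b))" using br(2)[OF c] by (rule hol_vec_pt)
        from hol_vec_homog[OF P this]
        have "isCont (\<lambda>x. P (pt x (G b c x))) b"
          using br(1) by (auto dest!: holomorphic_on_imp_continuous_on simp: continuous_on_eq_continuous_at)
        then have "((\<lambda>x. P (pt x (G b c x))) \<longlongrightarrow> P (pt b c)) (at b)"
          using br(3)[OF c] by (simp add: isCont_def)
        moreover have "((\<lambda>x. (x - b) * integrand l l0 (\<lambda>v. 1) (pt x (G b c x))) \<longlongrightarrow> \<kappa> (b, c)) (at b)"
          using \<kappa>[of "(b, c)"] ub c by simp
        ultimately have "((\<lambda>x. (x - b) * integrand l l0 (\<lambda>v. 1) (pt x (G b c x)) * P (pt x (G b c x)))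
            \<longlongrightarrow> \<kappa> (b, c) * P (pt b c)) (at b)" by (intro tendsto_mult)
        then show "((\<lambda>x. (x - b) * integrand l l0 P (pt x (G b c x))) \<longlongrightarrow> \<kappa> (b, c) * P (pt b c)) (at b)"
          by (simp add: integrand_def mult_ac)
      qed
    qed
    have reg: "((\<lambda>x. (x - b) * t x) \<longlongrightarrow> 0) (at b)" if b: "b \<notin> X" for b
      unfolding t_def
      by (rule trace_tendsto_0) (rule integrand_bounded[OF P _ nopole[OF b]])
    have inf: "((\<lambda>x. x * t x) \<longlongrightarrow> 0) at_infinity"
    proof -
      \<comment> \<open>The exchange of \<open>e0\<close> and \<open>e1\<close> keeps the centre and
        replaces \<open>x\<close> by its inverse. By \<open>aff\<close> all poles are at finite
        distance, so the fibre over 0 of this pencil carries none; it may be ramified, which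
        \<open>trace_tendsto_0\<close> admits.\<close>
      interpret inf: curve_pencil F F' d f e1 e0 e2
        by unfold_locales (use F nons d2 basis center cdet_swap[of e1 e0 e2] in auto)
      have "((\<lambda>s. (s - 0) * inf.trace (integrand l l0 P) s) \<longlongrightarrow> 0) (at 0)"
      proof (rule inf.trace_tendsto_0)
        fix c assume c: "c \<in> inf.rts 0"
        have e: "inf.pt 0 c = e1 + c *s e2" by (simp add: inf.pt_def)
        have "abs_proj2 (inf.pt 0 c) \<noteq> abs_proj2 (pt x y)" for x y
        proof
          assume "abs_proj2 (inf.pt 0 c) = abs_proj2 (pt x y)"
          then obtain k where k: "k \<noteq> 0" "inf.pt 0 c = k *s pt x y"
            using abs_proj2_eq_iff[OF pt_nonzero inf.pt_nonzero] by metis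
          then have "k *s e0 + (k * x - 1) *s e1 + (k * y - c) *s e2 = 0"
            by (simp add: e pt_def vec_eq_iff algebra_simps)
          then show False using basis_coords_zero(1)[OF basis] k(1) by blast
        qed
        then have "\<not> on_line l0 (f (abs_proj2 (inf.pt 0 c)))"
          using aff c inf.abs_pt_in_curve by metis
        from inf.integrand_bounded[OF P c this]
        show "\<exists>M. \<forall>\<^sub>F z in nhds (0, c). F (inf.pt (fst z) (snd z)) = 0 \<longrightarrow>
            cmod (integrand l l0 P (inf.pt (fst z) (snd z)) * grad F (inf.pt (fst z) (snd z)) e2) \<le> M"
          by (simp only: inf.integrand_def integrand_def)
      qed
      moreover have "\<forall>\<^sub>F s in at 0. (s - 0) * inf.trace (integrand l l0 P) s = inverse s * t (inverse s)"
      proof -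
        have "s * inf.trace (integrand l l0 P) s = inverse s * t (inverse s)" if s: "s \<noteq> 0" for s
        proof -
          have p: "pt (inverse s) y = inverse s *s inf.pt s (y * s)" for y
            using s by (simp add: pt_def inf.pt_def vec_eq_iff field_simps)
          have b: "bij_betw (\<lambda>y. y * s) (rts (inverse s)) (inf.rts s)"
          proof (rule bij_betwI[where g = "\<lambda>y. y / s"])
            show "(\<lambda>y. y * s) \<in> rts (inverse s) \<rightarrow> inf.rts s"
              using s by (auto simp: rts_def inf.rts_def p homog_smult[OF F])
            show "(\<lambda>y. y / s) \<in> inf.rts s \<rightarrow> rts (inverse s)"
              using s by (auto simp: rts_def inf.rts_def p homog_smult[OF F])
          qed (use s in auto)
          define k where "k = d - 3"
          have k: "d = k + 3" using d4 by (simp add: k_def)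
          have gh: "homog (k + 2) (\<lambda>v. grad F v e2)"
            by (rule homog_grad, rule back_subst[of "\<lambda>n. homog n F", OF F]) (simp add: k)
          \<comment> \<open>The ratio has degree 0, \<open>P\<close> has degree \<open>k\<close> and
            the derivative of \<open>F\<close> has degree \<open>k + 2\<close>, so scaling by
            \<open>inverse s\<close> produces the factor \<open>s\<^sup>2\<close>.\<close>
          have w: "integrand l l0 P (pt (inverse s) y) = s\<^sup>2 * integrand l l0 P (inf.pt s (y * s))" for y
          proof -
            have a: "abs_proj2 (pt (inverse s) y) = abs_proj2 (inf.pt s (y * s))"
              unfolding p using s by (intro abs_proj2_smult inf.pt_nonzero) simp
            show ?thesis unfolding integrand_def a unfolding p
              using s k P by (simp add: homog_smult[OF gh] homog_smult[of k P] power_add field_simps power2_eq_square)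
          qed
          have "t (inverse s) = (\<Sum>y \<in> rts (inverse s). s\<^sup>2 * integrand l l0 P (inf.pt s (y * s)))"
            by (simp add: t_def trace_def w)
          also have "\<dots> = (\<Sum>y \<in> inf.rts s. s\<^sup>2 * integrand l l0 P (inf.pt s y))"
            by (rule sum.reindex_bij_betw[OF b])
          finally show ?thesis using s
            by (simp add: inf.trace_def power2_eq_square flip: sum_distrib_left)
        qed
        then show ?thesis unfolding eventually_at_filter by (auto intro: always_eventually)
      qed
      ultimately have "((\<lambda>s. inverse s * t (inverse s)) \<longlongrightarrow> 0) (at 0)" by (rule Lim_transform_eventually)
      then show ?thesis by (simp add: lim_at_infinity_0 o_def)
    qed
    have "(\<Sum>b\<in>X. \<Sum>c \<in> rts b. \<kappa> (b, c) * P (pt b c)) = 0"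
      by (rule residue_sum_zero[OF hol finX pole reg inf])
    also have "(\<Sum>b\<in>X. \<Sum>c \<in> rts b. \<kappa> (b, c) * P (pt b c))
        = (\<Sum>z \<in> Sigma X rts. \<kappa> z * P (pt (fst z) (snd z)))"
      using finX finite_rts by (subst sum.Sigma) (auto simp: case_prod_unfold)
    \<comment> \<open>The other points in the fibres below the poles have coefficient zero, since
      \<open>l0\<close> does not vanish at their images.\<close>
    also have "\<dots> = (\<Sum>z \<in> ?I. \<kappa> z * P (pt (fst z) (snd z)))"
    proof (rule sum.mono_neutral_right)
      show "finite (Sigma X rts)" using finX finite_rts by auto
      show "?I \<subseteq> Sigma X rts"
      proof
        fix z assume "z \<in> ?I"
        then have "fst z \<in> X" "snd z \<in> rts (fst z)" by (auto simp: X_def pole_set_def)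
        then show "z \<in> Sigma X rts" by (cases z) simp
      qed
      show "\<forall>z \<in> Sigma X rts - ?I. \<kappa> z * P (pt (fst z) (snd z)) = 0"
      proof
        fix z assume z: "z \<in> Sigma X rts - ?I"
        then have "unram (fst z)" "snd z \<in> rts (fst z)" using unr by (auto simp: X_def)
        with \<kappa>[OF this] z have "\<kappa> z = 0" by (auto simp: pole_set_def)
        then show "\<kappa> z * P (pt (fst z) (snd z)) = 0" by simp
      qed
    qed
    finally show ?thesis .
  qed
  moreover have "\<forall>z \<in> ?I. \<kappa> z \<noteq> 0 \<longleftrightarrow> \<not> on_line l (f (abs_proj2 (pt (fst z) (snd z))))"
    using \<kappa> unr by (auto simp: pole_set_def)
  ultimately show ?thesis by blast
qed

end

text \<open>Fewer than \<open>d\<close> points impose independent conditions on forms of degree \<open>d - 3\<close> unless they are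
  collinear: a form that vanishes at all points but one is a product of lines, one of which can
  absorb two points.\<close>

lemma collinear_of_relations:
  assumes I: "finite I" "card I = d" and d: "d \<ge> 4"
    and v: "\<And>i. i \<in> I \<Longrightarrow> v i \<noteq> 0" "\<And>i j c. i \<in> I \<Longrightarrow> j \<in> I \<Longrightarrow> v i = c *s v j \<Longrightarrow> i = j"
    and rel: "\<And>i. i \<in> I \<Longrightarrow> \<exists>\<kappa>. \<kappa> i = 0 \<and> (\<forall>j \<in> I - {i}. \<kappa> j \<noteq> 0) \<and>
       (\<forall>P. homog (d - 3) P \<longrightarrow> (\<Sum>j\<in>I. \<kappa> j * P (v j)) = 0)"
    and abc: "a \<in> I" "b \<in> I" "c \<in> I" "a \<noteq> b" "a \<noteq> c" "b \<noteq> c"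
  shows "cdet (v a) (v b) (v c) = 0"
proof (rule ccontr)
  assume ne: "cdet (v a) (v b) (v c) \<noteq> 0"
  have "card {a, b, c} = 3" using abc by simp
  then have "\<not> I \<subseteq> {a, b, c}" using I d card_mono[of "{a, b, c}" I] by auto
  \<comment> \<open>Here \<open>d \<ge> 4\<close> is used: the relation that omits the fourth point
    \<open>i\<close> makes it unnecessary to spend a linear factor on \<open>i\<close>.\<close>
  then obtain i where i: "i \<in> I" "i \<noteq> a" "i \<noteq> b" "i \<noteq> c" by blast
  define J where "J = I - {i, a, b, c}"
  have cJ: "card J = d - 4" using I abc i by (simp add: J_def card_Diff_subset)
  obtain \<kappa> where \<kappa>: "\<kappa> i = 0" "\<And>j. j \<in> I - {i} \<Longrightarrow> \<kappa> j \<noteq> 0"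
    "\<And>P. homog (d - 3) P \<Longrightarrow> (\<Sum>j\<in>I. \<kappa> j * P (v j)) = 0" using rel[OF i(1)] by blast
  \<comment> \<open>A line through \<open>v j\<close> that misses \<open>v a\<close>; the two are
    different points, so they extend to a basis.\<close>
  have "\<exists>m. cdot m (v j) = 0 \<and> cdot m (v a) \<noteq> 0" if j: "j \<in> J" for j
  proof -
    have "\<nexists>k. v a = k *s v j" using v(2)[of a j] j abc by (auto simp: J_def)
    then obtain e where "cdet (v j) (v a) e \<noteq> 0" using not_multiple_basis v(1) j by (metis DiffD1 J_def)
    then have "cdot (ccross (v j) e) (v a) \<noteq> 0" by (simp add: cdot_ccross cdet_swap'[of _ e])
    moreover have "cdot (ccross (v j) e) (v j) = 0" by (simp add: cdot_ccross)
    ultimately show ?thesis by blast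
  qed
  then obtain m where m: "\<And>j. j \<in> J \<Longrightarrow> cdot (m j) (v j) = 0 \<and> cdot (m j) (v a) \<noteq> 0" by metis
  \<comment> \<open>One factor vanishes at \<open>b\<close> and \<open>c\<close> together, and one
    each at the \<open>d - 4\<close> remaining points: the degree is
    \<open>1 + (d - 4) = d - 3\<close>. Only the term of \<open>a\<close> survives in the
    relation.\<close>
  define P where "P w = cdot (ccross (v b) (v c)) w * (\<Prod>j\<in>J. cdot (m j) w)" for w
  have finJ: "finite J" using I by (simp add: J_def)
  have "homog (1 + (\<Sum>j\<in>J. 1)) P" unfolding P_def
    by (intro homog.mult homog_prod homog_cdot finJ)
  moreover have "1 + (\<Sum>j\<in>J. 1) = d - 3" using cJ d by simp
  ultimately have "homog (d - 3) P" by simp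
  from \<kappa>(3)[OF this] have "(\<Sum>j\<in>I. \<kappa> j * P (v j)) = 0" .
  moreover have "(\<Sum>j\<in>I. \<kappa> j * P (v j)) = (\<Sum>j\<in>{a}. \<kappa> j * P (v j))"
  proof (rule sum.mono_neutral_right[OF I(1)])
    show "\<forall>j \<in> I - {a}. \<kappa> j * P (v j) = 0"
    proof
      fix j assume j: "j \<in> I - {a}"
      consider "j = i" | "j = b" | "j = c" | "j \<in> J" using j by (auto simp: J_def)
      then show "\<kappa> j * P (v j) = 0"
      proof cases
        case 4
        then have "(\<Prod>k\<in>J. cdot (m k) (v j)) = 0" using m finJ by (intro prod_zero) auto
        then show ?thesis by (simp add: P_def)
      qed (simp_all add: \<kappa>(1) P_def cdot_ccross)
    qed
  qed (use abc in auto)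
  moreover have "cdot (ccross (v b) (v c)) (v a) \<noteq> 0"
    using ne by (simp add: cdot_ccross cdet_cycle[of "v a"])
  then have "P (v a) \<noteq> 0" using m finJ by (simp add: P_def)
  moreover have "\<kappa> a \<noteq> 0" using \<kappa>(2) abc i by blast
  ultimately show False by simp
qed

section \<open>Isomorphisms of plane curves are linear\<close>

text \<open>The denominator \<open>l0\<close> stays fixed while the numerator varies with the point
  to be omitted. This produces the \<open>d\<close> relations, each missing exactly one point, that
  \<open>collinear_of_relations\<close> takes as input.\<close>

lemma (in curve_pencil) preimage_collinear:
  assumes l0: "transversal F' d l0"
    and aff: "\<And>p. p \<in> plane_curve F \<Longrightarrow> on_line l0 (f p) \<Longrightarrow> \<exists>x y. p = abs_proj2 (pt x y) \<and> unram x"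
  shows "\<exists>m. transversal F d m \<and> (\<forall>p \<in> plane_curve F. on_line m p \<longleftrightarrow> on_line l0 (f p))"
proof -
  let ?I = "pole_set l0"
  define v where "v z = pt (fst z) (snd z)" for z
  have l00: "l0 \<noteq> 0" using l0 by (simp add: transversal_def)
  have bijI: "bij_betw (\<lambda>z. abs_proj2 (v z)) ?I {p \<in> plane_curve F. on_line l0 (f p)}"
    unfolding v_def by (rule pole_set_bij[OF aff])
  have finI: "finite ?I" using bijI finite_preimage_line(1)[OF l00] bij_betw_finite by blast
  have cI: "card ?I = d"
    using bij_betw_same_card[OF bijI] finite_preimage_line(2)[OF l00] l0 by (simp add: transversal_def)
  have vI: "v i \<noteq> 0" "abs_proj2 (v i) \<in> plane_curve F" "on_line l0 (f (abs_proj2 (v i)))" if "i \<in> ?I" for i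
    using that pt_nonzero by (auto simp: v_def pole_set_def abs_pt_in_curve)
  have vinj: "i = j" if "v i = c *s v j" for i j c
    using pt_proportional(1,2)[of "fst i" "snd i" c "fst j" "snd j"] that by (simp add: v_def prod_eq_iff)
  have rel: "\<exists>\<kappa>. \<kappa> i = 0 \<and> (\<forall>j \<in> ?I - {i}. \<kappa> j \<noteq> 0) \<and>
       (\<forall>P. homog (d - 3) P \<longrightarrow> (\<Sum>j\<in>?I. \<kappa> j * P (v j)) = 0)" if i: "i \<in> ?I" for i
  proof -
    define w where "w = rep_proj2 (f (abs_proj2 (v i)))"
    have w: "w \<noteq> 0" "cdot l0 w = 0" using vI(3)[OF i] by (auto simp: w_def on_line_def rep_proj2_nonzero)
    obtain n where n: "cdot l0 n = 0" "ccross w n \<noteq> 0" using line_direction[OF l00 w(2,1)] .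
    obtain c where c: "cdet w n c \<noteq> 0" using n(2) ccross_nonzero by blast
    \<comment> \<open>A line through \<open>w\<close> that does not contain \<open>n\<close>; it
      meets \<open>l0\<close> in \<open>w\<close> alone, so the coefficient vanishes at
      \<open>i\<close> and at no other pole.\<close>
    define l where "l = ccross w c"
    have ln: "cdot l n \<noteq> 0" "cdot l w = 0" using c by (simp_all add: l_def cdot_ccross cdet_swap'[of w c n])
    obtain \<kappa> where \<kappa>: "\<And>z. z \<in> ?I \<Longrightarrow> \<kappa> z \<noteq> 0 \<longleftrightarrow> \<not> on_line l (f (abs_proj2 (v z)))"
      "\<And>P. homog (d - 3) P \<Longrightarrow> (\<Sum>z\<in>?I. \<kappa> z * P (v z)) = 0"
      using residue_relation[OF l0 aff, of l] unfolding v_def by blast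
    have "on_line l (f (abs_proj2 (v i)))" using ln by (simp add: on_line_def w_def)
    then have "\<kappa> i = 0" using \<kappa>(1)[OF i] by blast
    moreover have "\<kappa> j \<noteq> 0" if j: "j \<in> ?I - {i}" for j
    proof -
      have "\<not> on_line l (f (abs_proj2 (v j)))"
      proof
        define u where "u = rep_proj2 (f (abs_proj2 (v j)))"
        assume "on_line l (f (abs_proj2 (v j)))"
        then have u: "cdot l u = 0" "cdot l0 u = 0" "u \<noteq> 0"
          using vI(3)[of j] j by (auto simp: u_def on_line_def rep_proj2_nonzero)
        obtain x y where xy: "u = x *s w + y *s n" using line_span[OF w(2) n(1) u(2) l00 n(2)] .
        then have "y = 0" using u(1) ln by simp
        then have ux: "u = x *s w" using xy by simp
        then have "x \<noteq> 0" using u(3) by auto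
        then have "abs_proj2 u = abs_proj2 w" using ux abs_proj2_smult w(1) by simp
        then have "f (abs_proj2 (v j)) = f (abs_proj2 (v i))" by (simp add: u_def w_def abs_rep_proj2)
        then have "abs_proj2 (v j) = abs_proj2 (v i)" using f_inj vI(2) i j by blast
        then have "j = i" using abs_pt_inj unfolding v_def by (metis prod_eq_iff)
        then show False using j by blast
      qed
      then show ?thesis using \<kappa>(1) j by blast
    qed
    ultimately show ?thesis using \<kappa>(2) by blast
  qed
  have coll: "cdet (v a) (v b) (v c) = 0" if "a \<in> ?I" "b \<in> ?I" "c \<in> ?I" "a \<noteq> b" "a \<noteq> c" "b \<noteq> c" for a b c
    by (rule collinear_of_relations[OF finI cI d4 vI(1) vinj rel that])
  obtain a where a: "a \<in> ?I" using cI d4 by (metis card.empty equals0I not_numeral_le_zero)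
  have "?I - {a} \<noteq> {}" using cI d4 card_Diff_singleton[OF a] by fastforce
  then obtain b where b: "b \<in> ?I" "b \<noteq> a" by blast
  define m where "m = ccross (v a) (v b)"
  have m0: "m \<noteq> 0"
    using ccross_zero[OF _ vI(1)[OF a], of "v b"] vinj b(2) unfolding m_def by blast
  have onm: "on_line m (abs_proj2 (v z))" if z: "z \<in> ?I" for z
  proof -
    have "cdet (v a) (v b) (v z) = 0" using coll[OF a b(1) z] b(2) by (cases "z = a \<or> z = b") auto
    then show ?thesis using on_line_abs[OF vI(1)[OF z]] by (simp add: m_def cdot_ccross)
  qed
  have sub: "{p \<in> plane_curve F. on_line l0 (f p)} \<subseteq> {p \<in> plane_curve F. on_line m p}"
    using bijI onm vI(2) unfolding bij_betw_def by (metis (no_types, lifting) image_iff mem_Collect_eq subsetI)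
  have cl: "card {p \<in> plane_curve F. on_line l0 (f p)} = d" using bij_betw_same_card[OF bijI] cI by simp
  \<comment> \<open>The section by \<open>m\<close> contains the \<open>d\<close> preimages and has
    at most \<open>d\<close> points.\<close>
  have eq: "{p \<in> plane_curve F. on_line l0 (f p)} = {p \<in> plane_curve F. on_line m p}"
    using card_seteq[OF card_line(1)[OF FF d2 m0] sub] card_line(2)[OF FF d2 m0] cl by simp
  then have "transversal F d m" using m0 cl by (simp add: transversal_def)
  with eq show ?thesis by blast
qed

text \<open>The graph of the implicit function over \<open>v0\<close>. The last clause says that
  arbitrarily small parameter discs still cover a neighbourhood of \<open>p\<close> in the curve;
  this is how openness and continuity on the curve are tested.\<close>

lemma curve_parametrization:
  assumes F: "homog d F" "nonsingular_form F" and p: "p \<in> plane_curve F"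
  obtains r \<gamma> where "r > 0" "hol_vec \<gamma> (ball 0 r)" "\<And>t. t \<in> ball 0 r \<Longrightarrow> \<gamma> t \<noteq> 0 \<and> F (\<gamma> t) = 0"
    "abs_proj2 (\<gamma> 0) = p" "\<And>t t' c. \<gamma> t = c *s \<gamma> t' \<Longrightarrow> t = t'"
    "\<And>s. s > 0 \<Longrightarrow> \<exists>W. open W \<and> p \<in> W \<and> W \<inter> plane_curve F \<subseteq> (\<lambda>t. abs_proj2 (\<gamma> t)) ` ball 0 s"
proof -
  define v0 where "v0 = rep_proj2 p"
  have v0: "v0 \<noteq> 0" "F v0 = 0" "abs_proj2 v0 = p"
    using p rep_plane_curve[OF F(1)] by (auto simp: v0_def rep_proj2_nonzero abs_rep_proj2)
  obtain w where w: "grad F v0 w \<noteq> 0" using nonsingular_grad[OF F(2) v0(1,2)] by blast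
  have "\<nexists>k. w = k *s v0" using w homog_euler[OF F(1), of v0] v0(2) by auto
  then obtain c where "cdet v0 w c \<noteq> 0" using not_multiple_basis[OF v0(1)] by blast
  then have D: "cdet v0 c w \<noteq> 0" by (simp add: cdet_swap'[of v0 c w])
  obtain r g where r: "r > 0" "g holomorphic_on ball 0 r" "g 0 = 0"
    and gz: "\<And>x. x \<in> ball 0 r \<Longrightarrow> F (v0 + x *s c + g x *s w) = 0"
    and gu: "\<forall>\<^sub>F z in nhds (0, 0). F (v0 + fst z *s c + snd z *s w) = 0 \<longrightarrow> snd z = g (fst z)"
    using implicit_function[OF F(1) v0(2) w, of c] by blast
  define \<gamma> where "\<gamma> t = v0 + t *s c + g t *s w" for t
  have inj: "t = t'" if "\<gamma> t = k *s \<gamma> t'" for t t' k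
  proof -
    have "(1 - k) *s v0 + (t - k * t') *s c + (g t - k * g t') *s w = 0"
      using that by (simp add: \<gamma>_def vec_eq_iff algebra_simps)
    from basis_coords_zero[OF D this] show ?thesis by simp
  qed
  have nz: "\<gamma> t \<noteq> 0" for t
  proof
    assume "\<gamma> t = 0"
    then have "1 *s v0 + t *s c + g t *s w = 0" by (simp add: \<gamma>_def)
    from basis_coords_zero(1)[OF D this] show False by simp
  qed
  obtain N0 where N0: "open N0" "(0, 0) \<in> N0"
    "\<And>z. z \<in> N0 \<Longrightarrow> F (v0 + fst z *s c + snd z *s w) = 0 \<Longrightarrow> snd z = g (fst z)"
    using gu unfolding eventually_nhds by blast
  have W: "\<exists>W. open W \<and> p \<in> W \<and> W \<inter> plane_curve F \<subseteq> (\<lambda>t. abs_proj2 (\<gamma> t)) ` ball 0 s" if s: "s > 0" for s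
  proof -
    define N where "N = N0 \<inter> (ball 0 s \<times> UNIV)"
    have N: "open N" using N0(1) by (auto simp: N_def intro!: open_Int open_Times)
    \<comment> \<open>The affine coordinates with respect to the basis \<open>v0\<close>,
      \<open>c\<close>, \<open>w\<close>. They are quotients of determinants, so they do not depend
      on the representative.\<close>
    define \<psi> where "\<psi> v = (cdet v0 v w / cdet v c w, cdet v0 c v / cdet v c w)" for v
    define P where "P v \<longleftrightarrow> cdet v c w \<noteq> 0 \<and> \<psi> v \<in> N" for v
    have cc: "continuous_on UNIV (\<lambda>v. cdet v c w)" "continuous_on UNIV (\<lambda>v. cdet v0 v w)"
      "continuous_on UNIV (\<lambda>v. cdet v0 c v)"
      by (auto simp: cdet_def intro!: continuous_intros)
    have o: "open {v. cdet v c w \<noteq> 0}" by (rule open_Collect_neq) (auto intro!: cc continuous_intros)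
    have "continuous_on {v. cdet v c w \<noteq> 0} \<psi>" unfolding \<psi>_def
      by (intro continuous_intros continuous_on_subset[OF cc(1)] continuous_on_subset[OF cc(2)]
          continuous_on_subset[OF cc(3)]) auto
    from continuous_open_preimage[OF this o N] have "open ({v. cdet v c w \<noteq> 0} \<inter> \<psi> -` N)" .
    moreover have "{v. cdet v c w \<noteq> 0} \<inter> \<psi> -` N = {v. v \<noteq> 0 \<and> P v}" by (auto simp: P_def)
    ultimately have "open {v. v \<noteq> 0 \<and> P v}" by simp
    moreover have "P (k *s v) \<longleftrightarrow> P v" if "k \<noteq> 0" for v k using that by (simp add: P_def \<psi>_def)
    ultimately have "open {q. P (rep_proj2 q)}" by (intro open_proj2I) auto
    moreover have "P (rep_proj2 p)"
      using D N0(2) s by (simp add: P_def \<psi>_def N_def flip: v0_def)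
    moreover have "q \<in> (\<lambda>t. abs_proj2 (\<gamma> t)) ` ball 0 s" if q: "P (rep_proj2 q)" "q \<in> plane_curve F" for q
    proof -
      define v x y where "v = rep_proj2 q" and "x = cdet v0 v w / cdet v c w" and "y = cdet v0 c v / cdet v c w"
      have v: "v \<noteq> 0" "F v = 0" "abs_proj2 v = q"
        using q(2) rep_plane_curve[OF F(1)] by (auto simp: v_def rep_proj2_nonzero abs_rep_proj2)
      have a: "cdet v c w \<noteq> 0" and xy: "(x, y) \<in> N" using q(1) by (auto simp: P_def \<psi>_def x_def y_def v_def)
      define \<alpha> where "\<alpha> = cdet v c w / cdet v0 c w"
      have \<alpha>: "\<alpha> \<noteq> 0" using a D by (simp add: \<alpha>_def)
      have e: "v = \<alpha> *s (v0 + x *s c + y *s w)"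
        by (subst basis_expand[OF D, of v])
          (use a in \<open>simp add: vector_add_ldistrib vector_smult_assoc \<alpha>_def x_def y_def\<close>)
      have "\<alpha> ^ d * F (v0 + x *s c + y *s w) = 0" using v(2) homog_smult[OF F(1)] by (metis e)
      then have "y = g x" using N0(3)[of "(x, y)"] xy \<alpha> by (auto simp: N_def)
      then have vg: "v = \<alpha> *s \<gamma> x" using e by (simp add: \<gamma>_def)
      have "q = abs_proj2 (\<gamma> x)" using v(3) abs_proj2_smult[OF nz \<alpha>] unfolding vg by simp
      moreover have "x \<in> ball 0 s" using xy by (auto simp: N_def)
      ultimately show ?thesis by blast
    qed
    ultimately show ?thesis by (intro exI[of _ "{q. P (rep_proj2 q)}"]) blast
  qed
  show ?thesis
  proof (rule that[OF r(1) _ _ _ inj W])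
    show "hol_vec \<gamma> (ball 0 r)" unfolding \<gamma>_def
      by (intro hol_vec_add hol_vec_const hol_vec_smult holomorphic_on_ident r(2))
    show "\<gamma> t \<noteq> 0 \<and> F (\<gamma> t) = 0" if "t \<in> ball 0 r" for t using nz gz[OF that] by (simp add: \<gamma>_def)
    show "abs_proj2 (\<gamma> 0) = p" by (simp add: \<gamma>_def r(3) v0(3))
  qed
qed

text \<open>The modulus attains its maximum by compactness. The set where \<open>H\<close> takes the
  value found there is closed by continuity and open by the maximum modulus principle, since small
  parameter discs cover neighbourhoods.\<close>

lemma compact_connected_constant:
  fixes X :: "'a::topological_space set" and H :: "'a \<Rightarrow> complex"
  assumes X: "compact X" "connected X"
    and loc: "\<And>p. p \<in> X \<Longrightarrow> \<exists>r \<gamma> k. r > 0 \<and> k holomorphic_on ball 0 r \<and> \<gamma> 0 = p \<and>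
      (\<forall>t \<in> ball 0 r. \<gamma> t \<in> X \<and> H (\<gamma> t) = k t) \<and>
      (\<forall>s>0. s \<le> r \<longrightarrow> (\<exists>W. open W \<and> p \<in> W \<and> W \<inter> X \<subseteq> \<gamma> ` ball 0 s))"
  shows "\<exists>c. \<forall>p \<in> X. H p = c"
proof (cases "X = {}")
  case False
  have "continuous_on X H" unfolding continuous_on_topological
  proof (intro ballI allI impI)
    fix p B assume p: "p \<in> X" and B: "open B" "H p \<in> B"
    obtain r \<gamma> k where r: "r > 0" "k holomorphic_on ball 0 r" "\<gamma> 0 = p"
      "\<forall>t \<in> ball 0 r. \<gamma> t \<in> X \<and> H (\<gamma> t) = k t"
      and W: "\<forall>s>0. s \<le> r \<longrightarrow> (\<exists>W. open W \<and> p \<in> W \<and> W \<inter> X \<subseteq> \<gamma> ` ball 0 s)" using loc[OF p] by blast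
    have "k 0 \<in> B" using r B by force
    moreover have "isCont k 0"
      using holomorphic_on_imp_continuous_on[OF r(2)] r(1) by (simp add: continuous_on_eq_continuous_at)
    ultimately have "\<forall>\<^sub>F t in nhds 0. k t \<in> B"
      using B(1) by (simp add: isCont_def topological_tendstoD eventually_nhds_conv_at)
    then obtain s where s: "s > 0" "\<And>t. t \<in> ball 0 s \<Longrightarrow> k t \<in> B"
      by (auto simp: eventually_nhds_metric dist_commute)
    obtain W where W': "open W" "p \<in> W" "W \<inter> X \<subseteq> \<gamma> ` ball 0 (min s r)"
      using W[rule_format, of "min s r"] s(1) r(1) by auto
    show "\<exists>A. open A \<and> p \<in> A \<and> (\<forall>y\<in>X. y \<in> A \<longrightarrow> H y \<in> B)"
    proof (intro exI[of _ W] conjI ballI impI W')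
      fix y assume "y \<in> X" "y \<in> W"
      then obtain t where "t \<in> ball 0 (min s r)" "y = \<gamma> t" using W'(3) by blast
      then show "H y \<in> B" using r(4) s(2) by auto
    qed
  qed
  note contH = this
  then have "continuous_on X (\<lambda>p. cmod (H p))" by (intro continuous_intros)
  from continuous_attains_sup[OF X(1) False this]
  obtain p0 where p0: "p0 \<in> X" "\<And>p. p \<in> X \<Longrightarrow> cmod (H p) \<le> cmod (H p0)" by blast
  define A where "A = {p \<in> X. H p = H p0}"
  have "closedin (top_of_set X) A" unfolding A_def
    by (rule continuous_closedin_preimage_constant[OF contH])
  moreover have "openin (top_of_set X) A"
  proof (subst openin_subopen, intro ballI)
    fix p assume "p \<in> A"
    then have p: "p \<in> X" "H p = H p0" by (auto simp: A_def)
    obtain r \<gamma> k where r: "r > 0" "k holomorphic_on ball 0 r" "\<gamma> 0 = p"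
      "\<forall>t \<in> ball 0 r. \<gamma> t \<in> X \<and> H (\<gamma> t) = k t"
      and W: "\<forall>s>0. s \<le> r \<longrightarrow> (\<exists>W. open W \<and> p \<in> W \<and> W \<inter> X \<subseteq> \<gamma> ` ball 0 s)" using loc[OF p(1)] by blast
    have k0: "k 0 = H p0" using r p by force
    have "k constant_on ball 0 r"
    proof (rule maximum_modulus_principle[OF r(2) open_ball connected_ball open_ball order_refl])
      show "0 \<in> ball (0::complex) r" using r(1) by simp
      show "cmod (k z) \<le> cmod (k 0)" if "z \<in> ball 0 r" for z using that r(4) p0(2) k0 by metis
    qed
    then have kc: "k t = H p0" if "t \<in> ball 0 r" for t
      using that k0 r(1) unfolding constant_on_def by (metis centre_in_ball)
    obtain W where W': "open W" "p \<in> W" "W \<inter> X \<subseteq> \<gamma> ` ball 0 r" using W r(1) by blast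
    show "\<exists>T. openin (top_of_set X) T \<and> p \<in> T \<and> T \<subseteq> A"
    proof (intro exI[of _ "X \<inter> W"] conjI)
      show "X \<inter> W \<subseteq> A"
      proof
        fix q assume q: "q \<in> X \<inter> W"
        then obtain t where "t \<in> ball 0 r" "q = \<gamma> t" using W'(3) by blast
        then show "q \<in> A" using q r(4) kc by (auto simp: A_def)
      qed
    qed (use p W' in \<open>auto simp: openin_open_Int\<close>)
  qed
  ultimately have "A = X" using X(2) p0(1) unfolding connected_clopen A_def by blast
  then show ?thesis by (auto simp: A_def)
qed auto

text \<open>Either neither function vanishes at 0 or both have a simple zero there; in the second
  case the factor \<open>t\<close> cancels from both.\<close>

lemma quotient_of_simple_zeros:
  fixes N M :: "complex \<Rightarrow> complex"
  assumes r: "r > 0" and hol: "N holomorphic_on ball 0 r" "M holomorphic_on ball 0 r"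
    and zz: "N 0 = 0 \<longleftrightarrow> M 0 = 0"
    and simple: "N 0 = 0 \<Longrightarrow> deriv N 0 \<noteq> 0" "M 0 = 0 \<Longrightarrow> deriv M 0 \<noteq> 0"
  obtains s k where "0 < s" "s \<le> r" "k holomorphic_on ball 0 s"
    "\<And>t. t \<in> ball 0 s \<Longrightarrow> k t \<noteq> 0 \<and> N t = k t * M t"
proof -
  have "\<exists>N1. N1 holomorphic_on ball 0 r \<and> N1 0 \<noteq> 0 \<and> (\<forall>t. t \<in> ball 0 r \<longrightarrow> N t = (if N 0 = 0 then t else 1) * N1 t)"
    if N: "N holomorphic_on ball 0 r" "N 0 = 0 \<Longrightarrow> deriv N 0 \<noteq> 0" for N :: "complex \<Rightarrow> complex"
  proof (cases "N 0 = 0")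
    case True
    have "(\<lambda>z. if z = 0 then deriv N 0 else N z / z - N 0 / (z - 0)) holomorphic_on ball 0 r"
      by (rule pole_theorem_open[OF N(1) open_ball]) auto
    then have "(\<lambda>z. if z = 0 then deriv N 0 else N z / z) holomorphic_on ball 0 r"
      by (simp only: True div_0 diff_zero)
    then show ?thesis using N(2) True by (intro exI[of _ "\<lambda>z. if z = 0 then deriv N 0 else N z / z"]) auto
  qed (use N in auto)
  from this[OF hol(1) simple(1)] this[OF hol(2) simple(2)] obtain N1 M1 where
    N1: "N1 holomorphic_on ball 0 r" "N1 0 \<noteq> 0" "\<And>t. t \<in> ball 0 r \<Longrightarrow> N t = (if N 0 = 0 then t else 1) * N1 t"
    and M1: "M1 holomorphic_on ball 0 r" "M1 0 \<noteq> 0" "\<And>t. t \<in> ball 0 r \<Longrightarrow> M t = (if M 0 = 0 then t else 1) * M1 t"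
    by blast
  have "\<forall>\<^sub>F t in nhds 0. N1 t \<noteq> 0" if "N1 holomorphic_on ball 0 r" "N1 0 \<noteq> 0" for N1 :: "complex \<Rightarrow> complex"
  proof -
    have "isCont N1 0"
      using holomorphic_on_imp_continuous_on[OF that(1)] r by (simp add: continuous_on_eq_continuous_at)
    then show ?thesis
      using that(2) by (simp add: isCont_def tendsto_imp_eventually_ne eventually_nhds_conv_at)
  qed
  then have "\<forall>\<^sub>F t in nhds 0. N1 t \<noteq> 0 \<and> M1 t \<noteq> 0" using N1 M1 by (simp add: eventually_conj)
  then obtain s where s: "s > 0" "\<And>t. t \<in> ball 0 s \<Longrightarrow> N1 t \<noteq> 0 \<and> M1 t \<noteq> 0"
    by (auto simp: eventually_nhds_metric dist_commute)
  show ?thesis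
  proof (rule that[of "min s r" "\<lambda>t. N1 t / M1 t"])
    show "(\<lambda>t. N1 t / M1 t) holomorphic_on ball 0 (min s r)"
      using s(2) by (intro holomorphic_intros holomorphic_on_subset[OF N1(1)] holomorphic_on_subset[OF M1(1)]) auto
    show "N1 t / M1 t \<noteq> 0 \<and> N t = N1 t / M1 t * M t" if "t \<in> ball 0 (min s r)" for t
      using that s(2)[of t] N1(3)[of t] M1(3)[of t] zz by auto
  qed (use s r in auto)
qed

section \<open>Pairs of lines with corresponding sections\<close>

context curve_iso
begin

definition corresponding :: "complex^3 \<Rightarrow> complex^3 \<Rightarrow> bool" where
  "corresponding l m \<longleftrightarrow> transversal F' d l \<and> transversal F d m \<and>
     (\<forall>p \<in> plane_curve F. on_line m p \<longleftrightarrow> on_line l (f p))"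

text \<open>A line of the pencil can fail only if its parameter is a branch value or if it meets the
  image of \<open>E\<close>, the points at infinity or over branch values of the source pencil.
  \<open>E\<close> is countable, and each point of the target lies on at most one line of the
  pencil.\<close>

lemma countable_bad_lines:
  assumes "pencil F' d a0 a1 a2"
  shows "countable {x. \<not> (\<exists>m. corresponding (ccross (a0 + x *s a1) a2) m)}"
proof -
  interpret t: pencil F' d a0 a1 a2 by (rule assms)
  have d2: "d \<ge> 2" using d4 by simp
  obtain e0 e1 e2 where P: "pencil F d e0 e1 e2" using exists_pencil[OF FF d2] by blast
  interpret curve_pencil F F' d f e0 e1 e2 by (rule curve_pencil.intro[OF curve_iso_axioms P])
  define E where "E = {p \<in> plane_curve F. \<not> (\<exists>x y. p = abs_proj2 (pt x y) \<and> unram x)}"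
  have c12: "ccross e1 e2 \<noteq> 0"
    using basis ccross_nonzero cdet_cycle[of e0 e1 e2] by metis
  have "E \<subseteq> {p \<in> plane_curve F. on_line (ccross e1 e2) p} \<union>
      (\<Union>x \<in> {x. \<not> unram x}. (\<lambda>y. abs_proj2 (pt x y)) ` rts x)"
  proof
    fix p assume p: "p \<in> E"
    define v where "v = rep_proj2 p"
    have v: "v \<noteq> 0" "p = abs_proj2 v" by (simp_all add: v_def rep_proj2_nonzero abs_rep_proj2)
    obtain \<alpha> \<beta> \<gamma> where ab: "\<alpha> = cdet v e1 e2 / cdet e0 e1 e2" "v = \<alpha> *s e0 + \<beta> *s e1 + \<gamma> *s e2"
      using basis_expand[OF basis, of v] by blast
    show "p \<in> {p \<in> plane_curve F. on_line (ccross e1 e2) p} \<union>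
      (\<Union>x \<in> {x. \<not> unram x}. (\<lambda>y. abs_proj2 (pt x y)) ` rts x)"
    proof (cases "\<alpha> = 0")
      case True
      then have "cdot (ccross e1 e2) v = 0" using basis ab(1) by (simp add: cdot_ccross cdet_cycle[of v])
      then show ?thesis using p by (simp add: E_def on_line_def v_def)
    next
      case False
      have "v = \<alpha> *s pt (\<beta> / \<alpha>) (\<gamma> / \<alpha>)"
        using False ab(2) by (simp add: pt_def vector_add_ldistrib vector_smult_assoc)
      then have pp: "p = abs_proj2 (pt (\<beta> / \<alpha>) (\<gamma> / \<alpha>))"
        using v(2) abs_proj2_smult[OF pt_nonzero False] by simp
      then have "\<not> unram (\<beta> / \<alpha>)" "\<gamma> / \<alpha> \<in> rts (\<beta> / \<alpha>)"
        using p abs_pt_in_curve unfolding E_def by blast+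
      then show ?thesis using pp by blast
    qed
  qed
  moreover have "countable ({p \<in> plane_curve F. on_line (ccross e1 e2) p} \<union>
      (\<Union>x \<in> {x. \<not> unram x}. (\<lambda>y. abs_proj2 (pt x y)) ` rts x))"
    using card_line(1)[OF FF d2 c12] countable_ram finite_rts
    by (intro countable_Un countable_UN countable_image) (auto intro: countable_finite)
  ultimately have cE: "countable E" using countable_subset by blast
  define B where "B q = {x. on_line (ccross (a0 + x *s a1) a2) q}" for q
  have cB: "countable (B q)" if q: "q \<in> plane_curve F'" for q
  proof -
    define w where "w = rep_proj2 q"
    have w: "w \<noteq> 0" "F' w = 0" using q rep_plane_curve[OF F'(1)] by (auto simp: w_def rep_proj2_nonzero)
    have Bq: "B q = {x. cdet a0 a2 w + x * cdet a1 a2 w = 0}"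
      by (simp add: B_def on_line_def cdot_ccross flip: w_def)
    \<comment> \<open>If both vanished, \<open>w\<close> would be a multiple of the centre
      \<open>a2\<close>, which is not on the curve.\<close>
    have ne: "cdet a0 a2 w \<noteq> 0 \<or> cdet a1 a2 w \<noteq> 0"
    proof (rule ccontr)
      assume "\<not> ?thesis"
      then have z: "cdet a0 w a2 = 0" "cdet w a1 a2 = 0"
        using cdet_swap'[of a0 w a2] cdet_cycle[of w a1 a2] by auto
      have "w = (cdet a0 a1 w / cdet a0 a1 a2) *s a2"
        using basis_expand[OF t.basis, of w] z by simp
      then obtain k where k: "w = k *s a2" by blast
      then have "k \<noteq> 0" using w(1) by auto
      then show False using w(2) t.center homog_smult[OF F'(1), of k a2] k by simp
    qed
    have "B q \<subseteq> {(- cdet a0 a2 w) / cdet a1 a2 w}"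
    proof
      fix x assume "x \<in> B q"
      then have e: "cdet a0 a2 w + x * cdet a1 a2 w = 0" by (simp add: Bq)
      then have "cdet a1 a2 w \<noteq> 0" using ne by auto
      moreover have "x * cdet a1 a2 w = - cdet a0 a2 w" using e by (simp add: add_eq_0_iff)
      ultimately show "x \<in> {(- cdet a0 a2 w) / cdet a1 a2 w}" by (metis nonzero_eq_divide_eq singletonI)
    qed
    then show ?thesis using countable_subset by blast
  qed
  have "{x. \<not> (\<exists>m. corresponding (ccross (a0 + x *s a1) a2) m)} \<subseteq> {x. \<not> t.unram x} \<union> (\<Union>q \<in> f ` E. B q)"
  proof (rule subsetI, rule ccontr)
    fix x assume x: "x \<in> {x. \<not> (\<exists>m. corresponding (ccross (a0 + x *s a1) a2) m)}"
      and n: "x \<notin> {x. \<not> t.unram x} \<union> (\<Union>q \<in> f ` E. B q)"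
    define l where "l = ccross (a0 + x *s a1) a2"
    have tr: "transversal F' d l" unfolding l_def using n by (intro t.transversal_unram) auto
    have "\<exists>m. transversal F d m \<and> (\<forall>p \<in> plane_curve F. on_line m p \<longleftrightarrow> on_line l (f p))"
    proof (rule preimage_collinear[OF tr])
      fix p assume p: "p \<in> plane_curve F" "on_line l (f p)"
      then have "x \<in> B (f p)" by (simp add: B_def l_def)
      then have "p \<notin> E" using n by blast
      then show "\<exists>x y. p = abs_proj2 (pt x y) \<and> unram x" using p(1) by (simp add: E_def)
    qed
    then show False using x tr by (auto simp: corresponding_def l_def)
  qed
  moreover have "countable ({x. \<not> t.unram x} \<union> (\<Union>q \<in> f ` E. B q))"
  proof (intro countable_Un countable_UN countable_image cE t.countable_ram)
    fix q assume "q \<in> f ` E"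
    then show "countable (B q)" using f_in cB by (auto simp: E_def)
  qed
  ultimately show ?thesis using countable_subset by blast
qed

text \<open>Two different lines of one pencil meet only in its centre \<open>e2\<close>, and a line
  through \<open>e1\<close> from the second pencil avoids that point. Each of the three exists
  because only countably many parameters are bad.\<close>

lemma three_lines:
  obtains l m :: "3 \<Rightarrow> complex^3" where "\<And>i. corresponding (l i) (m i)"
    "\<And>v. (\<And>i. cdot (l i) v = 0) \<Longrightarrow> v = 0"
proof -
  have d2: "d \<ge> 2" using d4 by simp
  obtain e0 e1 e2 where p: "pencil F' d e0 e1 e2" "F' e1 \<noteq> 0" using exists_pencil[OF F' d2] by blast
  interpret pencil F' d e0 e1 e2 by (rule p)
  have p': "pencil F' d e0 e2 e1"
    by unfold_locales (use F' d2 p(2) basis cdet_swap'[of e0 e2 e1] in auto)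
  have unc: "\<exists>x. x \<notin> A" if "countable A" for A :: "complex set"
  proof (rule ccontr)
    assume "\<nexists>x. x \<notin> A"
    then have "countable (UNIV :: complex set)" using that by (metis UNIV_eq_I)
    then show False using uncountable_UNIV_complex by blast
  qed
  obtain x1 where x1: "\<exists>m. corresponding (ccross (e0 + x1 *s e1) e2) m"
    using unc[OF countable_bad_lines[OF p(1)]] by blast
  have "countable (insert x1 {x. \<not> (\<exists>m. corresponding (ccross (e0 + x *s e1) e2) m)})"
    using countable_bad_lines[OF p(1)] by simp
  from unc[OF this] obtain x2 where x2: "\<exists>m. corresponding (ccross (e0 + x2 *s e1) e2) m" "x2 \<noteq> x1" by blast
  obtain y where y: "\<exists>m. corresponding (ccross (e0 + y *s e2) e1) m"
    using unc[OF countable_bad_lines[OF p']] by blast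
  define l :: "3 \<Rightarrow> complex^3" where "l i = (if i = 1 then ccross (e0 + x1 *s e1) e2
    else if i = 2 then ccross (e0 + x2 *s e1) e2 else ccross (e0 + y *s e2) e1)" for i
  have "\<exists>m. corresponding (l i) m" for i
    using x1 x2(1) y by (simp add: l_def)
  then obtain m where m: "\<And>i. corresponding (l i) (m i)" by metis
  have "v = 0" if z: "\<And>i. cdot (l i) v = 0" for v
  proof -
    obtain a b c where v: "v = a *s e0 + b *s e1 + c *s e2" using basis_expand[OF basis, of v] by blast
    have D: "cdet e0 e1 e2 \<noteq> 0" by (rule basis)
    have e: "cdet e0 e2 e1 = - cdet e0 e1 e2" "cdet e1 e2 e0 = cdet e0 e1 e2" "cdet e2 e1 e0 = - cdet e0 e1 e2"
      by (metis cdet_swap', metis cdet_cycle, metis cdet_cycle cdet_swap')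
    have k: "cdot (ccross (e0 + x *s e1) e2) v = cdet e0 e1 e2 * (x * a - b)" for x
      by (simp add: v cdot_ccross e algebra_simps)
    have "cdot (l 1) v = 0" "cdot (l 2) v = 0" "cdot (l 3) v = 0" using z by blast+
    then have "x1 * a = b" "x2 * a = b" and 3: "cdot (ccross (e0 + y *s e2) e1) v = 0"
      using D by (auto simp: l_def k)
    then have "(x1 - x2) * a = 0" by (simp add: algebra_simps)
    then have a: "a = 0" and b: "b = 0" using x2(2) \<open>x1 * a = b\<close> by auto
    then have "c = 0" using 3 D by (simp add: v cdot_ccross)
    then show ?thesis using v a b by simp
  qed
  with that m show ?thesis by blast
qed

text \<open>Both lines are transversal and vanish at corresponding points, so \<open>l\<close> along
  \<open>\<delta>\<close> and \<open>m\<close> along \<open>\<gamma>\<close> have only simple zeros,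
  at the same place, and their quotient has none.\<close>

lemma corresponding_local:
  assumes c: "corresponding l m" and r: "r > 0" "hol_vec \<gamma> (ball 0 r)"
    and \<gamma>: "\<And>t. t \<in> ball 0 r \<Longrightarrow> \<gamma> t \<noteq> 0 \<and> F (\<gamma> t) = 0"
    and inj: "\<And>t t' c. t \<in> ball 0 r \<Longrightarrow> t' \<in> ball 0 r \<Longrightarrow> \<gamma> t = c *s \<gamma> t' \<Longrightarrow> t = t'"
    and s: "0 < s" "s \<le> r" and \<delta>: "hol_vec \<delta> (ball 0 s)"
    "\<And>t. t \<in> ball 0 s \<Longrightarrow> \<delta> t \<noteq> 0 \<and> F' (\<delta> t) = 0 \<and> f (abs_proj2 (\<gamma> t)) = abs_proj2 (\<delta> t)"
  shows "\<exists>s' k. 0 < s' \<and> s' \<le> s \<and> k holomorphic_on ball 0 s' \<and>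
    (\<forall>t \<in> ball 0 s'. k t \<noteq> 0 \<and> cdot l (\<delta> t) = k t * cdot m (\<gamma> t))"
proof (rule quotient_of_simple_zeros[OF s(1) hol_vec_cdot[OF \<delta>(1)] hol_vec_cdot[OF hol_vec_subset[OF r(2)]]])
  have z: "0 \<in> ball (0::complex) r" "0 \<in> ball (0::complex) s" using r s by auto
  have "abs_proj2 (\<gamma> 0) \<in> plane_curve F" using \<gamma>[OF z(1)] abs_in_plane_curve[OF FF(1)] by blast
  then have "on_line m (abs_proj2 (\<gamma> 0)) \<longleftrightarrow> on_line l (abs_proj2 (\<delta> 0))"
    using c \<delta>(2)[OF z(2)] by (simp add: corresponding_def)
  then show "cdot l (\<delta> 0) = 0 \<longleftrightarrow> cdot m (\<gamma> 0) = 0"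
    using on_line_abs \<gamma>[OF z(1)] \<delta>(2)[OF z(2)] by blast
  have tr: "transversal F' d l" "transversal F d m" using c by (auto simp: corresponding_def)
  show "deriv (\<lambda>t. cdot l (\<delta> t)) 0 \<noteq> 0" if "cdot l (\<delta> 0) = 0"
    by (rule simple_zero_image[OF \<gamma> inj s \<delta> tr(1) that])
  show "deriv (\<lambda>t. cdot m (\<gamma> t)) 0 \<noteq> 0" if m0: "cdot m (\<gamma> 0) = 0"
  proof -
    obtain n where n: "cdot m n = 0" "grad F (\<gamma> 0) n \<noteq> 0"
      using transversal_direction[OF FF _ tr(2) m0] \<gamma>[OF z(1)] d4 by auto
    have "m \<noteq> 0" using tr(2) by (simp add: transversal_def)
    show ?thesis
      by (rule simple_zero[OF FF(1) r(2,1) \<gamma> _ \<open>m \<noteq> 0\<close> m0 n]) (auto intro: inj)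
  qed
qed (use s(2) in \<open>auto 0 4\<close>)

text \<open>The equation \<open>(l \<circ> f / l' \<circ> f) * (m' / m) = c\<close> with cleared
  denominators, so that it makes sense on the four lines too. It does not depend on the
  representatives.\<close>

definition related :: "complex^3 \<Rightarrow> complex^3 \<Rightarrow> complex^3 \<Rightarrow> complex^3 \<Rightarrow> complex \<Rightarrow> proj2 \<Rightarrow> bool" where
  "related l m l' m' c p \<longleftrightarrow> (\<forall>v w. v \<noteq> 0 \<longrightarrow> w \<noteq> 0 \<longrightarrow> abs_proj2 v = p \<longrightarrow> f p = abs_proj2 w \<longrightarrow>
     cdot l w * cdot m' v = c * (cdot l' w * cdot m v))"

lemma relatedI:
  assumes v: "v0 \<noteq> 0" "w0 \<noteq> 0" "f (abs_proj2 v0) = abs_proj2 w0"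
    and e: "cdot l w0 * cdot m' v0 = c * (cdot l' w0 * cdot m v0)"
  shows "related l m l' m' c (abs_proj2 v0)"
  unfolding related_def
proof (intro allI impI)
  fix v w :: "complex^3"
  assume vw: "v \<noteq> 0" "w \<noteq> 0" "abs_proj2 v = abs_proj2 v0" "f (abs_proj2 v0) = abs_proj2 w"
  obtain a where a: "v = a *s v0" using abs_proj2_eq_iff[OF v(1) vw(1)] vw(3) by metis
  obtain b where b: "w = b *s w0" using abs_proj2_eq_iff[OF v(2) vw(2)] v(3) vw(4) by metis
  have "cdot l w * cdot m' v = a * b * (cdot l w0 * cdot m' v0)" by (simp add: a b)
  also have "\<dots> = c * (cdot l' w * cdot m v)" unfolding e by (simp add: a b)
  finally show "cdot l w * cdot m' v = c * (cdot l' w * cdot m v)" .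
qed

text \<open>At a point of \<open>Z\<close> both sides of \<open>related\<close> vanish and every
  constant is admissible, so the equation alone does not define a function there. The value at
  \<open>p\<close> is taken from a local quotient, and the parametrizations are shrunk until they
  meet \<open>Z\<close> at most at \<open>p\<close>.\<close>

lemma ratio_constant:
  assumes top: "compact (plane_curve F)" "connected (plane_curve F)"
    and c: "corresponding l m" "corresponding l' m'"
  shows "\<exists>c. \<forall>p \<in> plane_curve F. related l m l' m' c p"
proof -
  define Z where "Z = {p \<in> plane_curve F. on_line m p} \<union> {p \<in> plane_curve F. on_line m' p}"
  have finZ: "finite Z" using card_line(1)[OF FF] c d4 by (auto simp: Z_def corresponding_def transversal_def)
  define data where "data p r \<gamma> k \<longleftrightarrow> r > 0 \<and> k holomorphic_on ball 0 r \<and> \<gamma> 0 = p \<and>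
      (\<forall>t \<in> ball 0 r. \<gamma> t \<in> plane_curve F \<and> related l m l' m' (k t) (\<gamma> t) \<and> (t \<noteq> 0 \<longrightarrow> \<gamma> t \<notin> Z)) \<and>
      (\<forall>s>0. s \<le> r \<longrightarrow> (\<exists>W. open W \<and> p \<in> W \<and> W \<inter> plane_curve F \<subseteq> \<gamma> ` ball 0 s))"
    for p r and \<gamma> :: "complex \<Rightarrow> proj2" and k :: "complex \<Rightarrow> complex"
  have "\<exists>r \<gamma> k. data p r \<gamma> k" if p: "p \<in> plane_curve F" for p
  proof -
    obtain r \<gamma> where r: "r > 0" "hol_vec \<gamma> (ball 0 r)"
      and \<gamma>: "\<And>t. t \<in> ball 0 r \<Longrightarrow> \<gamma> t \<noteq> 0 \<and> F (\<gamma> t) = 0" and \<gamma>0: "abs_proj2 (\<gamma> 0) = p"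
      and inj: "\<And>t t' c. \<gamma> t = c *s \<gamma> t' \<Longrightarrow> t = t'"
      and W: "\<And>s. s > 0 \<Longrightarrow> \<exists>W. open W \<and> p \<in> W \<and> W \<inter> plane_curve F \<subseteq> (\<lambda>t. abs_proj2 (\<gamma> t)) ` ball 0 s"
      using curve_parametrization[OF FF p] by blast
    obtain s \<delta> where s: "0 < s" "s \<le> r" and h\<delta>: "hol_vec \<delta> (ball 0 s)"
      and \<delta>: "\<And>t. t \<in> ball 0 s \<Longrightarrow> \<delta> t \<noteq> 0 \<and> F' (\<delta> t) = 0 \<and> f (abs_proj2 (\<gamma> t)) = abs_proj2 (\<delta> t)"
      using obtain_lift[OF r \<gamma>] by blast
    have loc: "\<exists>s' k. 0 < s' \<and> s' \<le> s \<and> k holomorphic_on ball 0 s' \<and>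
        (\<forall>t \<in> ball 0 s'. k t \<noteq> 0 \<and> cdot l (\<delta> t) = k t * cdot m (\<gamma> t))"
      if "corresponding l m" for l m
      by (rule corresponding_local[OF that r \<gamma> _ s h\<delta> \<delta>]) (auto intro: inj)
    obtain s1 k1 where k1: "0 < s1" "s1 \<le> s" "k1 holomorphic_on ball 0 s1"
      "\<And>t. t \<in> ball 0 s1 \<Longrightarrow> k1 t \<noteq> 0 \<and> cdot l (\<delta> t) = k1 t * cdot m (\<gamma> t)"
      using loc[OF c(1)] by blast
    obtain s2 k2 where k2: "0 < s2" "s2 \<le> s" "k2 holomorphic_on ball 0 s2"
      "\<And>t. t \<in> ball 0 s2 \<Longrightarrow> k2 t \<noteq> 0 \<and> cdot l' (\<delta> t) = k2 t * cdot m' (\<gamma> t)"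
      using loc[OF c(2)] by blast
    \<comment> \<open>Different parameters give different points and \<open>Z\<close> is finite, so
      a small disc contains no element of \<open>T\<close> except possibly 0.\<close>
    define T where "T = {t \<in> ball 0 r. abs_proj2 (\<gamma> t) \<in> Z}"
    have "inj_on (\<lambda>t. abs_proj2 (\<gamma> t)) T"
    proof (rule inj_onI)
      fix t t' assume "t \<in> T" "t' \<in> T" "abs_proj2 (\<gamma> t) = abs_proj2 (\<gamma> t')"
      then show "t = t'" using abs_proj2_eq_iff \<gamma> inj unfolding T_def by (metis (no_types, lifting) mem_Collect_eq)
    qed
    moreover have "finite ((\<lambda>t. abs_proj2 (\<gamma> t)) ` T)" by (rule finite_subset[OF _ finZ]) (auto simp: T_def)
    ultimately have "finite T" by (rule finite_imageD[rotated])
    then have "\<forall>\<^sub>F t in at 0. t \<notin> T" using islimpt_finite by (auto simp: islimpt_iff_eventually)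
    then obtain s3 where s3: "s3 > 0" "\<And>t. t \<noteq> 0 \<Longrightarrow> t \<in> ball 0 s3 \<Longrightarrow> t \<notin> T"
      by (auto simp: eventually_at dist_commute)
    define q where "q = Min {s1, s2, s3}"
    have q: "q > 0" "q \<le> s1" "q \<le> s2" "q \<le> s3" "q \<le> r" using k1 k2 s3 s by (auto simp: q_def)
    have "data p q (\<lambda>t. abs_proj2 (\<gamma> t)) (\<lambda>t. k1 t / k2 t)" unfolding data_def
    proof (intro conjI ballI allI impI)
      show "(\<lambda>t. k1 t / k2 t) holomorphic_on ball 0 q"
        using q k2(4) by (intro holomorphic_intros holomorphic_on_subset[OF k1(3)] holomorphic_on_subset[OF k2(3)]) auto
      fix t :: complex assume t: "t \<in> ball 0 q"
      have tr: "t \<in> ball 0 r" "t \<in> ball 0 s" "t \<in> ball 0 s1" "t \<in> ball 0 s2" "t \<in> ball 0 s3"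
        using t q k1(2) by auto
      show "abs_proj2 (\<gamma> t) \<in> plane_curve F" using \<gamma>[OF tr(1)] abs_in_plane_curve[OF FF(1)] by blast
      show "related l m l' m' (k1 t / k2 t) (abs_proj2 (\<gamma> t))"
        by (rule relatedI[of _ "\<delta> t"]) (use \<gamma>[OF tr(1)] \<delta>[OF tr(2)] k1(4)[OF tr(3)] k2(4)[OF tr(4)] in auto)
      show "abs_proj2 (\<gamma> t) \<notin> Z" if "t \<noteq> 0" using s3(2)[OF that tr(5)] tr(1) by (simp add: T_def)
    qed (use q \<gamma>0 W in auto)
    then show ?thesis by blast
  qed
  then obtain R \<Gamma> K where data: "\<And>p. p \<in> plane_curve F \<Longrightarrow> data p (R p) (\<Gamma> p) (K p)" by metis
  \<comment> \<open>Outside \<open>Z\<close> the constant is unique, so at all parameters but 0 this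
    agrees with the local quotient of any other parametrization; at 0 it agrees by
    definition.\<close>
  define H where "H p = K p 0" for p
  have relH: "related l m l' m' (H p) p" if "p \<in> plane_curve F" for p
    using data[OF that] unfolding data_def H_def by (metis centre_in_ball)
  have uniq: "a = b" if p: "p \<in> plane_curve F" "p \<notin> Z" "related l m l' m' a p" "related l m l' m' b p" for a b p
  proof -
    define v w where "v = rep_proj2 p" and "w = rep_proj2 (f p)"
    have vw: "v \<noteq> 0" "w \<noteq> 0" "abs_proj2 v = p" "f p = abs_proj2 w"
      by (simp_all add: v_def w_def rep_proj2_nonzero abs_rep_proj2)
    have "cdot m v \<noteq> 0" using p(1,2) by (auto simp: Z_def on_line_def v_def)
    moreover have "\<not> on_line l' (f p)" using p(1,2) c(2) by (auto simp: Z_def corresponding_def)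
    then have "cdot l' w \<noteq> 0" by (simp add: on_line_def w_def)
    moreover have "a * (cdot l' w * cdot m v) = b * (cdot l' w * cdot m v)"
      using p(3,4) vw unfolding related_def by metis
    ultimately show ?thesis by simp
  qed
  have "\<exists>c. \<forall>p \<in> plane_curve F. H p = c"
  proof (rule compact_connected_constant[OF top])
    fix p assume p: "p \<in> plane_curve F"
    have D: "data p (R p) (\<Gamma> p) (K p)" using data[OF p] .
    show "\<exists>r (\<gamma> :: complex \<Rightarrow> proj2) k. r > 0 \<and> k holomorphic_on ball 0 r \<and> \<gamma> 0 = p \<and>
      (\<forall>t \<in> ball 0 r. \<gamma> t \<in> plane_curve F \<and> H (\<gamma> t) = k t) \<and>
      (\<forall>s>0. s \<le> r \<longrightarrow> (\<exists>W. open W \<and> p \<in> W \<and> W \<inter> plane_curve F \<subseteq> \<gamma> ` ball 0 s))"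
    proof (intro exI conjI)
      show "\<forall>t \<in> ball 0 (R p). \<Gamma> p t \<in> plane_curve F \<and> H (\<Gamma> p t) = K p t"
      proof
        fix t :: complex assume t: "t \<in> ball 0 (R p)"
        have g: "\<Gamma> p t \<in> plane_curve F" "related l m l' m' (K p t) (\<Gamma> p t)" "t \<noteq> 0 \<Longrightarrow> \<Gamma> p t \<notin> Z"
          using D t unfolding data_def by blast+
        show "\<Gamma> p t \<in> plane_curve F \<and> H (\<Gamma> p t) = K p t"
        proof (cases "t = 0")
          case True
          then show ?thesis using D g(1) by (simp add: data_def H_def)
        next
          case False
          then show ?thesis using uniq[OF g(1) g(3) relH[OF g(1)] g(2)] g(1) by blast
        qed
      qed
    qed (use D in \<open>auto simp: data_def\<close>)
  qed
  then show ?thesis using relH by metis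
qed

text \<open>The values of three independent linear forms determine the image point up to a factor.
  Each is a multiple of a form on the source, with proportionality constants that do not vary along
  the curve.\<close>

theorem linear:
  assumes top: "compact (plane_curve F)" "connected (plane_curve F)"
  shows "\<exists>A :: complex^3^3. invertible A \<and>
    (\<forall>v. v \<noteq> 0 \<longrightarrow> F v = 0 \<longrightarrow> f (abs_proj2 v) = abs_proj2 (A *v v))"
proof -
  obtain l m :: "3 \<Rightarrow> complex^3" where lm: "\<And>i. corresponding (l i) (m i)"
    and ind: "\<And>v. (\<And>i. cdot (l i) v = 0) \<Longrightarrow> v = 0" using three_lines by blast
  define Z where "Z = (\<Union>i. {p \<in> plane_curve F. on_line (m i) p})"
  have finZ: "finite Z" using card_line(1)[OF FF] lm d4 by (auto simp: Z_def corresponding_def transversal_def)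
  have d2: "d \<ge> 2" using d4 by simp
  obtain e0 e1 e2 where "pencil F d e0 e1 e2" using exists_pencil[OF FF d2] by blast
  then interpret s: pencil F d e0 e1 e2 .
  obtain e0' e1' e2' where "pencil F' d e0' e1' e2'" using exists_pencil[OF F' d2] by blast
  then interpret t: pencil F' d e0' e1' e2' .
  have "\<not> plane_curve F \<subseteq> Z" using finite_subset[OF _ finZ] s.infinite_curve by auto
  then obtain p where p: "p \<in> plane_curve F" "p \<notin> Z" by blast
  define v0 w0 where "v0 = rep_proj2 p" and "w0 = rep_proj2 (f p)"
  have vw0: "v0 \<noteq> 0" "w0 \<noteq> 0" "abs_proj2 v0 = p" "f p = abs_proj2 w0"
    by (simp_all add: v0_def w0_def rep_proj2_nonzero abs_rep_proj2)
  have m0: "cdot (m i) v0 \<noteq> 0" for i using p by (auto simp: Z_def on_line_def v0_def)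
  have "\<not> on_line (l i) (f p)" for i using p lm[of i] by (auto simp: Z_def corresponding_def)
  then have l0: "cdot (l i) w0 \<noteq> 0" for i by (simp add: on_line_def w0_def)
  \<comment> \<open>All pairwise constants are normalised at one point off the lines
    \<open>m i\<close>: there the constant for \<open>i\<close> and \<open>j\<close> is
    \<open>a i / a j\<close>. Scaling each \<open>m i\<close> by \<open>a i\<close> makes all of
    them 1.\<close>
  define a where "a i = cdot (l i) w0 / cdot (m i) v0" for i
  have a0: "a i \<noteq> 0" for i using m0 l0 by (simp add: a_def)
  have key: "cdot (l i) w * (a j * cdot (m j) v) = cdot (l j) w * (a i * cdot (m i) v)"
    if v: "v \<noteq> 0" "w \<noteq> 0" "F v = 0" "f (abs_proj2 v) = abs_proj2 w" for i j v w
  proof -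
    obtain c where c: "\<And>q. q \<in> plane_curve F \<Longrightarrow> related (l i) (m i) (l j) (m j) c q"
      using ratio_constant[OF top lm lm] by blast
    have "cdot (l i) w0 * cdot (m j) v0 = c * (cdot (l j) w0 * cdot (m i) v0)"
      using c[OF p(1)] vw0 unfolding related_def by blast
    then have "a i = c * a j" using m0[of i] m0[of j] by (simp add: a_def field_simps)
    moreover have "abs_proj2 v \<in> plane_curve F" using abs_in_plane_curve[OF FF(1) v(1)] v(3) by blast
    then have "cdot (l i) w * cdot (m j) v = c * (cdot (l j) w * cdot (m i) v)"
      using c v unfolding related_def by blast
    ultimately show ?thesis by (simp add: algebra_simps)
  qed
  define L :: "complex^3^3" where "L = (\<chi> i. l i)"
  define M :: "complex^3^3" where "M = (\<chi> i. a i *s m i)"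
  have Lv: "(L *v v) $ i = cdot (l i) v" for v i
    by (simp add: L_def matrix_vector_mult_def sum_3 cdot_def)
  have Mv: "(M *v v) $ i = a i * cdot (m i) v" for v i
    by (simp add: M_def matrix_vector_mult_def sum_3 cdot_def algebra_simps)
  have "\<forall>v. L *v v = 0 \<longrightarrow> v = 0" using ind Lv by (metis zero_index)
  then obtain L' where L': "L' ** L = mat 1" using matrix_left_invertible_ker by blast
  define A where "A = L' ** M"
  have A: "\<exists>\<kappa>. \<kappa> \<noteq> 0 \<and> A *v v = \<kappa> *s w"
    if v: "v \<noteq> 0" "w \<noteq> 0" "F v = 0" "f (abs_proj2 v) = abs_proj2 w" for v w
  proof -
    obtain j where j: "cdot (l j) w \<noteq> 0" using ind v(2) by blast
    have "abs_proj2 v \<in> plane_curve F" using abs_in_plane_curve[OF FF(1) v(1)] v(3) by blast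
    then have "\<not> on_line (m j) (abs_proj2 v)"
      using lm[of j] v(4) j on_line_abs[OF v(2)] by (auto simp: corresponding_def)
    then have mj: "cdot (m j) v \<noteq> 0" using on_line_abs[OF v(1)] by blast
    define \<kappa> where "\<kappa> = a j * cdot (m j) v / cdot (l j) w"
    have "M *v v = \<kappa> *s (L *v w)"
      using key[OF v, of _ j] j by (simp add: vec_eq_iff Mv Lv \<kappa>_def field_simps)
    then have "A *v v = \<kappa> *s (L' *v (L *v w))"
      by (simp add: A_def vector_scalar_commute flip: matrix_vector_mul_assoc)
    also have "L' *v (L *v w) = w" by (simp add: matrix_vector_mul_assoc L')
    finally show ?thesis using j mj a0 by (intro exI[of _ \<kappa>]) (simp add: \<kappa>_def)
  qed
  have fA: "f (abs_proj2 v) = abs_proj2 (A *v v)" if v: "v \<noteq> 0" "F v = 0" for v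
  proof -
    define w where "w = rep_proj2 (f (abs_proj2 v))"
    have w: "w \<noteq> 0" "f (abs_proj2 v) = abs_proj2 w" by (simp_all add: w_def rep_proj2_nonzero abs_rep_proj2)
    obtain \<kappa> where "\<kappa> \<noteq> 0" "A *v v = \<kappa> *s w" using A[OF v(1) w(1) v(2) w(2)] by blast
    then show ?thesis using w abs_proj2_smult by simp
  qed
  \<comment> \<open>A singular matrix would send the whole curve into a line, but the target is
    infinite while its section by a line is finite.\<close>
  have "invertible A"
  proof (rule ccontr)
    assume "\<not> invertible A"
    have "\<not> (\<exists>B. B ** transpose A = mat 1)"
    proof
      assume "\<exists>B. B ** transpose A = mat 1"
      then obtain B where "transpose (B ** transpose A) = transpose (mat 1)" by metis
      then have "A ** transpose B = mat 1" by (simp add: matrix_transpose_mul transpose_mat)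
      then have "invertible A" using invertible_right_inverse by blast
      then show False using \<open>\<not> invertible A\<close> by blast
    qed
    then obtain n where n: "transpose A *v n = 0" "n \<noteq> 0" using matrix_left_invertible_ker by blast
    have nA: "cdot n (A *v v) = 0" for v
    proof -
      have "cdot n (A *v v) = cdot (transpose A *v n) v"
        by (simp add: cdot_def matrix_vector_mult_def transpose_def sum_3 algebra_simps)
      then show ?thesis using n by simp
    qed
    have "plane_curve F' \<subseteq> {q \<in> plane_curve F'. on_line n q}"
    proof
      fix q assume q: "q \<in> plane_curve F'"
      then obtain p where p: "p \<in> plane_curve F" "q = f p" using bij by (auto simp: bij_betw_def)
      define v w where "v = rep_proj2 p" and "w = rep_proj2 q"
      have vw: "v \<noteq> 0" "w \<noteq> 0" "p = abs_proj2 v" "q = abs_proj2 w"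
        by (simp_all add: v_def w_def rep_proj2_nonzero abs_rep_proj2)
      have "F v = 0" using p(1) rep_plane_curve[OF FF(1)] by (simp add: v_def)
      then obtain \<kappa> where "\<kappa> \<noteq> 0" "A *v v = \<kappa> *s w" using A[OF vw(1,2)] p(2) vw by metis
      then have "cdot n w = 0" using nA[of v] by simp
      then show "q \<in> {q \<in> plane_curve F'. on_line n q}" using q on_line_abs[OF vw(2)] vw(4) by simp
    qed
    from finite_subset[OF this card_line(1)[OF F' d2 n(2)]] show False using t.infinite_curve by simp
  qed
  with fA show ?thesis by blast
qed

end

section \<open>Holomorphic and antiholomorphic maps in charts\<close>

text \<open>The conjugation \<open>\<kappa>\<close> is the identity for holomorphic and \<^const>\<open>cnj\<close> for antiholomorphic maps.\<close>

definition conjugation :: "(complex \<Rightarrow> complex) \<Rightarrow> bool" where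
  "conjugation \<kappa> \<longleftrightarrow> \<kappa> = (\<lambda>z. z) \<or> \<kappa> = cnj"

definition khol :: "(complex \<Rightarrow> complex) \<Rightarrow> 'a surface \<Rightarrow> 'b surface \<Rightarrow> ('a \<Rightarrow> 'b) \<Rightarrow> bool" where
  "khol \<kappa> S T f \<longleftrightarrow> continuous_map (top_of S) (top_of T) f \<and>
     (\<forall>(U, x) \<in> atlas S. \<forall>(V, y) \<in> atlas T.
        (\<lambda>z. \<kappa> (y (f (inv_into U x z)))) holomorphic_on x ` {p \<in> U. f p \<in> V})"

definition charted :: "'a surface \<Rightarrow> bool" where
  "charted S \<longleftrightarrow> (\<forall>(U, x) \<in> atlas S. complex_chart (top_of S) U x)"

lemma khol_id: "holomorphic_map S T f \<longleftrightarrow> khol (\<lambda>z. z) S T f"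
  by (simp add: holomorphic_map_def khol_def o_def)

lemma khol_cnj: "antiholomorphic_map S T f \<longleftrightarrow> khol cnj S T f"
  by (simp add: antiholomorphic_map_def khol_def o_def)

lemma conjugation_involution [simp]: "conjugation \<kappa> \<Longrightarrow> \<kappa> (\<kappa> z) = z"
  by (auto simp: conjugation_def)

lemma conjugation_compose:
  assumes "conjugation \<kappa>" "h holomorphic_on A" "open A"
  shows "(\<lambda>z. \<kappa> (h (\<kappa> z))) holomorphic_on \<kappa> ` A"
proof (cases "\<kappa> = cnj")
  case True
  have "cnj ` cnj ` A = A" by (force simp: image_image)
  moreover have "cnj ` A = cnj -` A" by (force simp: image_iff intro: bexI[of _ "cnj _"])
  then have "open (cnj ` A)" using assms(3) by (simp add: open_vimage continuous_on_cnj)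
  ultimately have "cnj \<circ> h \<circ> cnj holomorphic_on cnj ` A"
    using assms(2) by (intro holomorphic_on_compose_cnj_cnj) simp_all
  then show ?thesis by (simp add: True o_def)
qed (use assms in \<open>auto simp: conjugation_def\<close>)

lemma chart_inj: "complex_chart X U x \<Longrightarrow> inj_on x U"
proof -
  assume "complex_chart X U x"
  then have "U \<subseteq> topspace X" "homeomorphic_map (subtopology X U) (top_of_set (x ` U)) x"
    by (auto simp: complex_chart_def dest: openin_subset)
  then show ?thesis using homeomorphic_imp_injective_map by (force simp: inf_absorb2)
qed

lemma chart_image_open:
  assumes c: "complex_chart X U x" and N: "openin X N" "N \<subseteq> U"
  shows "open (x ` N)"
proof -
  have "openin (subtopology X U) N" using N by (metis inf.absorb_iff1 openin_subtopology)
  moreover have "open_map (subtopology X U) (top_of_set (x ` U)) x"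
    using c homeomorphic_imp_open_map by (auto simp: complex_chart_def)
  ultimately have "openin (top_of_set (x ` U)) (x ` N)" by (auto simp: open_map_def)
  then show ?thesis using c openin_open_trans by (auto simp: complex_chart_def)
qed

text \<open>Locally a chart of \<open>T\<close> is inserted between \<open>f\<close> and
  \<open>g\<close>. With \<open>h1\<close> and \<open>h2\<close> the holomorphic chart expressions,
  the composite is \<open>h1\<close> followed by
  \<open>\<lambda>z. \<kappa>1 (h2 (\<kappa>1 z))\<close>, and conjugating a holomorphic function on
  both sides leaves it holomorphic.\<close>

lemma khol_compose:
  assumes \<kappa>: "conjugation \<kappa>1" "conjugation \<kappa>2"
    and S: "charted S" and W: "charted W" and T: "riemann_surface T"
    and f: "khol \<kappa>1 S T f" and g: "khol \<kappa>2 T W g"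
  shows "khol (\<lambda>z. \<kappa>1 (\<kappa>2 z)) S W (\<lambda>p. g (f p))"
  unfolding khol_def
proof (intro conjI ballI)
  have cf: "continuous_map (top_of S) (top_of T) f" and cg: "continuous_map (top_of T) (top_of W) g"
    using f g by (auto simp: khol_def)
  show "continuous_map (top_of S) (top_of W) (\<lambda>p. g (f p))"
    using continuous_map_compose[OF cf cg] by (simp add: o_def)
  fix c1 assume c1: "c1 \<in> atlas S"
  obtain U x where c1x: "c1 = (U, x)" by (cases c1)
  have "(\<lambda>z. \<kappa>1 (\<kappa>2 (y (g (f (inv_into U x z)))))) holomorphic_on x ` {p \<in> U. g (f p) \<in> V}"
    if Vy: "(V, y) \<in> atlas W" for V y
  proof -
    have c12: "(U, x) \<in> atlas S" "(V, y) \<in> atlas W" using c1 c1x Vy by auto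
    have cx: "complex_chart (top_of S) U x" and cy: "complex_chart (top_of W) V y"
      using S W c12 by (auto simp: charted_def)
    have oU: "openin (top_of S) U" and oV: "openin (top_of W) V"
      using cx cy by (auto simp: complex_chart_def)
    let ?A = "{p \<in> U. g (f p) \<in> V}"
    let ?h = "\<lambda>z. \<kappa>1 (\<kappa>2 (y (g (f (inv_into U x z)))))"
    have "?h field_differentiable at z" if z: "z \<in> x ` ?A" for z
    proof -
      from z obtain p where p: "p \<in> U" "g (f p) \<in> V" "z = x p" by blast
      have pS: "p \<in> points S" using p(1) oU openin_subset by blast
      then have "f p \<in> points T" using cf by (auto simp: continuous_map_def Pi_iff)
      then obtain T0 c where tc: "(T0, c) \<in> atlas T" "f p \<in> T0"
        using T unfolding riemann_surface_def by blast
      have cc: "complex_chart (top_of T) T0 c" using T tc(1) by (auto simp: riemann_surface_def)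
      have oT: "openin (top_of T) T0" using cc by (auto simp: complex_chart_def)
      define D2 where "D2 = c ` {q \<in> T0. g q \<in> V}"
      define h1 h2 where "h1 z = \<kappa>1 (c (f (inv_into U x z)))" and "h2 z = \<kappa>2 (y (g (inv_into T0 c z)))" for z
      have h1: "h1 holomorphic_on x ` {p \<in> U. f p \<in> T0}"
        using f c12(1) tc(1) unfolding khol_def h1_def by blast
      have h2: "h2 holomorphic_on D2"
        using g c12(2) tc(1) unfolding khol_def h2_def D2_def by blast
      have oD2: "open D2" unfolding D2_def
        by (rule chart_image_open[OF cc openin_continuous_map_preimage_gen[OF cg oT oV]]) auto
      define O1 where "O1 = {p \<in> U. f p \<in> {q \<in> T0. g q \<in> V}}"
      have oO: "open (x ` O1)" unfolding O1_def
        by (rule chart_image_open[OF cx openin_continuous_map_preimage_gen[OF cf oU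
              openin_continuous_map_preimage_gen[OF cg oT oV]]]) auto
      have zO: "z \<in> x ` O1" using p tc(2) by (auto simp: O1_def)
      have h1D: "h1 z' \<in> \<kappa>1 ` D2" and hh: "?h z' = \<kappa>1 (h2 (\<kappa>1 (h1 z')))" if z': "z' \<in> x ` O1" for z'
      proof -
        obtain q where q: "q \<in> O1" "z' = x q" using z' by blast
        then have i: "inv_into U x z' = q" using chart_inj[OF cx] by (simp add: O1_def)
        have fq: "f q \<in> T0" "g (f q) \<in> V" using q by (auto simp: O1_def)
        show "h1 z' \<in> \<kappa>1 ` D2" using fq by (auto simp: h1_def i D2_def)
        show "?h z' = \<kappa>1 (h2 (\<kappa>1 (h1 z')))"
          using chart_inj[OF cc] fq \<kappa> by (simp add: h1_def h2_def i)
      qed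
      have "(\<lambda>z. \<kappa>1 (h2 (\<kappa>1 z))) holomorphic_on \<kappa>1 ` D2" by (rule conjugation_compose[OF \<kappa>(1) h2 oD2])
      moreover have "h1 holomorphic_on x ` O1" by (rule holomorphic_on_subset[OF h1]) (auto simp: O1_def)
      ultimately have "((\<lambda>z. \<kappa>1 (h2 (\<kappa>1 z))) \<circ> h1) holomorphic_on x ` O1"
        using h1D by (intro holomorphic_on_compose_gen[of h1 _ _ "\<kappa>1 ` D2"]) auto
      then have "?h holomorphic_on x ` O1"
        by (rule holomorphic_transform) (use hh in \<open>simp add: o_def\<close>)
      then show ?thesis using oO zO holomorphic_on_imp_differentiable_at by blast
    qed
    then show ?thesis by (simp add: holomorphic_on_def field_differentiable_at_within)
  qed
  then show "case c1 of (U, x) \<Rightarrow> \<forall>(V, y) \<in> atlas W.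
      (\<lambda>z. \<kappa>1 (\<kappa>2 (y (g (f (inv_into U x z)))))) holomorphic_on x ` {p \<in> U. g (f p) \<in> V}"
    using c1x by auto
qed

section \<open>Charts of plane curves\<close>

lemma partial_deriv_smult:
  assumes "homog (Suc k) F"
  shows "partial_deriv i F (c *s v) = c ^ k * partial_deriv i F v"
  using homog_smult[OF homog_partial[OF assms]] .

lemma abs_in_curve_rep: "p \<in> plane_curve F \<Longrightarrow> homog d F \<Longrightarrow> rep_proj2 p \<noteq> 0 \<and> F (rep_proj2 p) = 0"
  using rep_plane_curve rep_proj2_nonzero by blast

text \<open>Shows that the atlas covers the curve. The holomorphic \<open>g\<close> expresses the
  third affine coordinate through the chart, so homogeneous coordinates can be recovered from the
  chart value.\<close>

lemma curve_chart:
  assumes F: "homog d F" "nonsingular_form F" "d \<ge> 1" and p: "p \<in> plane_curve F"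
  shows "\<exists>U x i j k g. (U, x) \<in> atlas (curve_surface F) \<and> p \<in> U \<and> i \<noteq> j \<and> j \<noteq> k \<and> i \<noteq> k \<and>
    g holomorphic_on x ` U \<and> (\<forall>v. v \<noteq> 0 \<longrightarrow> abs_proj2 v \<in> U \<longrightarrow>
       v $ i \<noteq> 0 \<and> x (abs_proj2 v) = v $ j / v $ i \<and> v $ k / v $ i = g (v $ j / v $ i))"
proof -
  obtain e where e: "d = Suc e" using F(3) by (cases d) auto
  define v0 where "v0 = rep_proj2 p"
  have v0: "v0 \<noteq> 0" "F v0 = 0" "abs_proj2 v0 = p"
    using abs_in_curve_rep[OF p F(1)] by (auto simp: v0_def abs_rep_proj2)
  obtain k where k: "partial_deriv k F v0 \<noteq> 0"
    using F(2) v0 unfolding nonsingular_form_def by blast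
  \<comment> \<open>If only the coordinate \<open>k\<close> were nonzero, Euler's relation would
    give \<open>v0 $ k * partial_deriv k F v0 = 0\<close>.\<close>
  have "\<exists>i. i \<noteq> k \<and> v0 $ i \<noteq> 0"
  proof (rule ccontr)
    assume n: "\<not> ?thesis"
    then have "v0 = v0 $ k *s axis k 1" by (auto simp: vec_eq_iff axis_def)
    then have "v0 $ k * partial_deriv k F v0 = grad F v0 v0"
      by (metis grad_axis grad_linear(2))
    also have "\<dots> = 0" using homog_euler[OF F(1)] v0 by simp
    finally have "v0 $ k = 0" using k by simp
    then show False using n v0(1) by (metis vec_eq_iff zero_index)
  qed
  then obtain i where i: "i \<noteq> k" "v0 $ i \<noteq> 0" by blast
  have "\<not> (UNIV :: 3 set) \<subseteq> {i, k}"
  proof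
    assume "(UNIV :: 3 set) \<subseteq> {i, k}"
    then have "card (UNIV :: 3 set) \<le> card {i, k}" by (intro card_mono) auto
    then show False using i by simp
  qed
  then obtain j where "j \<notin> {i, k}" by blast
  then have j: "i \<noteq> j" "j \<noteq> k" by auto
  have "{i, j, k} = (UNIV :: 3 set)" by (rule card_seteq) (use i j in auto)
  then have ex: "l = i \<or> l = j \<or> l = k" for l by blast
  define N where "N \<xi> \<eta> = axis i 1 + \<xi> *s axis j 1 + \<eta> *s (axis k 1 :: complex^3)" for \<xi> \<eta>
  have Nc: "N \<xi> \<eta> $ i = 1" "N \<xi> \<eta> $ j = \<xi>" "N \<xi> \<eta> $ k = \<eta>" for \<xi> \<eta>
    using i j by (auto simp: N_def axis_def)
  have N0: "N \<xi> \<eta> \<noteq> 0" for \<xi> \<eta> using Nc(1)[of \<xi> \<eta>] by (metis zero_index zero_neq_one)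
  have Nv: "v = v $ i *s N (v $ j / v $ i) (v $ k / v $ i)" if "v $ i \<noteq> 0" for v
    unfolding vec_eq_iff
  proof
    fix l show "v $ l = (v $ i *s N (v $ j / v $ i) (v $ k / v $ i)) $ l"
      using ex[of l] that Nc by auto
  qed
  define a b where "a = v0 $ j / v0 $ i" and "b = v0 $ k / v0 $ i"
  have vN: "v0 = v0 $ i *s N a b" using Nv[OF i(2)] by (simp add: a_def b_def)
  have z: "F (N a b) = 0" using v0(2) i(2) homog_smult[OF F(1), of "v0 $ i" "N a b"] vN by simp
  have gn: "grad F (N a b) (axis k 1) \<noteq> 0"
    using k partial_deriv_smult[of e F k "v0 $ i" "N a b"] F(1) e vN by (auto simp: grad_axis)
  obtain r g0 where r: "r > 0" "g0 holomorphic_on ball 0 r" "g0 0 = 0"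
    and gz: "\<And>x. x \<in> ball 0 r \<Longrightarrow> F (N a b + x *s axis j 1 + g0 x *s axis k 1) = 0"
    and gu: "\<forall>\<^sub>F z in nhds (0, 0). F (N a b + fst z *s axis j 1 + snd z *s axis k 1) = 0 \<longrightarrow> snd z = g0 (fst z)"
    using implicit_function[OF F(1) z gn] by blast
  define g where "g \<xi> = b + g0 (\<xi> - a)" for \<xi>
  have shift: "N \<xi> \<eta> = N a b + (\<xi> - a) *s axis j 1 + (\<eta> - b) *s axis k 1" for \<xi> \<eta>
    by (simp add: N_def vector_sub_rdistrib)
  have hg: "g holomorphic_on ball a r" unfolding g_def using r(2)
    by (auto intro!: holomorphic_intros holomorphic_on_compose_gen[of "\<lambda>y. y - a", unfolded o_def]
        simp: dist_norm norm_minus_commute)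
  have gzero: "F (N \<xi> (g \<xi>)) = 0" if "\<xi> \<in> ball a r" for \<xi>
  proof -
    have "\<xi> - a \<in> ball 0 r" using that by (simp add: dist_norm norm_minus_commute)
    from gz[OF this] show ?thesis by (subst shift) (simp add: g_def)
  qed
  obtain M where M: "open M" "(0, 0) \<in> M"
    "\<And>z. z \<in> M \<Longrightarrow> F (N a b + fst z *s axis j 1 + snd z *s axis k 1) = 0 \<Longrightarrow> snd z = g0 (fst z)"
    using gu unfolding eventually_nhds by blast
  have contN: "continuous_on A f \<Longrightarrow> continuous_on A h \<Longrightarrow> continuous_on A (\<lambda>z. N (f z) (h z))" for A :: "complex set" and f h
    unfolding N_def by (intro continuous_intros)
  have cg: "continuous_on (ball a r) g" using hg by (rule holomorphic_on_imp_continuous_on)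
  have cpd: "continuous_on UNIV (partial_deriv k F)"
    using homog_continuous[OF homog_partial] F(1) e by blast
  \<comment> \<open>The image of the chart: the graph stays in the neighbourhood where the implicit
    function is unique, and the partial derivative demanded by the atlas is nonzero on it.\<close>
  define D where "D = ball a r \<inter> (\<lambda>\<xi>. (\<xi> - a, g \<xi> - b)) -` M \<inter> (\<lambda>\<xi>. partial_deriv k F (N \<xi> (g \<xi>))) -` (- {0})"
  have oD: "open D"
  proof -
    have 1: "open (ball a r \<inter> (\<lambda>\<xi>. (\<xi> - a, g \<xi> - b)) -` M)"
      by (rule continuous_open_preimage[OF _ open_ball M(1)]) (intro continuous_intros cg)
    have 2: "open (ball a r \<inter> (\<lambda>\<xi>. partial_deriv k F (N \<xi> (g \<xi>))) -` (- {0}))"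
      by (rule continuous_open_preimage[OF _ open_ball])
        (auto intro!: continuous_on_compose2[OF cpd] contN continuous_intros cg)
    have "D = (ball a r \<inter> (\<lambda>\<xi>. (\<xi> - a, g \<xi> - b)) -` M) \<inter> (ball a r \<inter> (\<lambda>\<xi>. partial_deriv k F (N \<xi> (g \<xi>))) -` (- {0}))"
      by (auto simp: D_def)
    with 1 2 show ?thesis by (simp only: open_Int)
  qed
  have aD: "a \<in> D" using r M gn by (simp add: D_def g_def grad_axis)
  define P where "P v \<longleftrightarrow> v $ i \<noteq> 0 \<and> (v $ j / v $ i - a, v $ k / v $ i - b) \<in> M \<and> v $ j / v $ i \<in> D" for v
  have oP: "open {q. P (rep_proj2 q)}"
  proof (rule open_proj2I)
    have o: "open {v::complex^3. v $ i \<noteq> 0}" by (rule open_Collect_neq) (auto intro!: continuous_intros)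
    have "open ({v. v $ i \<noteq> 0} \<inter> (\<lambda>v. (v $ j / v $ i - a, v $ k / v $ i - b)) -` M)"
      "open ({v. v $ i \<noteq> 0} \<inter> (\<lambda>v. v $ j / v $ i) -` D)"
      by (auto intro!: continuous_open_preimage[OF _ o] M oD continuous_intros)
    moreover have "{v. v \<noteq> 0 \<and> P v} = ({v. v $ i \<noteq> 0} \<inter> (\<lambda>v. (v $ j / v $ i - a, v $ k / v $ i - b)) -` M)
        \<inter> ({v. v $ i \<noteq> 0} \<inter> (\<lambda>v. v $ j / v $ i) -` D)"
      by (auto simp: P_def)
    ultimately show "open {v. v \<noteq> 0 \<and> P v}" by (simp only: open_Int)
  qed (simp add: P_def)
  define U where "U = plane_curve F \<inter> {q. P (rep_proj2 q)}"
  define x where "x q = rep_proj2 q $ j / rep_proj2 q $ i" for q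
  define \<psi> where "\<psi> \<xi> = abs_proj2 (N \<xi> (g \<xi>))" for \<xi>
  have xabs: "x (abs_proj2 v) = v $ j / v $ i" if v: "v \<noteq> 0" for v
  proof -
    obtain c where "c \<noteq> 0" "rep_proj2 (abs_proj2 v) = c *s v" using rep_abs_proj2[OF v] .
    then show ?thesis by (simp add: x_def)
  qed
  have Pabs: "P (rep_proj2 (abs_proj2 v)) \<longleftrightarrow> P v" if v: "v \<noteq> 0" for v
  proof -
    obtain c where "c \<noteq> 0" "rep_proj2 (abs_proj2 v) = c *s v" using rep_abs_proj2[OF v] .
    then show ?thesis by (simp add: P_def)
  qed
  have onU: "v $ i \<noteq> 0 \<and> x (abs_proj2 v) = v $ j / v $ i \<and> v $ k / v $ i = g (v $ j / v $ i) \<and>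
      v $ j / v $ i \<in> D \<and> partial_deriv k F v \<noteq> 0 \<and> abs_proj2 v = \<psi> (v $ j / v $ i)"
    if v: "v \<noteq> 0" "abs_proj2 v \<in> U" for v
  proof -
    have Pv: "P v" and Fv: "F v = 0"
      using v Pabs abs_in_plane_curve[OF F(1)] by (auto simp: U_def)
    then have vi: "v $ i \<noteq> 0" and m: "(v $ j / v $ i - a, v $ k / v $ i - b) \<in> M" and d: "v $ j / v $ i \<in> D"
      by (auto simp: P_def)
    define \<xi> \<eta> where "\<xi> = v $ j / v $ i" and "\<eta> = v $ k / v $ i"
    have vn: "v = v $ i *s N \<xi> \<eta>" unfolding \<xi>_def \<eta>_def by (rule Nv[OF vi])
    have "F (N \<xi> \<eta>) = 0" using Fv vi homog_smult[OF F(1), of "v $ i" "N \<xi> \<eta>"] vn by simp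
    then have "F (N a b + fst (\<xi> - a, \<eta> - b) *s axis j 1 + snd (\<xi> - a, \<eta> - b) *s axis k 1) = 0"
      by (simp only: fst_conv snd_conv flip: shift)
    then have "snd (\<xi> - a, \<eta> - b) = g0 (fst (\<xi> - a, \<eta> - b))"
      by (rule M(3)[rotated]) (use m in \<open>simp add: \<xi>_def \<eta>_def\<close>)
    then have "\<eta> - b = g0 (\<xi> - a)" by simp
    then have \<eta>: "\<eta> = g \<xi>" by (simp add: g_def algebra_simps)
    have "partial_deriv k F v = (v $ i) ^ e * partial_deriv k F (N \<xi> (g \<xi>))"
      using partial_deriv_smult[of e F k "v $ i" "N \<xi> \<eta>"] F(1) e vn \<eta> by simp
    then have "partial_deriv k F v \<noteq> 0" using vi d by (simp add: D_def \<xi>_def)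
    moreover have "abs_proj2 v = \<psi> \<xi>"
      using abs_proj2_smult[OF N0 vi, of \<xi> \<eta>] vn \<eta> by (simp add: \<psi>_def)
    ultimately show ?thesis using vi d xabs[OF v(1)] \<eta> by (simp add: \<xi>_def \<eta>_def)
  qed
  have \<psi>U: "\<psi> \<xi> \<in> U" and x\<psi>: "x (\<psi> \<xi>) = \<xi>" if "\<xi> \<in> D" for \<xi>
  proof -
    have "\<psi> \<xi> \<in> plane_curve F" unfolding \<psi>_def
      using gzero[of \<xi>] that abs_in_plane_curve[OF F(1) N0] by (auto simp: D_def)
    moreover have "P (N \<xi> (g \<xi>))" using that by (simp add: P_def Nc D_def)
    ultimately show "\<psi> \<xi> \<in> U" using Pabs[OF N0] by (simp add: U_def \<psi>_def)
    show "x (\<psi> \<xi>) = \<xi>" using xabs[OF N0] by (simp add: \<psi>_def Nc)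
  qed
  have xU: "x q \<in> D" "\<psi> (x q) = q" if "q \<in> U" for q
    using onU[OF rep_proj2_nonzero, of q] that by (auto simp: abs_rep_proj2)
  have im: "x ` U = D" using xU \<psi>U x\<psi> by (auto simp: image_iff) metis
  have cx: "continuous_on U x" unfolding continuous_on_topological
  proof (intro ballI allI impI)
    fix q B assume q: "q \<in> U" and B: "open B" "x q \<in> B"
    have "open {q. rep_proj2 q $ i \<noteq> 0 \<and> rep_proj2 q $ j / rep_proj2 q $ i \<in> B}"
    proof (rule open_proj2I[where P = "\<lambda>v. v $ i \<noteq> 0 \<and> v $ j / v $ i \<in> B"])
      have o: "open {v::complex^3. v $ i \<noteq> 0}" by (rule open_Collect_neq) (auto intro!: continuous_intros)
      have "open ({v. v $ i \<noteq> 0} \<inter> (\<lambda>v. v $ j / v $ i) -` B)"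
        by (auto intro!: continuous_open_preimage[OF _ o] B continuous_intros)
      moreover have "{v. v \<noteq> 0 \<and> v $ i \<noteq> 0 \<and> v $ j / v $ i \<in> B} = {v. v $ i \<noteq> 0} \<inter> (\<lambda>v. v $ j / v $ i) -` B"
        by auto
      ultimately show "open {v. v \<noteq> 0 \<and> v $ i \<noteq> 0 \<and> v $ j / v $ i \<in> B}" by simp
    qed simp
    then show "\<exists>A. open A \<and> q \<in> A \<and> (\<forall>y\<in>U. y \<in> A \<longrightarrow> x y \<in> B)"
      using q B by (intro exI[of _ "{q. rep_proj2 q $ i \<noteq> 0 \<and> rep_proj2 q $ j / rep_proj2 q $ i \<in> B}"])
        (auto simp: U_def P_def x_def)
  qed
  have c\<psi>: "continuous_on D \<psi>" unfolding \<psi>_def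
    by (rule continuous_on_compose2[OF continuous_abs_proj2])
      (use N0 in \<open>auto intro!: contN continuous_intros continuous_on_subset[OF cg] simp: D_def\<close>)
  have sub: "subtopology (top_of_set (plane_curve F)) U = top_of_set U"
    by (simp add: subtopology_subtopology U_def)
  have "homeomorphic_maps (top_of_set U) (top_of_set D) x \<psi>"
    unfolding homeomorphic_maps_def
    using cx c\<psi> xU \<psi>U x\<psi> by (auto simp: continuous_map_in_subtopology)
  then have "homeomorphic_map (top_of_set U) (top_of_set D) x" by (rule homeomorphic_maps_imp_map)
  moreover have "openin (top_of_set (plane_curve F)) U" unfolding U_def by (rule openin_open_Int[OF oP])
  ultimately have "complex_chart (top_of_set (plane_curve F)) U x"
    unfolding complex_chart_def by (simp add: sub im oD)
  then have "(U, x) \<in> atlas (curve_surface F)"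
    using onU i j unfolding curve_surface_def by auto
  moreover have "p \<in> U" using xU \<psi>U[OF aD] v0 vN abs_proj2_smult[OF N0 i(2), of a b] by (simp add: \<psi>_def g_def r)
  moreover have "g holomorphic_on x ` U" unfolding im by (rule holomorphic_on_subset[OF hg]) (auto simp: D_def)
  ultimately show ?thesis using onU i j by blast
qed

section \<open>Conformal and anticonformal automorphisms are projective\<close>

definition kvec :: "(complex \<Rightarrow> complex) \<Rightarrow> complex^3 \<Rightarrow> complex^3" where
  "kvec \<kappa> v = (\<chi> i. \<kappa> (v $ i))"

lemma kvec_nth [simp]: "kvec \<kappa> v $ i = \<kappa> (v $ i)"
  by (simp add: kvec_def)

lemma kvec_id [simp]: "kvec (\<lambda>z. z) v = v"
  by (simp add: vec_eq_iff)

lemma kvec_cnj_involution [simp]: "kvec cnj (kvec cnj v) = v"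
  by (simp add: vec_eq_iff)

lemma kvec_cnj_smult: "kvec cnj (c *s v) = cnj c *s kvec cnj v"
  and kvec_cnj_add: "kvec cnj (v + w) = kvec cnj v + kvec cnj w"
  by (simp_all add: vec_eq_iff)

lemma kvec_cnj_eq_0 [simp]: "kvec cnj v = 0 \<longleftrightarrow> v = 0"
  by (simp add: vec_eq_iff)

lemma kvec_conjugation:
  assumes "conjugation \<kappa>"
  shows "kvec \<kappa> v = 0 \<longleftrightarrow> v = 0" "\<kappa> 1 = 1" "\<kappa> 0 = 0" "kvec \<kappa> (c *s v) = \<kappa> c *s kvec \<kappa> v"
  using assms by (auto simp: conjugation_def vec_eq_iff)

lemma top_of_curve [simp]: "top_of (curve_surface F) = top_of_set (plane_curve F)"
  by (simp add: curve_surface_def)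

lemma charted_curve: "charted (curve_surface F)"
  by (auto simp: charted_def curve_surface_def)

text \<open>In a chart of the target the image is given by one function \<open>Y\<close>, made
  holomorphic by \<open>\<kappa>\<close>. The other affine coordinate follows from
  \<open>curve_chart\<close>, conjugated on both sides so that it remains holomorphic in the
  parameter.\<close>

lemma khol_lift:
  assumes \<kappa>: "conjugation \<kappa>" and d: "d \<ge> 1"
    and F: "homog d F" "nonsingular_form F" and F': "homog d F'" "nonsingular_form F'"
    and f: "khol \<kappa> (curve_surface F) (curve_surface F') f"
    and r: "r > 0" and \<gamma>: "hol_vec \<gamma> (ball b r)" "\<And>t. t \<in> ball b r \<Longrightarrow> \<gamma> t \<noteq> 0 \<and> F (\<gamma> t) = 0"
  shows "\<exists>s \<delta>. 0 < s \<and> s \<le> r \<and> hol_vec \<delta> (ball b s) \<and>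
    (\<forall>t \<in> ball b s. \<delta> t \<noteq> 0 \<and> f (abs_proj2 (\<gamma> t)) = abs_proj2 (kvec \<kappa> (\<delta> t)))"
proof -
  have cf: "continuous_map (top_of_set (plane_curve F)) (top_of_set (plane_curve F')) f"
    using f by (simp add: khol_def)
  define q where "q t = abs_proj2 (\<gamma> t)" for t
  have qC: "q t \<in> plane_curve F" if "t \<in> ball b r" for t
    using \<gamma>(2)[OF that] abs_in_plane_curve[OF F(1)] by (simp add: q_def)
  have bb: "b \<in> ball b r" using r by simp
  have fC: "f p \<in> plane_curve F'" if "p \<in> plane_curve F" for p
    using cf that by (auto simp: continuous_map_def Pi_iff)
  obtain U x i j where U: "(U, x) \<in> atlas (curve_surface F)" "q b \<in> U"
    "\<And>v. v \<noteq> 0 \<Longrightarrow> abs_proj2 v \<in> U \<Longrightarrow> v $ i \<noteq> 0 \<and> x (abs_proj2 v) = v $ j / v $ i"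
    using curve_chart[OF F d qC[OF bb]] by metis
  obtain V y i' j' k' g where V: "(V, y) \<in> atlas (curve_surface F')" "f (q b) \<in> V"
    "i' \<noteq> j'" "j' \<noteq> k'" "i' \<noteq> k'" and g: "g holomorphic_on y ` V"
    and Vc: "\<And>v. v \<noteq> 0 \<Longrightarrow> abs_proj2 v \<in> V \<Longrightarrow> v $ i' \<noteq> 0 \<and> y (abs_proj2 v) = v $ j' / v $ i' \<and>
      v $ k' / v $ i' = g (v $ j' / v $ i')"
    using curve_chart[OF F' d fC[OF qC[OF bb]]] by metis
  have cU: "complex_chart (top_of_set (plane_curve F)) U x"
    and cV: "complex_chart (top_of_set (plane_curve F')) V y"
    using U(1) V(1) by (auto simp: curve_surface_def)
  have oU: "openin (top_of_set (plane_curve F)) U" and oV: "openin (top_of_set (plane_curve F')) V"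
    and oyV: "open (y ` V)" using cU cV by (auto simp: complex_chart_def)
  define O1 where "O1 = {p \<in> U. f p \<in> V}"
  have oO: "openin (top_of_set (plane_curve F)) O1" unfolding O1_def
    by (rule openin_continuous_map_preimage_gen[OF cf oU oV])
  have h: "(\<lambda>z. \<kappa> (y (f (inv_into U x z)))) holomorphic_on x ` O1"
    using f U(1) V(1) unfolding khol_def O1_def by blast
  have "continuous_on (ball b r) q" unfolding q_def
    by (rule continuous_on_compose2[OF continuous_abs_proj2 hol_vec_continuous[OF \<gamma>(1)]]) (use \<gamma>(2) in auto)
  moreover obtain W where W: "open W" "O1 = plane_curve F \<inter> W" using oO by (auto simp: openin_open)
  ultimately have "open (ball b r \<inter> q -` W)" using continuous_open_preimage open_ball by blast
  moreover have "b \<in> ball b r \<inter> q -` W" using bb U(2) V(2) W(2) by (auto simp: O1_def)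
  ultimately obtain s where s: "s > 0" "ball b s \<subseteq> ball b r \<inter> q -` W" by (meson open_contains_ball)
  define s' where "s' = min s r"
  have s': "0 < s'" "s' \<le> r" "ball b s' \<subseteq> ball b r" "ball b s' \<subseteq> ball b s" using s r by (auto simp: s'_def)
  have qO: "q t \<in> O1" if "t \<in> ball b s'" for t
    using that s' s(2) W(2) qC by blast
  have gi: "\<gamma> t $ i \<noteq> 0" "x (q t) = \<gamma> t $ j / \<gamma> t $ i" if "t \<in> ball b s'" for t
    using U(3)[of "\<gamma> t"] qO[OF that] \<gamma>(2)[of t] that s'(3) by (auto simp: q_def O1_def)
  define Y where "Y t = \<kappa> (y (f (q t)))" for t
  have "(\<lambda>t. \<gamma> t $ j / \<gamma> t $ i) holomorphic_on ball b s'"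
    using \<gamma>(1) s'(3) gi(1) by (intro holomorphic_intros) (auto simp: hol_vec_def intro: holomorphic_on_subset)
  moreover have "(\<lambda>t. \<gamma> t $ j / \<gamma> t $ i) ` ball b s' \<subseteq> x ` O1"
    using gi(2) qO by (metis (no_types, lifting) image_eqI image_subsetI)
  ultimately have "((\<lambda>z. \<kappa> (y (f (inv_into U x z)))) \<circ> (\<lambda>t. \<gamma> t $ j / \<gamma> t $ i)) holomorphic_on ball b s'"
    by (intro holomorphic_on_compose_gen[OF _ h])
  then have hY: "Y holomorphic_on ball b s'"
  proof (rule holomorphic_transform)
    fix t assume t: "t \<in> ball b s'"
    have "inv_into U x (x (q t)) = q t" using chart_inj[OF cU] qO[OF t] by (simp add: O1_def)
    then show "((\<lambda>z. \<kappa> (y (f (inv_into U x z)))) \<circ> (\<lambda>t. \<gamma> t $ j / \<gamma> t $ i)) t = Y t"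
      using gi(2)[OF t] by (simp add: Y_def)
  qed
  have YV: "Y ` ball b s' \<subseteq> \<kappa> ` y ` V" using qO by (auto simp: Y_def O1_def)
  have "((\<lambda>z. \<kappa> (g (\<kappa> z))) \<circ> Y) holomorphic_on ball b s'"
    by (rule holomorphic_on_compose_gen[OF hY conjugation_compose[OF \<kappa> g oyV] YV])
  then have hg: "(\<lambda>t. \<kappa> (g (\<kappa> (Y t)))) holomorphic_on ball b s'" by (simp add: o_def)
  define \<delta> where "\<delta> t = axis i' 1 + Y t *s axis j' 1 + \<kappa> (g (\<kappa> (Y t))) *s axis k' (1::complex)" for t
  have "hol_vec \<delta> (ball b s')" unfolding \<delta>_def
    by (intro hol_vec_add hol_vec_const hol_vec_smult hY hg)
  moreover have "\<delta> t \<noteq> 0 \<and> f (q t) = abs_proj2 (kvec \<kappa> (\<delta> t))" if t: "t \<in> ball b s'" for t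
  proof
    have "\<delta> t $ i' = 1" using V by (simp add: \<delta>_def axis_def)
    then show d0: "\<delta> t \<noteq> 0" by (metis zero_index zero_neq_one)
    define w where "w = rep_proj2 (f (q t))"
    have w: "w \<noteq> 0" "abs_proj2 w = f (q t)" by (simp_all add: w_def rep_proj2_nonzero abs_rep_proj2)
    have wV: "w $ i' \<noteq> 0" "y (f (q t)) = w $ j' / w $ i'" "w $ k' / w $ i' = g (w $ j' / w $ i')"
      using Vc[OF w(1)] w(2) qO[OF t] by (auto simp: O1_def)
    have wjk: "w $ j' = w $ i' * y (f (q t))" "w $ k' = w $ i' * g (y (f (q t)))"
      using wV(1) by (simp_all add: wV(2) flip: wV(3))
    have "{i', j', k'} = (UNIV :: 3 set)" by (rule card_seteq) (use V in auto)
    then have ex: "l = i' \<or> l = j' \<or> l = k'" for l by blast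
    have "w = w $ i' *s kvec \<kappa> (\<delta> t)"
      unfolding vec_eq_iff
    proof
      fix l show "w $ l = (w $ i' *s kvec \<kappa> (\<delta> t)) $ l"
        using ex[of l] V wjk kvec_conjugation(2,3)[OF \<kappa>] \<kappa>
        by (auto simp: \<delta>_def axis_def Y_def)
    qed
    then show "f (q t) = abs_proj2 (kvec \<kappa> (\<delta> t))"
      using w(2) abs_proj2_smult[of "kvec \<kappa> (\<delta> t)" "w $ i'"] wV(1) d0 kvec_conjugation(1)[OF \<kappa>] by metis
  qed
  ultimately show ?thesis using s' unfolding q_def by blast
qed

text \<open>The form with conjugated coefficients; its curve is the image of the given one under
  \<open>pcnj\<close>.\<close>

definition conj_form :: "(complex^3 \<Rightarrow> complex) \<Rightarrow> complex^3 \<Rightarrow> complex" where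
  "conj_form F v = cnj (F (kvec cnj v))"

definition pcnj :: "proj2 \<Rightarrow> proj2" where
  "pcnj q = abs_proj2 (kvec cnj (rep_proj2 q))"

lemma pcnj_abs: "v \<noteq> 0 \<Longrightarrow> pcnj (abs_proj2 v) = abs_proj2 (kvec cnj v)"
proof -
  assume v: "v \<noteq> 0"
  obtain c where "c \<noteq> 0" "rep_proj2 (abs_proj2 v) = c *s v" using rep_abs_proj2[OF v] .
  then show ?thesis using v by (simp add: pcnj_def kvec_cnj_smult abs_proj2_smult)
qed

lemma pcnj_involution [simp]: "pcnj (pcnj q) = q"
  using pcnj_abs[of "kvec cnj (rep_proj2 q)"] rep_proj2_nonzero by (simp add: pcnj_def abs_rep_proj2)

lemma homog_conj_form: "homog k F \<Longrightarrow> homog k (conj_form F)"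
proof (induction rule: homog.induct)
  case (const c) show ?case unfolding conj_form_def by (rule homog.const)
next
  case (coord i) show ?case unfolding conj_form_def by (simp add: homog.coord[of i, simplified])
next
  case (add k f g) then show ?case unfolding conj_form_def by (simp add: homog.add)
next
  case (mult j f k g) then show ?case unfolding conj_form_def by (simp add: homog.mult)
qed

lemma bounded_linear_kvec_cnj: "bounded_linear (kvec cnj)"
  by (intro linear_conv_bounded_linear[THEN iffD1] linearI) (simp_all add: vec_eq_iff)

text \<open>The partial derivatives are the conjugates of those of \<open>F\<close> at the conjugate
  point. They are compared through real total derivatives, since conjugation is only real
  linear.\<close>

lemma nonsingular_conj_form:
  assumes F: "homog d F" "nonsingular_form F"
  shows "nonsingular_form (conj_form F)"
  unfolding nonsingular_form_def
proof (intro allI impI)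
  fix v assume v: "v \<noteq> 0 \<and> conj_form F v = 0"
  then obtain k where k: "partial_deriv k F (kvec cnj v) \<noteq> 0"
    using F(2) unfolding nonsingular_form_def conj_form_def by (metis complex_cnj_zero_iff kvec_cnj_eq_0)
  have "(F has_derivative grad F (kvec cnj v)) (at (kvec cnj v))" by (rule homog_has_derivative[OF F(1)])
  then have "((\<lambda>v. F (kvec cnj v)) has_derivative (\<lambda>h. grad F (kvec cnj v) (kvec cnj h))) (at v)"
    by (rule has_derivative_compose[OF bounded_linear_imp_has_derivative[OF bounded_linear_kvec_cnj]])
  then have "(conj_form F has_derivative (\<lambda>h. cnj (grad F (kvec cnj v) (kvec cnj h)))) (at v)"
    unfolding conj_form_def[abs_def] by (rule bounded_linear.has_derivative[OF bounded_linear_cnj])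
  from has_derivative_unique[OF this homog_has_derivative[OF homog_conj_form[OF F(1)]]]
  have "grad (conj_form F) v (axis k 1) = cnj (grad F (kvec cnj v) (kvec cnj (axis k 1)))" by (metis)
  moreover have "kvec cnj (axis k 1) = axis k 1" by (simp add: vec_eq_iff axis_def)
  ultimately have "partial_deriv k (conj_form F) v \<noteq> 0" using k by (simp add: grad_axis)
  then show "\<exists>k. partial_deriv k (conj_form F) v \<noteq> 0" by blast
qed

lemma pcnj_plane_curve:
  assumes "homog d F"
  shows "bij_betw pcnj (plane_curve F) (plane_curve (conj_form F))"
proof (rule bij_betwI[where g = pcnj])
  show "pcnj \<in> plane_curve F \<rightarrow> plane_curve (conj_form F)"
    using abs_in_plane_curve[OF homog_conj_form[OF assms]] rep_plane_curve[OF assms] rep_proj2_nonzero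
    by (auto simp: pcnj_def conj_form_def)
  show "pcnj \<in> plane_curve (conj_form F) \<rightarrow> plane_curve F"
    using abs_in_plane_curve[OF assms] rep_plane_curve[OF homog_conj_form[OF assms]] rep_proj2_nonzero
    by (auto simp: pcnj_def conj_form_def)
qed auto

lemma continuous_pcnj: "continuous_on A pcnj"
proof -
  have "open (pcnj -` B)" if "open B" for B
  proof -
    have "open {v. v \<noteq> 0 \<and> abs_proj2 v \<in> B}" using that by (simp add: open_proj2_def)
    then have "open (kvec cnj -` {v. v \<noteq> 0 \<and> abs_proj2 v \<in> B})"
      by (rule open_vimage) (rule linear_continuous_on[OF bounded_linear_kvec_cnj])
    moreover have "kvec cnj -` {v. v \<noteq> 0 \<and> abs_proj2 v \<in> B} = {v. v \<noteq> 0 \<and> abs_proj2 v \<in> pcnj -` B}"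
      by (auto simp: pcnj_abs)
    ultimately show ?thesis unfolding open_proj2_def by simp
  qed
  then have "continuous_on UNIV pcnj" by (simp add: continuous_on_open_vimage)
  then show ?thesis using continuous_on_subset by blast
qed

lemma curve_automorphism_linear:
  assumes \<kappa>: "conjugation \<kappa>" and d: "d \<ge> 4" and F: "homog d F" "nonsingular_form F"
    and top: "compact (plane_curve F)" "connected (plane_curve F)"
    and bij: "bij_betw f (plane_curve F) (plane_curve F)"
    and f: "khol \<kappa> (curve_surface F) (curve_surface F) f"
  shows "\<exists>A :: complex^3^3. invertible A \<and>
    (\<forall>v. v \<noteq> 0 \<longrightarrow> F v = 0 \<longrightarrow> f (abs_proj2 v) = abs_proj2 (kvec \<kappa> (A *v v)))"
proof -
  have d1: "d \<ge> 1" using d by simp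
  have cf: "continuous_on (plane_curve F) f"
    using f by (simp add: khol_def continuous_map_in_subtopology)
  note lift = khol_lift[OF \<kappa> d1 F F f]
  show ?thesis
  proof (cases "\<kappa> = cnj")
    case False
    then have k: "\<kappa> = (\<lambda>z. z)" using \<kappa> by (auto simp: conjugation_def)
    have "hol_lift F f" unfolding hol_lift_def
      by (intro allI impI) (use lift in \<open>simp add: k\<close>)
    then interpret curve_iso F F d f
      by unfold_locales (use F d bij cf in auto)
    show ?thesis using linear[OF top] by (simp add: k)
  next
    case True
    have "hol_lift F (\<lambda>p. pcnj (f p))" unfolding hol_lift_def
    proof (intro allI impI)
      fix \<gamma> b r assume g: "r > 0" "hol_vec \<gamma> (ball b r)" "\<forall>t\<in>ball b r. \<gamma> t \<noteq> 0 \<and> F (\<gamma> t) = 0"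
      obtain s \<delta> where s: "0 < s" "s \<le> r" "hol_vec \<delta> (ball b s)"
        "\<forall>t \<in> ball b s. \<delta> t \<noteq> 0 \<and> f (abs_proj2 (\<gamma> t)) = abs_proj2 (kvec cnj (\<delta> t))"
        using lift[OF g(1,2)] g(3) True by blast
      then have "\<forall>t \<in> ball b s. \<delta> t \<noteq> 0 \<and> pcnj (f (abs_proj2 (\<gamma> t))) = abs_proj2 (\<delta> t)"
        by (simp add: pcnj_abs)
      with s show "\<exists>s \<delta>. 0 < s \<and> s \<le> r \<and> hol_vec \<delta> (ball b s) \<and>
          (\<forall>t\<in>ball b s. \<delta> t \<noteq> 0 \<and> pcnj (f (abs_proj2 (\<gamma> t))) = abs_proj2 (\<delta> t))" by blast
    qed
    moreover have "bij_betw (\<lambda>p. pcnj (f p)) (plane_curve F) (plane_curve (conj_form F))"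
      using bij_betw_trans[OF bij pcnj_plane_curve[OF F(1)]] by (simp add: o_def)
    moreover have "continuous_on (plane_curve F) (\<lambda>p. pcnj (f p))"
      by (rule continuous_on_compose2[OF continuous_pcnj[of UNIV] cf]) simp
    ultimately interpret curve_iso F "conj_form F" d "\<lambda>p. pcnj (f p)"
      by unfold_locales (use F d homog_conj_form nonsingular_conj_form in auto)
    obtain A :: "complex^3^3" where A: "invertible A"
      "\<And>v. v \<noteq> 0 \<Longrightarrow> F v = 0 \<Longrightarrow> pcnj (f (abs_proj2 v)) = abs_proj2 (A *v v)"
      using linear[OF top] by blast
    have "f (abs_proj2 v) = abs_proj2 (kvec cnj (A *v v))" if "v \<noteq> 0" "F v = 0" for v
      using A(2)[OF that] pcnj_abs[OF invertible_mult_vec_nonzero[OF A(1) that(1)]]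
      by (metis pcnj_involution)
    with A(1) True show ?thesis by blast
  qed
qed

text \<open>The automorphism is transported to the plane curve by \<open>\<phi>\<close>, which also
  carries over the compactness and connectedness of the surface.\<close>

lemma automorphism_linear:
  assumes S: "compact_riemann_surface S" and d: "d \<ge> 4" and model: "plane_model S d F \<phi>"
    and \<kappa>: "conjugation \<kappa>" and \<sigma>: "\<sigma> \<in> Bij (points S)" "khol \<kappa> S S \<sigma>"
  shows "\<exists>A :: complex^3^3. invertible A \<and>
    (\<forall>p \<in> points S. \<phi> (\<sigma> p) = abs_proj2 (kvec \<kappa> (A *v rep_proj2 (\<phi> p))))"
proof -
  have F: "homog d F" "nonsingular_form F" using model form_imp_homog by (auto simp: plane_model_def)
  have RS: "riemann_surface S" using S by (simp add: compact_riemann_surface_def)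
  have chS: "charted S" using RS by (auto simp: riemann_surface_def charted_def)
  define \<psi> where "\<psi> = inv_into (points S) \<phi>"
  have bij: "bij_betw \<phi> (points S) (plane_curve F)"
    and h\<phi>: "khol (\<lambda>z. z) S (curve_surface F) \<phi>" and h\<psi>: "khol (\<lambda>z. z) (curve_surface F) S \<psi>"
    using model by (simp_all add: plane_model_def biholomorphic_map_def khol_id \<psi>_def)
  have id: "conjugation (\<lambda>z. z)" by (simp add: conjugation_def)
  have "khol (\<lambda>z. z) (curve_surface F) S \<psi> \<Longrightarrow> khol \<kappa> (curve_surface F) S (\<lambda>q. \<sigma> (\<psi> q))"
    using khol_compose[OF id \<kappa> charted_curve chS RS h\<psi> \<sigma>(2)] by simp
  then have 1: "khol \<kappa> (curve_surface F) S (\<lambda>q. \<sigma> (\<psi> q))" using h\<psi> by blast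
  have 2: "khol \<kappa> (curve_surface F) (curve_surface F) (\<lambda>q. \<phi> (\<sigma> (\<psi> q)))"
    using khol_compose[OF \<kappa> id charted_curve charted_curve RS 1 h\<phi>] by simp
  have b\<psi>: "bij_betw \<psi> (plane_curve F) (points S)" unfolding \<psi>_def by (rule bij_betw_inv_into[OF bij])
  have b\<sigma>: "bij_betw \<sigma> (points S) (points S)" using \<sigma>(1) by (simp add: Bij_def)
  have 3: "bij_betw (\<lambda>q. \<phi> (\<sigma> (\<psi> q))) (plane_curve F) (plane_curve F)"
    using bij_betw_trans[OF bij_betw_trans[OF b\<psi> b\<sigma>] bij] by (simp add: o_def)
  have cm: "continuous_map (top_of S) (top_of_set (plane_curve F)) \<phi>" using h\<phi> by (simp add: khol_def)
  have im: "\<phi> ` points S = plane_curve F" using bij by (simp add: bij_betw_def)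
  have "compactin (top_of S) (points S)"
    using S by (simp add: compact_riemann_surface_def compact_space_def)
  from image_compactin[OF this cm] have top1: "compact (plane_curve F)"
    by (simp add: im compactin_subtopology)
  have "connected_space (top_of S)" using RS unfolding riemann_surface_def by blast
  then have "connectedin (top_of S) (points S)" by (simp add: connectedin_topspace)
  from connectedin_continuous_map_image[OF cm this] have top2: "connected (plane_curve F)"
    by (simp add: im connectedin_subtopology)
  obtain A :: "complex^3^3" where A: "invertible A"
    "\<And>v. v \<noteq> 0 \<Longrightarrow> F v = 0 \<Longrightarrow> \<phi> (\<sigma> (\<psi> (abs_proj2 v))) = abs_proj2 (kvec \<kappa> (A *v v))"
    using curve_automorphism_linear[OF \<kappa> d F top1 top2 3 2] by blast
  have "\<phi> (\<sigma> p) = abs_proj2 (kvec \<kappa> (A *v rep_proj2 (\<phi> p)))" if p: "p \<in> points S" for p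
  proof -
    have "\<phi> p \<in> plane_curve F" using p im by blast
    then have "F (rep_proj2 (\<phi> p)) = 0" using rep_plane_curve[OF F(1)] by blast
    moreover have "\<psi> (abs_proj2 (rep_proj2 (\<phi> p))) = p"
      using bij p by (simp add: \<psi>_def abs_rep_proj2 bij_betw_def)
    ultimately show ?thesis using A(2)[OF rep_proj2_nonzero, of "\<phi> p"] by simp
  qed
  with A(1) show ?thesis by blast
qed

section \<open>The projective linear group\<close>

lemma PGL3_coset:
  assumes "T \<in> carrier PGL3"
  obtains M where "invertible M" "T = {mat c ** M | c. c \<noteq> 0}"
proof -
  obtain M where "invertible M" "T = scalars3 #>\<^bsub>GL3\<^esub> M"
    using assms by (auto simp: PGL3_def carrier_FactGroup GL3_def)
  then show ?thesis using that by (auto simp: r_coset_def scalars3_def GL3_def)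
qed

lemma PGL3_same_class:
  assumes "T \<in> carrier PGL3" "A \<in> T" "B \<in> T"
  obtains c where "c \<noteq> 0" "B = mat c ** A"
proof -
  obtain M where "T = {mat c ** M | c. c \<noteq> 0}" using PGL3_coset[OF assms(1)] by blast
  then obtain a b where "a \<noteq> 0" "b \<noteq> 0" "A = mat a ** M" "B = mat b ** M" using assms by blast
  then have "b / a \<noteq> 0" "B = mat (b / a) ** A" by (simp_all add: matrix_mul_assoc mat_mult_mat)
  with that show ?thesis by blast
qed

lemma PGL3_class:
  assumes "invertible A"
  obtains T where "T \<in> carrier PGL3" "A \<in> T"
proof -
  have "A \<in> carrier GL3" using assms by (simp add: GL3_def)
  then have "scalars3 #>\<^bsub>GL3\<^esub> A \<in> carrier PGL3" by (auto simp: PGL3_def carrier_FactGroup)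
  moreover have "mat 1 \<otimes>\<^bsub>GL3\<^esub> A \<in> scalars3 #>\<^bsub>GL3\<^esub> A"
    unfolding r_coset_def scalars3_def by (force intro: exI[of _ 1])
  then have "A \<in> scalars3 #>\<^bsub>GL3\<^esub> A" by (simp add: GL3_def)
  ultimately show ?thesis using that by blast
qed

lemma PGL3_mult_mem: "A \<in> T \<Longrightarrow> B \<in> T' \<Longrightarrow> A ** B \<in> T \<otimes>\<^bsub>PGL3\<^esub> T'"
  unfolding PGL3_def FactGroup_def set_mult_def by (auto simp: GL3_def)

lemma PGL3_invertible: "T \<in> carrier PGL3 \<Longrightarrow> A \<in> T \<Longrightarrow> invertible A"
  using PGL3_coset invertible_mult invertible_mat by (smt (verit) mem_Collect_eq)

text \<open>\<open>Q\<close> is the image of the fixed points under a matrix of \<open>g\<close>.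
  The conclusion speaks of eigenvectors, with the eigenvalue free to vary with \<open>q\<close>, so
  that it applies to every representing matrix.\<close>

lemma conjugate_fixed_points:
  assumes G: "subgroup G PGL3" and g: "g \<in> carrier PGL3"
    and inf: "infinite {p. \<forall>T \<in> G. pgl_act T p = p}"
  shows "\<exists>Q. infinite Q \<and> (\<forall>T \<in> g <#\<^bsub>PGL3\<^esub> (G #>\<^bsub>PGL3\<^esub> inv\<^bsub>PGL3\<^esub> g). \<forall>A \<in> T. \<forall>q \<in> Q.
    \<exists>s. A *v rep_proj2 q = s *s rep_proj2 q)"
proof -
  interpret group PGL3 by (rule group_PGL3)
  let ?Fix = "{p. \<forall>T \<in> G. pgl_act T p = p}"
  have ig: "inv\<^bsub>PGL3\<^esub> g \<in> carrier PGL3" using g by simp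
  obtain P where P: "invertible P" "P \<in> g" using PGL3_coset[OF g] PGL3_invertible[OF g]
    by (metis (mono_tags, lifting) mem_Collect_eq one_neq_zero)
  obtain P' where P': "P' \<in> inv\<^bsub>PGL3\<^esub> g" using PGL3_coset[OF ig]
    by (metis (mono_tags, lifting) mem_Collect_eq one_neq_zero)
  have "P' ** P \<in> inv\<^bsub>PGL3\<^esub> g \<otimes>\<^bsub>PGL3\<^esub> g" using PGL3_mult_mem P' P(2) by blast
  then have "P' ** P \<in> scalars3" using l_inv[OF g] by (simp add: PGL3_def FactGroup_def)
  then obtain k where k: "P' ** P = mat k" by (auto simp: scalars3_def)
  define h where "h p = abs_proj2 (P *v rep_proj2 p)" for p
  have nz: "P *v rep_proj2 p \<noteq> 0" for p by (rule invertible_mult_vec_nonzero[OF P(1) rep_proj2_nonzero])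
  have "inj h"
  proof (rule injI)
    fix p q assume "h p = h q"
    then obtain c where c: "c \<noteq> 0" "P *v rep_proj2 q = c *s (P *v rep_proj2 p)"
      using abs_proj2_eq_iff[OF nz nz] by (auto simp: h_def)
    then have "P *v (rep_proj2 q - c *s rep_proj2 p) = 0"
      by (simp add: matrix_vector_mult_diff_distrib vector_scalar_commute)
    then have "rep_proj2 q - c *s rep_proj2 p = 0" using invertible_mult_vec_nonzero[OF P(1)] by blast
    then have "rep_proj2 q = c *s rep_proj2 p" by simp
    then show "p = q" using c(1) abs_proj2_smult[OF rep_proj2_nonzero] by (metis abs_rep_proj2)
  qed
  then have "inj_on h ?Fix" by (rule inj_on_subset) simp
  then have "infinite (h ` ?Fix)" using inf finite_imageD[of h ?Fix] by blast
  moreover have "\<exists>s. A *v rep_proj2 q = s *s rep_proj2 q"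
    if T: "T \<in> g <#\<^bsub>PGL3\<^esub> (G #>\<^bsub>PGL3\<^esub> inv\<^bsub>PGL3\<^esub> g)" and A: "A \<in> T" and q: "q \<in> h ` ?Fix" for T A q
  proof -
    obtain t where t: "t \<in> G" "T = g \<otimes>\<^bsub>PGL3\<^esub> (t \<otimes>\<^bsub>PGL3\<^esub> inv\<^bsub>PGL3\<^esub> g)"
      using T by (auto simp: l_coset_def r_coset_def)
    have tc: "t \<in> carrier PGL3" using G t(1) subgroup.mem_carrier by metis
    then have Tc: "T \<in> carrier PGL3" using t(2) g by simp
    obtain B where B: "B \<in> t" using PGL3_coset[OF tc] by (metis (mono_tags, lifting) mem_Collect_eq one_neq_zero)
    have "P ** (B ** P') \<in> T" unfolding t(2) by (intro PGL3_mult_mem P B P')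
    then obtain c where c: "c \<noteq> 0" "A = mat c ** (P ** (B ** P'))" using PGL3_same_class[OF Tc _ A] by blast
    obtain p where p: "p \<in> ?Fix" "q = h p" using q by blast
    define v where "v = rep_proj2 p"
    have v: "v \<noteq> 0" "abs_proj2 v = p" by (simp_all add: v_def rep_proj2_nonzero abs_rep_proj2)
    have "pgl_act t (abs_proj2 v) = abs_proj2 v" using p(1) t(1) v(2) by simp
    then have "abs_proj2 v = abs_proj2 (B *v v)" using pgl_act_eq[OF tc B v(1)] by simp
    moreover have "B *v v \<noteq> 0" by (rule invertible_mult_vec_nonzero[OF PGL3_invertible[OF tc B] v(1)])
    ultimately obtain s where s: "B *v v = s *s v" using abs_proj2_eq_iff[OF v(1)] by blast
    have "P' *v (P *v v) = k *s v" by (simp add: matrix_vector_mul_assoc k mat_mult_vec)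
    then have "A *v (P *v v) = (c * k * s) *s (P *v v)"
      unfolding c(2) by (simp add: mat_mult_vec s vector_scalar_commute vector_smult_assoc
          flip: matrix_vector_mul_assoc)
    moreover obtain a where "a \<noteq> 0" "rep_proj2 q = a *s (P *v v)"
      using rep_abs_proj2[OF nz[of p]] p(2) by (metis h_def v_def)
    ultimately have "A *v rep_proj2 q = (c * k * s) *s rep_proj2 q"
      by (simp add: vector_scalar_commute vector_smult_assoc mult_ac)
    then show ?thesis by blast
  qed
  ultimately show ?thesis by blast
qed


section \<open>Semilinear maps\<close>

definition semilinear :: "(complex \<Rightarrow> complex) \<Rightarrow> (complex^3 \<Rightarrow> complex^3) \<Rightarrow> bool" where
  "semilinear \<kappa> L \<longleftrightarrow> (\<forall>v w. L (v + w) = L v + L w) \<and> (\<forall>c v. L (c *s v) = \<kappa> c *s L v) \<and>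
     (\<forall>v. L v = 0 \<longrightarrow> v = 0)"

lemma semilinearD:
  assumes "semilinear \<kappa> L"
  shows "L (v + w) = L v + L w" "L (c *s v) = \<kappa> c *s L v" "L v = 0 \<Longrightarrow> v = 0"
  using assms by (auto simp: semilinear_def)

lemma semilinear_matrix:
  assumes "conjugation \<kappa>" "invertible A"
  shows "semilinear \<kappa> (\<lambda>v. kvec \<kappa> (A *v v))"
  unfolding semilinear_def
proof (intro conjI allI impI)
  have add: "kvec \<kappa> (v + w) = kvec \<kappa> v + kvec \<kappa> w" for v w
    using assms(1) by (auto simp: conjugation_def kvec_cnj_add)
  show "kvec \<kappa> (A *v (v + w)) = kvec \<kappa> (A *v v) + kvec \<kappa> (A *v w)" for v w
    by (simp only: matrix_vector_right_distrib add)
  show "kvec \<kappa> (A *v (c *s v)) = \<kappa> c *s kvec \<kappa> (A *v v)" for c v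
    by (simp only: vector_scalar_commute kvec_conjugation(4)[OF assms(1)])
  show "v = 0" if "kvec \<kappa> (A *v v) = 0" for v
    using that kvec_conjugation(1)[OF assms(1)] invertible_mult_vec_nonzero[OF assms(2)] by blast
qed

lemma semilinear_compose:
  assumes "semilinear \<kappa> L" "semilinear \<kappa>' L'"
  shows "semilinear (\<lambda>c. \<kappa> (\<kappa>' c)) (\<lambda>v. L (L' v))"
  unfolding semilinear_def
proof (intro conjI allI impI)
  show "L (L' (v + w)) = L (L' v) + L (L' w)" for v w
    by (simp only: semilinearD(1)[OF assms(1)] semilinearD(1)[OF assms(2)])
  show "L (L' (c *s v)) = \<kappa> (\<kappa>' c) *s L (L' v)" for c v
    by (simp only: semilinearD(2)[OF assms(1)] semilinearD(2)[OF assms(2)])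
  show "v = 0" if "L (L' v) = 0" for v
    using that semilinearD(3) assms by blast
qed

lemma semilinear_0:
  assumes "semilinear \<kappa> L"
  shows "L 0 = 0"
  using semilinearD(1)[OF assms, of 0 0] by simp

lemma semilinear_independent:
  assumes \<kappa>: "conjugation \<kappa>" and L: "semilinear \<kappa> L" and D: "cdet a b c \<noteq> 0"
    and z: "x *s L a + y *s L b + w *s L c = 0"
  shows "x = 0 \<and> y = 0 \<and> w = 0"
proof -
  have "L (\<kappa> x *s a + \<kappa> y *s b + \<kappa> w *s c) = 0"
    using z \<kappa> by (simp add: semilinearD(1,2)[OF L])
  then have "\<kappa> x *s a + \<kappa> y *s b + \<kappa> w *s c = 0" by (rule semilinearD(3)[OF L])
  from basis_coords_zero[OF D this] show ?thesis
    using \<kappa> by (auto simp: conjugation_def)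
qed


section \<open>The automorphism group of a plane model\<close>

locale plane_surface =
  fixes S :: "'a surface" and d :: nat and F :: "complex^3 \<Rightarrow> complex" and \<phi> :: "'a \<Rightarrow> proj2"
  assumes S: "compact_riemann_surface S" and d4: "d \<ge> 4" and model: "plane_model S d F \<phi>"
begin

lemma F: "homog d F" "nonsingular_form F" and d2: "d \<ge> 2"
  using model form_imp_homog d4 by (auto simp: plane_model_def)

lemma RS: "riemann_surface S"
  using S by (simp add: compact_riemann_surface_def)

lemma charted: "charted S"
  using RS unfolding riemann_surface_def charted_def by blast

lemma bij_model: "bij_betw \<phi> (points S) (plane_curve F)"
  using model by (simp add: plane_model_def biholomorphic_map_def)

definition autK :: "(complex \<Rightarrow> complex) \<Rightarrow> ('a \<Rightarrow> 'a) set" where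
  "autK \<kappa> = {f \<in> Bij (points S). khol \<kappa> S S f \<and> khol \<kappa> S S (inv_into (points S) f)}"

lemma conformal_autK: "conformal_automorphisms S = autK (\<lambda>z. z)"
  by (auto simp: conformal_automorphisms_def autK_def biholomorphic_map_def khol_id Bij_def)

lemma anticonformal_autK: "anticonformal_automorphisms S = autK cnj"
  by (auto simp: anticonformal_automorphisms_def autK_def khol_cnj)

text \<open>Elements of \<open>Bij\<close> are extensional, so restricted composites and inverses
  agree with the plain functions only on the points of the surface.\<close>

lemma khol_cong:
  assumes "\<And>p. p \<in> points S \<Longrightarrow> f p = g p" "khol \<kappa> S S f"
  shows "khol \<kappa> S S g"
  unfolding khol_def
proof (intro conjI ballI)
  show "continuous_map (top_of S) (top_of S) g"
    using assms by (auto simp: khol_def intro: continuous_map_eq)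
  fix c1 assume c1: "c1 \<in> atlas S"
  obtain U x where Ux: "c1 = (U, x)" by (cases c1)
  have "complex_chart (top_of S) U x" using charted c1 Ux by (auto simp: charted_def)
  then have U: "U \<subseteq> points S" unfolding complex_chart_def using openin_subset by blast
  have "(\<lambda>z. \<kappa> (y (g (inv_into U x z)))) holomorphic_on x ` {p \<in> U. g p \<in> V}" if "(V, y) \<in> atlas S" for V y
  proof -
    have e: "{p \<in> U. g p \<in> V} = {p \<in> U. f p \<in> V}" using assms(1) U by auto
    have "(\<lambda>z. \<kappa> (y (f (inv_into U x z)))) holomorphic_on x ` {p \<in> U. f p \<in> V}"
      using assms(2) c1 Ux that unfolding khol_def by blast
    then show ?thesis unfolding e
    proof (rule holomorphic_transform)
      fix z assume "z \<in> x ` {p \<in> U. f p \<in> V}"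
      then have "inv_into U x z \<in> U" by (auto intro: inv_into_into)
      then show "\<kappa> (y (f (inv_into U x z))) = \<kappa> (y (g (inv_into U x z)))" using assms(1) U by auto
    qed
  qed
  then show "case c1 of (U, x) \<Rightarrow> \<forall>(V, y) \<in> atlas S.
      (\<lambda>z. \<kappa> (y (g (inv_into U x z)))) holomorphic_on x ` {p \<in> U. g p \<in> V}"
    using Ux by auto
qed

lemma BijD:
  assumes "f \<in> Bij (points S)"
  shows "bij_betw f (points S) (points S)" "\<And>p. p \<in> points S \<Longrightarrow> f p \<in> points S"
    "\<And>p. p \<in> points S \<Longrightarrow> inv_into (points S) f (f p) = p" "f \<in> extensional (points S)"
  using assms by (auto simp: Bij_def bij_betw_def)

lemma autK_compose:
  assumes \<kappa>: "conjugation \<kappa>" "conjugation \<kappa>'" and f: "f \<in> autK \<kappa>" and g: "g \<in> autK \<kappa>'"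
  shows "compose (points S) f g \<in> autK (\<lambda>z. \<kappa> (\<kappa>' z))"
proof -
  let ?X = "points S"
  have fB: "f \<in> Bij ?X" and gB: "g \<in> Bij ?X" using f g by (auto simp: autK_def)
  have comm: "(\<lambda>z. \<kappa>' (\<kappa> z)) = (\<lambda>z. \<kappa> (\<kappa>' z))" using \<kappa> by (auto simp: conjugation_def)
  have B: "compose ?X f g \<in> Bij ?X" using fB gB by (rule compose_Bij)
  have "khol (\<lambda>z. \<kappa>' (\<kappa> z)) S S (\<lambda>p. f (g p))"
    using khol_compose[OF \<kappa>(2,1) charted charted RS] f g by (simp add: autK_def)
  then have 1: "khol (\<lambda>z. \<kappa> (\<kappa>' z)) S S (compose ?X f g)"
    unfolding comm by (rule khol_cong[rotated]) (simp add: compose_def)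
  have "khol (\<lambda>z. \<kappa> (\<kappa>' z)) S S (\<lambda>p. inv_into ?X g (inv_into ?X f p))"
    using khol_compose[OF \<kappa> charted charted RS] f g by (simp add: autK_def)
  then have 2: "khol (\<lambda>z. \<kappa> (\<kappa>' z)) S S (inv_into ?X (compose ?X f g))"
  proof (rule khol_cong[rotated])
    fix p assume p: "p \<in> ?X"
    obtain q where q: "q \<in> ?X" "p = f q" using p BijD(1)[OF fB] by (auto simp: bij_betw_def)
    obtain r where r: "r \<in> ?X" "q = g r" using q BijD(1)[OF gB] by (auto simp: bij_betw_def)
    have "inv_into ?X (compose ?X f g) (compose ?X f g r) = r" by (rule BijD(3)[OF B r(1)])
    then show "inv_into ?X g (inv_into ?X f p) = inv_into ?X (compose ?X f g) p"
      using q r BijD(3)[OF fB q(1)] BijD(3)[OF gB r(1)] by (simp add: compose_def)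
  qed
  show ?thesis using B 1 2 by (simp add: autK_def)
qed

lemma subgroup_conformal: "subgroup (conformal_automorphisms S) (BijGroup (points S))"
proof -
  let ?X = "points S"
  interpret group "BijGroup ?X" by (rule group_BijGroup)
  have c: "conjugation (\<lambda>z. z)" by (simp add: conjugation_def)
  have inv_cong: "khol (\<lambda>z. z) S S (restrict (inv_into ?X f) ?X)" if "f \<in> autK (\<lambda>z. z)" for f
    by (rule khol_cong[of "inv_into ?X f"]) (use that in \<open>simp_all add: autK_def\<close>)
  \<comment> \<open>Holomorphy of the identity is the compatibility of the charts.\<close>
  have id: "khol (\<lambda>z. z) S S (\<lambda>p. p)"
  proof -
    have "(\<lambda>z. y (inv_into U x z)) holomorphic_on x ` {p \<in> U. p \<in> V}"
      if "(U, x) \<in> atlas S" "(V, y) \<in> atlas S" for U x V y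
    proof -
      have "y \<circ> inv_into U x holomorphic_on x ` (U \<inter> V)"
        using RS that unfolding riemann_surface_def by blast
      moreover have "U \<inter> V = {p \<in> U. p \<in> V}" by auto
      ultimately show ?thesis by (simp add: o_def)
    qed
    then show ?thesis by (auto simp: khol_def)
  qed
  show ?thesis unfolding conformal_autK
  proof (rule subgroupI)
    show "autK (\<lambda>z. z) \<subseteq> carrier (BijGroup ?X)" by (auto simp: autK_def BijGroup_def)
    have idB: "(\<lambda>p\<in>?X. p) \<in> Bij ?X" by (rule id_Bij)
    have "(\<lambda>p\<in>?X. p) \<in> autK (\<lambda>z. z)" unfolding autK_def
    proof (intro CollectI conjI idB)
      show "khol (\<lambda>z. z) S S (\<lambda>p\<in>?X. p)" by (rule khol_cong[OF _ id]) simp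
      show "khol (\<lambda>z. z) S S (inv_into ?X (\<lambda>p\<in>?X. p))"
        by (rule khol_cong[OF _ id]) (use BijD(3)[OF idB] in simp)
    qed
    then show "autK (\<lambda>z. z) \<noteq> {}" by blast
    fix f assume f: "f \<in> autK (\<lambda>z. z)"
    then have fB: "f \<in> Bij ?X" by (simp add: autK_def)
    have iB: "restrict (inv_into ?X f) ?X \<in> Bij ?X" using fB by (rule restrict_inv_into_Bij)
    show "inv\<^bsub>BijGroup ?X\<^esub> f \<in> autK (\<lambda>z. z)" unfolding inv_BijGroup[OF fB] autK_def
    proof (intro CollectI conjI iB inv_cong[OF f])
      have "khol (\<lambda>z. z) S S f" using f by (simp add: autK_def)
      then show "khol (\<lambda>z. z) S S (inv_into ?X (restrict (inv_into ?X f) ?X))"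
      proof (rule khol_cong[rotated])
        fix p assume p: "p \<in> ?X"
        have fp: "f p \<in> ?X" by (rule BijD(2)[OF fB p])
        have "inv_into ?X (restrict (inv_into ?X f) ?X) (restrict (inv_into ?X f) ?X (f p)) = f p"
          by (rule BijD(3)[OF iB fp])
        then show "f p = inv_into ?X (restrict (inv_into ?X f) ?X) p"
          using fp BijD(3)[OF fB p] by simp
      qed
    qed
    fix g assume g: "g \<in> autK (\<lambda>z. z)"
    then have gB: "g \<in> Bij ?X" by (simp add: autK_def)
    show "f \<otimes>\<^bsub>BijGroup ?X\<^esub> g \<in> autK (\<lambda>z. z)"
      using autK_compose[OF c c f g] fB gB by (simp add: BijGroup_def)
  qed
qed

lemma Aut_plus_simps:
  "carrier (Aut_plus S) = autK (\<lambda>z. z)"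
  "\<one>\<^bsub>Aut_plus S\<^esub> = (\<lambda>p\<in>points S. p)"
  "f \<in> autK (\<lambda>z. z) \<Longrightarrow> g \<in> autK (\<lambda>z. z) \<Longrightarrow> f \<otimes>\<^bsub>Aut_plus S\<^esub> g = compose (points S) f g"
  by (auto simp: Aut_plus_def conformal_autK BijGroup_def autK_def)

lemma group_Aut_plus: "group (Aut_plus S)"
  unfolding Aut_plus_def
  by (rule subgroup.subgroup_is_group[OF subgroup_conformal group_BijGroup])

definition induced :: "('a \<Rightarrow> 'a) \<Rightarrow> (complex^3 \<Rightarrow> complex^3) \<Rightarrow> bool" where
  "induced f L \<longleftrightarrow> (\<forall>p \<in> points S. \<phi> (f p) = abs_proj2 (L (rep_proj2 (\<phi> p))))"

lemma induced_compose:
  assumes L: "semilinear \<kappa> L" "semilinear \<kappa>' L'" and \<kappa>: "conjugation \<kappa>"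
    and f: "induced f L" and g: "induced g L'" "g \<in> Bij (points S)"
  shows "induced (compose (points S) f g) (\<lambda>v. L (L' v))"
  unfolding induced_def
proof
  fix p assume p: "p \<in> points S"
  define v where "v = L' (rep_proj2 (\<phi> p))"
  have v: "v \<noteq> 0" using semilinearD(3)[OF L(2)] rep_proj2_nonzero by (auto simp: v_def)
  have gp: "g p \<in> points S" by (rule BijD(2)[OF g(2) p])
  have "\<phi> (g p) = abs_proj2 v" using g(1) p by (simp add: induced_def v_def)
  then obtain c where c: "c \<noteq> 0" "rep_proj2 (\<phi> (g p)) = c *s v" using rep_abs_proj2[OF v] by metis
  have "\<kappa> c \<noteq> 0" using \<kappa> c(1) by (auto simp: conjugation_def)
  moreover have "L v \<noteq> 0" using semilinearD(3)[OF L(1)] v by blast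
  ultimately have "abs_proj2 (L (c *s v)) = abs_proj2 (L v)"
    by (simp add: semilinearD(2)[OF L(1)] abs_proj2_smult)
  then show "\<phi> (compose (points S) f g p) = abs_proj2 (L (L' (rep_proj2 (\<phi> p))))"
    using f gp p c(2) by (simp add: induced_def compose_def v_def)
qed

lemma induced_eq:
  assumes "f \<in> Bij (points S)" "g \<in> Bij (points S)" "\<And>p. p \<in> points S \<Longrightarrow> \<phi> (f p) = \<phi> (g p)"
  shows "f = g"
proof (rule extensionalityI[OF BijD(4)[OF assms(1)] BijD(4)[OF assms(2)]])
  fix p assume p: "p \<in> points S"
  then show "f p = g p"
    using assms(3)[OF p] BijD(2)[OF assms(1) p] BijD(2)[OF assms(2) p] bij_model
    by (auto simp: bij_betw_def inj_on_def)
qed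

lemma induced_exists:
  assumes "conjugation \<kappa>" "f \<in> autK \<kappa>"
  obtains A :: "complex^3^3" where "invertible A" "induced f (\<lambda>v. kvec \<kappa> (A *v v))"
  using automorphism_linear[OF S d4 model assms(1)] assms(2) by (auto simp: autK_def induced_def)

lemma infinite_curve: "infinite (plane_curve F)"
proof -
  obtain e0 e1 e2 where "pencil F d e0 e1 e2" using exists_pencil[OF F d2] by blast
  then show ?thesis by (rule pencil.infinite_curve)
qed

section \<open>Points of the curve in general position and uniqueness of the inducing map\<close>

lemma point_off_lines:
  assumes "finite M" "0 \<notin> M"
  obtains v where "v \<noteq> 0" "F v = 0" "\<And>m. m \<in> M \<Longrightarrow> cdot m v \<noteq> 0"
proof -
  have "finite (\<Union>m\<in>M. {p \<in> plane_curve F. on_line m p})"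
    using assms card_line(1)[OF F d2] by (intro finite_UN_I) (metis)+
  then have "\<not> plane_curve F \<subseteq> (\<Union>m\<in>M. {p \<in> plane_curve F. on_line m p})"
    using infinite_curve finite_subset by blast
  then obtain p where p: "p \<in> plane_curve F" "\<And>m. m \<in> M \<Longrightarrow> \<not> on_line m p" by blast
  show ?thesis
    by (rule that[of "rep_proj2 p"])
      (use p rep_plane_curve[OF F(1)] rep_proj2_nonzero in \<open>auto simp: on_line_def\<close>)
qed

text \<open>A projective frame on the curve: the fourth point has no vanishing coordinate with
  respect to the first three.\<close>

lemma four_points:
  obtains v1 v2 v3 a b c where "cdet v1 v2 v3 \<noteq> 0" "F v1 = 0" "F v2 = 0" "F v3 = 0"
    "F (a *s v1 + b *s v2 + c *s v3) = 0" "a \<noteq> 0" "b \<noteq> 0" "c \<noteq> 0"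
proof -
  obtain v1 where v1: "v1 \<noteq> 0" "F v1 = 0" using point_off_lines[of "{}"] by auto
  obtain x y where xy: "cdet v1 x y \<noteq> 0" using extend_basis[OF v1(1)] .
  then have "ccross v1 x \<noteq> 0" using ccross_nonzero by blast
  then obtain v2 where v2: "v2 \<noteq> 0" "F v2 = 0" "cdot (ccross v1 x) v2 \<noteq> 0"
    using point_off_lines[of "{ccross v1 x}"] by auto
  then have "cdet v1 v2 x \<noteq> 0" by (simp add: cdot_ccross cdet_swap'[of v1 x])
  then have "ccross v1 v2 \<noteq> 0" using ccross_nonzero by blast
  then obtain v3 where v3: "v3 \<noteq> 0" "F v3 = 0" "cdot (ccross v1 v2) v3 \<noteq> 0"
    using point_off_lines[of "{ccross v1 v2}"] by auto
  then have D: "cdet v1 v2 v3 \<noteq> 0" by (simp add: cdot_ccross)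
  have D2: "cdet v2 v3 v1 \<noteq> 0" and D3: "cdet v3 v1 v2 \<noteq> 0"
    using D cdet_cycle[of v1 v2 v3] cdet_cycle[of v3 v1 v2] by auto
  have "0 \<notin> {ccross v2 v3, ccross v3 v1, ccross v1 v2}"
    using ccross_nonzero[of v2 v3] ccross_nonzero[of v3 v1] ccross_nonzero[of v1 v2] D D2 D3 by auto
  then obtain w where w: "w \<noteq> 0" "F w = 0"
    "\<And>m. m \<in> {ccross v2 v3, ccross v3 v1, ccross v1 v2} \<Longrightarrow> cdot m w \<noteq> 0"
    using point_off_lines[of "{ccross v2 v3, ccross v3 v1, ccross v1 v2}"] by auto
  have n: "cdet w v2 v3 \<noteq> 0" "cdet v1 w v3 \<noteq> 0" "cdet v1 v2 w \<noteq> 0"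
    using w(3)[of "ccross v2 v3"] w(3)[of "ccross v3 v1"] w(3)[of "ccross v1 v2"]
      cdet_cycle[of w v2 v3] cdet_cycle[of v3 v1 w] by (auto simp: cdot_ccross)
  show ?thesis
    by (rule that[OF D v1(2) v2(2) v3(2), of "cdet w v2 v3 / cdet v1 v2 v3" "cdet v1 w v3 / cdet v1 v2 v3"
          "cdet v1 v2 w / cdet v1 v2 v3"])
      (use n D w(2) basis_expand[OF D, of w] in auto)
qed

lemma induced_preserves_curve:
  assumes L: "semilinear \<kappa> L" and \<kappa>: "conjugation \<kappa>" and f: "induced f L" "f \<in> Bij (points S)"
    and v: "F v = 0"
  shows "F (L v) = 0"
proof (cases "v = 0")
  case True
  then show ?thesis using v semilinear_0[OF L] by simp
next
  case False
  have "abs_proj2 v \<in> \<phi> ` points S"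
    using v False abs_in_plane_curve[OF F(1)] bij_model by (simp add: bij_betw_def)
  then obtain p where p: "p \<in> points S" "\<phi> p = abs_proj2 v" by fastforce
  obtain c where c: "c \<noteq> 0" "rep_proj2 (\<phi> p) = c *s v" using rep_abs_proj2[OF False] p(2) by metis
  have "\<phi> (f p) \<in> plane_curve F" using BijD(2)[OF f(2) p(1)] bij_model by (auto simp: bij_betw_def)
  then have "abs_proj2 (L (rep_proj2 (\<phi> p))) \<in> plane_curve F" using f(1) p(1) by (simp add: induced_def)
  moreover have "L (rep_proj2 (\<phi> p)) \<noteq> 0" using semilinearD(3)[OF L] rep_proj2_nonzero by blast
  ultimately have "F (L (rep_proj2 (\<phi> p))) = 0" using abs_in_plane_curve[OF F(1)] by blast
  then have "\<kappa> c ^ d * F (L v) = 0"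
    using homog_smult[OF F(1)] by (simp add: c(2) semilinearD(2)[OF L])
  moreover have "\<kappa> c \<noteq> 0" using \<kappa> c(1) by (auto simp: conjugation_def)
  ultimately show ?thesis by simp
qed

text \<open>Both maps agree projectively on the curve, hence on a projective frame, and this
  determines a semilinear map up to a factor.\<close>

lemma induced_unique:
  assumes \<kappa>: "conjugation \<kappa>" and L: "semilinear \<kappa> L" "semilinear \<kappa> L'"
    and i: "induced f L" "induced f L'"
  obtains k where "k \<noteq> 0" "\<And>v. L' v = k *s L v"
proof -
  have pr: "\<exists>k. k \<noteq> 0 \<and> L' v = k *s L v" if v: "v \<noteq> 0" "F v = 0" for v
  proof -
    have "abs_proj2 v \<in> plane_curve F" using v abs_in_plane_curve[OF F(1)] by blast
    then have "abs_proj2 v \<in> \<phi> ` points S" using bij_model by (simp add: bij_betw_def)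
    then obtain p where p: "p \<in> points S" "\<phi> p = abs_proj2 v" by fastforce
    define w where "w = rep_proj2 (\<phi> p)"
    have w0: "w \<noteq> 0" by (simp add: w_def rep_proj2_nonzero)
    have n: "L w \<noteq> 0" "L' w \<noteq> 0" using semilinearD(3) L w0 by blast+
    have "abs_proj2 (L w) = abs_proj2 (L' w)" using i p(1) by (auto simp: induced_def w_def)
    then obtain k where k: "k \<noteq> 0" "L' w = k *s L w" using abs_proj2_eq_iff[OF n] by blast
    obtain c where c: "c \<noteq> 0" "w = c *s v" using rep_abs_proj2[OF v(1)] p(2) by (metis w_def)
    have kc: "\<kappa> c \<noteq> 0" using c(1) \<kappa> by (auto simp: conjugation_def)
    have "\<kappa> c *s L' v = \<kappa> c *s (k *s L v)"
      using k(2) c(2) by (simp add: semilinearD(2)[OF L(1)] semilinearD(2)[OF L(2)] vector_smult_assoc mult.commute)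
    from vector_mul_lcancel[THEN iffD1, OF this] kc have "L' v = k *s L v" by blast
    with k(1) show ?thesis by blast
  qed
  obtain v1 v2 v3 a b c where v: "cdet v1 v2 v3 \<noteq> 0" "F v1 = 0" "F v2 = 0" "F v3 = 0"
    "F (a *s v1 + b *s v2 + c *s v3) = 0" "a \<noteq> 0" "b \<noteq> 0" "c \<noteq> 0" by (rule four_points)
  note nz = basis_nonzero[OF v(1)]
  have n4: "a *s v1 + b *s v2 + c *s v3 \<noteq> 0" using basis_coords_zero(1)[OF v(1)] v(6) by blast
  obtain k1 where k1: "k1 \<noteq> 0" "L' v1 = k1 *s L v1" using pr[OF nz(1) v(2)] by blast
  obtain k2 where k2: "L' v2 = k2 *s L v2" using pr[OF nz(2) v(3)] by blast
  obtain k3 where k3: "L' v3 = k3 *s L v3" using pr[OF nz(3) v(4)] by blast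
  obtain k where k: "L' (a *s v1 + b *s v2 + c *s v3) = k *s L (a *s v1 + b *s v2 + c *s v3)"
    using pr[OF n4 v(5)] by blast
  \<comment> \<open>The factors at the three basis vectors are compared with the one at the fourth
    point, whose coordinates are all nonzero.\<close>
  have "(\<kappa> a * (k1 - k)) *s L v1 + (\<kappa> b * (k2 - k)) *s L v2 + (\<kappa> c * (k3 - k)) *s L v3 = 0"
    using k by (simp add: semilinearD(1,2)[OF L(1)] semilinearD(1,2)[OF L(2)] k1 k2 k3 vec_eq_iff algebra_simps)
  from semilinear_independent[OF \<kappa> L(1) v(1) this]
  have "k1 = k" "k2 = k" "k3 = k" using v(6-8) \<kappa> by (auto simp: conjugation_def)
  then have "L' u = k1 *s L u" for u
    by (subst (1 2) basis_expand[OF v(1), of u])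
      (simp add: semilinearD(1,2)[OF L(1)] semilinearD(1,2)[OF L(2)] k1 k2 k3 vec_eq_iff algebra_simps)
  with k1(1) that show ?thesis by blast
qed

lemma class_in_Aut:
  assumes "f \<in> autK (\<lambda>z. z)" "invertible A" "induced f (\<lambda>v. A *v v)"
  obtains T where "T \<in> Aut_plus_in_PGL3 S \<phi>" "A \<in> T" "\<And>p. p \<in> points S \<Longrightarrow> \<phi> (f p) = pgl_act T (\<phi> p)"
proof -
  obtain T where T: "T \<in> carrier PGL3" "A \<in> T" using PGL3_class[OF assms(2)] .
  have "\<phi> (f p) = pgl_act T (\<phi> p)" if "p \<in> points S" for p
    using pgl_act_eq[OF T rep_proj2_nonzero, of "\<phi> p"] assms(3) that by (simp add: induced_def abs_rep_proj2)
  with T assms(1) that show ?thesis by (auto simp: Aut_plus_in_PGL3_def Aut_plus_simps)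
qed

lemma finite_autK:
  assumes "finite (Aut_plus_in_PGL3 S \<phi>)"
  shows "finite (autK (\<lambda>z. z))"
proof -
  have c: "conjugation (\<lambda>z. z)" by (simp add: conjugation_def)
  have "\<exists>T. T \<in> Aut_plus_in_PGL3 S \<phi> \<and> (\<forall>p \<in> points S. \<phi> (f p) = pgl_act T (\<phi> p))"
    if f: "f \<in> autK (\<lambda>z. z)" for f
  proof -
    obtain A :: "complex^3^3" where A: "invertible A" "induced f (\<lambda>v. A *v v)"
      using induced_exists[OF c f] by auto
    obtain T where "T \<in> Aut_plus_in_PGL3 S \<phi>" "\<And>p. p \<in> points S \<Longrightarrow> \<phi> (f p) = pgl_act T (\<phi> p)"
      using class_in_Aut[OF f A] by blast
    then show ?thesis by blast
  qed
  then obtain T where T: "\<And>f. f \<in> autK (\<lambda>z. z) \<Longrightarrow> T f \<in> Aut_plus_in_PGL3 S \<phi> \<and>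
      (\<forall>p \<in> points S. \<phi> (f p) = pgl_act (T f) (\<phi> p))" by metis
  have "inj_on T (autK (\<lambda>z. z))"
  proof (rule inj_onI)
    fix f g assume f: "f \<in> autK (\<lambda>z. z)" and g: "g \<in> autK (\<lambda>z. z)" and e: "T f = T g"
    show "f = g"
      by (rule induced_eq) (use f g e T in \<open>auto simp: autK_def\<close>)
  qed
  moreover have "T ` autK (\<lambda>z. z) \<subseteq> Aut_plus_in_PGL3 S \<phi>" using T by blast
  ultimately show ?thesis using assms finite_imageD finite_subset by metis
qed

end

section \<open>Groups of homologies\<close>

text \<open>\<open>p\<close> is the characteristic polynomial, expanded by multilinearity of the
  determinant; its leading coefficient is \<open>-1\<close>.\<close>

lemma finite_eigenvalues:
  fixes A :: "complex^3^3"
  shows "finite {\<mu>. \<exists>w. w \<noteq> 0 \<and> A *v w = \<mu> *s w}"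
proof -
  define a b c :: "complex^3" where "a = axis 1 1" and "b = axis 2 1" and "c = axis 3 1"
  have D: "cdet a b c = 1" by (simp add: a_def b_def c_def cdet_def axis_def)
  define a' b' c' where "a' = A *v a" and "b' = A *v b" and "c' = A *v c"
  define p where "p = [:cdet a' b' c', - cdet a b' c' - cdet a' b c' - cdet a' b' c,
      cdet a b c' + cdet a b' c + cdet a' b c, - cdet a b c:]"
  have p: "poly p \<mu> = cdet (a' + (-\<mu>) *s a) (b' + (-\<mu>) *s b) (c' + (-\<mu>) *s c)" for \<mu>
    unfolding p_def by (simp only: cdet_linear1 cdet_linear2 cdet_linear3) (simp add: algebra_simps)
  have "p \<noteq> 0" by (simp add: p_def D)
  moreover have "poly p \<mu> = 0" if w: "w \<noteq> 0" "A *v w = \<mu> *s w" for \<mu> w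
  proof (rule ccontr)
    assume n: "poly p \<mu> \<noteq> 0"
    have D': "cdet a b c \<noteq> 0" by (simp add: D)
    obtain x y z where xyz: "w = x *s a + y *s b + z *s c" using basis_expand[OF D', of w] by blast
    have "x *s (a' + (-\<mu>) *s a) + y *s (b' + (-\<mu>) *s b) + z *s (c' + (-\<mu>) *s c) = A *v w - \<mu> *s w"
      unfolding xyz a'_def b'_def c'_def
      by (simp add: matrix_vector_right_distrib vector_scalar_commute vec_eq_iff algebra_simps)
    then have "x *s (a' + (-\<mu>) *s a) + y *s (b' + (-\<mu>) *s b) + z *s (c' + (-\<mu>) *s c) = 0"
      using w(2) by simp
    from basis_coords_zero[OF n[unfolded p] this] xyz w(1) show False by simp
  qed
  then have "{\<mu>. \<exists>w. w \<noteq> 0 \<and> A *v w = \<mu> *s w} \<subseteq> {\<mu>. poly p \<mu> = 0}" by blast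
  ultimately show ?thesis using poly_roots_finite finite_subset by blast
qed

text \<open>Infinitely many common fixed points force three collinear ones with the same eigenvalue of a
  fixed non-scalar matrix; every matrix that fixes three points of a line is scalar on it.\<close>

lemma common_axis:
  fixes A1 :: "complex^3^3"
  assumes Q: "infinite Q" and A1: "\<And>q. q \<in> Q \<Longrightarrow> \<exists>s. A1 *v rep_proj2 q = s *s rep_proj2 q"
    and ns: "\<nexists>s. \<forall>v. A1 *v v = s *s v"
  obtains e1 e2 where "ccross e1 e2 \<noteq> 0"
    "\<And>A :: complex^3^3. (\<And>q. q \<in> Q \<Longrightarrow> \<exists>s. A *v rep_proj2 q = s *s rep_proj2 q) \<Longrightarrow>
      \<exists>s. A *v e1 = s *s e1 \<and> A *v e2 = s *s e2"
proof -
  obtain \<mu> where \<mu>: "\<And>q. q \<in> Q \<Longrightarrow> A1 *v rep_proj2 q = \<mu> q *s rep_proj2 q" using A1 by metis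
  have "finite (\<mu> ` Q)"
    by (rule finite_subset[OF _ finite_eigenvalues[of A1]]) (use \<mu> rep_proj2_nonzero in blast)
  from pigeonhole_infinite[OF Q this] obtain q0 where q0: "q0 \<in> Q" "infinite {q \<in> Q. \<mu> q = \<mu> q0}" by blast
  define R where "R = {q \<in> Q. \<mu> q = \<mu> q0}"
  have R: "infinite R" using q0 by (simp add: R_def)
  obtain q1 where q1: "q1 \<in> R" using R by (metis finite.emptyI equals0I)
  obtain q2 where q2: "q2 \<in> R" "q2 \<noteq> q1" using R finite_subset[of R "{q1}"] by auto
  obtain q3 where q3: "q3 \<in> R" "q3 \<noteq> q1" "q3 \<noteq> q2" using R finite_subset[of R "{q1, q2}"] by auto
  define v1 v2 v3 where "v1 = rep_proj2 q1" and "v2 = rep_proj2 q2" and "v3 = rep_proj2 q3"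
  have nz: "v1 \<noteq> 0" "v2 \<noteq> 0" "v3 \<noteq> 0" by (simp_all add: v1_def v2_def v3_def rep_proj2_nonzero)
  have np: "p = q" if "rep_proj2 q = c *s rep_proj2 p" for p q c
  proof -
    have "c \<noteq> 0" using that rep_proj2_nonzero[of q] by auto
    then show ?thesis using that abs_proj2_smult[OF rep_proj2_nonzero, of c p] by (metis abs_rep_proj2)
  qed
  have ev: "A1 *v v1 = \<mu> q0 *s v1" "A1 *v v2 = \<mu> q0 *s v2" "A1 *v v3 = \<mu> q0 *s v3"
    using \<mu> q1 q2 q3 by (auto simp: R_def v1_def v2_def v3_def)
  \<comment> \<open>Three independent eigenvectors with the same eigenvalue would make
    \<open>A1\<close> a scalar matrix.\<close>
  have D0: "cdet v1 v2 v3 = 0"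
  proof (rule ccontr)
    assume D: "cdet v1 v2 v3 \<noteq> 0"
    have "A1 *v v = \<mu> q0 *s v" for v
      by (subst (1 2) basis_expand[OF D, of v])
        (simp add: matrix_vector_right_distrib vector_scalar_commute ev vec_eq_iff algebra_simps)
    with ns show False by blast
  qed
  have c12: "ccross v1 v2 \<noteq> 0"
    using ccross_zero[OF _ nz(1), of v2] np q2(2) by (auto simp: v1_def v2_def)
  have "cdot (ccross v1 v2) v3 = 0" "cdot (ccross v1 v2) v1 = 0" "cdot (ccross v1 v2) v2 = 0"
    by (simp_all add: cdot_ccross D0)
  from line_span[OF this(2,3,1) c12 c12] obtain x y where xy: "v3 = x *s v1 + y *s v2" .
  have x0: "x \<noteq> 0"
  proof
    assume "x = 0"
    then have "v3 = y *s v2" using xy by simp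
    then show False using np q3(3) by (auto simp: v2_def v3_def)
  qed
  have y0: "y \<noteq> 0"
  proof
    assume "y = 0"
    then have "v3 = x *s v1" using xy by simp
    then show False using np q3(2) by (auto simp: v1_def v3_def)
  qed
  obtain w where w: "cdet v1 v2 w \<noteq> 0" using c12 ccross_nonzero by blast
  show ?thesis
  proof (rule that[OF c12])
    fix A :: "complex^3^3"
    assume A: "\<And>q. q \<in> Q \<Longrightarrow> \<exists>s. A *v rep_proj2 q = s *s rep_proj2 q"
    have RQ: "q1 \<in> Q" "q2 \<in> Q" "q3 \<in> Q" using q1 q2 q3 by (auto simp: R_def)
    obtain s1 s2 s3 where s: "A *v v1 = s1 *s v1" "A *v v2 = s2 *s v2" "A *v v3 = s3 *s v3"
      using A[OF RQ(1)] A[OF RQ(2)] A[OF RQ(3)] by (auto simp: v1_def v2_def v3_def)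
    \<comment> \<open>The third point is a combination of the first two with both coefficients
      nonzero, which forces all three eigenvalues to agree.\<close>
    have "(x * (s1 - s3)) *s v1 + (y * (s2 - s3)) *s v2 + 0 *s w = 0"
      using s(3) unfolding xy
      by (simp add: matrix_vector_right_distrib vector_scalar_commute s(1,2) vec_eq_iff algebra_simps)
    from basis_coords_zero[OF w this] have "s1 = s2" using x0 y0 by simp
    with s show "\<exists>s. A *v v1 = s *s v1 \<and> A *v v2 = s *s v2" by blast
  qed
qed

lemma root_of_unity_dvd:
  assumes "n > 0" "cis (2 * pi / real n) ^ d = 1"
  shows "n dvd d"
proof -
  have z: "cis (2 * pi / real n) ^ k = cis (2 * pi * real k / real n)" for k :: nat
    by (simp only: Complex.DeMoivre) (simp add: mult_ac)
  have "cis (2 * pi / real n) ^ n = 1" using assms(1) by (simp add: z)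
  then have "cis (2 * pi / real n) ^ d = cis (2 * pi / real n) ^ (d mod n)"
    by (metis div_mult_mod_eq mult.left_neutral power_add power_mult power_one mult.commute)
  then have eq: "cis (2 * pi * real (d mod n) / real n) = cis (2 * pi * real 0 / real n)"
    using assms(2) by (simp add: z)
  have inj: "inj_on (\<lambda>k. cis (2 * pi * real k / real n)) {..<n}"
    using Complex.bij_betw_roots_unity[OF assms(1)] by (simp add: bij_betw_def)
  have "d mod n = 0" by (rule inj_onD[OF inj eq]) (use assms(1) in auto)
  then show ?thesis by auto
qed

text \<open>Multiplication by \<open>x\<close> permutes the group, so comparing the products of all
  values gives \<open>h x ^ order G = 1\<close>. By counting, the injective image consists of all
  roots of unity of that order, and the element over the primitive root generates.\<close>

lemma (in group) cyclic_if_character: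
  fixes h :: "'a \<Rightarrow> complex"
  assumes fin: "finite (carrier G)"
    and hom: "\<And>x y. x \<in> carrier G \<Longrightarrow> y \<in> carrier G \<Longrightarrow> h (x \<otimes> y) = h x * h y"
    and one: "h \<one> = 1" and inj: "inj_on h (carrier G)"
  shows "cyclic_group G" "\<And>x. x \<in> carrier G \<Longrightarrow> h x ^ order G = 1"
    "\<exists>x \<in> carrier G. h x = cis (2 * pi / real (order G))"
proof -
  have n: "order G > 0" using fin by (simp add: order_gt_0_iff_finite)
  have pow: "h (x [^] k) = h x ^ k" if "x \<in> carrier G" for x and k :: nat
    by (induction k) (use that in \<open>auto simp: one hom nat_pow_Suc\<close>)
  have nz: "h x \<noteq> 0" if "x \<in> carrier G" for x
    using hom[OF that inv_closed[OF that]] that one by (auto simp: r_inv)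
  show r: "h x ^ order G = 1" if x: "x \<in> carrier G" for x
  proof -
    have inj': "inj_on (\<lambda>y. x \<otimes> y) (carrier G)" using x by (auto simp: inj_on_def)
    have "(\<lambda>y. x \<otimes> y) ` carrier G = carrier G" by (rule endo_inj_surj[OF fin _ inj']) (use x in auto)
    then have "(\<Prod>y\<in>carrier G. h y) = (\<Prod>y\<in>carrier G. h (x \<otimes> y))"
      using prod.reindex[OF inj', of h] by simp
    also have "\<dots> = (\<Prod>y\<in>carrier G. h x * h y)" by (rule prod.cong) (use x hom in auto)
    also have "\<dots> = h x ^ order G * (\<Prod>y\<in>carrier G. h y)" by (simp add: prod.distrib order_def)
    finally show ?thesis using nz fin by simp
  qed
  have "h ` carrier G \<subseteq> {z. z ^ order G = 1}" using r by blast
  moreover have "card (h ` carrier G) = card {z::complex. z ^ order G = 1}"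
    using card_image[OF inj] Complex.card_roots_unity_eq[OF n] by (simp add: order_def)
  moreover have "finite {z::complex. z ^ order G = 1}"
    using finite_roots_unity[of "order G"] n by simp
  ultimately have im: "h ` carrier G = {z. z ^ order G = 1}" by (intro card_subset_eq)
  have z: "cis (2 * pi / real (order G)) ^ k = cis (2 * pi * real k / real (order G))" for k
    by (simp only: Complex.DeMoivre) (simp add: mult_ac)
  have "cis (2 * pi / real (order G)) ^ order G = 1" using n by (simp add: z)
  then show ex: "\<exists>x \<in> carrier G. h x = cis (2 * pi / real (order G))" using im by (metis (mono_tags) image_iff mem_Collect_eq)
  then obtain x where x: "x \<in> carrier G" "h x = cis (2 * pi / real (order G))" by blast
  show "cyclic_group G" unfolding cyclic_group
  proof (intro bexI[of _ x] equalityI subsetI)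
    fix y assume y: "y \<in> carrier G"
    then have "h y \<in> (\<lambda>k. cis (2 * pi * real k / real (order G))) ` {..<order G}"
      using r Complex.bij_betw_roots_unity[OF n] by (auto simp: bij_betw_def)
    then obtain k :: nat where "h y = cis (2 * pi * real k / real (order G))" by blast
    then have "h y = h (x [^] k)" by (simp only: pow[OF x(1)] x(2) z)
    then have "y = x [^] k" using inj y x(1) by (auto dest: inj_onD)
    then have "y = x [^] int k" by (simp add: int_pow_int)
    then show "y \<in> range (\<lambda>n::int. x [^] n)" by blast
  qed (use x in auto)
qed

locale homology_surface = plane_surface S d F \<phi> for S :: "'a surface" and d F \<phi> +
  fixes e1 e2 e3 :: "complex^3"
  assumes basis: "cdet e1 e2 e3 \<noteq> 0" and fin: "finite (autK (\<lambda>z. z))"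
    and axis: "\<And>f. f \<in> autK (\<lambda>z. z) \<Longrightarrow>
      \<exists>L s. semilinear (\<lambda>z. z) L \<and> induced f L \<and> L e1 = s *s e1 \<and> L e2 = s *s e2"
begin

abbreviation "Aut \<equiv> autK (\<lambda>z. z)"

text \<open>\<open>L\<close> acts as the scalar \<open>s\<close> on the axis spanned by \<open>e1\<close> and \<open>e2\<close>, and as \<open>t\<close> on the quotient.\<close>

definition homology :: "('a \<Rightarrow> 'a) \<Rightarrow> (complex^3 \<Rightarrow> complex^3) \<Rightarrow> complex \<Rightarrow> complex \<Rightarrow> bool" where
  "homology f L s t \<longleftrightarrow> semilinear (\<lambda>z. z) L \<and> induced f L \<and> s \<noteq> 0 \<and> t \<noteq> 0 \<and>
     L e1 = s *s e1 \<and> L e2 = s *s e2 \<and> (\<forall>v. cdet e1 e2 (L v) = t * cdet e1 e2 v)"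

lemma id_conj: "conjugation (\<lambda>z. z)"
  by (simp add: conjugation_def)

lemma Aut_Bij: "f \<in> Aut \<Longrightarrow> f \<in> Bij (points S)"
  by (simp add: autK_def)

lemma homology_exists:
  assumes "f \<in> Aut"
  shows "\<exists>L s t. homology f L s t"
proof -
  obtain L s where L: "semilinear (\<lambda>z. z) L" "induced f L" "L e1 = s *s e1" "L e2 = s *s e2"
    using axis[OF assms] by blast
  have s0: "s \<noteq> 0"
  proof
    assume "s = 0"
    then have "L e1 = 0" using L(3) by simp
    then show False using semilinearD(3)[OF L(1)] basis_nonzero(1)[OF basis] by blast
  qed
  define t where "t = cdet e1 e2 (L e3) / cdet e1 e2 e3"
  have lt: "cdet e1 e2 (L v) = t * cdet e1 e2 v" for v
  proof -
    obtain x y z where v: "v = x *s e1 + y *s e2 + z *s e3" using basis_expand[OF basis, of v] by blast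
    show ?thesis using basis unfolding v
      by (simp add: semilinearD(1,2)[OF L(1)] L(3,4) t_def)
  qed
  have "t \<noteq> 0"
  proof
    \<comment> \<open>Then \<open>L e3\<close> lies on the axis, where \<open>L\<close> is
      multiplication by \<open>s\<close>; subtracting its preimage on the axis from
      \<open>e3\<close> gives a nonzero vector in the kernel.\<close>
    assume t0: "t = 0"
    obtain x y z where v: "L e3 = x *s e1 + y *s e2 + z *s e3"
      using basis_expand[OF basis, of "L e3"] by blast
    have "z * cdet e1 e2 e3 = 0" using lt[of e3] t0 by (simp add: v)
    then have "z = 0" using basis by simp
    then have "x *s e1 + y *s e2 = L e3" using v by simp
    moreover have "L (e3 + (- (x / s)) *s e1 + (- (y / s)) *s e2) =
        L e3 + (- (x / s)) *s (s *s e1) + (- (y / s)) *s (s *s e2)"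
      by (simp only: semilinearD(1,2)[OF L(1)] L(3,4))
    moreover have "L e3 + (- (x / s)) *s (s *s e1) + (- (y / s)) *s (s *s e2) = L e3 - (x *s e1 + y *s e2)"
      using s0 by (simp add: vec_eq_iff)
    ultimately have "L (e3 + (- (x / s)) *s e1 + (- (y / s)) *s e2) = 0" by simp
    then have "e3 + (- (x / s)) *s e1 + (- (y / s)) *s e2 = 0" by (rule semilinearD(3)[OF L(1)])
    then have "(- (x / s)) *s e1 + (- (y / s)) *s e2 + 1 *s e3 = 0"
      by (simp only: vector_smult_lid add_ac)
    from basis_coords_zero(3)[OF basis this] show False by simp
  qed
  with L s0 lt show ?thesis unfolding homology_def by blast
qed

lemma homology_compose:
  assumes "homology f L s t" "homology g L' s' t'" "g \<in> Aut"
  shows "homology (compose (points S) f g) (\<lambda>v. L (L' v)) (s * s') (t * t')"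
  unfolding homology_def
proof (intro conjI allI)
  have L: "semilinear (\<lambda>z. z) L" "semilinear (\<lambda>z. z) L'" using assms by (auto simp: homology_def)
  show "semilinear (\<lambda>z. z) (\<lambda>v. L (L' v))" using semilinear_compose[OF L] by simp
  show "induced (compose (points S) f g) (\<lambda>v. L (L' v))"
    by (rule induced_compose[OF L id_conj]) (use assms Aut_Bij in \<open>auto simp: homology_def\<close>)
  show "L (L' e1) = (s * s') *s e1" "L (L' e2) = (s * s') *s e2"
    using assms by (simp_all add: homology_def semilinearD(2)[OF L(1)] vector_smult_assoc mult.commute)
qed (use assms in \<open>auto simp: homology_def\<close>)

lemma homology_scale:
  assumes "homology f L s t" "semilinear (\<lambda>z. z) L'" "induced f L'"
  obtains k where "k \<noteq> 0" "\<And>v. L' v = k *s L v" "homology f L' (k * s) (k * t)"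
proof -
  have L: "semilinear (\<lambda>z. z) L" "induced f L" using assms by (auto simp: homology_def)
  obtain k where k: "k \<noteq> 0" "\<And>v. L' v = k *s L v"
    using induced_unique[OF id_conj L(1) assms(2) L(2) assms(3)] by blast
  then have "homology f L' (k * s) (k * t)" using assms by (simp add: homology_def vector_smult_assoc)
  with k that show ?thesis by blast
qed

text \<open>The inducing map is unique up to a factor, which cancels in the ratio.\<close>

lemma homology_ratio: "homology f L s t \<Longrightarrow> homology f L' s' t' \<Longrightarrow> t' / s' = t / s"
proof -
  assume a: "homology f L s t" "homology f L' s' t'"
  then have L': "semilinear (\<lambda>z. z) L'" "induced f L'" by (auto simp: homology_def)
  obtain k where k: "k \<noteq> 0" "\<And>v. L' v = k *s L v" "homology f L' (k * s) (k * t)"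
    using homology_scale[OF a(1) L'] by blast
  have "s' *s e1 = (k * s) *s e1" using a(2) k(3) by (simp add: homology_def)
  then have s: "s' = k * s" using basis_nonzero(1)[OF basis] by (simp add: vector_mul_rcancel)
  have "t' * cdet e1 e2 e3 = (k * t) * cdet e1 e2 e3" using a(2) k(3) unfolding homology_def by metis
  then have "t' = k * t" using basis by simp
  with s k(1) show ?thesis by simp
qed

lemma homology_one: "homology (\<lambda>p\<in>points S. p) (\<lambda>v. v) 1 1"
  by (simp add: homology_def semilinear_def induced_def abs_rep_proj2)

text \<open>Up to a scalar \<open>L\<close> is a transvection, and a non-trivial transvection has infinite order.\<close>

lemma homology_equal:
  assumes f: "f \<in> Aut" and t: "homology f L s s"
  shows "f = (\<lambda>p\<in>points S. p)"
proof -
  interpret A: group "Aut_plus S" by (rule group_Aut_plus)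
  note simps = Aut_plus_simps
  have L: "semilinear (\<lambda>z. z) L" "s \<noteq> 0" "L e1 = s *s e1" "L e2 = s *s e2"
    "\<And>v. cdet e1 e2 (L v) = s * cdet e1 e2 v" using t by (auto simp: homology_def)
  obtain x y z where v: "L e3 = x *s e1 + y *s e2 + z *s e3"
    using basis_expand[OF basis, of "L e3"] by blast
  have "z = s" using L(5)[of e3] basis by (simp add: v)
  then have v: "L e3 = s *s e3 + (x *s e1 + y *s e2)" using v by (simp add: add_ac)
  \<comment> \<open>The power \<open>m\<close> of the map shifts \<open>e3\<close> by
    \<open>m * s ^ (m - 1)\<close> times a fixed axis vector; multiplication by \<open>s\<close>
    avoids the exponent \<open>m - 1\<close> at \<open>m = 0\<close>.\<close>
  have pw: "\<exists>M. homology (f [^]\<^bsub>Aut_plus S\<^esub> m) M (s ^ m) (s ^ m) \<and>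
      s *s M e3 = s ^ Suc m *s e3 + (of_nat m * s ^ m) *s (x *s e1 + y *s e2)" for m :: nat
  proof (induction m)
    case 0
    have "homology (f [^]\<^bsub>Aut_plus S\<^esub> (0::nat)) (\<lambda>v. v) 1 1"
      using homology_one by (simp only: A.nat_pow_0 simps(2))
    then show ?case by (intro exI[of _ "\<lambda>v. v"]) simp
  next
    case (Suc m)
    then obtain M where M: "homology (f [^]\<^bsub>Aut_plus S\<^esub> m) M (s ^ m) (s ^ m)"
      "s *s M e3 = s ^ Suc m *s e3 + (of_nat m * s ^ m) *s (x *s e1 + y *s e2)" by blast
    have fm: "f [^]\<^bsub>Aut_plus S\<^esub> m \<in> Aut" using A.nat_pow_closed[of f m] f by (simp add: simps(1))
    have Ml: "semilinear (\<lambda>z. z) M" "M e1 = s ^ m *s e1" "M e2 = s ^ m *s e2" using M by (auto simp: homology_def)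
    have "homology (f [^]\<^bsub>Aut_plus S\<^esub> Suc m) (\<lambda>v. M (L v)) (s ^ m * s) (s ^ m * s)"
      using homology_compose[OF M(1) t f] by (simp add: A.nat_pow_Suc simps(3)[OF fm f])
    moreover have "s *s M (L e3) = s ^ Suc (Suc m) *s e3 + (of_nat (Suc m) * s ^ Suc m) *s (x *s e1 + y *s e2)"
    proof -
      have "s *s M (L e3) = s *s (s *s M e3) + s *s (x *s (s ^ m *s e1) + y *s (s ^ m *s e2))"
        unfolding v by (simp add: semilinearD(1,2)[OF Ml(1)] Ml(2,3) vector_add_ldistrib)
      then show ?thesis unfolding M(2) by (simp add: vec_eq_iff algebra_simps)
    qed
    ultimately show ?case by (intro exI[of _ "\<lambda>v. M (L v)"]) (simp add: mult.commute)
  qed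
  have "\<not> inj (\<lambda>m::nat. f [^]\<^bsub>Aut_plus S\<^esub> m)"
  proof
    assume "inj (\<lambda>m::nat. f [^]\<^bsub>Aut_plus S\<^esub> m)"
    moreover have "range (\<lambda>m::nat. f [^]\<^bsub>Aut_plus S\<^esub> m) \<subseteq> Aut"
      using A.nat_pow_closed[of f] f by (auto simp: simps(1))
    ultimately show False using finite_subset[OF _ fin] finite_imageD infinite_UNIV_nat by blast
  qed
  then obtain m n :: nat where mn: "f [^]\<^bsub>Aut_plus S\<^esub> m = f [^]\<^bsub>Aut_plus S\<^esub> n" "m \<noteq> n"
    unfolding inj_def by blast
  obtain M M' where M: "homology (f [^]\<^bsub>Aut_plus S\<^esub> n) M (s ^ n) (s ^ n)"
      "s *s M e3 = s ^ Suc n *s e3 + (of_nat n * s ^ n) *s (x *s e1 + y *s e2)"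
    and M': "homology (f [^]\<^bsub>Aut_plus S\<^esub> n) M' (s ^ m) (s ^ m)"
      "s *s M' e3 = s ^ Suc m *s e3 + (of_nat m * s ^ m) *s (x *s e1 + y *s e2)"
    using pw[of n] pw[of m] unfolding mn(1) by blast
  have Ms: "semilinear (\<lambda>z. z) M" "induced (f [^]\<^bsub>Aut_plus S\<^esub> n) M" "M e1 = s ^ n *s e1"
    using M(1) by (auto simp: homology_def)
  obtain k where k: "\<And>v. M v = k *s M' v" using homology_scale[OF M'(1) Ms(1,2)] by blast
  have "(k * s ^ m) *s e1 = s ^ n *s e1"
    using Ms(3) k[of e1] M'(1) by (simp add: homology_def vector_smult_assoc)
  then have ks: "k * s ^ m = s ^ n" using basis_nonzero(1)[OF basis] by (simp add: vector_mul_rcancel)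
  have "s *s M e3 = k *s (s *s M' e3)" by (simp add: k vector_smult_assoc mult.commute)
  also have "\<dots> = (k * s ^ m * s) *s e3 + (of_nat m * (k * s ^ m)) *s (x *s e1 + y *s e2)"
    unfolding M'(2) by (simp add: vector_add_ldistrib vector_smult_assoc mult_ac)
  finally have "s ^ Suc n *s e3 + (of_nat n * s ^ n) *s (x *s e1 + y *s e2) =
      (s ^ n * s) *s e3 + (of_nat m * s ^ n) *s (x *s e1 + y *s e2)" unfolding M(2) ks .
  \<comment> \<open>Two different powers induce the same automorphism, so the shifts agree after
    rescaling; as \<open>n \<noteq> m\<close>, the axis vector must be zero.\<close>
  then have "((of_nat n - of_nat m) * s ^ n * x) *s e1 + ((of_nat n - of_nat m) * s ^ n * y) *s e2 + 0 *s e3 = 0"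
    by (simp add: vec_eq_iff algebra_simps)
  from basis_coords_zero[OF basis this] have "x = 0" "y = 0" using mn(2) L(2) by auto
  then have "L e3 = s *s e3" using v by simp
  then have Ls: "L v = s *s v" for v
    by (subst (1 2) basis_expand[OF basis, of v])
      (simp add: semilinearD(1,2)[OF L(1)] L(3,4) vec_eq_iff algebra_simps)
  show ?thesis
  proof (rule induced_eq[OF Aut_Bij[OF f] id_Bij])
    fix p assume p: "p \<in> points S"
    have "\<phi> (f p) = abs_proj2 (s *s rep_proj2 (\<phi> p))" using t p Ls by (simp add: homology_def induced_def)
    then show "\<phi> (f p) = \<phi> ((\<lambda>p\<in>points S. p) p)"
      using p L(2) by (simp add: abs_proj2_smult rep_proj2_nonzero abs_rep_proj2)
  qed
qed

definition character :: "('a \<Rightarrow> 'a) \<Rightarrow> complex" where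
  "character f = (SOME x. \<exists>L s t. homology f L s t \<and> x = t / s)"

lemma character_eq: "homology f L s t \<Longrightarrow> character f = t / s"
  unfolding character_def by (rule some_equality) (use homology_ratio in blast)+

lemma character_hom:
  assumes "f \<in> Aut" "g \<in> Aut"
  shows "character (f \<otimes>\<^bsub>Aut_plus S\<^esub> g) = character f * character g"
proof -
  obtain L s t L' s' t' where t: "homology f L s t" "homology g L' s' t'" using homology_exists assms by metis
  show ?thesis
    using character_eq[OF homology_compose[OF t assms(2)]] character_eq[OF t(1)] character_eq[OF t(2)]
    by (simp add: Aut_plus_simps(3)[OF assms])
qed

lemma character_one: "character (\<one>\<^bsub>Aut_plus S\<^esub>) = 1"
  using character_eq[OF homology_one] by (simp add: Aut_plus_simps(2))

lemma character_trivial: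
  assumes "f \<in> Aut" "character f = 1"
  shows "f = \<one>\<^bsub>Aut_plus S\<^esub>"
proof -
  obtain L s t where t: "homology f L s t" using homology_exists assms(1) by metis
  then have "t = s" using character_eq[OF t] assms(2) by (auto simp: homology_def)
  then show ?thesis using homology_equal[OF assms(1)] t by (simp add: Aut_plus_simps(2))
qed

lemma character_inj: "inj_on character Aut"
proof (rule inj_onI)
  interpret A: group "Aut_plus S" by (rule group_Aut_plus)
  fix f g assume f: "f \<in> Aut" and g: "g \<in> Aut" and e: "character f = character g"
  have c: "f \<in> carrier (Aut_plus S)" "g \<in> carrier (Aut_plus S)" using f g by (simp_all add: Aut_plus_simps(1))
  have ig: "inv\<^bsub>Aut_plus S\<^esub> g \<in> Aut" using A.inv_closed[OF c(2)] by (simp add: Aut_plus_simps(1))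
  have "character (f \<otimes>\<^bsub>Aut_plus S\<^esub> inv\<^bsub>Aut_plus S\<^esub> g) = character (g \<otimes>\<^bsub>Aut_plus S\<^esub> inv\<^bsub>Aut_plus S\<^esub> g)"
    using character_hom[OF f ig] character_hom[OF g ig] e by simp
  then have "character (f \<otimes>\<^bsub>Aut_plus S\<^esub> inv\<^bsub>Aut_plus S\<^esub> g) = 1"
    using character_one c by (simp add: A.r_inv)
  moreover have "f \<otimes>\<^bsub>Aut_plus S\<^esub> inv\<^bsub>Aut_plus S\<^esub> g \<in> Aut"
    using A.m_closed[OF c(1) A.inv_closed[OF c(2)]] by (simp only: Aut_plus_simps(1))
  ultimately have "f \<otimes>\<^bsub>Aut_plus S\<^esub> inv\<^bsub>Aut_plus S\<^esub> g = \<one>\<^bsub>Aut_plus S\<^esub>" using character_trivial by blast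
  then show "f = g" using c by (metis A.inv_equality A.inv_inv A.inv_closed)
qed

lemma cyclic_Aut: "cyclic_group (Aut_plus S)"
  and character_order: "f \<in> Aut \<Longrightarrow> character f ^ order (Aut_plus S) = 1"
  and character_primitive: "\<exists>f \<in> Aut. character f = cis (2 * pi / real (order (Aut_plus S)))"
proof -
  interpret A: group "Aut_plus S" by (rule group_Aut_plus)
  have ca: "carrier (Aut_plus S) = Aut" by (rule Aut_plus_simps(1))
  have hom: "\<And>x y. x \<in> carrier (Aut_plus S) \<Longrightarrow> y \<in> carrier (Aut_plus S) \<Longrightarrow>
      character (x \<otimes>\<^bsub>Aut_plus S\<^esub> y) = character x * character y"
    using character_hom ca by simp
  have fin': "finite (carrier (Aut_plus S))" and inj: "inj_on character (carrier (Aut_plus S))"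
    using fin character_inj ca by simp_all
  show "cyclic_group (Aut_plus S)"
    by (rule A.cyclic_if_character(1)[OF fin' _ character_one inj]) (rule hom)
  show "character f ^ order (Aut_plus S) = 1" if "f \<in> Aut"
    by (rule A.cyclic_if_character(2)[OF fin' _ character_one inj]) (use hom that ca in simp_all)
  show "\<exists>f \<in> Aut. character f = cis (2 * pi / real (order (Aut_plus S)))"
    unfolding ca[symmetric] by (rule A.cyclic_if_character(3)[OF fin' _ character_one inj]) (rule hom)
qed

end

section \<open>Pseudoreal surfaces with a common axis\<close>

context homology_surface
begin

lemma square_Aut:
  assumes \<sigma>: "\<sigma> \<in> autK cnj"
  shows "compose (points S) \<sigma> \<sigma> \<in> Aut"
proof -
  have "conjugation cnj" by (simp add: conjugation_def)
  from autK_compose[OF this this \<sigma> \<sigma>] show ?thesis by simp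
qed

text \<open>The square of the antilinear map \<open>B\<close> is a homology with the real eigenvalues \<open>s < 0 < t\<close>: otherwise
  \<open>B\<close> would fix a point of the axis, the eigenvalues would agree in sign, and, their ratio being a
  root of unity, the square would be trivial. If the centre were on the curve, the tangent there would
  meet the axis in a point fixed by \<open>B\<close>.\<close>

lemma anticonformal_square:
  assumes \<sigma>: "\<sigma> \<in> autK cnj" and ninv: "compose (points S) \<sigma> \<sigma> \<noteq> (\<lambda>p\<in>points S. p)"
  obtains N s t e where "homology (compose (points S) \<sigma> \<sigma>) N s t" "t = - s"
    "cdet e1 e2 e \<noteq> 0" "F e \<noteq> 0" "N e = t *s e"
    "\<And>v. N v = t *s v \<Longrightarrow> \<exists>c. v = c *s e"
proof -
  let ?\<tau> = "compose (points S) \<sigma> \<sigma>"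
  interpret A: group "Aut_plus S" by (rule group_Aut_plus)
  have cj: "conjugation cnj" by (simp add: conjugation_def)
  have \<tau>: "?\<tau> \<in> Aut" by (rule square_Aut[OF \<sigma>])
  have \<sigma>B: "\<sigma> \<in> Bij (points S)" using \<sigma> by (simp add: autK_def)
  obtain A :: "complex^3^3" where A: "invertible A" "induced \<sigma> (\<lambda>v. kvec cnj (A *v v))"
    using induced_exists[OF cj \<sigma>] by blast
  define B where "B v = kvec cnj (A *v v)" for v
  have B: "semilinear cnj B" and iB: "induced \<sigma> B"
    using semilinear_matrix[OF cj A(1)] A(2) by (simp_all add: B_def[abs_def])
  note Bs = semilinearD(1,2)[OF B]
  define N where "N v = B (B v)" for v
  have N: "semilinear (\<lambda>z. z) N" using semilinear_compose[OF B B] by (simp add: N_def[abs_def])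
  note Ns = semilinearD(1,2)[OF N]
  have iN: "induced ?\<tau> N" using induced_compose[OF B B cj iB iB \<sigma>B] by (simp add: N_def[abs_def])
  obtain L s0 t0 where "homology ?\<tau> L s0 t0" using homology_exists[OF \<tau>] by blast
  then obtain k where "homology ?\<tau> N (k * s0) (k * t0)" using homology_scale[OF _ N iN] by metis
  then obtain s t where h: "homology ?\<tau> N s t" by blast
  have st: "s \<noteq> 0" "t \<noteq> 0" and N12: "N e1 = s *s e1" "N e2 = s *s e2"
    and Nl: "\<And>v. cdet e1 e2 (N v) = t * cdet e1 e2 v" using h by (auto simp: homology_def)
  have ts: "t \<noteq> s" using homology_equal[OF \<tau>] h ninv by metis
  define n where "n = order (Aut_plus S)"
  have n: "n > 0" using fin by (simp add: n_def A.order_gt_0_iff_finite Aut_plus_simps(1))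
  have root: "(t / s) ^ n = 1"
    using character_order[OF \<tau>] character_eq[OF h] by (simp add: n_def)
  have "cmod (t / s) ^ n = 1" using root by (metis norm_one norm_power)
  then have "cmod (t / s) = 1" using power_eq_imp_eq_base[of "cmod (t / s)" n 1] n by simp
  then have mod: "cmod t = cmod s" using st by (simp add: norm_divide)
  obtain x y z where N3: "N e3 = x *s e1 + y *s e2 + z *s e3" using basis_expand[OF basis, of "N e3"] by blast
  have "z = t" using Nl[of e3] basis by (simp add: N3)
  \<comment> \<open>The centre of the homology: \<open>e3\<close> corrected along the axis to an
    eigenvector for \<open>t\<close>, which is possible because \<open>t \<noteq> s\<close>.\<close>
  define e where "e = e3 + (x / (t - s)) *s e1 + (y / (t - s)) *s e2"
  have le: "cdet e1 e2 e \<noteq> 0" using basis by (simp add: e_def)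
  have Ne: "N e = t *s e"
  proof -
    have tx: "x + x / (t - s) * s = t * (x / (t - s))" for x using ts by (simp add: field_simps)
    have "N e = (x *s e1 + y *s e2 + t *s e3) + (x / (t - s)) *s (s *s e1) + (y / (t - s)) *s (s *s e2)"
      unfolding e_def by (simp only: Ns N3 N12 \<open>z = t\<close>)
    also have "\<dots> = (x + x / (t - s) * s) *s e1 + (y + y / (t - s) * s) *s e2 + t *s e3"
      by (simp add: vec_eq_iff algebra_simps)
    also have "\<dots> = t *s e" unfolding tx e_def by (simp add: vec_eq_iff algebra_simps)
    finally show ?thesis .
  qed
  have Npi: "N v = s *s v" if v: "cdet e1 e2 v = 0" for v
  proof -
    obtain a b where v: "v = a *s e1 + b *s e2" using basis_expand[OF basis, of v] v by auto
    show ?thesis unfolding v by (simp only: Ns N12) (simp add: vec_eq_iff algebra_simps)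
  qed
  have eig: "(cdet e1 e2 v = 0 \<and> a = s) \<or> (a = t \<and> (\<exists>c. v = c *s e))"
    if v: "v \<noteq> 0" "N v = a *s v" for v a
  proof (cases "cdet e1 e2 v = 0")
    case True
    have "a *s v = s *s v" by (rule trans[OF v(2)[symmetric] Npi[OF True]])
    then show ?thesis using True v(1) by (auto simp: vector_mul_rcancel)
  next
    case False
    then have a: "a = t" using Nl[of v] v(2) by simp
    define u where "u = v + (- (cdet e1 e2 v / cdet e1 e2 e)) *s e"
    have lu: "cdet e1 e2 u = 0" unfolding u_def by (simp only: cdet_linear3) (use le in simp)
    have "N u = t *s u" unfolding u_def
      by (simp only: Ns Ne v(2) a) (simp add: vec_eq_iff algebra_simps)
    then have "t *s u = s *s u" using Npi[OF lu] by metis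
    then have "u = 0" using ts by (simp add: vector_mul_rcancel)
    then have "v = (cdet e1 e2 v / cdet e1 e2 e) *s e" by (simp add: u_def vec_eq_iff algebra_simps)
    then show ?thesis using a by blast
  qed
  \<comment> \<open>\<open>B\<close> commutes with its square and is antilinear, so it maps
    eigenvectors for \<open>a\<close> to eigenvectors for the conjugate of \<open>a\<close>.\<close>
  have NB: "N (B v) = cnj a *s B v" if "N v = a *s v" for v a
  proof -
    have "N (B v) = B (N v)" by (simp add: N_def)
    then show ?thesis using that by (simp add: Bs)
  qed
  have Bnz: "B v \<noteq> 0" if "v \<noteq> 0" for v using semilinearD(3)[OF B] that by blast
  note nz = basis_nonzero[OF basis]
  \<comment> \<open>Otherwise \<open>B\<close> would send both \<open>e1\<close> and
    \<open>e2\<close> to multiples of \<open>e\<close>, against injectivity.\<close>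
  have nt: "cnj s \<noteq> t"
  proof
    assume c: "cnj s = t"
    then obtain a b where ab: "B e1 = a *s e" "B e2 = b *s e"
      using eig[OF Bnz[OF nz(1)] NB[OF N12(1)]] eig[OF Bnz[OF nz(2)] NB[OF N12(2)]] ts by blast
    have "b *s B e1 + (- a) *s B e2 + 0 *s B e3 = 0" unfolding ab by (simp add: vec_eq_iff mult_ac)
    from semilinear_independent[OF cj B basis this] ab(1) Bnz[OF nz(1)] show False by simp
  qed
  have lB: "cdet e1 e2 (B e1) = 0" "cdet e1 e2 (B e2) = 0" and sr: "cnj s = s"
    using eig[OF Bnz[OF nz(1)] NB[OF N12(1)]] eig[OF Bnz[OF nz(2)] NB[OF N12(2)]] nt by blast+
  have lBv: "cdet e1 e2 (B v) = 0" if v: "cdet e1 e2 v = 0" for v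
  proof -
    obtain a b where "v = a *s e1 + b *s e2" using basis_expand[OF basis, of v] v by auto
    then show ?thesis by (simp add: Bs lB)
  qed
  have e0: "e \<noteq> 0" using le by auto
  have "cnj t \<noteq> s" using nt sr by (metis complex_cnj_cnj)
  \<comment> \<open>The centre is fixed by \<open>B\<close>, and applying \<open>B\<close> twice
    shows that \<open>t\<close> is the positive real number \<open>\<bar>\<nu>\<bar>\<close>
    squared.\<close>
  then obtain \<nu> where \<nu>: "B e = \<nu> *s e" using eig[OF Bnz[OF e0] NB[OF Ne]] by blast
  have "(cnj \<nu> * \<nu>) *s e = t *s e" using Ne by (simp only: N_def \<nu> Bs vector_smult_assoc)
  then have t\<nu>: "t = cnj \<nu> * \<nu>" using e0 by (auto simp: vector_mul_rcancel)
  \<comment> \<open>A fixed point on the axis would in the same way make \<open>s\<close> the square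
    of a modulus; as \<open>s\<close> and \<open>t\<close> have equal modulus, they would
    coincide.\<close>
  have noline: False if w: "w \<noteq> 0" "cdet e1 e2 w = 0" "B w = \<mu> *s w" for w \<mu>
  proof -
    have "(cnj \<mu> * \<mu>) *s w = s *s w" using Npi[OF w(2)] by (simp only: N_def w(3) Bs vector_smult_assoc)
    then have s\<mu>: "s = cnj \<mu> * \<mu>" using w(1) by (auto simp: vector_mul_rcancel)
    have "cmod \<nu> ^ 2 = cmod \<mu> ^ 2"
      using mod unfolding t\<nu> s\<mu> by (simp add: norm_mult power2_eq_square)
    then have "t = s" unfolding t\<nu> s\<mu> by (metis complex_norm_square mult.commute)
    with ts show False by blast
  qed
  define a where "a = Re s"
  have sa: "s = complex_of_real a" using sr by (simp add: a_def complex_eq_iff)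
  have "a < 0"
  proof (rule ccontr)
    assume "\<not> a < 0"
    then have a0: "a > 0" using st sa by (cases "a = 0") auto
    define q where "q = complex_of_real (sqrt a)"
    have q: "cnj q = q" "q * q = s" using a0 by (simp_all add: q_def sa flip: of_real_mult)
    \<comment> \<open>For positive \<open>s\<close> with root \<open>q\<close>, this vector
      satisfies \<open>B w = q *s w\<close>, since \<open>B\<close> squared is \<open>q * q\<close>
      on the axis. If it vanishes, \<open>e1\<close> itself is fixed up to a factor.\<close>
    define w where "w = q *s e1 + B e1"
    have lw: "cdet e1 e2 w = 0" by (simp add: w_def lB)
    have BB: "B (B e1) = (q * q) *s e1" using N12(1) by (simp only: N_def q(2))
    have "B w = q *s w" unfolding w_def
      by (simp only: Bs q(1) BB) (simp add: vec_eq_iff algebra_simps)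
    then have "w = 0" using noline lw by blast
    then have "B e1 = (- q) *s e1" by (simp add: w_def vec_eq_iff eq_neg_iff_add_eq_0 add.commute)
    then show False using noline[OF nz(1) cdet_same(2)] by blast
  qed
  have "t = complex_of_real ((cmod \<nu>)\<^sup>2)" unfolding t\<nu> by (metis complex_norm_square mult.commute)
  moreover have "(cmod \<nu>)\<^sup>2 = - a"
    using mod \<open>a < 0\<close> unfolding t\<nu> sa by (simp add: norm_mult power2_eq_square)
  ultimately have tms: "t = - s" by (simp add: sa)
  have "F e \<noteq> 0"
  proof
    assume Fe: "F e = 0"
    have ge: "grad F e e = 0" by (simp add: homog_euler[OF F(1)] Fe)
    define D1 D2 where "D1 = grad F e e1" and "D2 = grad F e e2"
    have cyc: "cdet e e1 e2 \<noteq> 0" using le cdet_cycle[of e e1 e2] by simp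
    have D12: "D1 \<noteq> 0 \<or> D2 \<noteq> 0"
      using grad_basis_nonzero[OF F(2) e0 Fe cyc ge] by (auto simp: D1_def D2_def)
    then obtain m where m: "grad F e m \<noteq> 0" by (auto simp: D1_def D2_def)
    \<comment> \<open>The point where the tangent at \<open>e\<close> meets the axis: the
      combination of \<open>e1\<close> and \<open>e2\<close> that the gradient kills.\<close>
    define w where "w = D2 *s e1 + (- D1) *s e2"
    have lw: "cdet e1 e2 w = 0" unfolding w_def by (simp only: cdet_linear3) simp
    have w0: "w \<noteq> 0"
    proof
      assume "w = 0"
      then have "D2 *s e1 + (- D1) *s e2 + 0 *s e3 = 0" unfolding w_def by (simp only: vector_smult_lzero add_0_right)
      from basis_coords_zero[OF basis this] D12 show False by simp
    qed
    have gw: "grad F e w = 0" unfolding w_def by (simp only: grad_linear) (simp add: D1_def D2_def)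
    obtain r g where r: "r > 0" "g holomorphic_on ball 0 r" "g 0 = 0"
      and gz: "\<And>x. x \<in> ball 0 r \<Longrightarrow> F (e + x *s w + g x *s m) = 0"
      using implicit_function[OF F(1) Fe m, of w] by metis
    have z: "0 \<in> ball (0::complex) r" using r by simp
    have gd: "(g has_field_derivative deriv g 0) (at 0)" using holomorphic_derivI[OF r(2) open_ball z] .
    have "((\<lambda>x. F (e + x *s w + g x *s m)) has_field_derivative
        grad F (e + 0 *s w + g 0 *s m) (w + deriv g 0 *s m)) (at 0)"
      by (rule homog_curve_derivative[OF F(1)]) (auto intro!: derivative_eq_intros gd)
    then have "((\<lambda>x. 0) has_field_derivative grad F e (w + deriv g 0 *s m)) (at 0)"
      using has_field_derivative_transform_within_open[OF _ open_ball z, of _ _ "\<lambda>x. 0"] gz r(3) by simp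
    then have "grad F e (w + deriv g 0 *s m) = 0" using DERIV_unique[OF _ DERIV_const] by blast
    then have g'0: "deriv g 0 = 0" using gw m by simp
    have BL: "bounded_linear B"
    proof (rule linear_conv_bounded_linear[THEN iffD1], rule linearI)
      show "B (c *\<^sub>R v) = c *\<^sub>R B v" for c v
      proof -
        have "c *\<^sub>R v = complex_of_real c *s v" "c *\<^sub>R B v = complex_of_real c *s B v"
          by (simp_all add: vec_eq_iff scaleR_conv_of_real[symmetric])
        then show ?thesis by (simp add: Bs)
      qed
    qed (simp add: Bs)
    \<comment> \<open>A curve through \<open>e\<close> with tangent \<open>w\<close>, restricted to
      real parameters because \<open>B\<close> is only real linear. Its image under \<open>B\<close>
      stays on the curve, so \<open>B w\<close> is tangent at \<open>B e\<close>, a multiple of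
      \<open>e\<close>.\<close>
    define \<gamma> where "\<gamma> x = e + complex_of_real x *s w + g (complex_of_real x) *s m" for x :: real
    have g0: "(g has_derivative (\<lambda>h. 0)) (at (complex_of_real 0))"
      using gd g'0 by (simp add: has_field_derivative_def lambda_zero)
    have "((\<lambda>x. g (complex_of_real x)) has_derivative (\<lambda>h. 0)) (at 0)"
      by (rule has_derivative_compose[of complex_of_real complex_of_real 0 UNIV g "\<lambda>h. 0", OF _ g0])
        (auto intro!: derivative_eq_intros)
    then have "(\<gamma> has_derivative (\<lambda>h. complex_of_real h *s w)) (at 0)"
      unfolding \<gamma>_def by (auto intro!: derivative_eq_intros)
    from bounded_linear.has_derivative[OF BL this]
    have "((\<lambda>x. B (\<gamma> x)) has_derivative (\<lambda>h. B (complex_of_real h *s w))) (at 0)" .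
    from has_derivative_compose[OF this homog_has_derivative[OF F(1)]]
    have "((\<lambda>x. F (B (\<gamma> x))) has_derivative (\<lambda>h. grad F (B (\<gamma> 0)) (B (complex_of_real h *s w)))) (at 0)" .
    then have "((\<lambda>x. 0) has_derivative (\<lambda>h. grad F (B (\<gamma> 0)) (B (complex_of_real h *s w)))) (at 0)"
    proof (rule has_derivative_transform_within_open[OF _ open_ball, of _ _ _ _ 0 r])
      fix x :: real assume "x \<in> ball 0 r"
      then have "F (\<gamma> x) = 0" unfolding \<gamma>_def by (intro gz) simp
      then show "F (B (\<gamma> x)) = 0" by (rule induced_preserves_curve[OF B cj iB \<sigma>B])
    qed (use r in simp)
    from fun_cong[OF has_derivative_unique[OF this has_derivative_const], of 1]
    have "grad F (B e) (B w) = 0" by (simp add: \<gamma>_def r(3))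
    moreover obtain d' where d': "d = Suc d'" using d4 by (cases d) auto
    ultimately have "\<nu> ^ d' * grad F e (B w) = 0"
      using homog_smult[OF homog_grad[of d' F "B w"], of \<nu> e] F(1) by (simp add: \<nu>)
    moreover have "\<nu> \<noteq> 0" using \<nu> Bnz[OF e0] by auto
    ultimately have gB: "grad F e (B w) = 0" by simp
    obtain p q where pq: "B w = p *s e1 + q *s e2"
      using basis_expand[OF basis, of "B w"] lBv[OF lw] by auto
    have pD: "p * D1 + q * D2 = 0" using gB by (simp add: pq D1_def D2_def)
    have "\<exists>\<mu>. B w = \<mu> *s w"
    proof (cases "D1 = 0")
      case True
      then have "q = 0" using pD D12 by simp
      then have "B w = (p / D2) *s w" unfolding pq using True D12 by (simp add: w_def vector_smult_assoc)
      then show ?thesis ..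
    next
      case False
      have "- (q * D2) = p * D1" using pD unfolding add_eq_0_iff by simp
      then have c: "(- (q / D1)) * D2 = p" "(- (q / D1)) * (- D1) = q"
        using False by (simp_all add: field_simps)
      have "B w = (- (q / D1)) *s w"
        unfolding pq unfolding w_def vector_add_ldistrib vector_smult_assoc c ..
      then show ?thesis ..
    qed
    then show False using noline[OF w0 lw] by blast
  qed
  moreover have "\<exists>c. v = c *s e" if "N v = t *s v" for v
  proof (cases "v = 0")
    case True
    then show ?thesis by (intro exI[of _ 0]) simp
  next
    case False
    then show ?thesis using eig[OF _ that] ts by blast
  qed
  ultimately show ?thesis using that h tms le Ne by blast
qed

text \<open>The faithful character makes the group commutative, so \<open>L\<close> preserves the
  eigenline of \<open>N\<close> through \<open>e\<close>. In the pencil with centre \<open>e\<close>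
  it acts on each line by \<open>y \<mapsto> \<zeta> * y\<close>. The product of the
  \<open>d\<close> roots of a suitable fibre is nonzero and unchanged, whence
  \<open>\<zeta> ^ d = 1\<close>.\<close>

lemma character_power_degree:
  assumes \<tau>: "\<tau> \<in> Aut" "homology \<tau> N s t"
    and e: "cdet e1 e2 e \<noteq> 0" "F e \<noteq> 0" "N e = t *s e" "\<And>v. N v = t *s v \<Longrightarrow> \<exists>c. v = c *s e"
    and f: "f \<in> Aut"
  shows "character f ^ d = 1"
proof -
  obtain L s' t' where L: "homology f L s' t'" using homology_exists[OF f] by blast
  then have Ll: "semilinear (\<lambda>z. z) L" "induced f L" and L12: "s' \<noteq> 0" "L e1 = s' *s e1" "L e2 = s' *s e2"
    and Lt: "\<And>v. cdet e1 e2 (L v) = t' * cdet e1 e2 v" and t'0: "t' \<noteq> 0" by (auto simp: homology_def)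
  note Ls = semilinearD(1,2)[OF Ll(1)]
  have Nl: "semilinear (\<lambda>z. z) N" and N1: "s \<noteq> 0" "N e1 = s *s e1" using \<tau>(2) by (auto simp: homology_def)
  note Ns = semilinearD(1,2)[OF Nl]
  have c: "compose (points S) f \<tau> = compose (points S) \<tau> f"
  proof (rule inj_onD[OF character_inj])
    show "character (compose (points S) f \<tau>) = character (compose (points S) \<tau> f)"
      using character_hom[OF f \<tau>(1)] character_hom[OF \<tau>(1) f]
      by (simp add: Aut_plus_simps(3)[OF f \<tau>(1)] Aut_plus_simps(3)[OF \<tau>(1) f])
    show "compose (points S) f \<tau> \<in> Aut" "compose (points S) \<tau> f \<in> Aut"
      using autK_compose[OF id_conj id_conj f \<tau>(1)] autK_compose[OF id_conj id_conj \<tau>(1) f] by simp_all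
  qed
  have h1: "homology (compose (points S) f \<tau>) (\<lambda>v. L (N v)) (s' * s) (t' * t)"
    by (rule homology_compose[OF L \<tau>(2,1)])
  have h2: "homology (compose (points S) f \<tau>) (\<lambda>v. N (L v)) (s * s') (t * t')"
    unfolding c by (rule homology_compose[OF \<tau>(2) L f])
  then have h2': "semilinear (\<lambda>z. z) (\<lambda>v. N (L v))" "induced (compose (points S) f \<tau>) (\<lambda>v. N (L v))"
    by (auto simp: homology_def)
  obtain k where k: "\<And>v. N (L v) = k *s L (N v)" using homology_scale[OF h1 h2'] by metis
  \<comment> \<open>Commuting automorphisms give matrices that commute only up to a factor;
    evaluation on the axis shows that this factor is 1.\<close>
  have "(s * s') *s e1 = (k * (s' * s)) *s e1"
    using k[of e1] by (simp add: L12 N1 Ls Ns vector_smult_assoc mult_ac)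
  then have "k = 1" using N1(1) L12(1) basis_nonzero(1)[OF basis] by (simp add: vector_mul_rcancel)
  then have "N (L e) = t *s L e" using k[of e] by (simp add: e(3) Ls)
  then obtain c where c: "L e = c *s e" using e(4) by blast
  then have "c = t'" using Lt[of e] e(1) by simp
  define \<zeta> where "\<zeta> = t' / s'"
  have \<zeta>: "\<zeta> \<noteq> 0" "character f = \<zeta>" using L12(1) t'0 character_eq[OF L] by (simp_all add: \<zeta>_def)
  interpret P: pencil F d e1 e2 e
    by unfold_locales (use F d2 e in auto)
  \<comment> \<open>The fibre needs \<open>d\<close> different roots, none of them zero:
    \<open>x\<close> must avoid the branch values and the points where the axis meets the curve, and
    both sets are countable.\<close>
  have "\<exists>x. P.unram x \<and> F (P.pt x 0) \<noteq> 0"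
  proof (rule ccontr)
    assume n: "\<not> ?thesis"
    obtain p where p: "degree p \<le> d" "coeff p d = F e2" "\<forall>x. poly p x = F (e1 + x *s e2)"
      using homog_poly[OF F(1)] by blast
    have pt0: "P.pt x 0 = e1 + x *s e2" for x by (simp add: P.pt_def)
    have "p \<noteq> 0"
    proof
      assume "p = 0"
      then have z: "F e2 = 0" "\<And>x. F (e1 + x *s e2) = 0" using p by auto
      have "F (x *s e1 + y *s e2) = 0" for x y
      proof (cases "x = 0")
        case True
        then show ?thesis using homog_smult[OF F(1), of y e2] z by simp
      next
        case False
        then have e: "x *s e1 + y *s e2 = x *s (e1 + (y / x) *s e2)"
          by (simp add: vector_add_ldistrib vector_smult_assoc)
        have "F (x *s e1 + y *s e2) = x ^ d * F (e1 + (y / x) *s e2)"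
          by (subst e) (rule homog_smult[OF F(1)])
        then show ?thesis using z(2) by simp
      qed
      moreover have "ccross e1 e2 \<noteq> 0" using basis ccross_nonzero by blast
      ultimately show False using line_not_in_curve[OF F d2] by blast
    qed
    have "(UNIV :: complex set) \<subseteq> {x. \<not> P.unram x} \<union> {x. poly p x = 0}" using n p(3) pt0 by auto
    moreover have "countable ({x. \<not> P.unram x} \<union> {x. poly p x = 0})"
      using P.countable_ram poly_roots_finite[OF \<open>p \<noteq> 0\<close>] by (simp add: countable_finite)
    ultimately have "countable (UNIV :: complex set)" using countable_subset by blast
    then show False using uncountable_UNIV_complex by blast
  qed
  then obtain x where x: "P.unram x" "F (P.pt x 0) \<noteq> 0" by blast
  define R where "R = P.rts x"
  have R: "finite R" "card R = d" "0 \<notin> R"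
    using P.finite_rts P.card_rts_unram[OF x(1)] x(2) by (simp_all add: R_def P.rts_def)
  have sub: "(\<lambda>y. \<zeta> * y) ` R \<subseteq> R"
  proof clarify
    fix y assume y: "y \<in> R"
    then have "F (P.pt x y) = 0" by (simp add: R_def P.rts_def)
    then have "F (L (P.pt x y)) = 0"
      by (rule induced_preserves_curve[OF Ll(1) id_conj Ll(2) Aut_Bij[OF f]])
    moreover have "L (P.pt x y) = s' *s P.pt x (\<zeta> * y)"
      using L12(1) unfolding P.pt_def \<zeta>_def
      by (simp add: Ls L12 c \<open>c = t'\<close> vec_eq_iff field_simps)
    ultimately show "\<zeta> * y \<in> R"
      using L12(1) homog_smult[OF F(1), of s'] by (simp add: R_def P.rts_def)
  qed
  have inj: "inj_on (\<lambda>y. \<zeta> * y) R" using \<zeta>(1) by (auto simp: inj_on_def)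
  have im: "(\<lambda>y. \<zeta> * y) ` R = R" by (rule endo_inj_surj[OF R(1) sub inj])
  have "(\<Prod>y\<in>R. y) = (\<Prod>y\<in>R. \<zeta> * y)"
    using prod.reindex[OF inj, of "\<lambda>y. y"] im by simp
  also have "\<dots> = \<zeta> ^ d * (\<Prod>y\<in>R. y)" by (simp add: prod.distrib R(2))
  finally have "\<zeta> ^ d = 1" using R by simp
  then show ?thesis using \<zeta>(2) by simp
qed

lemma cyclic_even_dvd:
  assumes \<sigma>: "\<sigma> \<in> autK cnj" and ninv: "compose (points S) \<sigma> \<sigma> \<noteq> (\<lambda>p\<in>points S. p)"
  shows "cyclic_group (Aut_plus S) \<and> finite (carrier (Aut_plus S)) \<and>
    even (order (Aut_plus S)) \<and> order (Aut_plus S) dvd d"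
proof -
  interpret A: group "Aut_plus S" by (rule group_Aut_plus)
  have ca: "carrier (Aut_plus S) = Aut" by (rule Aut_plus_simps(1))
  obtain N s t e where h: "homology (compose (points S) \<sigma> \<sigma>) N s t" "t = - s"
    and e: "cdet e1 e2 e \<noteq> 0" "F e \<noteq> 0" "N e = t *s e" "\<And>v. N v = t *s v \<Longrightarrow> \<exists>c. v = c *s e"
    using anticonformal_square[OF \<sigma> ninv] by blast
  have "s \<noteq> 0" using h(1) by (simp add: homology_def)
  then have "character (compose (points S) \<sigma> \<sigma>) = -1" using character_eq[OF h(1)] h(2) by simp
  then have m1: "(-1 :: complex) ^ order (Aut_plus S) = 1" using character_order[OF square_Aut[OF \<sigma>]] by simp
  have "even (order (Aut_plus S))"
  proof (rule ccontr)
    assume "odd (order (Aut_plus S))"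
    then show False using m1 by simp
  qed
  moreover have "order (Aut_plus S) dvd d"
  proof -
    obtain f where "f \<in> Aut" "character f = cis (2 * pi / real (order (Aut_plus S)))" using character_primitive by blast
    then have "cis (2 * pi / real (order (Aut_plus S))) ^ d = 1"
      using character_power_degree[OF square_Aut[OF \<sigma>] h(1) e] by metis
    then show ?thesis
      using root_of_unity_dvd fin by (simp add: A.order_gt_0_iff_finite ca)
  qed
  ultimately show ?thesis using cyclic_Aut fin by (simp add: ca)
qed

end

theorem mainTheorem1:
  fixes S :: "'a surface" and d :: nat and F :: "complex^3 \<Rightarrow> complex"
    and \<phi> :: "'a \<Rightarrow> proj2" and G :: "(complex^3^3) set set"
  assumes "compact_riemann_surface S"
    and "d \<ge> 4" and "plane_model S d F \<phi>"
    and "pseudoreal S"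
    and "subgroup G PGL3" and "finite G" and "G \<noteq> {\<one>\<^bsub>PGL3\<^esub>}"
    and "infinite {p. \<forall>T \<in> G. pgl_act T p = p}"
    and "\<exists>g \<in> carrier PGL3. Aut_plus_in_PGL3 S \<phi> = g <#\<^bsub>PGL3\<^esub> (G #>\<^bsub>PGL3\<^esub> inv\<^bsub>PGL3\<^esub> g)"
  shows "cyclic_group (Aut_plus S) \<and> finite (carrier (Aut_plus S)) \<and>
    even (order (Aut_plus S)) \<and> order (Aut_plus S) dvd d"
proof -
  interpret plane_surface S d F \<phi> by unfold_locales (use assms in auto)
  have idc: "conjugation (\<lambda>z. z)" and cj: "conjugation cnj" by (simp_all add: conjugation_def)
  obtain g where g: "g \<in> carrier PGL3" "Aut_plus_in_PGL3 S \<phi> = g <#\<^bsub>PGL3\<^esub> (G #>\<^bsub>PGL3\<^esub> inv\<^bsub>PGL3\<^esub> g)"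
    using assms(9) by blast
  have "finite (Aut_plus_in_PGL3 S \<phi>)" unfolding g(2) l_coset_def r_coset_def using assms(6) by simp
  then have fin: "finite (autK (\<lambda>z. z))" by (rule finite_autK)
  obtain Q where Q: "infinite Q" "\<And>T A q. T \<in> Aut_plus_in_PGL3 S \<phi> \<Longrightarrow> A \<in> T \<Longrightarrow> q \<in> Q \<Longrightarrow>
      \<exists>s. A *v rep_proj2 q = s *s rep_proj2 q"
    using conjugate_fixed_points[OF assms(5) g(1) assms(8)] unfolding g(2) by blast
  have repr: "\<exists>A :: complex^3^3. invertible A \<and> induced f (\<lambda>v. A *v v) \<and>
      (\<forall>q \<in> Q. \<exists>s. A *v rep_proj2 q = s *s rep_proj2 q)" if f: "f \<in> autK (\<lambda>z. z)" for f
  proof -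
    obtain A :: "complex^3^3" where A: "invertible A" "induced f (\<lambda>v. A *v v)"
      using induced_exists[OF idc f] by auto
    obtain T where "T \<in> Aut_plus_in_PGL3 S \<phi>" "A \<in> T" using class_in_Aut[OF f A] by blast
    then have "\<forall>q \<in> Q. \<exists>s. A *v rep_proj2 q = s *s rep_proj2 q" using Q(2) by blast
    with A show ?thesis by blast
  qed
  obtain \<sigma> where \<sigma>: "\<sigma> \<in> autK cnj" and ni: "\<not> (\<forall>p \<in> points S. \<sigma> (\<sigma> p) = p)"
    using assms(4) unfolding pseudoreal_def anticonformal_autK by blast
  define \<tau> where "\<tau> = compose (points S) \<sigma> \<sigma>"
  have \<tau>: "\<tau> \<in> autK (\<lambda>z. z)" using autK_compose[OF cj cj \<sigma> \<sigma>] by (simp add: \<tau>_def)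
  have \<tau>1: "\<tau> \<noteq> (\<lambda>p\<in>points S. p)"
  proof
    assume e: "\<tau> = (\<lambda>p\<in>points S. p)"
    have "\<sigma> (\<sigma> p) = p" if "p \<in> points S" for p
      using fun_cong[OF e, of p] that by (simp add: \<tau>_def compose_def)
    with ni show False by blast
  qed
  obtain A1 :: "complex^3^3" where A1: "invertible A1" "induced \<tau> (\<lambda>v. A1 *v v)"
    "\<And>q. q \<in> Q \<Longrightarrow> \<exists>s. A1 *v rep_proj2 q = s *s rep_proj2 q" using repr[OF \<tau>] by blast
  \<comment> \<open>A scalar matrix would induce the identity, but the square of
    \<open>\<sigma>\<close> is not the identity.\<close>
  have "\<nexists>s. \<forall>v. A1 *v v = s *s v"
  proof
    assume "\<exists>s. \<forall>v. A1 *v v = s *s v"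
    then obtain s where s: "\<And>v. A1 *v v = s *s v" by blast
    have "s \<noteq> 0"
      using invertible_mult_vec_nonzero[OF A1(1), of "axis 1 1"] s[of "axis 1 1"] by (auto simp: axis_eq_0_iff)
    then have \<phi>\<tau>: "\<phi> (\<tau> p) = \<phi> p" if "p \<in> points S" for p
      using A1(2) that by (simp add: induced_def s abs_proj2_smult rep_proj2_nonzero abs_rep_proj2)
    have "\<tau> = (\<lambda>p\<in>points S. p)"
    proof (rule induced_eq[OF _ id_Bij])
      show "\<tau> \<in> Bij (points S)" using \<tau> by (simp add: autK_def)
      show "\<phi> (\<tau> p) = \<phi> ((\<lambda>p\<in>points S. p) p)" if "p \<in> points S" for p using \<phi>\<tau> that by simp
    qed
    with \<tau>1 show False by blast
  qed
  from common_axis[OF Q(1) A1(3) this] obtain e1 e2 where e12: "ccross e1 e2 \<noteq> 0"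
    "\<And>A :: complex^3^3. (\<And>q. q \<in> Q \<Longrightarrow> \<exists>s. A *v rep_proj2 q = s *s rep_proj2 q) \<Longrightarrow>
      \<exists>s. A *v e1 = s *s e1 \<and> A *v e2 = s *s e2" by blast
  obtain e3 where e3: "cdet e1 e2 e3 \<noteq> 0" using e12(1) ccross_nonzero by blast
  interpret homology_surface S d F \<phi> e1 e2 e3
  proof
    show "cdet e1 e2 e3 \<noteq> 0" "finite (autK (\<lambda>z. z))" by (rule e3, rule fin)
    fix f assume f: "f \<in> autK (\<lambda>z. z)"
    obtain A :: "complex^3^3" where A: "invertible A" "induced f (\<lambda>v. A *v v)"
      "\<And>q. q \<in> Q \<Longrightarrow> \<exists>s. A *v rep_proj2 q = s *s rep_proj2 q" using repr[OF f] by blast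
    obtain s where "A *v e1 = s *s e1" "A *v e2 = s *s e2" using e12(2)[OF A(3)] by blast
    moreover have "semilinear (\<lambda>z. z) (\<lambda>v. A *v v)" using semilinear_matrix[OF idc A(1)] by simp
    ultimately show "\<exists>L s. semilinear (\<lambda>z. z) L \<and> induced f L \<and> L e1 = s *s e1 \<and> L e2 = s *s e2"
      using A(2) by blast
  qed
  show ?thesis by (rule cyclic_even_dvd[OF \<sigma> \<tau>1[unfolded \<tau>_def]])
qed

end
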